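(* Let $(X,\mathcal{S})$ be a conically stratified space and let $\Omega$ be a bi-complete category. Then the category $\mathsf{Csh}_\Omega(X,\mathcal{S})$ of $\mathcal{S}$-constructible cosheaves on $X$ valued in $\Omega$ is equivalent to the category $[\mathsf{Ent}(X,\mathcal{S}),\Omega]$ of functors from the entrance path category of $(X,\mathcal{S})$ to $\Omega$ and natural transformations.
   Context: **Stratified spaces.** An $n$-step filtration of a topological space $X$ is a nested sequence of closed subspaces $\emptyset=X^{-1}\subseteq X^0\subseteq\cdots\subseteq X^n=X$; a filtered space is a space with an $n$-step filtration for some $n$, and its formal dimension is $\sup\{n\mid X^n\setminus X^{n-1}\neq\emptyset\}$ (the empty space has formal dimension $-1$). A filtration-preserving homeomorphism of filtered spaces is a homeomorphism restricting to a homeomorphism in each degree. $\mathbb{R}^d$ is filtered with everything below degree $d$ empty. The product of an $n$-step and an $m$-step filtered space has the $(n+m)$-step filtration $(X\times Y)^k=\bigcup_{i+j=k}X^i\times Y^j$. The cone on a space $L$ is the set $C(L)=(L\times\mathbb{R}_{>0})\cup\{\star\}$, where $U\subseteq C(L)$ is open iff $U\cap(L\times\mathbb{R}_{>0})$ is open and, if $\star\in U$, there is $\epsilon>0$ with $L\times(0,\epsilon)\subseteq U$ (so $C(\emptyset)=\{\star\}$). If $L$ is filtered, $C(L)$ is filtered by $C(L)^0=\{\star\}$, $C(L)^{i+1}=(L^i\times\mathbb{R}_{>0})\cup\{\star\}$. An $n$-dimensional conically stratified space is a Hausdorff space $X$ with an $n$-step filtration such that for every $d\ge 0$ and every $x\in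 X^d-X^{d-1}$ there are an open set $U_x\ni x$, a filtered space $L_x$ of formal dimension $n-d-1$, and a filtration-preserving homeomorphism $h_x:\mathbb{R}^d\times C(L_x)\to U_x$ (with $U_x$ filtered by $U_x\cap X^i$) taking $(0,\star)$ to $x$. Any such open set $U_x$ is called a basic open about $x$. A $d$-dimensional stratum is a connected component of $X^d-X^{d-1}$; $\mathcal{S}$ denotes the set of strata. A basic open about a point $x\in S\in\mathcal{S}$ is called an $S$-basic open. A stratum-preserving map $(Y,\mathcal{T})\to(X,\mathcal{S})$ is a continuous map sending each $T\in\mathcal{T}$ into some $S\in\mathcal{S}$. **Entrance path category.** Stratify $\mathbb{I}=[0,1]$ by a finite set of $0$-strata containing $0$ and $1$, the $1$-strata being the open intervals in between; write $(\mathbb{I},\{0,\dots,1\})$, listing the $0$-strata. An entrance path is such a stratification $(\mathbb{I},\mathcal{T})$ together with a stratum-preserving map $\alpha:(\mathbb{I},\mathcal{T})\to(X,\mathcal{S})$ such that the dimension of the stratum containing $\alpha(t)$ is non-increasing in $t$. If $\beta(0)=\alpha(1)$, the concatenation $\beta*\alpha$ is $\alpha(2t)$ for $0\le t\le 1/2$ and $\beta(2t-1)$ for $1/2\le t\le 1$, with the concatenated stratification. A reparametrization of $\alpha:(\mathbb{I},\mathcal{T})\to(X,\mathcal{S})$ is $\alpha\circ\phi$ with $\phi:(\mathbb{I},\mathcal{T}')\to(\mathbb{I},\mathcal{T})$ an isomorphism (stratum-preserving with stratum-preserving inverse), $\phi(0)=0,\phi(1)=1$. Let $\Delta=[v_0v_1v_2]$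 be the $2$-simplex stratified by its vertices, edges and face. An elementary homotopy $\alpha\Rightarrow\beta$ from $\alpha:(\mathbb{I},\{0,1/2,1\})\to(X,\mathcal{S})$ to $\beta:(\mathbb{I},\{0,1\})\to(X,\mathcal{S})$ is a stratum-preserving map $h:\Delta\to(X,\mathcal{S})$ together with stratum-preserving parametrizations $\tilde\alpha$ of $[v_0,v_1]\cup[v_1,v_2]$ (with $0,1/2,1\mapsto v_0,v_1,v_2$) and $\tilde\beta$ of $[v_0,v_2]$ (with $0,1\mapsto v_0,v_2$) by $\mathbb{I}$, such that $h\circ\tilde\alpha=\alpha$, $h\circ\tilde\beta=\beta$; $h$ maps $[v_0,v_1,v_2]\setminus[v_1,v_2]$ into a single stratum; and the image of $h$ lies in some basic open about $h(v_2)=\alpha(1)=\beta(1)$. Two entrance paths $\alpha,\beta$ are elementarily related if some reparametrizations of them decompose as concatenations $\alpha_3*\alpha_2*\alpha_1$ and $\beta_3*\beta_2*\beta_1$ (outer pieces possibly absent) with $\alpha_1=\beta_1$, $\alpha_3=\beta_3$, and $\alpha_2\Rightarrow\beta_2$ or $\beta_2\Rightarrow\alpha_2$. Two entrance paths are equivalent if they are connected by a finite chain of elementary relations. $\mathsf{Ent}(X,\mathcal{S})$ is the category whose objects are the points of $X$ and whose morphisms $x\to y$ are equivalence classes of entrance paths from $x$ to $y$, composed by concatenation (identities are classes of constant paths). **Cosheaves.** Let $\mathsf{Open}(X)$ be the poset of open sets of $X$ under inclusion. A complete cover of an open set $U$ is a collection $\mathcal{U}$ of open sets with union $U$ such that for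 all $U_i,U_j\in\mathcal{U}$ some subcollection of $\mathcal{U}$ covers $U_i\cap U_j$ (has union $U_i\cap U_j$). A cover is regarded as a poset under inclusion. A pre-cosheaf is a functor $F:\mathsf{Open}(X)\to\Omega$; it is a cosheaf if for every open $U$ and every complete cover $\mathcal{U}$ of $U$ the universal morphism $\mathrm{colim}\,F|_{\mathcal{U}}\to F(U)$ is an isomorphism. A cosheaf $F$ is $\mathcal{S}$-constructible if for every stratum $S\in\mathcal{S}$ and every pair of $S$-basic opens $U\subseteq V$ the morphism $F(U)\to F(V)$ is an isomorphism. $\mathsf{Csh}_\Omega(X,\mathcal{S})$ is the category of $\mathcal{S}$-constructible cosheaves valued in $\Omega$ and natural transformations. Bi-complete means having all small limits and colimits.
   Formalization: In the elementary relation, decomposing a path as a concatenation may refine its stratification (cut it at points that are not 0-strata); with equal stratifications required, constant paths would not be identities, e.g. for a loop around a circle. *)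

theory Defs
  imports "HOL-Analysis.Analysis"
begin

section \<open>Categories\<close>

record ('o, 'm) cat =
  Obj :: "'o set"
  Arr :: "'m set"
  Dom :: "'m \<Rightarrow> 'o"
  Cod :: "'m \<Rightarrow> 'o"
  Ident :: "'o \<Rightarrow> 'm"
  Comp :: "'m \<Rightarrow> 'm \<Rightarrow> 'm"

definition hom :: "('o, 'm, 'z) cat_scheme \<Rightarrow> 'o \<Rightarrow> 'o \<Rightarrow> 'm set" where
  "hom C x y = {f \<in> Arr C. Dom C f = x \<and> Cod C f = y}"

text \<open>\<^term>\<open>Comp C g f\<close> is the composite "g after f".\<close>

definition is_category :: "('o, 'm) cat \<Rightarrow> bool" where
  "is_category C \<longleftrightarrow>
     (\<forall>f \<in> Arr C. Dom C f \<in> Obj C \<and> Cod C f \<in> Obj C) \<and>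
     (\<forall>x \<in> Obj C. Ident C x \<in> hom C x x) \<and>
     (\<forall>f \<in> Arr C. \<forall>g \<in> Arr C. Dom C g = Cod C f \<longrightarrow>
        Comp C g f \<in> hom C (Dom C f) (Cod C g)) \<and>
     (\<forall>f \<in> Arr C. Comp C f (Ident C (Dom C f)) = f \<and> Comp C (Ident C (Cod C f)) f = f) \<and>
     (\<forall>f \<in> Arr C. \<forall>g \<in> Arr C. \<forall>h \<in> Arr C. Dom C g = Cod C f \<longrightarrow> Dom C h = Cod C g \<longrightarrow>
        Comp C h (Comp C g f) = Comp C (Comp C h g) f)"

definition is_iso :: "('o, 'm) cat \<Rightarrow> 'm \<Rightarrow> bool" where
  "is_iso C f \<longleftrightarrow> f \<in> Arr C \<and>
     (\<exists>g \<in> hom C (Cod C f) (Dom C f).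
        Comp C g f = Ident C (Dom C f) \<and> Comp C f g = Ident C (Cod C f))"

text \<open>Functors and natural transformations are required to be extensional, that is, equal to
  \<^term>\<open>undefined\<close> outside the objects and arrows of their domain, so that
  equality in HOL is the mathematical equality.\<close>

record ('o, 'm, 'p, 'n) func =
  Omap :: "'o \<Rightarrow> 'p"
  Amap :: "'m \<Rightarrow> 'n"

definition is_functor :: "('o, 'm) cat \<Rightarrow> ('p, 'n) cat \<Rightarrow> ('o, 'm, 'p, 'n) func \<Rightarrow> bool" where
  "is_functor C D F \<longleftrightarrow>
     is_category C \<and> is_category D \<and>
     Omap F \<in> extensional (Obj C) \<and> Amap F \<in> extensional (Arr C) \<and>
     (\<forall>x \<in> Obj C. Omap F x \<in> Obj D) \<and>
     (\<forall>f \<in> Arr C. Amap F f \<in> hom D (Omap F (Dom C f)) (Omap F (Cod C f))) \<and>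
     (\<forall>x \<in> Obj C. Amap F (Ident C x) = Ident D (Omap F x)) \<and>
     (\<forall>f \<in> Arr C. \<forall>g \<in> Arr C. Dom C g = Cod C f \<longrightarrow>
        Amap F (Comp C g f) = Comp D (Amap F g) (Amap F f))"

definition id_functor :: "('o, 'm) cat \<Rightarrow> ('o, 'm, 'o, 'm) func" where
  "id_functor C = \<lparr>Omap = restrict id (Obj C), Amap = restrict id (Arr C)\<rparr>"

definition comp_functor ::
  "('o, 'm) cat \<Rightarrow> ('p, 'n, 'q, 'l) func \<Rightarrow> ('o, 'm, 'p, 'n) func \<Rightarrow> ('o, 'm, 'q, 'l) func" where
  "comp_functor C G F =
     \<lparr>Omap = restrict (Omap G \<circ> Omap F) (Obj C), Amap = restrict (Amap G \<circ> Amap F) (Arr C)\<rparr>"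

definition is_nat_trans :: "('o, 'm) cat \<Rightarrow> ('p, 'n) cat \<Rightarrow> ('o, 'm, 'p, 'n) func \<Rightarrow>
    ('o, 'm, 'p, 'n) func \<Rightarrow> ('o \<Rightarrow> 'n) \<Rightarrow> bool" where
  "is_nat_trans C D F G \<tau> \<longleftrightarrow>
     is_functor C D F \<and> is_functor C D G \<and> \<tau> \<in> extensional (Obj C) \<and>
     (\<forall>x \<in> Obj C. \<tau> x \<in> hom D (Omap F x) (Omap G x)) \<and>
     (\<forall>f \<in> Arr C. Comp D (\<tau> (Cod C f)) (Amap F f) = Comp D (Amap G f) (\<tau> (Dom C f)))"

definition is_nat_iso :: "('o, 'm) cat \<Rightarrow> ('p, 'n) cat \<Rightarrow> ('o, 'm, 'p, 'n) func \<Rightarrow>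
    ('o, 'm, 'p, 'n) func \<Rightarrow> ('o \<Rightarrow> 'n) \<Rightarrow> bool" where
  "is_nat_iso C D F G \<tau> \<longleftrightarrow> is_nat_trans C D F G \<tau> \<and> (\<forall>x \<in> Obj C. is_iso D (\<tau> x))"

definition equivalent_categories :: "('o, 'm) cat \<Rightarrow> ('p, 'n) cat \<Rightarrow> bool" where
  "equivalent_categories C D \<longleftrightarrow>
     (\<exists>F G \<eta> \<epsilon>. is_functor C D F \<and> is_functor D C G \<and>
        is_nat_iso C C (id_functor C) (comp_functor C G F) \<eta> \<and>
        is_nat_iso D D (comp_functor D F G) (id_functor D) \<epsilon>)"

text \<open>Arrows of the functor category carry their source and target functors.\<close>

definition functor_cat :: "('o, 'm) cat \<Rightarrow> ('p, 'n) cat \<Rightarrow>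
    (('o, 'm, 'p, 'n) func,
     ('o, 'm, 'p, 'n) func \<times> ('o \<Rightarrow> 'n) \<times> ('o, 'm, 'p, 'n) func) cat" where
  "functor_cat C D =
     \<lparr>Obj = {F. is_functor C D F},
      Arr = {(F, \<tau>, G). is_nat_trans C D F G \<tau>},
      Dom = (\<lambda>(F, \<tau>, G). F),
      Cod = (\<lambda>(F, \<tau>, G). G),
      Ident = (\<lambda>F. (F, \<lambda>x \<in> Obj C. Ident D (Omap F x), F)),
      Comp = (\<lambda>(G', \<sigma>, H) (F, \<tau>, G). (F, \<lambda>x \<in> Obj C. Comp D (\<sigma> x) (\<tau> x), H))\<rparr>"

definition full_subcat :: "('o, 'm) cat \<Rightarrow> 'o set \<Rightarrow> ('o, 'm) cat" where
  "full_subcat C A =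
     C\<lparr>Obj := Obj C \<inter> A, Arr := {f \<in> Arr C. Dom C f \<in> A \<and> Cod C f \<in> A}\<rparr>"

subsection \<open>Limits and colimits\<close>

definition is_cone :: "('i, 'j) cat \<Rightarrow> ('o, 'm) cat \<Rightarrow> ('i, 'j, 'o, 'm) func \<Rightarrow>
    'o \<Rightarrow> ('i \<Rightarrow> 'm) \<Rightarrow> bool" where
  "is_cone J C D c \<pi> \<longleftrightarrow> c \<in> Obj C \<and>
     (\<forall>j \<in> Obj J. \<pi> j \<in> hom C c (Omap D j)) \<and>
     (\<forall>f \<in> Arr J. Comp C (Amap D f) (\<pi> (Dom J f)) = \<pi> (Cod J f))"

definition is_limit :: "('i, 'j) cat \<Rightarrow> ('o, 'm) cat \<Rightarrow> ('i, 'j, 'o, 'm) func \<Rightarrow>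
    'o \<Rightarrow> ('i \<Rightarrow> 'm) \<Rightarrow> bool" where
  "is_limit J C D c \<pi> \<longleftrightarrow> is_cone J C D c \<pi> \<and>
     (\<forall>c' \<pi>'. is_cone J C D c' \<pi>' \<longrightarrow>
        (\<exists>!m. m \<in> hom C c' c \<and> (\<forall>j \<in> Obj J. Comp C (\<pi> j) m = \<pi>' j)))"

definition is_cocone :: "('i, 'j) cat \<Rightarrow> ('o, 'm) cat \<Rightarrow> ('i, 'j, 'o, 'm) func \<Rightarrow>
    'o \<Rightarrow> ('i \<Rightarrow> 'm) \<Rightarrow> bool" where
  "is_cocone J C D c \<kappa> \<longleftrightarrow> c \<in> Obj C \<and>
     (\<forall>j \<in> Obj J. \<kappa> j \<in> hom C (Omap D j) c) \<and>
     (\<forall>f \<in> Arr J. Comp C (\<kappa> (Cod J f)) (Amap D f) = \<kappa> (Dom J f))"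

definition is_colimit :: "('i, 'j) cat \<Rightarrow> ('o, 'm) cat \<Rightarrow> ('i, 'j, 'o, 'm) func \<Rightarrow>
    'o \<Rightarrow> ('i \<Rightarrow> 'm) \<Rightarrow> bool" where
  "is_colimit J C D c \<kappa> \<longleftrightarrow> is_cocone J C D c \<kappa> \<and>
     (\<forall>c' \<kappa>'. is_cocone J C D c' \<kappa>' \<longrightarrow>
        (\<exists>!m. m \<in> hom C c c' \<and> (\<forall>j \<in> Obj J. Comp C m (\<kappa> j) = \<kappa>' j)))"

text \<open>HOL has no quantification over types inside a formula, so "small" is relative to a
  type of indices: a small category is one whose objects and arrows are elements of
  the type \<open>'u\<close>. The objects and arrows of the bi-complete category itself are
  of unrelated, arbitrary types. For a space on the type \<open>'a\<close>, take sets of stratified paths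
  (defined below) as indices: points, open sets, inclusions of open sets and classes of entrance
  paths all inject into this type, an open set for instance as the set of constant paths in it.
  Asking for no larger limits and colimits only weakens the hypothesis of bi-completeness.\<close>

definition bicomplete :: "'u itself \<Rightarrow> ('o, 'm) cat \<Rightarrow> bool" where
  "bicomplete _ C \<longleftrightarrow>
     (\<forall>(J :: ('u, 'u) cat) D. is_functor J C D \<longrightarrow>
        (\<exists>c \<pi>. is_limit J C D c \<pi>) \<and> (\<exists>c \<kappa>. is_colimit J C D c \<kappa>))"

section \<open>Filtered and conically stratified spaces\<close>

text \<open>\<open>Fil K k\<close> is the closed subspace of degree \<open>k\<close>. The one of degree
  \<open>- 1\<close> is empty and left implicit, and an \<open>n\<close>-step filtration is continued by the whole
  space in degrees above \<open>n\<close>.\<close>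

record 'a fspace =
  Top :: "'a topology"
  Fil :: "nat \<Rightarrow> 'a set"

definition step_filtration :: "nat \<Rightarrow> 'a fspace \<Rightarrow> bool" where
  "step_filtration n K \<longleftrightarrow>
     (\<forall>k. closedin (Top K) (Fil K k)) \<and>
     (\<forall>k. Fil K k \<subseteq> Fil K (Suc k)) \<and>
     (\<forall>k \<ge> n. Fil K k = topspace (Top K))"

definition filtered_space :: "'a fspace \<Rightarrow> bool" where
  "filtered_space K \<longleftrightarrow> (\<exists>n. step_filtration n K)"

definition layer :: "'a fspace \<Rightarrow> nat \<Rightarrow> 'a set" where
  "layer K d = Fil K d - (case d of 0 \<Rightarrow> {} | Suc e \<Rightarrow> Fil K e)"

definition formal_dim :: "'a fspace \<Rightarrow> int" where
  "formal_dim K =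
     (if topspace (Top K) = {} then - 1 else int (Sup {k. layer K k \<noteq> {}}))"

definition filtered_homeo :: "'a fspace \<Rightarrow> 'b fspace \<Rightarrow> ('a \<Rightarrow> 'b) \<Rightarrow> bool" where
  "filtered_homeo K M h \<longleftrightarrow> homeomorphic_map (Top K) (Top M) h \<and>
     (\<forall>k. homeomorphic_map (subtopology (Top K) (Fil K k)) (subtopology (Top M) (Fil M k)) h)"

definition subspace_filtered :: "'a fspace \<Rightarrow> 'a set \<Rightarrow> 'a fspace" where
  "subspace_filtered K U = \<lparr>Top = subtopology (Top K) U, Fil = (\<lambda>k. U \<inter> Fil K k)\<rparr>"

definition euclidean_filtered :: "nat \<Rightarrow> (nat \<Rightarrow> real) fspace" where
  "euclidean_filtered d =
     \<lparr>Top = Euclidean_space d,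
      Fil = (\<lambda>k. if k < d then {} else topspace (Euclidean_space d))\<rparr>"

definition prod_filtered :: "'a fspace \<Rightarrow> 'b fspace \<Rightarrow> ('a \<times> 'b) fspace" where
  "prod_filtered K M =
     \<lparr>Top = prod_topology (Top K) (Top M),
      Fil = (\<lambda>k. \<Union>{Fil K i \<times> Fil M j | i j. i + j = k})\<rparr>"

subsection \<open>Cones\<close>

text \<open>The apex is \<^term>\<open>None\<close>, the point \<open>(l, r)\<close> off the apex is \<^term>\<open>Some (l, r)\<close>.\<close>

definition cone_open :: "'a topology \<Rightarrow> ('a \<times> real) option set \<Rightarrow> bool" where
  "cone_open L U \<longleftrightarrow>
     U \<subseteq> insert None (Some ` (topspace L \<times> {0<..})) \<and>
     openin (prod_topology L (top_of_set {0<..})) (Some -` U) \<and>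
     (None \<in> U \<longrightarrow> (\<exists>\<epsilon>>0. Some ` (topspace L \<times> {0<..<\<epsilon>}) \<subseteq> U))"

lemma istopology_cone_open: "istopology (cone_open L)"
  unfolding istopology_def
proof (intro conjI allI impI)
  fix U V assume U: "cone_open L U" and V: "cone_open L V"
  have "\<exists>\<epsilon>>0. Some ` (topspace L \<times> {0<..<\<epsilon>}) \<subseteq> U \<inter> V" if apex: "None \<in> U \<inter> V"
  proof -
    obtain a where "a > 0" "Some ` (topspace L \<times> {0<..<a}) \<subseteq> U"
      using apex U unfolding cone_open_def by auto
    moreover obtain b where "b > 0" "Some ` (topspace L \<times> {0<..<b}) \<subseteq> V"
      using apex V unfolding cone_open_def by auto
    ultimately show ?thesis
      by (intro exI[of _ "min a b"]) (auto simp: image_subset_iff)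
  qed
  moreover have "openin (prod_topology L (top_of_set {0<..})) (Some -` (U \<inter> V))"
    using U V unfolding cone_open_def vimage_Int by (blast intro: openin_Int)
  moreover have "U \<inter> V \<subseteq> insert None (Some ` (topspace L \<times> {0<..}))"
    using U unfolding cone_open_def by blast
  ultimately show "cone_open L (U \<inter> V)"
    unfolding cone_open_def by blast
next
  fix \<U> assume \<U>: "\<forall>U\<in>\<U>. cone_open L U"
  have "openin (prod_topology L (top_of_set {0<..})) (Some -` \<Union>\<U>)"
    unfolding vimage_Union by (rule openin_Union) (use \<U> cone_open_def in blast)
  moreover have "\<exists>\<epsilon>>0. Some ` (topspace L \<times> {0<..<\<epsilon>}) \<subseteq> \<Union>\<U>" if apex: "None \<in> \<Union>\<U>"
  proof -
    obtain U where "U \<in> \<U>" "None \<in> U"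
      using apex by blast
    moreover from this obtain \<epsilon> where "\<epsilon> > 0" "Some ` (topspace L \<times> {0<..<\<epsilon>}) \<subseteq> U"
      using \<U> unfolding cone_open_def by meson
    ultimately show ?thesis
      by (intro exI[of _ \<epsilon>]) blast
  qed
  moreover have "\<Union>\<U> \<subseteq> insert None (Some ` (topspace L \<times> {0<..}))"
    using \<U> unfolding cone_open_def by (intro Union_least) blast
  ultimately show "cone_open L (\<Union>\<U>)"
    unfolding cone_open_def by blast
qed

definition cone_topology :: "'a topology \<Rightarrow> ('a \<times> real) option topology" where
  "cone_topology L = topology (cone_open L)"

lemma openin_cone_topology: "openin (cone_topology L) U \<longleftrightarrow> cone_open L U"
  by (simp add: cone_topology_def istopology_cone_open topology_inverse')

definition cone_filtered :: "'a fspace \<Rightarrow> ('a \<times> real) option fspace" where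
  "cone_filtered L =
     \<lparr>Top = cone_topology (Top L),
      Fil = (\<lambda>k. case k of 0 \<Rightarrow> {None} | Suc i \<Rightarrow> insert None (Some ` (Fil L i \<times> {0<..})))\<rparr>"

subsection \<open>Basic opens and strata\<close>

text \<open>Taking the link on the type \<open>'a\<close> of points of the space is no restriction: a link \<open>L\<close>
  of a point of \<open>K\<close> on any type is isomorphic, as a filtered space, to the image of
  \<open>{0} \<times> L \<times> {1}\<close> in \<open>K\<close>, with degrees shifted.\<close>

definition basic_open :: "nat \<Rightarrow> 'a fspace \<Rightarrow> 'a \<Rightarrow> 'a set \<Rightarrow> bool" where
  "basic_open n K x U \<longleftrightarrow> openin (Top K) U \<and> x \<in> U \<and>
     (\<exists>d (L :: 'a fspace) h.
        x \<in> layer K d \<and> filtered_space L \<and> formal_dim L = int n - int d - 1 \<and>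
        filtered_homeo (prod_filtered (euclidean_filtered d) (cone_filtered L))
          (subspace_filtered K U) h \<and>
        h (\<lambda>_. 0, None) = x)"

definition conically_stratified :: "nat \<Rightarrow> 'a fspace \<Rightarrow> bool" where
  "conically_stratified n K \<longleftrightarrow> Hausdorff_space (Top K) \<and> step_filtration n K \<and>
     (\<forall>d. \<forall>x \<in> layer K d. \<exists>U. basic_open n K x U)"

definition strata_of_dim :: "'a fspace \<Rightarrow> nat \<Rightarrow> 'a set set" where
  "strata_of_dim K d = connected_components_of (subtopology (Top K) (layer K d))"

definition strata :: "'a fspace \<Rightarrow> 'a set set" where
  "strata K = (\<Union>d. strata_of_dim K d)"

definition stratum_dim_at :: "'a fspace \<Rightarrow> 'a \<Rightarrow> nat" where
  "stratum_dim_at K x = (THE d. \<exists>S \<in> strata_of_dim K d. x \<in> S)"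

definition stratum_basic_open :: "nat \<Rightarrow> 'a fspace \<Rightarrow> 'a set \<Rightarrow> 'a set \<Rightarrow> bool" where
  "stratum_basic_open n K S U \<longleftrightarrow> (\<exists>x \<in> S. basic_open n K x U)"

definition stratum_preserving ::
  "'b topology \<Rightarrow> 'b set set \<Rightarrow> 'a topology \<Rightarrow> 'a set set \<Rightarrow> ('b \<Rightarrow> 'a) \<Rightarrow> bool" where
  "stratum_preserving Y \<T> X \<S> f \<longleftrightarrow>
     continuous_map Y X f \<and> (\<forall>T \<in> \<T>. \<exists>S \<in> \<S>. f ` T \<subseteq> S)"

section \<open>The entrance path category\<close>

abbreviation unit_interval :: "real topology" where
  "unit_interval \<equiv> top_of_set {0..1}"

text \<open>A stratification of the unit interval is given by the set of its 0-strata.\<close>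

definition interval_stratification :: "real set \<Rightarrow> bool" where
  "interval_stratification P \<longleftrightarrow> finite P \<and> P \<subseteq> {0..1} \<and> 0 \<in> P \<and> 1 \<in> P"

definition interval_strata :: "real set \<Rightarrow> real set set" where
  "interval_strata P = {{p} | p. p \<in> P} \<union>
     {{a<..<b} | a b. a \<in> P \<and> b \<in> P \<and> a < b \<and> P \<inter> {a<..<b} = {}}"

text \<open>A path together with a stratification of the interval. As for functors, the underlying
  function is \<^term>\<open>undefined\<close> outside the interval.\<close>

type_synonym 'a strat_path = "real set \<times> (real \<Rightarrow> 'a)"

definition entrance_path :: "'a fspace \<Rightarrow> 'a strat_path \<Rightarrow> bool" where
  "entrance_path K = (\<lambda>(P, \<alpha>). interval_stratification P \<and> \<alpha> \<in> extensional {0..1} \<and>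
     stratum_preserving unit_interval (interval_strata P) (Top K) (strata K) \<alpha> \<and>
     (\<forall>s \<in> {0..1}. \<forall>t \<in> {0..1}. s \<le> t \<longrightarrow>
        stratum_dim_at K (\<alpha> t) \<le> stratum_dim_at K (\<alpha> s)))"

definition path_start :: "'a strat_path \<Rightarrow> 'a" where
  "path_start p = snd p 0"

definition path_end :: "'a strat_path \<Rightarrow> 'a" where
  "path_end p = snd p 1"

definition const_path :: "'a \<Rightarrow> 'a strat_path" where
  "const_path x = ({0, 1}, \<lambda>t \<in> {0..1}. x)"

text \<open>As in \<open>\<beta> * \<alpha>\<close>, the path traversed first is the second argument.\<close>

definition concat_path :: "'a strat_path \<Rightarrow> 'a strat_path \<Rightarrow> 'a strat_path" where
  "concat_path = (\<lambda>(Q, \<beta>) (P, \<alpha>).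
     ((\<lambda>t. t / 2) ` P \<union> (\<lambda>t. (t + 1) / 2) ` Q,
      \<lambda>t \<in> {0..1}. if t \<le> 1/2 then \<alpha> (2 * t) else \<beta> (2 * t - 1)))"

definition reparametrization :: "'a strat_path \<Rightarrow> 'a strat_path \<Rightarrow> bool" where
  "reparametrization = (\<lambda>(P, \<alpha>) (P', \<alpha>'). interval_stratification P' \<and>
     (\<exists>\<phi> \<psi>. homeomorphic_maps unit_interval unit_interval \<phi> \<psi> \<and>
        stratum_preserving unit_interval (interval_strata P')
          unit_interval (interval_strata P) \<phi> \<and>
        stratum_preserving unit_interval (interval_strata P)
          unit_interval (interval_strata P') \<psi> \<and>
        \<phi> 0 = 0 \<and> \<phi> 1 = 1 \<and> \<alpha>' = (\<lambda>t \<in> {0..1}. \<alpha> (\<phi> t))))"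

subsection \<open>Elementary homotopies\<close>

abbreviation v0 :: "real \<times> real" where "v0 \<equiv> (0, 0)"
abbreviation v1 :: "real \<times> real" where "v1 \<equiv> (1, 0)"
abbreviation v2 :: "real \<times> real" where "v2 \<equiv> (0, 1)"

definition triangle :: "(real \<times> real) set" where
  "triangle = convex hull {v0, v1, v2}"

definition triangle_strata :: "(real \<times> real) set set" where
  "triangle_strata =
     {{v0}, {v1}, {v2}, open_segment v0 v1, open_segment v1 v2, open_segment v0 v2,
      interior triangle}"

definition elementary_homotopy ::
  "nat \<Rightarrow> 'a fspace \<Rightarrow> 'a strat_path \<Rightarrow> 'a strat_path \<Rightarrow> bool" where
  "elementary_homotopy n K = (\<lambda>(P, \<alpha>) (Q, \<beta>).
     P = {0, 1/2, 1} \<and> Q = {0, 1} \<and> entrance_path K (P, \<alpha>) \<and> entrance_path K (Q, \<beta>) \<and>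
     (\<exists>h a b.
        stratum_preserving (top_of_set triangle) triangle_strata (Top K) (strata K) h \<and>
        homeomorphic_map unit_interval
          (top_of_set (closed_segment v0 v1 \<union> closed_segment v1 v2)) a \<and>
        stratum_preserving unit_interval (interval_strata P)
          (top_of_set triangle) triangle_strata a \<and>
        a 0 = v0 \<and> a (1/2) = v1 \<and> a 1 = v2 \<and>
        homeomorphic_map unit_interval (top_of_set (closed_segment v0 v2)) b \<and>
        stratum_preserving unit_interval (interval_strata Q)
          (top_of_set triangle) triangle_strata b \<and>
        b 0 = v0 \<and> b 1 = v2 \<and>
        (\<forall>t \<in> {0..1}. h (a t) = \<alpha> t) \<and> (\<forall>t \<in> {0..1}. h (b t) = \<beta> t) \<and>
        (\<exists>S \<in> strata K. h ` (triangle - closed_segment v1 v2) \<subseteq> S) \<and>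
        (\<exists>U. basic_open n K (h v2) U \<and> h ` triangle \<subseteq> U)))"

subsection \<open>Equivalence of entrance paths\<close>

text \<open>The concatenation \<open>p3 * p2 * p1\<close>, where \<open>p3\<close> or \<open>p1\<close> may be absent. The bracketing
  is immaterial up to reparametrization.\<close>

definition concat3 ::
  "'a strat_path option \<Rightarrow> 'a strat_path \<Rightarrow> 'a strat_path option \<Rightarrow> 'a strat_path" where
  "concat3 p3 p2 p1 =
     (let q = (case p1 of None \<Rightarrow> p2 | Some p \<Rightarrow> concat_path p2 p)
      in case p3 of None \<Rightarrow> q | Some p \<Rightarrow> concat_path p q)"

text \<open>Decomposing a path may cut it at points that are not 0-strata: the underlying maps
  agree, and the stratification of the concatenation refines that of the path. If it had to be
  the same stratification, then a path stratified by its two end points only could not be cut,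
  and unless it lies in a basic open about its end it would be
  equivalent to no other path, not even to its composites with constant paths.\<close>

definition decomposes ::
  "'a fspace \<Rightarrow> 'a strat_path \<Rightarrow>
    'a strat_path option \<Rightarrow> 'a strat_path \<Rightarrow> 'a strat_path option \<Rightarrow> bool" where
  "decomposes K p p3 p2 p1 \<longleftrightarrow>
     (\<forall>q \<in> set_option p3. entrance_path K q \<and> path_start q = path_end p2) \<and>
     entrance_path K p2 \<and>
     (\<forall>q \<in> set_option p1. entrance_path K q \<and> path_end q = path_start p2) \<and>
     snd p = snd (concat3 p3 p2 p1) \<and> fst p \<subseteq> fst (concat3 p3 p2 p1)"

definition elementarily_related ::
  "nat \<Rightarrow> 'a fspace \<Rightarrow> 'a strat_path \<Rightarrow> 'a strat_path \<Rightarrow> bool" where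
  "elementarily_related n K p q \<longleftrightarrow> entrance_path K p \<and> entrance_path K q \<and>
     (\<exists>p' q' r3 p2 q2 r1. reparametrization p p' \<and> reparametrization q q' \<and>
        decomposes K p' r3 p2 r1 \<and> decomposes K q' r3 q2 r1 \<and>
        (elementary_homotopy n K p2 q2 \<or> elementary_homotopy n K q2 p2))"

definition path_class :: "nat \<Rightarrow> 'a fspace \<Rightarrow> 'a strat_path \<Rightarrow> 'a strat_path set" where
  "path_class n K p = {q. (elementarily_related n K)\<^sup>*\<^sup>* p q}"

definition Ent :: "nat \<Rightarrow> 'a fspace \<Rightarrow> ('a, 'a strat_path set) cat" where
  "Ent n K =
     \<lparr>Obj = topspace (Top K),
      Arr = {path_class n K p | p. entrance_path K p},
      Dom = (\<lambda>A. the_elem (path_start ` A)),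
      Cod = (\<lambda>A. the_elem (path_end ` A)),
      Ident = (\<lambda>x. path_class n K (const_path x)),
      Comp = (\<lambda>B A. \<Union>{path_class n K (concat_path q p) | p q. p \<in> A \<and> q \<in> B})\<rparr>"

section \<open>Constructible cosheaves\<close>

definition inclusion_poset :: "'a set set \<Rightarrow> ('a set, 'a set \<times> 'a set) cat" where
  "inclusion_poset \<U> =
     \<lparr>Obj = \<U>,
      Arr = {(U, V). U \<in> \<U> \<and> V \<in> \<U> \<and> U \<subseteq> V},
      Dom = fst,
      Cod = snd,
      Ident = (\<lambda>U. (U, U)),
      Comp = (\<lambda>g f. (fst f, snd g))\<rparr>"

definition Open :: "'a topology \<Rightarrow> ('a set, 'a set \<times> 'a set) cat" where
  "Open X = inclusion_poset {U. openin X U}"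

definition restrict_functor :: "('o, 'm, 'p, 'n) func \<Rightarrow> ('o, 'm) cat \<Rightarrow> ('o, 'm, 'p, 'n) func" where
  "restrict_functor F C = \<lparr>Omap = restrict (Omap F) (Obj C), Amap = restrict (Amap F) (Arr C)\<rparr>"

definition complete_cover :: "'a topology \<Rightarrow> 'a set \<Rightarrow> 'a set set \<Rightarrow> bool" where
  "complete_cover X U \<U> \<longleftrightarrow> (\<forall>V \<in> \<U>. openin X V) \<and> \<Union>\<U> = U \<and>
     (\<forall>V \<in> \<U>. \<forall>W \<in> \<U>. \<exists>\<V> \<subseteq> \<U>. \<Union>\<V> = V \<inter> W)"

definition is_cosheaf :: "'a topology \<Rightarrow> ('o, 'm) cat \<Rightarrow>
    ('a set, 'a set \<times> 'a set, 'o, 'm) func \<Rightarrow> bool" where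
  "is_cosheaf X \<Omega> F \<longleftrightarrow> is_functor (Open X) \<Omega> F \<and>
     (\<forall>U \<U>. openin X U \<longrightarrow> complete_cover X U \<U> \<longrightarrow>
        (\<exists>c \<kappa> m.
           is_colimit (inclusion_poset \<U>) \<Omega> (restrict_functor F (inclusion_poset \<U>)) c \<kappa> \<and>
           m \<in> hom \<Omega> c (Omap F U) \<and> (\<forall>V \<in> \<U>. Comp \<Omega> m (\<kappa> V) = Amap F (V, U)) \<and>
           is_iso \<Omega> m))"

definition is_constructible :: "nat \<Rightarrow> 'a fspace \<Rightarrow> ('o, 'm) cat \<Rightarrow>
    ('a set, 'a set \<times> 'a set, 'o, 'm) func \<Rightarrow> bool" where
  "is_constructible n K \<Omega> F \<longleftrightarrow>
     (\<forall>S \<in> strata K. \<forall>U V. stratum_basic_open n K S U \<longrightarrow> stratum_basic_open n K S V \<longrightarrow> U \<subseteq> V \<longrightarrow>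
        is_iso \<Omega> (Amap F (U, V)))"

definition Csh :: "('o, 'm) cat \<Rightarrow> nat \<Rightarrow> 'a fspace \<Rightarrow>
    (('a set, 'a set \<times> 'a set, 'o, 'm) func,
     ('a set, 'a set \<times> 'a set, 'o, 'm) func \<times> ('a set \<Rightarrow> 'm) \<times>
       ('a set, 'a set \<times> 'a set, 'o, 'm) func) cat" where
  "Csh \<Omega> n K = full_subcat (functor_cat (Open (Top K)) \<Omega>)
     {F. is_cosheaf (Top K) \<Omega> F \<and> is_constructible n K \<Omega> F}"

end

theory Submission
  imports Defs
begin

text \<open>The equivalence sends a constructible cosheaf \<open>F\<close> to its costalks \<open>F (U\<^sub>x)\<close>, where \<open>U\<^sub>x\<close> is a chosen
  basic open about \<open>x\<close>. Basic opens about \<open>x\<close> form a neighbourhood base at \<open>x\<close>, so there is a map from the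
  costalk at \<open>x\<close> to \<open>F U\<close> for every open \<open>U\<close> containing \<open>x\<close>, which is invertible when \<open>U\<close> is basic about \<open>x\<close>.
  A basic open about \<open>x\<close> is also basic about all its points in the layer of \<open>x\<close>; hence a short piece of an entrance
  path lies in a basic open about its end, which defines transport along it. The path in an elementary homotopy lies
  in a basic open about its end, so transport is homotopy invariant. By the cosheaf condition \<open>F U\<close> is the
  universal recipient of maps from the costalks in \<open>U\<close> that are compatible with transport in \<open>U\<close>, and
  therefore \<open>F\<close> is determined by its costalks and transport, also on morphisms.

  Conversely a functor \<open>G\<close> on the entrance path category yields the cosheaf whose value on \<open>U\<close> is the colimit
  of \<open>G\<close> over the paths in \<open>U\<close>; subdividing paths gives the cosheaf condition. The radial contraction of a basic
  open to its centre \<open>x\<close> carries a path to an elementary homotopy, which makes \<open>x\<close> terminal among the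
  paths in the basic open, so that the value there is \<open>G x\<close>.\<close>

section \<open>Categories\<close>

text \<open>Levels only drop along an entrance path, so on a short piece the end lies deepest: a
  basic open about a point of the piece that contains the piece is again basic about its end. The
  germ at the end is therefore invertible, and data along a path are extended backwards, from the
  end to the start. Statements about whole paths follow from such pieces by bisection. Objects of
  \<open>\<Omega>\<close> have no elements, so a value of a cosheaf is studied through the maps from
  it to a test object \<open>z\<close>; for these maps the cosheaf condition becomes the sheaf
  condition. Of a chart only two features enter: it can be composed with filtered embeddings of the
  model into itself, and it carries a contraction that keeps the level of every point until the last
  instant. In the colimit that defines the cosheaf over \<open>U\<close>, paths stay in
  \<open>U\<close> but their homotopies may leave it. Cocones see only the values of
  \<open>G\<close>, which depend on classes in the whole space, so no entrance path category of
  \<open>U\<close> itself has to be compared with that of the space.\<close>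

lemma hom_iff: "f \<in> hom C a b \<longleftrightarrow> f \<in> Arr C \<and> Dom C f = a \<and> Cod C f = b"
  by (simp add: hom_def)

lemma homD: "f \<in> hom C a b \<Longrightarrow> f \<in> Arr C" "f \<in> hom C a b \<Longrightarrow> Dom C f = a"
    "f \<in> hom C a b \<Longrightarrow> Cod C f = b"
  by (simp_all add: hom_def)

lemma arr_hom: "f \<in> Arr C \<Longrightarrow> f \<in> hom C (Dom C f) (Cod C f)"
  by (simp add: hom_def)

locale category =
  fixes C :: "('o, 'm) cat"
  assumes is_cat: "is_category C"
begin

lemma hom_obj: assumes "f \<in> hom C a b" shows "a \<in> Obj C" "b \<in> Obj C"
  using is_cat assms unfolding is_category_def hom_def by blast+

lemma ident_hom [simp, intro]: "a \<in> Obj C \<Longrightarrow> Ident C a \<in> hom C a a"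
  using is_cat unfolding is_category_def by blast

lemma comp_hom [intro]:
  assumes "f \<in> hom C a b" "g \<in> hom C b c" shows "Comp C g f \<in> hom C a c"
proof -
  have "f \<in> Arr C" "g \<in> Arr C" "Dom C g = Cod C f" "a = Dom C f" "c = Cod C g"
    using assms by (auto simp: hom_def)
  then show ?thesis using is_cat unfolding is_category_def by blast
qed

lemma comp_assoc:
  assumes "f \<in> hom C a b" "g \<in> hom C b c" "h \<in> hom C c d"
  shows "Comp C (Comp C h g) f = Comp C h (Comp C g f)"
proof -
  have "f \<in> Arr C" "g \<in> Arr C" "h \<in> Arr C" "Dom C g = Cod C f" "Dom C h = Cod C g"
    using assms by (auto simp: hom_def)
  then show ?thesis using is_cat unfolding is_category_def by metis
qed

lemma comp_ident_right: "f \<in> hom C a b \<Longrightarrow> Comp C f (Ident C a) = f"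
  and comp_ident_left: "f \<in> hom C a b \<Longrightarrow> Comp C (Ident C b) f = f"
  using is_cat unfolding is_category_def hom_def by auto

lemma isoI:
  assumes "f \<in> hom C a b" "g \<in> hom C b a" "Comp C g f = Ident C a" "Comp C f g = Ident C b"
  shows "is_iso C f"
  using assms unfolding is_iso_def hom_def by auto

lemma ident_iso: "a \<in> Obj C \<Longrightarrow> is_iso C (Ident C a)"
  by (rule isoI[of _ a a "Ident C a"]) (auto simp: comp_ident_left[OF ident_hom])

definition inv_arr :: "'m \<Rightarrow> 'm" where
  "inv_arr f = (SOME g. g \<in> hom C (Cod C f) (Dom C f) \<and> Comp C g f = Ident C (Dom C f) \<and>
     Comp C f g = Ident C (Cod C f))"

lemma inv_arr:
  assumes "is_iso C f" "f \<in> hom C a b"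
  shows "inv_arr f \<in> hom C b a" "Comp C (inv_arr f) f = Ident C a" "Comp C f (inv_arr f) = Ident C b"
proof -
  have "\<exists>g. g \<in> hom C (Cod C f) (Dom C f) \<and> Comp C g f = Ident C (Dom C f) \<and>
     Comp C f g = Ident C (Cod C f)"
    using assms unfolding is_iso_def by blast
  from someI_ex[OF this] show "inv_arr f \<in> hom C b a" "Comp C (inv_arr f) f = Ident C a"
    "Comp C f (inv_arr f) = Ident C b"
    using homD[OF assms(2)] unfolding inv_arr_def by auto
qed

lemma inv_arr_iso: "is_iso C f \<Longrightarrow> f \<in> hom C a b \<Longrightarrow> is_iso C (inv_arr f)"
  using inv_arr[of f a b] by (intro isoI[of _ b a f])

lemma iso_cancel_right:
  assumes "is_iso C f" "f \<in> hom C a b" "g \<in> hom C b c" "g' \<in> hom C b c"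
    and "Comp C g f = Comp C g' f"
  shows "g = g'"
proof -
  note i = inv_arr[OF assms(1,2)]
  have "g = Comp C (Comp C g f) (inv_arr f)"
    using comp_assoc[OF i(1) assms(2,3)] i comp_ident_right[OF assms(3)] by simp
  also have "\<dots> = g'"
    using comp_assoc[OF i(1) assms(2,4)] i comp_ident_right[OF assms(4)] assms(5) by simp
  finally show ?thesis .
qed

lemma iso_cancel_left:
  assumes "is_iso C f" "f \<in> hom C b c" "g \<in> hom C a b" "g' \<in> hom C a b"
    and "Comp C f g = Comp C f g'"
  shows "g = g'"
proof -
  note i = inv_arr[OF assms(1,2)]
  have "g = Comp C (inv_arr f) (Comp C f g)"
    using comp_assoc[OF assms(3,2) i(1)] i comp_ident_left[OF assms(3)] by simp
  also have "\<dots> = g'"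
    using comp_assoc[OF assms(4,2) i(1)] i comp_ident_left[OF assms(4)] assms(5) by simp
  finally show ?thesis .
qed

lemma comp_iso:
  assumes "is_iso C f" "f \<in> hom C a b" "is_iso C g" "g \<in> hom C b c"
  shows "is_iso C (Comp C g f)"
proof (rule isoI[of _ a c "Comp C (inv_arr f) (inv_arr g)"])
  note i = inv_arr[OF assms(1,2)] and j = inv_arr[OF assms(3,4)]
  show "Comp C g f \<in> hom C a c" using assms by blast
  show "Comp C (inv_arr f) (inv_arr g) \<in> hom C c a" using i j by blast
  show "Comp C (Comp C (inv_arr f) (inv_arr g)) (Comp C g f) = Ident C a"
    using comp_assoc[OF comp_hom[OF assms(2,4)] j(1) i(1)] comp_assoc[OF assms(2,4) j(1)]
      comp_ident_left[OF assms(2)] i j by simp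
  show "Comp C (Comp C g f) (Comp C (inv_arr f) (inv_arr g)) = Ident C c"
    using comp_assoc[OF comp_hom[OF j(1) i(1)] assms(2,4)] comp_assoc[OF j(1) i(1) assms(2)]
      comp_ident_left[OF j(1)] i j by simp
qed

text \<open>Two out of three. It gives constructibility of the path cosheaf, where the legs at a
  common centre are invertible over both basic opens.\<close>

lemma iso_of_comp_iso:
  assumes f: "is_iso C f" "f \<in> hom C a b" and g: "g \<in> hom C b c" and gf: "is_iso C (Comp C g f)"
  shows "is_iso C g"
proof -
  note i = inv_arr[OF f]
  have "g = Comp C (Comp C g f) (inv_arr f)"
    using comp_assoc[OF i(1) f(2) g] i comp_ident_right[OF g] by simp
  moreover have "is_iso C (Comp C (Comp C g f) (inv_arr f))"
    using comp_iso[OF inv_arr_iso[OF f] i(1) gf] f g by blast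
  ultimately show ?thesis by simp
qed

end

section \<open>Functors and natural transformations\<close>

lemma functorD:
  assumes "is_functor C D F"
  shows "is_category C" "is_category D" "Omap F \<in> extensional (Obj C)" "Amap F \<in> extensional (Arr C)"
    "\<And>x. x \<in> Obj C \<Longrightarrow> Omap F x \<in> Obj D"
    "\<And>f a b. f \<in> hom C a b \<Longrightarrow> Amap F f \<in> hom D (Omap F a) (Omap F b)"
    "\<And>x. x \<in> Obj C \<Longrightarrow> Amap F (Ident C x) = Ident D (Omap F x)"
    "\<And>f g a b c. f \<in> hom C a b \<Longrightarrow> g \<in> hom C b c \<Longrightarrow> Amap F (Comp C g f) = Comp D (Amap F g) (Amap F f)"
  using assms unfolding is_functor_def hom_def by auto

lemma functorI:
  assumes "is_category C" "is_category D" "Omap F \<in> extensional (Obj C)" "Amap F \<in> extensional (Arr C)"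
    "\<And>x. x \<in> Obj C \<Longrightarrow> Omap F x \<in> Obj D"
    "\<And>f a b. f \<in> hom C a b \<Longrightarrow> Amap F f \<in> hom D (Omap F a) (Omap F b)"
    "\<And>x. x \<in> Obj C \<Longrightarrow> Amap F (Ident C x) = Ident D (Omap F x)"
    "\<And>f g a b c. f \<in> hom C a b \<Longrightarrow> g \<in> hom C b c \<Longrightarrow> Amap F (Comp C g f) = Comp D (Amap F g) (Amap F f)"
  shows "is_functor C D F"
  using assms unfolding is_functor_def by (simp add: hom_def)

lemma nat_transD:
  assumes "is_nat_trans C D F G \<tau>"
  shows "is_functor C D F" "is_functor C D G" "\<tau> \<in> extensional (Obj C)"
    "\<And>x. x \<in> Obj C \<Longrightarrow> \<tau> x \<in> hom D (Omap F x) (Omap G x)"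
    "\<And>f a b. f \<in> hom C a b \<Longrightarrow> Comp D (\<tau> b) (Amap F f) = Comp D (Amap G f) (\<tau> a)"
  using assms unfolding is_nat_trans_def hom_def by auto

lemma nat_transI:
  assumes "is_functor C D F" "is_functor C D G" "\<tau> \<in> extensional (Obj C)"
    "\<And>x. x \<in> Obj C \<Longrightarrow> \<tau> x \<in> hom D (Omap F x) (Omap G x)"
    "\<And>f a b. f \<in> hom C a b \<Longrightarrow> Comp D (\<tau> b) (Amap F f) = Comp D (Amap G f) (\<tau> a)"
  shows "is_nat_trans C D F G \<tau>"
  using assms unfolding is_nat_trans_def by (simp add: hom_def)

lemma nat_trans_ident:
  assumes F: "is_functor C D F"
  shows "is_nat_trans C D F F (\<lambda>x \<in> Obj C. Ident D (Omap F x))"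
proof -
  interpret C: category C using functorD(1)[OF F] by unfold_locales
  interpret D: category D using functorD(2)[OF F] by unfold_locales
  show ?thesis
  proof (rule nat_transI[OF F F])
    fix f a b assume f: "f \<in> hom C a b"
    show "Comp D ((\<lambda>x\<in>Obj C. Ident D (Omap F x)) b) (Amap F f) =
       Comp D (Amap F f) ((\<lambda>x\<in>Obj C. Ident D (Omap F x)) a)"
      using C.hom_obj[OF f] D.comp_ident_left[OF functorD(6)[OF F f]]
        D.comp_ident_right[OF functorD(6)[OF F f]] by simp
  qed (auto simp: functorD(5)[OF F])
qed

lemma nat_trans_comp:
  assumes \<tau>: "is_nat_trans C D F G \<tau>" and \<sigma>: "is_nat_trans C D G H \<sigma>"
  shows "is_nat_trans C D F H (\<lambda>x \<in> Obj C. Comp D (\<sigma> x) (\<tau> x))"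
proof -
  note F = nat_transD(1)[OF \<tau>] and G = nat_transD(2)[OF \<tau>] and H = nat_transD(2)[OF \<sigma>]
  interpret C: category C using functorD(1)[OF F] by unfold_locales
  interpret D: category D using functorD(2)[OF F] by unfold_locales
  show ?thesis
  proof (rule nat_transI[OF F H])
    fix f a b assume f: "f \<in> hom C a b"
    note ab = C.hom_obj[OF f]
    note m = functorD(6)[OF F f] functorD(6)[OF G f] functorD(6)[OF H f]
      nat_transD(4)[OF \<tau> ab(1)] nat_transD(4)[OF \<tau> ab(2)] nat_transD(4)[OF \<sigma> ab(1)] nat_transD(4)[OF \<sigma> ab(2)]
    show "Comp D ((\<lambda>x\<in>Obj C. Comp D (\<sigma> x) (\<tau> x)) b) (Amap F f) =
       Comp D (Amap H f) ((\<lambda>x\<in>Obj C. Comp D (\<sigma> x) (\<tau> x)) a)"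
      using ab nat_transD(5)[OF \<tau> f] nat_transD(5)[OF \<sigma> f]
        D.comp_assoc[OF m(1) m(5) m(7)] D.comp_assoc[OF m(4) m(2) m(7)] D.comp_assoc[OF m(4) m(6) m(3)]
      by simp
  qed (auto intro!: D.comp_hom nat_transD(4)[OF \<tau>] nat_transD(4)[OF \<sigma>])
qed

section \<open>Functor categories and full subcategories\<close>

lemma functor_cat_simps [simp]:
  "Obj (functor_cat C D) = {F. is_functor C D F}"
  "(F, \<tau>, G) \<in> Arr (functor_cat C D) \<longleftrightarrow> is_nat_trans C D F G \<tau>"
  "Dom (functor_cat C D) (F, \<tau>, G) = F"
  "Cod (functor_cat C D) (F, \<tau>, G) = G"
  "Ident (functor_cat C D) F = (F, \<lambda>x \<in> Obj C. Ident D (Omap F x), F)"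
  "Comp (functor_cat C D) (G', \<sigma>, H) (F, \<tau>, G) = (F, \<lambda>x \<in> Obj C. Comp D (\<sigma> x) (\<tau> x), H)"
  by (simp_all add: functor_cat_def)

lemma hom_functor_cat:
  "f \<in> hom (functor_cat C D) F G \<longleftrightarrow> (\<exists>\<tau>. f = (F, \<tau>, G) \<and> is_nat_trans C D F G \<tau>)"
  by (cases f) (auto simp: hom_def)

lemma is_category_functor_cat:
  assumes "is_category C" "is_category D"
  shows "is_category (functor_cat C D)"
proof -
  interpret C: category C using assms by unfold_locales
  interpret D: category D using assms by unfold_locales
  have ext: "\<tau> = \<tau>'" if "\<tau> \<in> extensional (Obj C)" "\<tau>' \<in> extensional (Obj C)"
      "\<And>x. x \<in> Obj C \<Longrightarrow> \<tau> x = \<tau>' x" for \<tau> \<tau>' :: "'a \<Rightarrow> 'd"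
    using extensionalityI[OF that] by blast
  show ?thesis
    unfolding is_category_def
  proof (intro conjI ballI impI)
    fix f assume "f \<in> Arr (functor_cat C D)"
    then obtain F \<tau> G where [simp]: "f = (F, \<tau>, G)" and \<tau>: "is_nat_trans C D F G \<tau>"
      by (cases f) simp
    show "Dom (functor_cat C D) f \<in> Obj (functor_cat C D)" "Cod (functor_cat C D) f \<in> Obj (functor_cat C D)"
      using nat_transD(1,2)[OF \<tau>] by auto
    show "Comp (functor_cat C D) f (Ident (functor_cat C D) (Dom (functor_cat C D) f)) = f"
      using nat_transD(3)[OF \<tau>] D.comp_ident_right[OF nat_transD(4)[OF \<tau>]] by (auto intro!: ext)
    show "Comp (functor_cat C D) (Ident (functor_cat C D) (Cod (functor_cat C D) f)) f = f"
      using nat_transD(3)[OF \<tau>] D.comp_ident_left[OF nat_transD(4)[OF \<tau>]] by (auto intro!: ext)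
  next
    fix F assume "F \<in> Obj (functor_cat C D)"
    then show "Ident (functor_cat C D) F \<in> hom (functor_cat C D) F F"
      using nat_trans_ident[of C D F] by (simp add: hom_functor_cat)
  next
    fix f g assume "f \<in> Arr (functor_cat C D)" "g \<in> Arr (functor_cat C D)"
      "Dom (functor_cat C D) g = Cod (functor_cat C D) f"
    then obtain F \<tau> G \<sigma> H where [simp]: "f = (F, \<tau>, G)" "g = (G, \<sigma>, H)"
      and \<tau>: "is_nat_trans C D F G \<tau>" and \<sigma>: "is_nat_trans C D G H \<sigma>"
      by (cases f, cases g) simp
    show "Comp (functor_cat C D) g f \<in> hom (functor_cat C D) (Dom (functor_cat C D) f) (Cod (functor_cat C D) g)"
      using nat_trans_comp[OF \<tau> \<sigma>] by (simp add: hom_functor_cat)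
    fix h assume "h \<in> Arr (functor_cat C D)" "Dom (functor_cat C D) h = Cod (functor_cat C D) g"
    then obtain \<rho> L where [simp]: "h = (H, \<rho>, L)" and \<rho>: "is_nat_trans C D H L \<rho>"
      by (cases h) simp
    show "Comp (functor_cat C D) h (Comp (functor_cat C D) g f) =
        Comp (functor_cat C D) (Comp (functor_cat C D) h g) f"
      using D.comp_assoc[OF nat_transD(4)[OF \<tau>] nat_transD(4)[OF \<sigma>] nat_transD(4)[OF \<rho>]]
      by (auto simp: restrict_def)
  qed
qed

text \<open>The inverses of the components form a natural family, since naturality may be tested
  after precomposition with the invertible \<open>\<tau> a\<close>.\<close>

lemma is_nat_iso_imp_is_iso:
  assumes "is_nat_iso C D F G \<tau>"
  shows "is_iso (functor_cat C D) (F, \<tau>, G)"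
proof -
  have \<tau>: "is_nat_trans C D F G \<tau>" and iso: "\<And>x. x \<in> Obj C \<Longrightarrow> is_iso D (\<tau> x)"
    using assms by (auto simp: is_nat_iso_def)
  note F = nat_transD(1)[OF \<tau>] and G = nat_transD(2)[OF \<tau>]
  interpret C: category C using functorD(1)[OF F] by unfold_locales
  interpret D: category D using functorD(2)[OF F] by unfold_locales
  interpret FC: category "functor_cat C D"
    using is_category_functor_cat C.is_cat D.is_cat by unfold_locales
  define \<sigma> where "\<sigma> = (\<lambda>x \<in> Obj C. D.inv_arr (\<tau> x))"
  note i = D.inv_arr[OF iso nat_transD(4)[OF \<tau>]]
  have \<sigma>: "is_nat_trans C D G F \<sigma>"
  proof (rule nat_transI[OF G F])
    fix f a b assume f: "f \<in> hom C a b"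
    note ab = C.hom_obj[OF f]
    note m = functorD(6)[OF F f] functorD(6)[OF G f] nat_transD(4)[OF \<tau> ab(1)] nat_transD(4)[OF \<tau> ab(2)]
      i(1)[OF ab(1) ab(1)] i(1)[OF ab(2) ab(2)]
    have "Comp D (Comp D (\<sigma> b) (Amap G f)) (\<tau> a) = Comp D (\<sigma> b) (Comp D (\<tau> b) (Amap F f))"
      using ab nat_transD(5)[OF \<tau> f] D.comp_assoc[OF m(3) m(2) m(6)] by (simp add: \<sigma>_def)
    also have "\<dots> = Amap F f"
      using ab D.comp_assoc[OF m(1) m(4) m(6)] i(2)[OF ab(2) ab(2)] D.comp_ident_left[OF m(1)] by (simp add: \<sigma>_def)
    also have "\<dots> = Comp D (Comp D (Amap F f) (\<sigma> a)) (\<tau> a)"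
      using ab D.comp_assoc[OF m(3) m(5) m(1)] i(2)[OF ab(1) ab(1)] D.comp_ident_right[OF m(1)]
      by (simp add: \<sigma>_def)
    finally show "Comp D (\<sigma> b) (Amap G f) = Comp D (Amap F f) (\<sigma> a)"
      using ab D.iso_cancel_right[OF iso[OF ab(1)] m(3) D.comp_hom[OF m(2,6)] D.comp_hom[OF m(5,1)]]
      by (simp add: \<sigma>_def)
  qed (auto simp: \<sigma>_def i(1))
  show ?thesis
    by (rule FC.isoI[of _ F G "(G, \<sigma>, F)"])
      (use \<tau> \<sigma> in \<open>auto simp: hom_functor_cat restrict_def \<sigma>_def i\<close>)
qed

lemma full_subcat_simps [simp]:
  "Obj (full_subcat C A) = Obj C \<inter> A"
  "Dom (full_subcat C A) = Dom C" "Cod (full_subcat C A) = Cod C"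
  "Ident (full_subcat C A) = Ident C" "Comp (full_subcat C A) = Comp C"
  by (simp_all add: full_subcat_def)

lemma hom_full_subcat:
  "hom (full_subcat C A) a b = (if a \<in> A \<and> b \<in> A then hom C a b else {})"
  by (auto simp: hom_def full_subcat_def)

lemma Arr_full_subcat: "f \<in> Arr (full_subcat C A) \<longleftrightarrow> f \<in> Arr C \<and> Dom C f \<in> A \<and> Cod C f \<in> A"
  by (simp add: full_subcat_def)

lemma is_category_full_subcat:
  assumes "is_category C"
  shows "is_category (full_subcat C A)"
proof -
  interpret category C using assms by unfold_locales
  show ?thesis
    unfolding is_category_def
  proof (intro conjI ballI impI)
    fix f g h assume f: "f \<in> Arr (full_subcat C A)" and g: "g \<in> Arr (full_subcat C A)"
      and "h \<in> Arr (full_subcat C A)" "Dom (full_subcat C A) g = Cod (full_subcat C A) f"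
      "Dom (full_subcat C A) h = Cod (full_subcat C A) g"
    then have "f \<in> hom C (Dom C f) (Cod C f)" "g \<in> hom C (Cod C f) (Cod C g)"
      "h \<in> hom C (Cod C g) (Cod C h)"
      by (simp_all add: hom_iff Arr_full_subcat)
    from comp_assoc[OF this]
    show "Comp (full_subcat C A) h (Comp (full_subcat C A) g f) =
        Comp (full_subcat C A) (Comp (full_subcat C A) h g) f" by simp
  next
    fix f g assume f: "f \<in> Arr (full_subcat C A)" and g: "g \<in> Arr (full_subcat C A)"
      and "Dom (full_subcat C A) g = Cod (full_subcat C A) f"
    then have "f \<in> hom C (Dom C f) (Cod C f)" "g \<in> hom C (Cod C f) (Cod C g)"
      by (simp_all add: hom_iff Arr_full_subcat)
    from comp_hom[OF this] show "Comp (full_subcat C A) g f \<in> hom (full_subcat C A) (Dom (full_subcat C A) f)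
        (Cod (full_subcat C A) g)"
      using f g by (simp add: hom_full_subcat Arr_full_subcat)
  next
    fix f assume f: "f \<in> Arr (full_subcat C A)"
    then have f': "f \<in> hom C (Dom C f) (Cod C f)" by (simp add: hom_iff Arr_full_subcat)
    show "Dom (full_subcat C A) f \<in> Obj (full_subcat C A)" "Cod (full_subcat C A) f \<in> Obj (full_subcat C A)"
      using f hom_obj[OF f'] by (simp_all add: Arr_full_subcat)
    show "Comp (full_subcat C A) f (Ident (full_subcat C A) (Dom (full_subcat C A) f)) = f"
      "Comp (full_subcat C A) (Ident (full_subcat C A) (Cod (full_subcat C A) f)) f = f"
      using comp_ident_left[OF f'] comp_ident_right[OF f'] by simp_all
  qed (simp add: hom_full_subcat)
qed

section \<open>A criterion for an equivalence of categories\<close>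

lemma is_functor_id:
  assumes "is_category C"
  shows "is_functor C C (id_functor C)"
proof -
  interpret category C using assms by unfold_locales
  show ?thesis
  proof (rule functorI[OF assms assms])
    fix f g a b c assume f: "f \<in> hom C a b" and g: "g \<in> hom C b c"
    show "Amap (id_functor C) (Comp C g f) = Comp C (Amap (id_functor C) g) (Amap (id_functor C) f)"
      using homD(1)[OF comp_hom[OF f g]] homD(1)[OF f] homD(1)[OF g] by (simp add: id_functor_def)
  next
    fix f a b assume f: "f \<in> hom C a b"
    show "Amap (id_functor C) f \<in> hom C (Omap (id_functor C) a) (Omap (id_functor C) b)"
      using f homD(1)[OF f] hom_obj[OF f] by (simp add: id_functor_def)
  next
    fix x assume x: "x \<in> Obj C"
    show "Amap (id_functor C) (Ident C x) = Ident C (Omap (id_functor C) x)"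
      using x homD(1)[OF ident_hom[OF x]] by (simp add: id_functor_def)
  qed (simp_all add: id_functor_def)
qed

lemma is_functor_comp:
  assumes F: "is_functor C D F" and G: "is_functor D E G"
  shows "is_functor C E (comp_functor C G F)"
proof -
  interpret category C using functorD(1)[OF F] by unfold_locales
  show ?thesis
  proof (rule functorI)
    show "is_category C" "is_category E" using functorD(1)[OF F] functorD(2)[OF G] .
  next
    fix f g a b c assume f: "f \<in> hom C a b" and g: "g \<in> hom C b c"
    show "Amap (comp_functor C G F) (Comp C g f) =
        Comp E (Amap (comp_functor C G F) g) (Amap (comp_functor C G F) f)"
      using homD(1)[OF comp_hom[OF f g]] homD(1)[OF f] homD(1)[OF g] functorD(8)[OF F f g]
        functorD(8)[OF G functorD(6)[OF F f] functorD(6)[OF F g]] by (simp add: comp_functor_def)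
  next
    fix f a b assume f: "f \<in> hom C a b"
    show "Amap (comp_functor C G F) f \<in> hom E (Omap (comp_functor C G F) a) (Omap (comp_functor C G F) b)"
      using homD(1)[OF f] hom_obj[OF f] functorD(6)[OF G functorD(6)[OF F f]] by (simp add: comp_functor_def)
  next
    fix x assume x: "x \<in> Obj C"
    show "Amap (comp_functor C G F) (Ident C x) = Ident E (Omap (comp_functor C G F) x)"
      using x homD(1)[OF ident_hom[OF x]] functorD(7)[OF F x] functorD(7)[OF G functorD(5)[OF F x]]
      by (simp add: comp_functor_def)
  qed (simp_all add: comp_functor_def functorD(5)[OF F] functorD(5)[OF G])
qed

text \<open>The functor back is built by choice: \<open>r d\<close> is a preimage of
  \<open>d\<close> up to an isomorphism \<open>i d\<close>, and an arrow goes to the unique lift of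
  its conjugate by these isomorphisms. Equations in \<open>C\<close> are checked after applying
  \<open>\<Phi>\<close>, which is faithful.\<close>

lemma equivalent_categoriesI:
  assumes \<Phi>: "is_functor C D \<Phi>"
    and ff: "\<And>a b g. a \<in> Obj C \<Longrightarrow> b \<in> Obj C \<Longrightarrow> g \<in> hom D (Omap \<Phi> a) (Omap \<Phi> b) \<Longrightarrow>
      \<exists>!f. f \<in> hom C a b \<and> Amap \<Phi> f = g"
    and eso: "\<And>d. d \<in> Obj D \<Longrightarrow> \<exists>c \<in> Obj C. \<exists>i \<in> hom D (Omap \<Phi> c) d. is_iso D i"
  shows "equivalent_categories C D"
proof -
  interpret C: category C using functorD(1)[OF \<Phi>] by unfold_locales
  interpret D: category D using functorD(2)[OF \<Phi>] by unfold_locales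
  have "\<forall>d \<in> Obj D. \<exists>c. \<exists>i. c \<in> Obj C \<and> i \<in> hom D (Omap \<Phi> c) d \<and> is_iso D i"
    using eso by blast
  then obtain r i where r: "\<And>d. d \<in> Obj D \<Longrightarrow> r d \<in> Obj C"
    and i: "\<And>d. d \<in> Obj D \<Longrightarrow> i d \<in> hom D (Omap \<Phi> (r d)) d" "\<And>d. d \<in> Obj D \<Longrightarrow> is_iso D (i d)"
    by metis
  define j where "j = (\<lambda>d. D.inv_arr (i d))"
  have j: "j d \<in> hom D d (Omap \<Phi> (r d))" "Comp D (j d) (i d) = Ident D (Omap \<Phi> (r d))"
      "Comp D (i d) (j d) = Ident D d" "is_iso D (j d)" if "d \<in> Obj D" for d
    using D.inv_arr[OF i(2)[OF that] i(1)[OF that]] D.inv_arr_iso[OF i(2)[OF that] i(1)[OF that]]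
    by (auto simp: j_def)
  define lift where "lift = (\<lambda>a b g. THE f. f \<in> hom C a b \<and> Amap \<Phi> f = g)"
  have lift: "lift a b g \<in> hom C a b" "Amap \<Phi> (lift a b g) = g"
    if "a \<in> Obj C" "b \<in> Obj C" "g \<in> hom D (Omap \<Phi> a) (Omap \<Phi> b)" for a b g
    using theI'[OF ff[OF that]] unfolding lift_def by auto
  have faithful: "f = f'" if "f \<in> hom C a b" "f' \<in> hom C a b" "Amap \<Phi> f = Amap \<Phi> f'" for f f' a b
    using ff[OF C.hom_obj[OF that(1)] functorD(6)[OF \<Phi> that(1)]] that by (elim ex1E) metis
  \<comment> \<open>Conjugation turns an arrow from \<open>a\<close> to \<open>b\<close> into one
    from \<open>Omap \<Phi> (r a)\<close> to \<open>Omap \<Phi> (r b)\<close>, between objects where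
    lifts exist.\<close>
  define conj where "conj = (\<lambda>g. Comp D (j (Cod D g)) (Comp D g (i (Dom D g))))"
  have conj: "conj g \<in> hom D (Omap \<Phi> (r a)) (Omap \<Phi> (r b))" "Comp D (i b) (conj g) = Comp D g (i a)"
    if g: "g \<in> hom D a b" for g a b
  proof -
    note ab = D.hom_obj[OF g]
    have [simp]: "Dom D g = a" "Cod D g = b" using homD[OF g] by auto
    have gi: "Comp D g (i a) \<in> hom D (Omap \<Phi> (r a)) b" using i(1)[OF ab(1)] g by blast
    show "conj g \<in> hom D (Omap \<Phi> (r a)) (Omap \<Phi> (r b))"
      using gi j(1)[OF ab(2)] by (auto simp: conj_def)
    show "Comp D (i b) (conj g) = Comp D g (i a)"
      using D.comp_assoc[OF gi j(1)[OF ab(2)] i(1)[OF ab(2)]] j(3)[OF ab(2)] D.comp_ident_left[OF gi]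
      by (simp add: conj_def)
  qed
  define R where "R = \<lparr>Omap = restrict r (Obj D),
    Amap = (\<lambda>g \<in> Arr D. lift (r (Dom D g)) (r (Cod D g)) (conj g))\<rparr>"
  have Ro: "Omap R d = r d" if "d \<in> Obj D" for d using that by (simp add: R_def)
  have Ra: "Amap R g \<in> hom C (r a) (r b)" "Amap \<Phi> (Amap R g) = conj g" if g: "g \<in> hom D a b" for g a b
    using lift[OF r r conj(1)[OF g]] D.hom_obj[OF g] homD[OF g] by (simp_all add: R_def)
  have R: "is_functor D C R"
  proof (rule functorI)
    fix x assume x: "x \<in> Obj D"
    have "Amap R (Ident D x) = Ident C (r x)"
    proof (rule faithful)
      show "Amap R (Ident D x) \<in> hom C (r x) (r x)" using Ra x by blast
      show "Ident C (r x) \<in> hom C (r x) (r x)" using r x by blast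
      have [simp]: "Dom D (Ident D x) = x" "Cod D (Ident D x) = x" using homD[OF D.ident_hom[OF x]] by auto
      show "Amap \<Phi> (Amap R (Ident D x)) = Amap \<Phi> (Ident C (r x))"
        using Ra(2)[OF D.ident_hom[OF x]] j[OF x] D.comp_ident_left[OF i(1)[OF x]] functorD(7)[OF \<Phi> r[OF x]]
        by (simp add: conj_def)
    qed
    then show "Amap R (Ident D x) = Ident C (Omap R x)" using x by (simp add: Ro)
  next
    fix f g a b c assume f: "f \<in> hom D a b" and g: "g \<in> hom D b c"
    note abc = D.hom_obj[OF f] D.hom_obj[OF g]
    note gf = D.comp_hom[OF f g]
    show "Amap R (Comp D g f) = Comp C (Amap R g) (Amap R f)"
    proof (rule faithful)
      show "Amap R (Comp D g f) \<in> hom C (r a) (r c)" using Ra gf by blast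
      show "Comp C (Amap R g) (Amap R f) \<in> hom C (r a) (r c)" using Ra f g by blast
      have "Comp D (i c) (conj (Comp D g f)) = Comp D (i c) (Comp D (conj g) (conj f))"
      proof -
        have "Comp D (i c) (Comp D (conj g) (conj f)) = Comp D (Comp D g (i b)) (conj f)"
          using D.comp_assoc[OF conj(1)[OF f] conj(1)[OF g] i(1)[OF abc(4)]] conj(2)[OF g] by simp
        also have "\<dots> = Comp D g (Comp D f (i a))"
          using D.comp_assoc[OF conj(1)[OF f] i(1)[OF abc(2)] g] conj(2)[OF f] by simp
        also have "\<dots> = Comp D (i c) (conj (Comp D g f))"
          using D.comp_assoc[OF i(1)[OF abc(1)] f g] conj(2)[OF gf] by simp
        finally show ?thesis by simp
      qed
      then have "conj (Comp D g f) = Comp D (conj g) (conj f)"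
        by (rule D.iso_cancel_left[OF i(2)[OF abc(4)] i(1)[OF abc(4)] conj(1)[OF gf]
              D.comp_hom[OF conj(1)[OF f] conj(1)[OF g]]])
      then show "Amap \<Phi> (Amap R (Comp D g f)) = Amap \<Phi> (Comp C (Amap R g) (Amap R f))"
        using Ra(2)[OF f] Ra(2)[OF g] Ra(2)[OF gf] functorD(8)[OF \<Phi> Ra(1)[OF f] Ra(1)[OF g]] by simp
    qed
  next
    fix f a b assume f: "f \<in> hom D a b"
    then show "Amap R f \<in> hom C (Omap R a) (Omap R b)"
      using Ra(1)[OF f] D.hom_obj[OF f] by (simp add: Ro)
  qed (simp_all add: R_def C.is_cat D.is_cat r)
  have \<Phi>o: "Omap \<Phi> c \<in> Obj D" if "c \<in> Obj C" for c using functorD(5)[OF \<Phi> that] .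
  note R\<Phi> = is_functor_comp[OF \<Phi> R] and \<Phi>R = is_functor_comp[OF R \<Phi>]
    and idC = is_functor_id[OF C.is_cat] and idD = is_functor_id[OF D.is_cat]
  \<comment> \<open>The unit leads from \<open>c\<close> to \<open>r (Omap \<Phi> c)\<close>, so it
    lifts \<open>j\<close> and not \<open>i\<close>; the lift of \<open>i\<close> will be its
    inverse.\<close>
  define \<eta> where "\<eta> = (\<lambda>c \<in> Obj C. lift c (r (Omap \<Phi> c)) (j (Omap \<Phi> c)))"
  have \<eta>: "\<eta> c \<in> hom C c (r (Omap \<Phi> c))" "Amap \<Phi> (\<eta> c) = j (Omap \<Phi> c)" if c: "c \<in> Obj C" for c
    using lift[OF c r[OF \<Phi>o[OF c]] j(1)[OF \<Phi>o[OF c]]] c by (simp_all add: \<eta>_def)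
  have "is_nat_iso C C (id_functor C) (comp_functor C R \<Phi>) \<eta>"
    unfolding is_nat_iso_def
  proof (intro conjI ballI nat_transI[OF idC R\<Phi>])
    show "\<eta> \<in> extensional (Obj C)" by (simp add: \<eta>_def)
    fix c assume c: "c \<in> Obj C"
    show "\<eta> c \<in> hom C (Omap (id_functor C) c) (Omap (comp_functor C R \<Phi>) c)"
      using \<eta>[OF c] c \<Phi>o by (simp add: id_functor_def comp_functor_def Ro)
    define \<theta> where "\<theta> = lift (r (Omap \<Phi> c)) c (i (Omap \<Phi> c))"
    have \<theta>: "\<theta> \<in> hom C (r (Omap \<Phi> c)) c" "Amap \<Phi> \<theta> = i (Omap \<Phi> c)"
      using lift[OF r[OF \<Phi>o[OF c]] c i(1)[OF \<Phi>o[OF c]]] by (simp_all add: \<theta>_def)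
    show "is_iso C (\<eta> c)"
    proof (rule C.isoI[OF \<eta>(1)[OF c] \<theta>(1)])
      show "Comp C \<theta> (\<eta> c) = Ident C c"
        by (rule faithful[OF C.comp_hom[OF \<eta>(1)[OF c] \<theta>(1)] C.ident_hom[OF c]])
          (use functorD(8)[OF \<Phi> \<eta>(1)[OF c] \<theta>(1)] functorD(7)[OF \<Phi> c] \<eta>(2)[OF c] \<theta>(2) j[OF \<Phi>o[OF c]] in simp)
      show "Comp C (\<eta> c) \<theta> = Ident C (r (Omap \<Phi> c))"
        by (rule faithful[OF C.comp_hom[OF \<theta>(1) \<eta>(1)[OF c]] C.ident_hom[OF r[OF \<Phi>o[OF c]]]])
          (use functorD(8)[OF \<Phi> \<theta>(1) \<eta>(1)[OF c]] functorD(7)[OF \<Phi> r[OF \<Phi>o[OF c]]] \<eta>(2)[OF c] \<theta>(2)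
            j[OF \<Phi>o[OF c]] in simp)
    qed
  next
    fix f a b assume f: "f \<in> hom C a b"
    note ab = C.hom_obj[OF f]
    note \<Phi>f = functorD(6)[OF \<Phi> f]
    have "Comp C (\<eta> b) f = Comp C (Amap R (Amap \<Phi> f)) (\<eta> a)"
    proof (rule faithful[OF C.comp_hom[OF f \<eta>(1)[OF ab(2)]] C.comp_hom[OF \<eta>(1)[OF ab(1)] Ra(1)[OF \<Phi>f]]])
      have "Comp D (conj (Amap \<Phi> f)) (j (Omap \<Phi> a)) = Comp D (j (Omap \<Phi> b)) (Amap \<Phi> f)"
        using D.comp_assoc[OF j(1)[OF \<Phi>o[OF ab(1)]] D.comp_hom[OF i(1)[OF \<Phi>o[OF ab(1)]] \<Phi>f] j(1)[OF \<Phi>o[OF ab(2)]]]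
          D.comp_assoc[OF j(1)[OF \<Phi>o[OF ab(1)]] i(1)[OF \<Phi>o[OF ab(1)]] \<Phi>f] D.comp_ident_right[OF \<Phi>f]
          j(3)[OF \<Phi>o[OF ab(1)]] homD[OF \<Phi>f] by (simp add: conj_def)
      then show "Amap \<Phi> (Comp C (\<eta> b) f) = Amap \<Phi> (Comp C (Amap R (Amap \<Phi> f)) (\<eta> a))"
        using functorD(8)[OF \<Phi> f \<eta>(1)[OF ab(2)]] functorD(8)[OF \<Phi> \<eta>(1)[OF ab(1)] Ra(1)[OF \<Phi>f]]
          \<eta>(2)[OF ab(1)] \<eta>(2)[OF ab(2)] Ra(2)[OF \<Phi>f] by simp
    qed
    then show "Comp C (\<eta> b) (Amap (id_functor C) f) = Comp C (Amap (comp_functor C R \<Phi>) f) (\<eta> a)"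
      using homD(1)[OF f] by (simp add: id_functor_def comp_functor_def)
  qed
  moreover have "is_nat_iso D D (comp_functor D \<Phi> R) (id_functor D) (restrict i (Obj D))"
    unfolding is_nat_iso_def
  proof (intro conjI ballI nat_transI[OF \<Phi>R idD])
    fix f a b assume f: "f \<in> hom D a b"
    then show "Comp D (restrict i (Obj D) b) (Amap (comp_functor D \<Phi> R) f) =
        Comp D (Amap (id_functor D) f) (restrict i (Obj D) a)"
      using homD(1)[OF f] D.hom_obj[OF f] conj(2)[OF f] Ra(2)[OF f]
      by (simp add: id_functor_def comp_functor_def)
  qed (simp_all add: i comp_functor_def id_functor_def Ro)
  ultimately show ?thesis
    using \<Phi> R unfolding equivalent_categories_def by blast
qed

section \<open>Basic opens\<close>

lemma step_filtrationD:
  assumes "step_filtration n K"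
  shows "closedin (Top K) (Fil K k)" "i \<le> j \<Longrightarrow> Fil K i \<subseteq> Fil K j"
    "Fil K n = topspace (Top K)" "Fil K k \<subseteq> topspace (Top K)"
  using assms closedin_subset lift_Suc_mono_le[of "Fil K" i j] unfolding step_filtration_def by blast+

text \<open>A homeomorphism restricts to a homeomorphism of any subspace onto its image, so being
  filtered reduces to an equality of images in each degree.\<close>

lemma filtered_homeo_iff:
  assumes "\<And>k. Fil K k \<subseteq> topspace (Top K)" "\<And>k. Fil M k \<subseteq> topspace (Top M)"
  shows "filtered_homeo K M h \<longleftrightarrow> homeomorphic_map (Top K) (Top M) h \<and> (\<forall>k. h ` Fil K k = Fil M k)"
proof (intro iffI conjI allI)
  fix k assume "filtered_homeo K M h"
  then have "homeomorphic_map (subtopology (Top K) (Fil K k)) (subtopology (Top M) (Fil M k)) h"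
    by (simp add: filtered_homeo_def)
  from homeomorphic_imp_surjective_map[OF this] show "h ` Fil K k = Fil M k"
    using assms by (simp add: Int_absorb1)
next
  assume *: "homeomorphic_map (Top K) (Top M) h \<and> (\<forall>k. h ` Fil K k = Fil M k)"
  then obtain g where g: "homeomorphic_maps (Top K) (Top M) h g"
    unfolding homeomorphic_map_maps by (elim conjE exE)
  have "homeomorphic_maps (subtopology (Top K) (Fil K k)) (subtopology (Top M) (Fil M k)) h g" for k
    by (rule homeomorphic_maps_subtopologies[OF g]) (use * assms in \<open>simp add: Int_absorb1\<close>)
  then show "filtered_homeo K M h"
    using * homeomorphic_maps_imp_map unfolding filtered_homeo_def by metis
qed (simp add: filtered_homeo_def)

lemma layer_iff: "x \<in> layer K d \<longleftrightarrow> x \<in> Fil K d \<and> (d = 0 \<or> x \<notin> Fil K (d - 1))"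
  by (auto simp: layer_def split: nat.split)

subsection \<open>The local model\<close>

definition model :: "nat \<Rightarrow> 'a fspace \<Rightarrow> ((nat \<Rightarrow> real) \<times> ('a \<times> real) option) fspace" where
  "model d L = prod_filtered (euclidean_filtered d) (cone_filtered L)"

lemma topspace_cone [simp]:
  "topspace (cone_topology X) = insert None (Some ` (topspace X \<times> {0<..}))"
proof -
  have "Some -` insert None (Some ` (topspace X \<times> {0<..})) = topspace X \<times> {0 :: real<..}" by auto
  moreover have "openin (top_of_set {0<..}) {0<..}" by (simp add: openin_open_eq)
  ultimately have "openin (cone_topology X) (insert None (Some ` (topspace X \<times> {0<..})))"
    unfolding openin_cone_topology cone_open_def
    by (simp add: openin_prod_Times_iff) (auto intro!: exI[of _ 1])
  moreover have "U \<subseteq> insert None (Some ` (topspace X \<times> {0<..}))" if "openin (cone_topology X) U" for U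
    using that unfolding openin_cone_topology cone_open_def by blast
  ultimately show ?thesis unfolding topspace_def by blast
qed

lemma Top_model: "Top (model d L) = prod_topology (Euclidean_space d) (cone_topology (Top L))"
  by (simp add: model_def prod_filtered_def euclidean_filtered_def cone_filtered_def)

lemma Fil_cone_mono: "step_filtration m L \<Longrightarrow> i \<le> j \<Longrightarrow> Fil (cone_filtered L) i \<subseteq> Fil (cone_filtered L) j"
  using step_filtrationD(2)[of m L "i - 1" "j - 1"]
  by (cases i; cases j) (auto simp: cone_filtered_def)

text \<open>The Euclidean factor is empty below degree \<open>d\<close> and everything from
  \<open>d\<close> on. In the union over \<open>i + j = k\<close> the cone degree is thus at most
  \<open>k - d\<close>, and the term with \<open>k - d\<close> contains the others. In degree
  \<open>d\<close> only the points over the apex remain.\<close>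

lemma Fil_model:
  assumes "filtered_space L"
  shows "Fil (model d L) k =
    (if k < d then {} else topspace (Euclidean_space d) \<times> Fil (cone_filtered L) (k - d))"
proof -
  obtain m where m: "step_filtration m L" using assms by (auto simp: filtered_space_def)
  show ?thesis
  proof (cases "k < d")
    case True
    then show ?thesis by (auto simp: model_def prod_filtered_def euclidean_filtered_def)
  next
    case False
    have "(\<Union>{Fil (euclidean_filtered d) i \<times> Fil (cone_filtered L) j | i j. i + j = k}) =
        topspace (Euclidean_space d) \<times> Fil (cone_filtered L) (k - d)"
    proof (intro equalityI subsetI)
      fix p assume "p \<in> \<Union>{Fil (euclidean_filtered d) i \<times> Fil (cone_filtered L) j | i j. i + j = k}"
      then obtain i j where ij: "i + j = k" "p \<in> Fil (euclidean_filtered d) i \<times> Fil (cone_filtered L) j"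
        by blast
      then have "\<not> i < d" by (auto simp: euclidean_filtered_def)
      then have "j \<le> k - d" using ij by simp
      from ij \<open>\<not> i < d\<close> Fil_cone_mono[OF m this]
      show "p \<in> topspace (Euclidean_space d) \<times> Fil (cone_filtered L) (k - d)"
        by (auto simp: euclidean_filtered_def)
    next
      fix p assume "p \<in> topspace (Euclidean_space d) \<times> Fil (cone_filtered L) (k - d)"
      then show "p \<in> \<Union>{Fil (euclidean_filtered d) i \<times> Fil (cone_filtered L) j | i j. i + j = k}"
        using False
        by (intro UnionI[of "Fil (euclidean_filtered d) d \<times> Fil (cone_filtered L) (k - d)"])
          (force simp: euclidean_filtered_def)+
    qed
    then show ?thesis using False by (simp add: model_def prod_filtered_def)
  qed
qed

lemma Fil_cone_topspace:
  assumes "filtered_space L"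
  shows "Fil (cone_filtered L) k \<subseteq> topspace (cone_topology (Top L))"
  using assms step_filtrationD(4) unfolding filtered_space_def
  by (cases k) (auto simp: cone_filtered_def, blast)

lemma Fil_model_topspace:
  assumes "filtered_space L"
  shows "Fil (model d L) k \<subseteq> topspace (Top (model d L))"
  using Fil_cone_topspace[OF assms] by (auto simp: Fil_model[OF assms] Top_model)

lemma Fil_cone_0 [simp]: "Fil (cone_filtered L) 0 = {None}"
  by (simp add: cone_filtered_def)

lemma None_in_Fil_cone [simp]: "None \<in> Fil (cone_filtered L) k"
  by (simp add: cone_filtered_def split: nat.split)

text \<open>Only the link coordinate decides the degree of a point off the apex. Hence changing one
  positive radius into another respects the filtration, whether this squeezes the cone or contracts
  it.\<close>

lemma Some_in_Fil_cone: "r > 0 \<Longrightarrow> s > 0 \<Longrightarrow>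
    Some (l, r) \<in> Fil (cone_filtered L) k \<longleftrightarrow> Some (l, s) \<in> Fil (cone_filtered L) k"
  by (auto simp: cone_filtered_def split: nat.split)

subsection \<open>Changing the chart of a basic open\<close>

text \<open>Composing the chart with a filtered homeomorphism \<open>g\<close> of the model onto an
  open part \<open>V\<close> gives a chart with the same dimension and the same link. A squeezing
  \<open>g\<close> shrinks a basic open, a translation \<open>g\<close> recentres it.\<close>

lemma basic_open_reembed:
  fixes K L :: "'a fspace"
  assumes K: "step_filtration n K"
    and U: "openin (Top K) U"
    and L: "filtered_space L" "formal_dim L = int n - int d - 1"
    and h: "filtered_homeo (model d L) (subspace_filtered K U) h"
    and V: "openin (Top (model d L)) V"
    and g: "homeomorphic_map (Top (model d L)) (subtopology (Top (model d L)) V) g"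
    and gF: "\<And>k. g ` Fil (model d L) k = V \<inter> Fil (model d L) k"
    and g0: "g (\<lambda>_. 0, None) = (v, None)"
  shows "basic_open n K (h (v, None)) (h ` V)"
proof -
  let ?M = "model d L"
  have KU: "Fil (subspace_filtered K U) k \<subseteq> topspace (Top (subspace_filtered K U))" for k
    using step_filtrationD(4)[OF K] by (auto simp: subspace_filtered_def)
  have h1: "homeomorphic_map (Top ?M) (subtopology (Top K) U) h"
    and hF: "\<And>k. h ` Fil ?M k = U \<inter> Fil K k"
    using h filtered_homeo_iff[OF Fil_model_topspace[OF L(1)] KU] by (auto simp: subspace_filtered_def)
  have Vs: "V \<subseteq> topspace (Top ?M)" using V openin_subset by blast
  have Us: "U \<subseteq> topspace (Top K)" using U openin_subset by blast
  have hinj: "inj_on h (topspace (Top ?M))" and him: "h ` topspace (Top ?M) = U"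
    using h1 Us by (auto simp: homeomorphic_eq_everything_map Int_absorb1)
  have oV: "openin (subtopology (Top K) U) (h ` V)"
    using homeomorphic_map_openness[OF h1 Vs] V by blast
  then have oV': "openin (Top K) (h ` V)" using openin_trans_full U by blast
  obtain h' where h': "homeomorphic_maps (Top ?M) (subtopology (Top K) U) h h'"
    using h1 homeomorphic_map_maps by blast
  have VU: "h ` V \<subseteq> U" using Vs him by blast
  have "homeomorphic_maps (subtopology (Top ?M) V) (subtopology (subtopology (Top K) U) (h ` V)) h h'"
    by (rule homeomorphic_maps_subtopologies[OF h'])
      (use Vs VU Us in \<open>auto simp: Int_absorb1 Int_absorb2\<close>)
  moreover have "subtopology (subtopology (Top K) U) (h ` V) = subtopology (Top K) (h ` V)"
    using VU by (simp add: subtopology_subtopology Int_absorb1)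
  ultimately have hV: "homeomorphic_map (subtopology (Top ?M) V) (subtopology (Top K) (h ` V)) h"
    using homeomorphic_map_maps by metis
  have hg: "homeomorphic_map (Top ?M) (subtopology (Top K) (h ` V)) (h \<circ> g)"
    using homeomorphic_map_compose[OF g hV] .
  have hgF: "(h \<circ> g) ` Fil ?M k = h ` V \<inter> Fil K k" for k
  proof -
    have "h ` (V \<inter> Fil ?M k) = h ` V \<inter> h ` Fil ?M k"
      using inj_on_image_Int[OF hinj Vs Fil_model_topspace[OF L(1)]] .
    then have "h ` (g ` Fil ?M k) = h ` V \<inter> (U \<inter> Fil K k)" by (simp only: gF hF)
    then show ?thesis using VU unfolding image_comp by blast
  qed
  have 0: "((\<lambda>_. 0), None) \<in> topspace (Top ?M)"
    by (simp add: Top_model topspace_Euclidean_space)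
  then have vV: "(v, None) \<in> V" using homeomorphic_imp_surjective_map[OF g] Vs g0
    by (metis IntD2 image_eqI topspace_subtopology)
  then have v: "v \<in> topspace (Euclidean_space d)" using Vs by (auto simp: Top_model)
  \<comment> \<open>The new centre lies over the apex, hence in degree \<open>d\<close>; the model
    is empty below \<open>d\<close>, so no smaller degree contains it.\<close>
  have "h (v, None) \<in> layer K d"
  proof -
    have "(v, None) \<in> Fil ?M d" using v by (simp add: Fil_model[OF L(1)])
    then have "h (v, None) \<in> Fil K d" using hF by blast
    moreover have "h (v, None) \<notin> Fil K (d - 1)" if "d \<noteq> 0"
    proof
      assume "h (v, None) \<in> Fil K (d - 1)"
      then have "h (v, None) \<in> h ` Fil ?M (d - 1)" using hF vV VU by blast
      moreover have "Fil ?M (d - 1) = {}" using that by (simp add: Fil_model[OF L(1)])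
      ultimately show False by simp
    qed
    ultimately show ?thesis by (auto simp: layer_iff)
  qed
  moreover have "filtered_homeo ?M (subspace_filtered K (h ` V)) (h \<circ> g)"
  proof -
    have KV: "Fil (subspace_filtered K (h ` V)) k \<subseteq> topspace (Top (subspace_filtered K (h ` V)))" for k
      using step_filtrationD(4)[OF K] by (auto simp: subspace_filtered_def)
    show ?thesis
      using filtered_homeo_iff[OF Fil_model_topspace[OF L(1)] KV, of d "h \<circ> g"] hg hgF
      by (simp add: subspace_filtered_def)
  qed
  ultimately show ?thesis
    unfolding basic_open_def model_def[symmetric]
    using oV' vV L g0 by (auto intro!: exI[of _ d] exI[of _ L] exI[of _ "h \<circ> g"])
qed

section \<open>Squeezing the local model into a small neighbourhood of its centre\<close>

lemma continuous_map_map_prod: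
  assumes "continuous_map X X' f" "continuous_map Y Y' g"
  shows "continuous_map (prod_topology X Y) (prod_topology X' Y') (map_prod f g)"
  using continuous_map_compose[OF continuous_map_fst assms(1)] continuous_map_compose[OF continuous_map_snd assms(2)]
  unfolding map_prod_def case_prod_unfold o_def by (rule continuous_map_pairedI)

lemma homeomorphic_maps_prod':
  assumes "homeomorphic_maps X X' f f'" "homeomorphic_maps Y Y' g g'"
  shows "homeomorphic_maps (prod_topology X Y) (prod_topology X' Y') (map_prod f g) (map_prod f' g')"
  using assms unfolding homeomorphic_maps_def by (auto intro: continuous_map_map_prod)

text \<open>The map acts on the radius alone. Off the apex it is a product map; at the apex
  \<open>f0\<close> is what the cone topology, with its neighbourhoods uniform over the link,
  demands. The domain is a partial cone over \<open>A\<close> so that a map onto a truncated cone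
  and its inverse are both covered.\<close>

lemma continuous_map_cone:
  fixes f :: "real \<Rightarrow> real"
  assumes A: "open A" "A \<subseteq> {0<..}" and f: "continuous_on A f" "f ` A \<subseteq> {0<..}"
    and f0: "\<And>e. e > 0 \<Longrightarrow> \<exists>a>0. {0<..<a} \<subseteq> A \<and> f ` {0<..<a} \<subseteq> {..<e}"
  shows "continuous_map (subtopology (cone_topology X) (insert None (Some ` (topspace X \<times> A))))
    (cone_topology X) (map_option (map_prod id f))" (is "continuous_map (subtopology _ ?C) _ ?g")
  unfolding continuous_map
proof (intro conjI allI impI)
  show "?g ` topspace (subtopology (cone_topology X) ?C) \<subseteq> topspace (cone_topology X)"
    using A f by auto
  fix V assume "openin (cone_topology X) V"
  then have V: "cone_open X V" by (simp add: openin_cone_topology)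
  let ?W = "{x \<in> topspace (subtopology (cone_topology X) ?C). ?g x \<in> V}"
  have "cone_open X ?W"
    unfolding cone_open_def
  proof (intro conjI impI)
    show "?W \<subseteq> insert None (Some ` (topspace X \<times> {0<..}))" by auto
    have cf: "continuous_map (subtopology (prod_topology X (top_of_set {0<..})) (topspace X \<times> A))
        (prod_topology X (top_of_set {0<..})) (\<lambda>p. (fst p, f (snd p)))"
    proof (rule continuous_map_pairedI)
      show "continuous_map (subtopology (prod_topology X (top_of_set {0<..})) (topspace X \<times> A)) X fst"
        by (rule continuous_map_from_subtopology[OF continuous_map_fst])
      have "continuous_map (top_of_set A) (top_of_set {0<..}) f"
        using f by (simp add: continuous_map_in_subtopology image_subset_iff_funcset)
      moreover have "continuous_map (subtopology (prod_topology X (top_of_set {0<..})) (topspace X \<times> A)) (top_of_set A) snd"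
        unfolding continuous_map_in_subtopology
        using continuous_map_into_fulltopology[OF continuous_map_snd]
        by (auto intro: continuous_map_from_subtopology)
      ultimately show "continuous_map (subtopology (prod_topology X (top_of_set {0<..})) (topspace X \<times> A))
          (top_of_set {0<..}) (\<lambda>p. f (snd p))"
        using continuous_map_compose[unfolded o_def] by blast
    qed
    have oA: "openin (prod_topology X (top_of_set {0<..})) (topspace X \<times> A)"
      using A by (simp add: openin_prod_Times_iff openin_open_eq)
    have "openin (prod_topology X (top_of_set {0<..})) (Some -` V)"
      using V by (simp add: cone_open_def)
    then have "openin (subtopology (prod_topology X (top_of_set {0<..})) (topspace X \<times> A))
        {p \<in> topspace (subtopology (prod_topology X (top_of_set {0<..})) (topspace X \<times> A)). (fst p, f (snd p)) \<in> Some -` V}"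
      using openin_continuous_map_preimage[OF cf] by blast
    then have "openin (prod_topology X (top_of_set {0<..}))
        {p \<in> topspace (subtopology (prod_topology X (top_of_set {0<..})) (topspace X \<times> A)). (fst p, f (snd p)) \<in> Some -` V}"
      using openin_trans_full oA by blast
    moreover have "{p \<in> topspace (subtopology (prod_topology X (top_of_set {0<..})) (topspace X \<times> A)). (fst p, f (snd p)) \<in> Some -` V}
        = Some -` ?W"
      using A by (auto simp: map_prod_def)
    ultimately show "openin (prod_topology X (top_of_set {0<..})) (Some -` ?W)" by simp
    assume "None \<in> ?W"
    then have "None \<in> V" by simp
    then obtain e where e: "e > 0" "Some ` (topspace X \<times> {0<..<e}) \<subseteq> V"
      using V by (auto simp: cone_open_def)
    obtain a where a: "a > 0" "{0<..<a} \<subseteq> A" "f ` {0<..<a} \<subseteq> {..<e}" using f0[OF e(1)] by blast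
    have "Some ` (topspace X \<times> {0<..<a}) \<subseteq> ?W"
    proof
      fix w assume "w \<in> Some ` (topspace X \<times> {0<..<a})"
      then obtain l r where w: "w = Some (l, r)" and lr: "l \<in> topspace X" "r \<in> {0<..<a}" by blast
      have "f r \<in> {0<..<e}" using lr a f by fastforce
      then have "Some (l, f r) \<in> V" using e lr by blast
      then show "w \<in> ?W" using lr a w by auto
    qed
    then show "\<exists>\<epsilon>>0. Some ` (topspace X \<times> {0<..<\<epsilon>}) \<subseteq> ?W" using a by blast
  qed
  then have "openin (cone_topology X) ?W" by (simp add: openin_cone_topology)
  then show "openin (subtopology (cone_topology X) ?C) ?W"
    by (subst openin_subtopology) (auto intro!: exI[of _ ?W])
qed

lemma openin_cone_ball:
  assumes "e > 0"
  shows "openin (cone_topology X) (insert None (Some ` (topspace X \<times> {0<..<e})))"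
proof -
  have "Some -` insert None (Some ` (topspace X \<times> {0<..<e})) = topspace X \<times> {0<..<e}" by auto
  moreover have "openin (top_of_set {0<..}) {0<..<e}" by (auto simp: openin_open_eq)
  ultimately show ?thesis
    using assms unfolding openin_cone_topology cone_open_def
    by (auto simp: openin_prod_Times_iff)
qed

text \<open>For positive \<open>e\<close> this is an odd increasing bijection from the reals to the
  interval from \<open>- e\<close> to \<open>e\<close>, and \<open>stretch e\<close> is its inverse.
  It fixes 0 and preserves positivity, so the same function squeezes Euclidean coordinates and the
  radius of a cone.\<close>

definition squeeze :: "real \<Rightarrow> real \<Rightarrow> real" where "squeeze e t = e * t / (1 + \<bar>t\<bar>)"
definition stretch :: "real \<Rightarrow> real \<Rightarrow> real" where "stretch e t = t / (e - \<bar>t\<bar>)"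

lemma squeeze_less: assumes "e > 0" shows "\<bar>squeeze e t\<bar> < e"
  using assms by (simp add: squeeze_def abs_mult field_simps)

lemma stretch_squeeze: assumes "e > 0" shows "stretch e (squeeze e t) = t"
proof -
  have *: "1 + \<bar>t\<bar> > 0" by simp
  have "e - \<bar>squeeze e t\<bar> = e / (1 + \<bar>t\<bar>)"
    using assms * by (simp add: squeeze_def abs_mult field_simps)
  then show ?thesis using assms * by (simp add: stretch_def) (simp add: squeeze_def)
qed

lemma squeeze_stretch: assumes "\<bar>t\<bar> < e" shows "squeeze e (stretch e t) = t"
proof -
  have *: "e - \<bar>t\<bar> > 0" "e > 0" using assms by linarith+
  then have "1 + \<bar>stretch e t\<bar> = e / (e - \<bar>t\<bar>)"
    by (simp add: stretch_def field_simps)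
  then show ?thesis using * by (simp add: squeeze_def) (simp add: stretch_def)
qed

lemma squeeze_pos: "e > 0 \<Longrightarrow> t > 0 \<Longrightarrow> squeeze e t > 0"
  by (simp add: squeeze_def)

lemma stretch_pos: "t < e \<Longrightarrow> t > 0 \<Longrightarrow> stretch e t > 0"
  by (simp add: stretch_def)

lemma homeomorphic_maps_squeeze_cone:
  assumes e: "e > 0"
  shows "homeomorphic_maps (cone_topology X)
    (subtopology (cone_topology X) (insert None (Some ` (topspace X \<times> {0<..<e}))))
    (map_option (map_prod id (squeeze e))) (map_option (map_prod id (stretch e)))"
  unfolding homeomorphic_maps_def
proof (intro conjI ballI)
  have "continuous_map (subtopology (cone_topology X) (insert None (Some ` (topspace X \<times> {0<..}))))
    (cone_topology X) (map_option (map_prod id (squeeze e)))"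
  proof (rule continuous_map_cone)
    show "continuous_on {0<..} (squeeze e)"
      unfolding squeeze_def by (intro continuous_intros) (auto simp: abs_if)
    fix e' :: real assume e': "e' > 0"
    have "squeeze e r < e'" if "0 < r" "r < e' / e" for r
    proof -
      have "squeeze e r < e * r" using that e by (simp add: squeeze_def field_simps)
      also have "\<dots> < e'" using that e by (simp add: field_simps)
      finally show ?thesis .
    qed
    then show "\<exists>a>0. {0<..<a} \<subseteq> {0<..} \<and> squeeze e ` {0<..<a} \<subseteq> {..<e'}"
      using e e' by (intro exI[of _ "e' / e"]) auto
  qed (use squeeze_pos[OF e] in auto)
  then have "continuous_map (cone_topology X) (cone_topology X) (map_option (map_prod id (squeeze e)))"
    by (metis subtopology_topspace topspace_cone)
  then show "continuous_map (cone_topology X)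
     (subtopology (cone_topology X) (insert None (Some ` (topspace X \<times> {0<..<e}))))
     (map_option (map_prod id (squeeze e)))"
    unfolding continuous_map_in_subtopology
    using squeeze_pos[OF e] squeeze_less[OF e] by (auto simp: abs_less_iff)
  show "continuous_map (subtopology (cone_topology X) (insert None (Some ` (topspace X \<times> {0<..<e}))))
    (cone_topology X) (map_option (map_prod id (stretch e)))"
  proof (rule continuous_map_cone)
    show "continuous_on {0<..<e} (stretch e)"
      unfolding stretch_def by (intro continuous_intros) auto
    show "stretch e ` {0<..<e} \<subseteq> {0<..}" using stretch_pos by auto
    fix e' :: real assume e': "e' > 0"
    \<comment> \<open>The bound \<open>e / 2\<close> keeps the denominator of
      \<open>stretch e r\<close> above \<open>e / 2\<close>; the bound \<open>e' * e / 2\<close>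
      then makes the quotient less than \<open>e'\<close>.\<close>
    define a where "a = min (e / 2) (e' * e / 2)"
    have "stretch e r < e'" if "0 < r" "r < a" for r
    proof -
      have "r < e / 2" "r < e' * e / 2" using that by (auto simp: a_def)
      then have "stretch e r \<le> r / (e / 2)"
        using that unfolding stretch_def by (intro divide_left_mono) auto
      also have "\<dots> < e'" using \<open>r < e' * e / 2\<close> e by (simp add: field_simps)
      finally show ?thesis .
    qed
    moreover have "a > 0" "a \<le> e" using e e' by (auto simp: a_def)
    ultimately show "\<exists>a>0. {0<..<a} \<subseteq> {0<..<e} \<and> stretch e ` {0<..<a} \<subseteq> {..<e'}"
      by (intro exI[of _ a]) auto
  qed auto
qed (use e in \<open>auto simp: stretch_squeeze squeeze_stretch\<close>)

lemma continuous_map_Euclidean_compose: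
  assumes "\<And>i. i < d \<Longrightarrow> continuous_map X euclideanreal (\<lambda>x. f x i)"
    and "\<And>x i. x \<in> topspace X \<Longrightarrow> i \<ge> d \<Longrightarrow> f x i = 0"
  shows "continuous_map X (Euclidean_space d) f"
proof -
  have "continuous_map X (Euclidean_space d) (\<lambda>x i. if i < d then f x i else 0)"
    using assms by (simp add: continuous_map_componentwise_Euclidean_space)
  then show ?thesis
    by (rule continuous_map_eq) (use assms in \<open>auto simp: fun_eq_iff\<close>)
qed

lemma continuous_map_Euclidean_proj: "continuous_map (Euclidean_space d) euclideanreal (\<lambda>v. v i)"
  unfolding Euclidean_space_def
  by (rule continuous_map_from_subtopology) (rule continuous_map_product_projection, simp)

text \<open>A box rather than a ball, as squeezing acts on each coordinate separately. The
  coordinates from \<open>d\<close> on vanish, so for positive \<open>e\<close> only the first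
  \<open>d\<close> inequalities restrict the point.\<close>

definition obox :: "nat \<Rightarrow> real \<Rightarrow> (nat \<Rightarrow> real) set" where
  "obox d e = {v \<in> topspace (Euclidean_space d). \<forall>i. \<bar>v i\<bar> < e}"

lemma homeomorphic_maps_squeeze_Euclidean:
  assumes e: "e > 0"
  shows "homeomorphic_maps (Euclidean_space d) (subtopology (Euclidean_space d) (obox d e))
    (\<lambda>v i. squeeze e (v i)) (\<lambda>v i. stretch e (v i))"
  unfolding homeomorphic_maps_def
proof (intro conjI ballI)
  have sq: "continuous_map euclideanreal euclideanreal (squeeze e)"
    unfolding squeeze_def continuous_map_iff_continuous2
    by (intro continuous_intros) (auto simp: abs_if add_nonneg_eq_0_iff)
  have "continuous_map (Euclidean_space d) (Euclidean_space d) (\<lambda>v i. squeeze e (v i))"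
    by (rule continuous_map_Euclidean_compose)
      (auto simp: topspace_Euclidean_space squeeze_def
        intro: continuous_map_compose[OF continuous_map_Euclidean_proj sq, unfolded o_def, unfolded squeeze_def])
  then show "continuous_map (Euclidean_space d) (subtopology (Euclidean_space d) (obox d e)) (\<lambda>v i. squeeze e (v i))"
    unfolding continuous_map_in_subtopology
    using squeeze_less[OF e] by (auto simp: obox_def topspace_Euclidean_space squeeze_def)
  have st: "continuous_map (top_of_set {-e<..<e}) euclideanreal (stretch e)"
    unfolding stretch_def continuous_map_iff_continuous
    by (intro continuous_intros) (auto simp: abs_if)
  have pr: "continuous_map (subtopology (Euclidean_space d) (obox d e)) (top_of_set {-e<..<e}) (\<lambda>v. v i)" for i
    unfolding continuous_map_in_subtopology
    by (auto intro!: continuous_map_from_subtopology continuous_map_Euclidean_proj simp: obox_def abs_less_iff)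
      (smt (verit))
  show "continuous_map (subtopology (Euclidean_space d) (obox d e)) (Euclidean_space d) (\<lambda>v i. stretch e (v i))"
    by (rule continuous_map_Euclidean_compose)
      (auto simp: topspace_Euclidean_space stretch_def
        intro: continuous_map_compose[OF pr st, unfolded o_def, unfolded stretch_def])
qed (use e in \<open>auto simp: stretch_squeeze squeeze_stretch obox_def\<close>)

lemma homeomorphic_maps_translate_Euclidean:
  assumes "a \<in> topspace (Euclidean_space d)"
  shows "homeomorphic_maps (Euclidean_space d) (Euclidean_space d) (\<lambda>v i. v i + a i) (\<lambda>v i. v i - a i)"
  unfolding homeomorphic_maps_def
  using assms
  by (auto intro!: continuous_map_Euclidean_space_add continuous_map_Euclidean_space_diff
      simp: continuous_map_id[unfolded id_def])

text \<open>A basic open of the product topology restricts finitely many coordinates, so the least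
  of their radii is positive.\<close>

lemma Euclidean_nbhd_obox:
  assumes A: "openin (Euclidean_space d) A" "(\<lambda>_. 0) \<in> A"
  shows "\<exists>e>0. obox d e \<subseteq> A"
proof -
  obtain T where T: "openin (powertop_real UNIV) T" "A = T \<inter> {x. \<forall>i\<ge>d. x i = 0}"
    using A(1) unfolding Euclidean_space_def openin_subtopology by auto
  then obtain U where U: "finite {i. U i \<noteq> (UNIV :: real set)}" "\<And>i. open (U i)"
      "(\<lambda>_. 0) \<in> Pi\<^sub>E UNIV U" "Pi\<^sub>E UNIV U \<subseteq> T"
    using A(2) unfolding openin_product_topology_alt by (auto dest!: bspec[of _ _ "\<lambda>_. 0"])
  have "\<exists>e>0. ball 0 e \<subseteq> U i" for i
    using U(2,3) open_contains_ball[of "U i"] by (auto simp: PiE_iff)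
  then obtain e where e: "\<And>i. e i > 0" "\<And>i. ball 0 (e i) \<subseteq> U i" by metis
  \<comment> \<open>The inserted 1 keeps the set nonempty when no coordinate is restricted.\<close>
  define m where "m = Min (insert 1 (e ` {i. U i \<noteq> UNIV}))"
  have m: "m > 0" "\<And>i. U i \<noteq> UNIV \<Longrightarrow> m \<le> e i"
    using U(1) e(1) by (auto simp: m_def)
  have "obox d m \<subseteq> A"
  proof
    fix v assume v: "v \<in> obox d m"
    have "v i \<in> U i" for i
    proof (cases "U i = UNIV")
      case False
      then have "\<bar>v i\<bar> < e i" using v m(2)[OF False] less_le_trans by (auto simp: obox_def)
      then show ?thesis using e(2)[of i] by (auto simp: subset_iff)
    qed simp
    then show "v \<in> A" using v U(4) T(2) by (auto simp: obox_def topspace_Euclidean_space PiE_iff)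
  qed
  with m show ?thesis by blast
qed

lemma openin_obox:
  assumes "e > 0" shows "openin (Euclidean_space d) (obox d e)"
proof -
  have "openin (Euclidean_space d) {v \<in> topspace (Euclidean_space d). v i \<in> {-e<..<e}}" for i
    by (rule openin_continuous_map_preimage[OF continuous_map_Euclidean_proj]) auto
  then have "openin (Euclidean_space d) (topspace (Euclidean_space d) \<inter> (\<Inter>i\<in>{..<d}. {v \<in> topspace (Euclidean_space d). v i \<in> {-e<..<e}}))"
    by (cases "d = 0") (auto intro!: openin_Int openin_INT)
  moreover have "topspace (Euclidean_space d) \<inter> (\<Inter>i\<in>{..<d}. {v \<in> topspace (Euclidean_space d). v i \<in> {-e<..<e}}) = obox d e"
  proof (intro equalityI subsetI)
    fix v assume v: "v \<in> topspace (Euclidean_space d) \<inter> (\<Inter>i\<in>{..<d}. {v \<in> topspace (Euclidean_space d). v i \<in> {-e<..<e}})"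
    have "\<bar>v i\<bar> < e" for i
      using v assms by (cases "i < d") (auto simp: topspace_Euclidean_space abs_less_iff minus_less_iff)
    then show "v \<in> obox d e" using v by (simp add: obox_def)
  next
    fix v assume v: "v \<in> obox d e"
    then have "v i \<in> {-e<..<e}" for i by (simp add: obox_def abs_less_iff) (metis minus_less_iff)
    then show "v \<in> topspace (Euclidean_space d) \<inter> (\<Inter>i\<in>{..<d}. {v \<in> topspace (Euclidean_space d). v i \<in> {-e<..<e}})"
      using v by (simp add: obox_def)
  qed
  ultimately show ?thesis by simp
qed

lemma image_squeeze_cone_Fil:
  assumes e: "e > 0" and L: "filtered_space L"
  shows "map_option (map_prod id (squeeze e)) ` Fil (cone_filtered L) k =
    insert None (Some ` (topspace (Top L) \<times> {0<..<e})) \<inter> Fil (cone_filtered L) k" (is "?g ` _ = ?C \<inter> _")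
proof (intro equalityI subsetI)
  fix w assume "w \<in> ?g ` Fil (cone_filtered L) k"
  then obtain u where u: "u \<in> Fil (cone_filtered L) k" "w = ?g u" by blast
  show "w \<in> ?C \<inter> Fil (cone_filtered L) k"
  proof (cases u)
    case (Some p)
    then obtain l r where u': "u = Some (l, r)" by (cases p) auto
    then have lr: "l \<in> topspace (Top L)" "r > 0" using u(1) Fil_cone_topspace[OF L, of k] by auto
    then have "Some (l, squeeze e r) \<in> Fil (cone_filtered L) k"
      using u(1) u' Some_in_Fil_cone[OF lr(2) squeeze_pos[OF e lr(2)], of l L k] by simp
    then show ?thesis using lr u u' squeeze_pos[OF e lr(2)] squeeze_less[OF e, of r] by simp
  qed (use u in auto)
next
  fix w assume w: "w \<in> ?C \<inter> Fil (cone_filtered L) k"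
  show "w \<in> ?g ` Fil (cone_filtered L) k"
  proof (cases w)
    case (Some p)
    then obtain l r where u': "w = Some (l, r)" by (cases p) auto
    then have lr: "l \<in> topspace (Top L)" "r > 0" "r < e" using w by auto
    then have "Some (l, stretch e r) \<in> Fil (cone_filtered L) k"
      using w u' Some_in_Fil_cone[OF lr(2) stretch_pos[OF lr(3,2)], of l L k] by simp
    then show ?thesis using lr u' by (intro image_eqI[of _ _ "Some (l, stretch e r)"]) (auto simp: squeeze_stretch)
  qed (auto intro!: image_eqI[of _ _ None])
qed

section \<open>Neighbourhood bases, change of centre and degrees in a basic open\<close>

lemma basic_openE:
  fixes K :: "'a fspace"
  assumes K: "step_filtration n K" and U: "basic_open n K x U"
  obtains d L h where "x \<in> layer K d" "filtered_space (L :: 'a fspace)" "formal_dim L = int n - int d - 1"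
    "filtered_homeo (model d L) (subspace_filtered K U) h" "h (\<lambda>_. 0, None) = x"
    "homeomorphic_map (Top (model d L)) (subtopology (Top K) U) h"
    "\<And>k. h ` Fil (model d L) k = U \<inter> Fil K k"
    "openin (Top K) U" "h ` topspace (Top (model d L)) = U" "inj_on h (topspace (Top (model d L)))"
proof -
  obtain d L h where *: "openin (Top K) U" "x \<in> layer K d" "filtered_space (L :: 'a fspace)"
      "formal_dim L = int n - int d - 1"
      "filtered_homeo (model d L) (subspace_filtered K U) h" "h (\<lambda>_. 0, None) = x"
    using U unfolding basic_open_def model_def[symmetric] by blast
  have KU: "Fil (subspace_filtered K U) k \<subseteq> topspace (Top (subspace_filtered K U))" for k
    using step_filtrationD(4)[OF K] by (auto simp: subspace_filtered_def)
  have h1: "homeomorphic_map (Top (model d L)) (subtopology (Top K) U) h"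
    and hF: "\<And>k. h ` Fil (model d L) k = U \<inter> Fil K k"
    using *(5) filtered_homeo_iff[OF Fil_model_topspace[OF *(3)] KU] by (auto simp: subspace_filtered_def)
  moreover have "h ` topspace (Top (model d L)) = U" "inj_on h (topspace (Top (model d L)))"
    using h1 openin_subset[OF *(1)] by (auto simp: homeomorphic_eq_everything_map Int_absorb1)
  ultimately show thesis using that[OF *(2-6) h1 hF *(1)] by blast
qed

lemma zero_in_Euclidean [simp]: "(\<lambda>_. 0) \<in> topspace (Euclidean_space d)"
  by (simp add: topspace_Euclidean_space)

lemma image_map_prod_Times: "map_prod f g ` (A \<times> B) = f ` A \<times> g ` B"
  by force

text \<open>The chart pulls \<open>S\<close> back to a neighbourhood of the origin, which contains a
  box times a truncated cone. Squeezing carries the whole model onto that product, so the image of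
  the product is basic about the same centre.\<close>

lemma basic_open_base:
  fixes K :: "'a fspace"
  assumes K: "step_filtration n K" and U: "basic_open n K x U" and S: "openin (Top K) S" "x \<in> S"
  shows "\<exists>W. basic_open n K x W \<and> W \<subseteq> S \<and> W \<subseteq> U"
proof -
  obtain d and L :: "'a fspace" and h where h: "x \<in> layer K d" "filtered_space L" "formal_dim L = int n - int d - 1"
    "filtered_homeo (model d L) (subspace_filtered K U) h" "h (\<lambda>_. 0, None) = x"
    "homeomorphic_map (Top (model d L)) (subtopology (Top K) U) h"
    "\<And>k. h ` Fil (model d L) k = U \<inter> Fil K k"
    "openin (Top K) U" "h ` topspace (Top (model d L)) = U" "inj_on h (topspace (Top (model d L)))"
    by (rule basic_openE[OF K U]) (rule that)
  let ?M = "model d L"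
  have hc: "continuous_map (Top ?M) (Top K) h"
    using h(6) by (auto simp: homeomorphic_eq_everything_map continuous_map_in_subtopology)
  define P where "P = {p \<in> topspace (Top ?M). h p \<in> S}"
  have "openin (Top ?M) P"
    using openin_continuous_map_preimage[OF hc S(1)] by (simp only: P_def)
  then have oP: "openin (prod_topology (Euclidean_space d) (cone_topology (Top L))) P"
    by (simp only: Top_model)
  have "(\<lambda>_. 0, None) \<in> P"
    using S(2) h(5) by (simp add: Top_model P_def)
  from openin_prod_topology_alt[THEN iffD1, rule_format, OF oP this]
  obtain A B where AB: "openin (Euclidean_space d) A" "openin (cone_topology (Top L)) B"
      "(\<lambda>_. 0) \<in> A" "None \<in> B" "A \<times> B \<subseteq> {p \<in> topspace (Top ?M). h p \<in> S}"
    unfolding P_def by blast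
  obtain e1 where e1: "e1 > 0" "obox d e1 \<subseteq> A" using Euclidean_nbhd_obox[OF AB(1,3)] by blast
  obtain e2 where e2: "e2 > 0" "Some ` (topspace (Top L) \<times> {0<..<e2}) \<subseteq> B"
    using AB(2,4) by (auto simp: openin_cone_topology cone_open_def)
  \<comment> \<open>The smaller radius is taken for both factors, so that one squeezing parameter
    serves.\<close>
  define e where "e = min e1 e2"
  have e: "e > 0" using e1 e2 by (simp add: e_def)
  define C where "C = insert None (Some ` (topspace (Top L) \<times> {0<..<e}))"
  define V where "V = obox d e \<times> C"
  have VAB: "V \<subseteq> A \<times> B"
    using e1 e2 AB(4) by (auto simp: V_def C_def obox_def e_def)
  define g where "g = map_prod (\<lambda>(v :: nat \<Rightarrow> real) i. squeeze e (v i)) (map_option (map_prod id (squeeze e)) :: ('a \<times> real) option \<Rightarrow> _)"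
  have oV: "openin (Top ?M) V"
    using openin_obox[OF e, of d] openin_cone_ball[OF e, of "Top L"]
    unfolding V_def C_def Top_model openin_prod_Times_iff by blast
  have gm: "homeomorphic_map (Top ?M) (subtopology (Top ?M) V) g"
    unfolding Top_model V_def C_def g_def subtopology_Times
    by (rule homeomorphic_maps_imp_map[OF homeomorphic_maps_prod'[OF
          homeomorphic_maps_squeeze_Euclidean[OF e] homeomorphic_maps_squeeze_cone[OF e]]])
  have gF: "g ` Fil ?M k = V \<inter> Fil ?M k" for k
  proof -
    have "(\<lambda>v i. squeeze e (v i)) ` topspace (Euclidean_space d) = topspace (Euclidean_space d) \<inter> obox d e"
      using homeomorphic_imp_surjective_map[OF homeomorphic_maps_imp_map[OF homeomorphic_maps_squeeze_Euclidean[OF e, of d]]]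
      by simp
    then show ?thesis
      using image_squeeze_cone_Fil[OF e h(2), of "k - d"]
      by (simp add: Fil_model[OF h(2)] g_def V_def C_def image_map_prod_Times Times_Int_Times Int_commute)
  qed
  have g0: "g (\<lambda>_. 0, None) = (\<lambda>_. 0, None)" by (simp add: g_def squeeze_def)
  have "basic_open n K x (h ` V)"
    using basic_open_reembed[OF K h(8,2,3,4) oV gm gF g0] h(5) by simp
  moreover have "h ` V \<subseteq> S" using VAB AB(5) by auto
  moreover have "h ` V \<subseteq> U" using VAB AB(5) h(9) by auto
  ultimately show ?thesis by blast
qed

text \<open>In degree \<open>d\<close> the model consists of the points over the apex, so
  \<open>y\<close> is the image of some \<open>(a, None)\<close>, and translating the Euclidean
  factor by \<open>a\<close> moves the centre to \<open>y\<close>.\<close>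

lemma basic_open_move:
  fixes K :: "'a fspace"
  assumes K: "step_filtration n K" and U: "basic_open n K x U" and y: "y \<in> U"
    and xy: "x \<in> layer K d" "y \<in> Fil K d"
  shows "basic_open n K y U" "y \<in> layer K d"
proof -
  obtain d' and L :: "'a fspace" and h where h: "x \<in> layer K d'" "filtered_space L" "formal_dim L = int n - int d' - 1"
    "filtered_homeo (model d' L) (subspace_filtered K U) h" "h (\<lambda>_. 0, None) = x"
    "homeomorphic_map (Top (model d' L)) (subtopology (Top K) U) h"
    "\<And>k. h ` Fil (model d' L) k = U \<inter> Fil K k"
    "openin (Top K) U" "h ` topspace (Top (model d' L)) = U" "inj_on h (topspace (Top (model d' L)))"
    by (rule basic_openE[OF K U]) (rule that)
  \<comment> \<open>\<open>basic_open\<close> hides its dimension; it is \<open>d\<close> because a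
    point lies in only one layer.\<close>
  have d': "d' = d"
  proof (rule ccontr)
    assume "d' \<noteq> d"
    then consider "d' \<le> d - 1" "d \<noteq> 0" | "d \<le> d' - 1" "d' \<noteq> 0" by linarith
    then show False
      by cases (use h(1) xy(1) step_filtrationD(2)[OF K, of d' "d - 1"] step_filtrationD(2)[OF K, of d "d' - 1"]
          in \<open>auto simp: layer_iff\<close>)
  qed
  let ?M = "model d' L"
  have "y \<in> h ` Fil ?M d'" using h(7) xy(2) y d' by blast
  then obtain a where a: "a \<in> topspace (Euclidean_space d')" "y = h (a, None)"
    by (auto simp: Fil_model[OF h(2)])
  define g where "g = map_prod (\<lambda>(v :: nat \<Rightarrow> real) i. v i + a i) (id :: ('a \<times> real) option \<Rightarrow> _)"
  have "homeomorphic_maps (cone_topology (Top L)) (cone_topology (Top L)) id id"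
    by (simp add: homeomorphic_maps_def)
  then have gm: "homeomorphic_map (Top ?M) (Top ?M) g"
    unfolding Top_model g_def
    using homeomorphic_maps_imp_map[OF homeomorphic_maps_prod'[OF homeomorphic_maps_translate_Euclidean[OF a(1)]]]
    by blast
  have gE: "(\<lambda>v i. v i + a i) ` topspace (Euclidean_space d') = topspace (Euclidean_space d')"
    using homeomorphic_imp_surjective_map[OF homeomorphic_maps_imp_map[OF homeomorphic_maps_translate_Euclidean[OF a(1)]]] .
  have "basic_open n K (h (a, None)) (h ` topspace (Top ?M))"
  proof (rule basic_open_reembed[OF K h(8,2,3,4) openin_topspace])
    show "homeomorphic_map (Top ?M) (subtopology (Top ?M) (topspace (Top ?M))) g" using gm by simp
    show "g (\<lambda>_. 0, None) = (a, None)" by (simp add: g_def)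
    show "g ` Fil ?M k = topspace (Top ?M) \<inter> Fil ?M k" for k
      using Fil_cone_topspace[OF h(2)] gE by (simp add: Fil_model[OF h(2)] g_def Top_model image_map_prod_Times Times_Int_Times Int_absorb1)
  qed
  then show *: "basic_open n K y U" using h(9) a by simp
  show "y \<in> layer K d"
  proof -
    have "y \<notin> Fil K (d - 1)" if "d \<noteq> 0"
    proof
      assume "y \<in> Fil K (d - 1)"
      then have "y \<in> h ` Fil ?M (d - 1)" using h(7) y by blast
      moreover have "Fil ?M (d - 1) = {}" using that d' by (simp add: Fil_model[OF h(2)])
      ultimately show False by simp
    qed
    then show ?thesis using xy by (auto simp: layer_iff)
  qed
qed

text \<open>The model is empty below the dimension of its centre, so no point of a basic open lies
  deeper than the centre.\<close>

lemma basic_open_Fil: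
  fixes K :: "'a fspace"
  assumes K: "step_filtration n K" and U: "basic_open n K x U" and x: "x \<in> layer K d"
    and y: "y \<in> U" "y \<in> Fil K k"
  shows "d \<le> k"
proof -
  obtain d' and L :: "'a fspace" and h where h: "x \<in> layer K d'" "filtered_space L" "formal_dim L = int n - int d' - 1"
    "filtered_homeo (model d' L) (subspace_filtered K U) h" "h (\<lambda>_. 0, None) = x"
    "homeomorphic_map (Top (model d' L)) (subtopology (Top K) U) h"
    "\<And>k. h ` Fil (model d' L) k = U \<inter> Fil K k"
    "openin (Top K) U" "h ` topspace (Top (model d' L)) = U" "inj_on h (topspace (Top (model d' L)))"
    by (rule basic_openE[OF K U]) (rule that)
  have "y \<in> h ` Fil (model d' L) k" using h(7) y by blast
  then have "d' \<le> k" by (auto simp: Fil_model[OF h(2)] split: if_splits)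
  have "x \<in> Fil K d'" using h(1) by (simp add: layer_iff)
  show ?thesis
  proof (rule ccontr)
    assume "\<not> d \<le> k"
    then have "d' \<le> d - 1" "d \<noteq> 0" using \<open>d' \<le> k\<close> by auto
    then show False using \<open>x \<in> Fil K d'\<close> x step_filtrationD(2)[OF K, of d' "d - 1"] by (auto simp: layer_iff)
  qed
qed

subsection \<open>Radial contraction\<close>

text \<open>At \<open>s = 1\<close> the factor \<open>1 - s\<close> vanishes, but radii off the apex
  are positive; hence the separate case.\<close>

definition cone_contract :: "real \<Rightarrow> ('a \<times> real) option \<Rightarrow> ('a \<times> real) option" where
  "cone_contract s w = (if s = 1 then None else map_option (map_prod id (\<lambda>r. (1 - s) * r)) w)"

lemma cone_contract_simps [simp]:
  "cone_contract s None = None" "cone_contract 1 w = None"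
  "cone_contract 0 w = w"
  by (cases w; auto simp: cone_contract_def)+

text \<open>Truncated cones form a neighbourhood base at the apex, so where the contraction arrives
  at the apex its joint continuity is an estimate of the radius that is uniform over the link. This
  concerns the apex itself and the time 1; elsewhere continuity is that of the product of two
  positive numbers.\<close>

lemma continuous_map_cone_contract:
  "continuous_map (prod_topology unit_interval (cone_topology X)) (cone_topology X)
     (\<lambda>p. cone_contract (fst p) (snd p))"
  unfolding continuous_map
proof (intro conjI allI impI)
  show "(\<lambda>p. cone_contract (fst p) (snd p)) ` topspace (prod_topology unit_interval (cone_topology X))
      \<subseteq> topspace (cone_topology X)"
    by (auto simp: cone_contract_def)
  fix V assume V: "openin (cone_topology X) V"
  let ?P = "prod_topology unit_interval (cone_topology X)"
  let ?W = "{p \<in> topspace ?P. cone_contract (fst p) (snd p) \<in> V}"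
  have ball: "\<exists>\<epsilon>>0. Some ` (topspace X \<times> {0<..<\<epsilon>}) \<subseteq> V" if "None \<in> V"
    using V that by (auto simp: openin_cone_topology cone_open_def)
  have opI: "openin unit_interval ({0..1} \<inter> T)" if "open T" for T
    using that by (simp add: openin_open_Int)
  have opC: "openin (cone_topology X) (Some ` (A \<times> B))" if "openin X A" "open B" "B \<subseteq> {0<..}" for A and B :: "real set"
  proof -
    have "Some -` (Some ` (A \<times> B)) = A \<times> B" by auto
    moreover have "A \<subseteq> topspace X" using that openin_subset by blast
    moreover have "openin (top_of_set {0<..}) B" using that by (simp add: openin_open_eq)
    ultimately show ?thesis using that
      by (auto simp: openin_cone_topology cone_open_def openin_prod_Times_iff)
  qed
  have "\<exists>A B. openin unit_interval A \<and> openin (cone_topology X) B \<and> s \<in> A \<and> w \<in> B \<and> A \<times> B \<subseteq> ?W"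
    if sw: "(s, w) \<in> ?W" for s w
  proof -
    have s: "s \<in> {0..1}" and w: "w \<in> topspace (cone_topology X)" and wV: "cone_contract s w \<in> V" using sw by auto
    show ?thesis
    proof (cases w)
      case None
      then obtain e where e: "e > 0" "Some ` (topspace X \<times> {0<..<e}) \<subseteq> V" "None \<in> V"
        using wV ball by auto
      \<comment> \<open>Contracting never raises the radius, so at the apex the truncated cone of
        radius \<open>e\<close> works for all times at once.\<close>
      have "{0..1} \<times> insert None (Some ` (topspace X \<times> {0<..<e})) \<subseteq> ?W"
      proof (rule subrelI)
        fix s' :: real and w' assume "(s', w') \<in> {0..1} \<times> insert None (Some ` (topspace X \<times> {0<..<e}))"
        then have s': "s' \<in> {0..1}" and w': "w' \<in> insert None (Some ` (topspace X \<times> {0<..<e}))"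
          by (blast, blast)
        have "cone_contract s' w' \<in> V"
        proof (cases "s' = 1 \<or> w' = None")
          case True
          then show ?thesis using e(3) by (elim disjE) simp_all
        next
          case False
          then obtain l r where lr: "w' = Some (l, r)" "l \<in> topspace X" "0 < r" "r < e" using w' by auto
          have "(1 - s') * r \<le> r" using s' lr by (simp add: mult_left_le_one_le)
          then have "(1 - s') * r < e" using lr(4) by linarith
          moreover have "0 < (1 - s') * r" using s' lr(3) False by simp
          ultimately
          have "Some (l, (1 - s') * r) \<in> V" using lr(2) by (intro subsetD[OF e(2)]) simp
          then show ?thesis using lr(1) False by (simp add: cone_contract_def)
        qed
        then show "(s', w') \<in> ?W" using s' w' by auto
      qed
      then show ?thesis
        using None s openin_cone_ball[OF e(1), of X] by (intro exI[of _ "{0..1}"] exI conjI) auto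
    next
      case (Some p)
      then obtain l r where lr: "w = Some (l, r)" "l \<in> topspace X" "0 < r" using w by auto
      show ?thesis
      proof (cases "s = 1")
        case True
        then obtain e where e: "e > 0" "Some ` (topspace X \<times> {0<..<e}) \<subseteq> V" "None \<in> V"
          using wV ball by auto
        \<comment> \<open>Times with \<open>1 - s' < e / (2 * r)\<close> and radii below
          \<open>2 * r\<close> have a product below \<open>e\<close>.\<close>
        define A where "A = {0..1} \<inter> {1 - e / (2 * r)<..}"
        have "A \<times> Some ` (topspace X \<times> {0<..<2 * r}) \<subseteq> ?W"
        proof (rule subrelI)
          fix s' w' assume "(s', w') \<in> A \<times> Some ` (topspace X \<times> {0<..<2 * r})"
          then obtain l' r' where s': "s' \<in> A" and l': "l' \<in> topspace X" "r' \<in> {0<..<2 * r}"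
            and w': "w' = Some (l', r')" by blast
          have "cone_contract s' (Some (l', r')) \<in> V"
          proof (cases "s' = 1")
            case True
            then show ?thesis using e(3) by simp
          next
            case False
            then have s'': "0 < 1 - s'" "1 - s' < e / (2 * r)" using s' by (auto simp: A_def)
            have "(1 - s') * r' < (1 - s') * (2 * r)" using s'' l' by simp
            also have "\<dots> < e" using s'' lr by (simp add: field_simps)
            finally have "Some (l', (1 - s') * r') \<in> V" using s'' l' by (intro subsetD[OF e(2)]) simp
            then show ?thesis using False by (simp add: cone_contract_def)
          qed
          then show "(s', w') \<in> ?W" using s' l' w' by (auto simp: A_def)
        qed
        moreover have "openin unit_interval A" unfolding A_def by (rule opI) auto
        moreover have "s \<in> A" using True e lr by (simp add: A_def)
        moreover have "openin (cone_topology X) (Some ` (topspace X \<times> {0<..<2 * r}))" by (rule opC) auto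
        moreover have "w \<in> Some ` (topspace X \<times> {0<..<2 * r})" using lr by auto
        ultimately show ?thesis by blast
      next
        case False
        \<comment> \<open>Here the contracted radius is still positive, so a product neighbourhood
          inside \<open>V\<close> can be pulled back along the multiplication of radii.\<close>
        then have s1: "s < 1" using s by auto
        have "openin (prod_topology X (top_of_set {0<..})) (Some -` V)"
          using V by (simp add: openin_cone_topology cone_open_def)
        moreover have "(l, (1 - s) * r) \<in> Some -` V" using wV lr False by (simp add: cone_contract_def)
        ultimately obtain A1 B1 where AB: "openin X A1" "openin (top_of_set {0<..}) B1" "l \<in> A1"
            "(1 - s) * r \<in> B1" "A1 \<times> B1 \<subseteq> Some -` V"
          unfolding openin_prod_topology_alt by meson
        have oB: "open B1" using AB(2) by (simp add: openin_open_eq)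
        have "open ((\<lambda>q. (1 - fst q) * snd q) -` B1 :: (real \<times> real) set)"
          by (intro open_vimage oB continuous_intros)
        moreover have "(s, r) \<in> (\<lambda>q. (1 - fst q) * snd q) -` B1" using AB by simp
        ultimately obtain A2 B2 where AB2: "open A2" "open B2" "(s, r) \<in> A2 \<times> B2"
            "A2 \<times> B2 \<subseteq> (\<lambda>q. (1 - fst q) * snd q) -` B1"
          by (rule open_prod_elim)
        define A where "A = {0..1} \<inter> (A2 \<inter> {..<1})"
        define B where "B = Some ` (A1 \<times> (B2 \<inter> {0<..}))"
        have A1: "A1 \<subseteq> topspace X" using AB(1) openin_subset by blast
        have "A \<times> B \<subseteq> ?W"
        proof (rule subrelI)
          fix s' w' assume "(s', w') \<in> A \<times> B"
          then have s': "s' \<in> A" and w': "w' \<in> B" by (blast, blast)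
          obtain l' r' where lr': "w' = Some (l', r')" "l' \<in> A1" "r' \<in> B2" "r' > 0" using w' by (auto simp: B_def)
          have "(1 - s') * r' \<in> B1" using AB2(4) s' lr' by (auto simp: A_def)
          then have "cone_contract s' w' \<in> V" using AB(5) lr' s' by (auto simp: A_def cone_contract_def)
          then show "(s', w') \<in> ?W" using s' lr' A1 by (auto simp: A_def)
        qed
        moreover have "openin unit_interval A" unfolding A_def by (rule opI) (use AB2 in auto)
        moreover have "openin (cone_topology X) B" unfolding B_def by (rule opC) (use AB AB2 in auto)
        moreover have "s \<in> A" "w \<in> B" using s s1 AB2 lr AB by (auto simp: A_def B_def)
        ultimately show ?thesis by blast
      qed
    qed
  qed
  then show "openin ?P ?W" unfolding openin_prod_topology_alt by blast
qed

text \<open>The chart carries over the contraction of the model that multiplies vector and radius by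
  \<open>1 - s\<close>. Before time 1 it changes no degree, because it neither leaves the Euclidean
  space nor alters the link coordinate; the points fall to the centre only at time 1. The model need
  not be compact, since the cone topology is uniform over the link.\<close>

lemma basic_open_contraction:
  fixes K :: "'a fspace"
  assumes K: "step_filtration n K" and U: "basic_open n K x U"
  obtains c where "continuous_map (prod_topology unit_interval (subtopology (Top K) U)) (subtopology (Top K) U) c"
    "\<And>y. y \<in> U \<Longrightarrow> c (0, y) = y" "\<And>y. y \<in> U \<Longrightarrow> c (1, y) = x"
    "\<And>s. s \<in> {0..1} \<Longrightarrow> c (s, x) = x"
    "\<And>s y k. y \<in> U \<Longrightarrow> 0 \<le> s \<Longrightarrow> s < 1 \<Longrightarrow> c (s, y) \<in> Fil K k \<longleftrightarrow> y \<in> Fil K k"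
proof -
  obtain d and L :: "'a fspace" and h where h: "x \<in> layer K d" "filtered_space L" "formal_dim L = int n - int d - 1"
    "filtered_homeo (model d L) (subspace_filtered K U) h" "h (\<lambda>_. 0, None) = x"
    "homeomorphic_map (Top (model d L)) (subtopology (Top K) U) h"
    "\<And>k. h ` Fil (model d L) k = U \<inter> Fil K k"
    "openin (Top K) U" "h ` topspace (Top (model d L)) = U" "inj_on h (topspace (Top (model d L)))"
    by (rule basic_openE[OF K U]) (rule that)
  let ?M = "model d L"
  obtain h' where h': "homeomorphic_maps (Top ?M) (subtopology (Top K) U) h h'"
    using h(6) homeomorphic_map_maps by blast
  have tU: "topspace (subtopology (Top K) U) = U" using openin_subset[OF h(8)] by auto
  have h'c: "continuous_map (subtopology (Top K) U) (Top ?M) h'"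
    and hc: "continuous_map (Top ?M) (subtopology (Top K) U) h"
    and h'h: "\<And>p. p \<in> topspace (Top ?M) \<Longrightarrow> h' (h p) = p"
    and hh': "\<And>y. y \<in> U \<Longrightarrow> h (h' y) = y"
    using h' tU unfolding homeomorphic_maps_def by auto
  have h'U: "h' y \<in> topspace (Top ?M)" if "y \<in> U" for y
    using h'c that tU by (auto simp: continuous_map_def)
  define m where "m = (\<lambda>(s :: real, p). ((\<lambda>i :: nat. (1 - s) * fst p i), cone_contract s (snd p :: ('a \<times> real) option)))"
  have mc: "continuous_map (prod_topology unit_interval (Top ?M)) (Top ?M) m"
  proof -
    let ?P = "prod_topology unit_interval (Top ?M)"
    have f: "continuous_map ?P unit_interval fst"
      and s1: "continuous_map ?P (Euclidean_space d) (\<lambda>p. fst (snd p))"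
      and s2: "continuous_map ?P (cone_topology (Top L)) (\<lambda>p. snd (snd p))"
      unfolding Top_model
      by (auto intro: continuous_map_fst continuous_map_compose[OF continuous_map_snd continuous_map_fst, unfolded o_def]
          continuous_map_compose[OF continuous_map_snd continuous_map_snd, unfolded o_def])
    have "continuous_map ?P (Euclidean_space d) (\<lambda>p i. (1 - fst p) * fst (snd p) i)"
    proof (rule continuous_map_Euclidean_compose)
      fix i
      have "continuous_map ?P euclideanreal (\<lambda>p. fst (snd p) i)"
        using continuous_map_compose[OF s1 continuous_map_Euclidean_proj, unfolded o_def] .
      moreover have "continuous_map ?P euclideanreal fst"
        using f continuous_map_into_fulltopology by blast
      ultimately show "continuous_map ?P euclideanreal (\<lambda>p. (1 - fst p) * fst (snd p) i)"
        by (intro continuous_map_real_mult continuous_map_diff) auto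
    qed (auto simp: Top_model topspace_Euclidean_space)
    moreover have "continuous_map ?P (cone_topology (Top L)) (\<lambda>p. cone_contract (fst p) (snd (snd p)))"
      using continuous_map_compose[OF continuous_map_pairedI[OF f s2] continuous_map_cone_contract]
      by (simp add: o_def)
    ultimately show ?thesis
      unfolding m_def case_prod_unfold by (subst (2) Top_model) (rule continuous_map_pairedI)
  qed
  have mM: "m (s, p) \<in> topspace (Top ?M)" if "s \<in> {0..1}" "p \<in> topspace (Top ?M)" for s p
    using mc that by (auto simp: continuous_map_def Pi_iff)
  have mF: "m (s, p) \<in> Fil ?M k \<longleftrightarrow> p \<in> Fil ?M k" if s: "0 \<le> s" "s < 1" and p: "p \<in> topspace (Top ?M)" for s p k
  proof -
    obtain v w where vw: "p = (v, w)" by (cases p)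
    have "cone_contract s w \<in> Fil (cone_filtered L) j \<longleftrightarrow> w \<in> Fil (cone_filtered L) j" for j
    proof (cases w)
      case (Some q)
      then obtain l r where "w = Some (l, r)" "r > 0" using p vw by (auto simp: Top_model)
      then show ?thesis using s Some_in_Fil_cone[of "(1 - s) * r" r l L j] by (simp add: cone_contract_def)
    qed simp
    moreover have "v \<in> topspace (Euclidean_space d)" using p vw by (simp add: Top_model)
    ultimately show ?thesis
      by (auto simp: vw m_def Fil_model[OF h(2)] topspace_Euclidean_space)
  qed
  define c where "c = (\<lambda>q. h (m (fst q, h' (snd q))))"
  have "continuous_map (prod_topology unit_interval (subtopology (Top K) U)) (prod_topology unit_interval (Top ?M))
      (\<lambda>q. (fst q, h' (snd q)))"
    by (intro continuous_map_pairedI continuous_map_fst continuous_map_compose[OF continuous_map_snd h'c, unfolded o_def])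
  then have "continuous_map (prod_topology unit_interval (subtopology (Top K) U)) (subtopology (Top K) U) c"
    unfolding c_def
    using continuous_map_compose[OF continuous_map_compose[OF _ mc] hc] by (simp add: o_def)
  moreover have "c (0, y) = y" if "y \<in> U" for y
    using hh'[OF that] by (simp add: c_def m_def case_prod_unfold)
  moreover have "c (1, y) = x" if "y \<in> U" for y
    using h(5) by (simp add: c_def m_def case_prod_unfold)
  moreover have "c (s, x) = x" if "s \<in> {0..1}" for s
  proof -
    have "h' x = ((\<lambda>_. 0), None)" using h'h[of "((\<lambda>_. 0), None)"] h(5) by (simp add: Top_model)
    then show ?thesis using h(5) by (simp add: c_def m_def)
  qed
  moreover have "c (s, y) \<in> Fil K k \<longleftrightarrow> y \<in> Fil K k" if "y \<in> U" "0 \<le> s" "s < 1" for s y k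
  proof -
    \<comment> \<open>Injectivity of the chart allows degrees in the space to be read off in the
      model.\<close>
    have F: "h p \<in> Fil K k \<longleftrightarrow> p \<in> Fil ?M k" if p: "p \<in> topspace (Top ?M)" for p
    proof
      assume "h p \<in> Fil K k"
      moreover have "h p \<in> U" using p h(9) by blast
      ultimately have "h p \<in> h ` Fil ?M k" using h(7) by blast
      then obtain p' where p': "p' \<in> Fil ?M k" "h p = h p'" by blast
      then have "p = p'" using h(10) p Fil_model_topspace[OF h(2)] by (meson inj_onD subsetD)
      then show "p \<in> Fil ?M k" using p' by simp
    qed (use h(7) in blast)
    have "c (s, y) \<in> Fil K k \<longleftrightarrow> h' y \<in> Fil ?M k"
      using F[OF mM] mF[OF that(2,3) h'U[OF that(1)]] h'U[OF that(1)] that by (simp add: c_def)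
    also have "\<dots> \<longleftrightarrow> y \<in> Fil K k" using F[OF h'U[OF that(1)]] hh'[OF that(1)] by simp
    finally show ?thesis .
  qed
  ultimately show thesis using that by blast
qed

section \<open>Increasing reparametrizations\<close>

text \<open>On underlying functions these are the reparametrizations;
  \<open>incr_reparametrization\<close> and \<open>reparametrization_sim\<close> give the two
  directions.\<close>

definition incr :: "(real \<Rightarrow> real) \<Rightarrow> bool" where
  "incr \<phi> \<longleftrightarrow> continuous_on {0..1} \<phi> \<and> strict_mono_on {0..1} \<phi> \<and> \<phi> 0 = 0 \<and> \<phi> 1 = 1"

lemma incr_less_iff: "incr \<phi> \<Longrightarrow> s \<in> {0..1} \<Longrightarrow> t \<in> {0..1} \<Longrightarrow> \<phi> s < \<phi> t \<longleftrightarrow> s < t"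
  unfolding incr_def using strict_mono_on_less by blast

lemma incr_le_iff: "incr \<phi> \<Longrightarrow> s \<in> {0..1} \<Longrightarrow> t \<in> {0..1} \<Longrightarrow> \<phi> s \<le> \<phi> t \<longleftrightarrow> s \<le> t"
  using incr_less_iff[of \<phi> t s] by (meson not_le)

lemma incr_eq_iff: "incr \<phi> \<Longrightarrow> s \<in> {0..1} \<Longrightarrow> t \<in> {0..1} \<Longrightarrow> \<phi> s = \<phi> t \<longleftrightarrow> s = t"
  using incr_le_iff[of \<phi> s t] incr_le_iff[of \<phi> t s] by (metis antisym order_refl)

lemma incr_01: "incr \<phi> \<Longrightarrow> \<phi> 0 = 0" "incr \<phi> \<Longrightarrow> \<phi> 1 = 1"
  by (simp_all add: incr_def)

lemma incr_in: "incr \<phi> \<Longrightarrow> t \<in> {0..1} \<Longrightarrow> \<phi> t \<in> {0..1}"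
  using incr_le_iff[of \<phi> 0 t] incr_le_iff[of \<phi> t 1] incr_01[of \<phi>] by simp

lemma incr_surj:
  assumes "incr \<phi>" "y \<in> {0..1}"
  obtains x where "x \<in> {0..1}" "\<phi> x = y"
  using IVT'[of \<phi> 0 y 1] assms by (auto simp: incr_def)

lemma incr_id: "incr (\<lambda>t. t)"
  by (auto simp: incr_def strict_mono_on_def)

lemma incr_comp:
  assumes "incr \<phi>" "incr \<xi>"
  shows "incr (\<lambda>t. \<phi> (\<xi> t))"
proof -
  have "continuous_on {0..1} (\<lambda>t. \<phi> (\<xi> t))"
    using assms incr_in[OF assms(2)] by (intro continuous_on_compose2[of "{0..1}" \<phi> "{0..1}" \<xi>]) (auto simp: incr_def)
  moreover have "strict_mono_on {0..1} (\<lambda>t. \<phi> (\<xi> t))"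
    using incr_less_iff[OF assms(1) incr_in[OF assms(2)] incr_in[OF assms(2)]] incr_less_iff[OF assms(2)]
    by (auto simp: strict_mono_on_def)
  ultimately show ?thesis using assms by (simp add: incr_def)
qed

lemma incr_inv:
  assumes "incr \<phi>"
  obtains \<psi> where "incr \<psi>" "\<And>t. t \<in> {0..1} \<Longrightarrow> \<phi> (\<psi> t) = t" "\<And>t. t \<in> {0..1} \<Longrightarrow> \<psi> (\<phi> t) = t"
proof -
  define \<psi> where "\<psi> = the_inv_into {0..1} \<phi>"
  have inj: "inj_on \<phi> {0..1}" by (rule inj_onI) (simp only: incr_eq_iff[OF assms])
  have im: "\<phi> ` {0..1} = {0..1}" using incr_in[OF assms] incr_surj[OF assms] by blast
  have 1: "\<phi> (\<psi> t) = t" if "t \<in> {0..1}" for t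
    unfolding \<psi>_def using f_the_inv_into_f[OF inj] that im by blast
  have 2: "\<psi> (\<phi> t) = t" if "t \<in> {0..1}" for t
    unfolding \<psi>_def using the_inv_into_f_f[OF inj that] .
  have 3: "\<psi> t \<in> {0..1}" if "t \<in> {0..1}" for t
    unfolding \<psi>_def using the_inv_into_into[OF inj] that im by blast
  \<comment> \<open>The interval is compact, so the inverse of a continuous bijection is
    continuous.\<close>
  have c: "continuous_on {0..1} \<psi>"
    using continuous_on_inv[of "{0..1}" \<phi> \<psi>] assms 2 im by (auto simp: incr_def)
  have m: "\<psi> s < \<psi> t" if "s \<in> {0..1}" "t \<in> {0..1}" "s < t" for s t
    using incr_less_iff[OF assms 3[OF that(1)] 3[OF that(2)]] 1 that by simp
  have "\<psi> 0 = 0" "\<psi> 1 = 1" using 2[of 0] 2[of 1] incr_01[OF assms] by auto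
  then have "incr \<psi>" using c m by (auto simp: incr_def strict_mono_on_def)
  then show thesis using that 1 2 by blast
qed

text \<open>The first half runs through the times up to \<open>m\<close>, the second through the
  times after \<open>m\<close>; pulling a path back along it cuts the path at
  \<open>m\<close>.\<close>

definition glue :: "real \<Rightarrow> (real \<Rightarrow> real) \<Rightarrow> (real \<Rightarrow> real) \<Rightarrow> real \<Rightarrow> real" where
  "glue m \<phi> \<xi> t = (if t \<le> 1/2 then m * \<phi> (2 * t) else m + (1 - m) * \<xi> (2 * t - 1))"

lemma half_eq: "t * 2 = 1 \<Longrightarrow> t = (1 / 2 :: real)" "2 * t = 1 \<Longrightarrow> t = (1 / 2 :: real)"
  by simp_all

lemma incr_glue:
  assumes m: "0 < m" "m < 1" and \<phi>: "incr \<phi>" and \<xi>: "incr \<xi>"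
  shows "incr (glue m \<phi> \<xi>)"
proof -
  have c1: "continuous_on {t \<in> {0..1}. t \<le> 1/2} (\<lambda>t. m * \<phi> (2 * t))"
    by (rule continuous_on_mult_left, rule continuous_on_compose2[of "{0..1}" \<phi>])
      (use \<phi> in \<open>auto simp: incr_def intro!: continuous_intros\<close>)
  have c2: "continuous_on {t \<in> {0..1}. 1/2 \<le> t} (\<lambda>t. m + (1 - m) * \<xi> (2 * t - 1))"
    by (rule continuous_on_add[OF continuous_on_const], rule continuous_on_mult_left,
        rule continuous_on_compose2[of "{0..1}" \<xi>])
      (use \<xi> in \<open>auto simp: incr_def intro!: continuous_intros\<close>)
  have "continuous_on {0..1} (glue m \<phi> \<xi>)"
    unfolding glue_def
    by (rule continuous_on_cases_le[OF c1 c2]) (auto simp: incr_01[OF \<phi>] incr_01[OF \<xi>] intro!: continuous_intros dest!: half_eq)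
  moreover have "glue m \<phi> \<xi> s < glue m \<phi> \<xi> t" if st: "0 \<le> s" "s < t" "t \<le> 1" for s t
  proof -
    consider "t \<le> 1/2" | "s > 1/2" | "s \<le> 1/2" "t > 1/2" using st by linarith
    then show ?thesis
    proof cases
      case 1
      then show ?thesis using st m incr_less_iff[OF \<phi>, of "2 * s" "2 * t"] by (simp add: glue_def)
    next
      case 2
      then show ?thesis using st m incr_less_iff[OF \<xi>, of "2 * s - 1" "2 * t - 1"] by (simp add: glue_def)
    next
      case 3
      have "\<phi> (2 * s) \<le> 1" using incr_in[OF \<phi>, of "2 * s"] 3 st by simp
      then have "m * \<phi> (2 * s) \<le> m" using m by simp
      moreover have "0 < \<xi> (2 * t - 1)"
        using incr_less_iff[OF \<xi>, of 0 "2 * t - 1"] incr_01[OF \<xi>] 3 st by simp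
      then have "0 < (1 - m) * \<xi> (2 * t - 1)" using m by simp
      ultimately have "m * \<phi> (2 * s) < m + (1 - m) * \<xi> (2 * t - 1)" by linarith
      then show ?thesis using 3 by (simp add: glue_def)
    qed
  qed
  moreover have "glue m \<phi> \<xi> 0 = 0" "glue m \<phi> \<xi> 1 = 1"
    using incr_01[OF \<phi>] incr_01[OF \<xi>] by (simp_all add: glue_def)
  ultimately show ?thesis unfolding incr_def strict_mono_on_def by auto
qed

text \<open>Paths are treated as bare functions from here on, made extensional so that agreement on
  the interval is equality. The stratification is put back only where \<open>entrance_path\<close>
  asks for it.\<close>

definition pull :: "(real \<Rightarrow> 'a) \<Rightarrow> (real \<Rightarrow> real) \<Rightarrow> real \<Rightarrow> 'a" where
  "pull \<alpha> \<phi> = (\<lambda>t \<in> {0..1}. \<alpha> (\<phi> t))"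

definition sub :: "(real \<Rightarrow> 'a) \<Rightarrow> real \<Rightarrow> real \<Rightarrow> real \<Rightarrow> 'a" where
  "sub \<alpha> a b = pull \<alpha> (\<lambda>t. a + (b - a) * t)"

definition joinp :: "(real \<Rightarrow> 'a) \<Rightarrow> (real \<Rightarrow> 'a) \<Rightarrow> real \<Rightarrow> 'a" where
  "joinp \<beta> \<alpha> = (\<lambda>t \<in> {0..1}. if t \<le> 1/2 then \<alpha> (2 * t) else \<beta> (2 * t - 1))"

definition cst :: "'a \<Rightarrow> real \<Rightarrow> 'a" where
  "cst x = (\<lambda>t \<in> {0..1}. x)"

lemma pull_apply: "t \<in> {0..1} \<Longrightarrow> pull \<alpha> \<phi> t = \<alpha> (\<phi> t)"
  and sub_apply: "t \<in> {0..1} \<Longrightarrow> sub \<alpha> a b t = \<alpha> (a + (b - a) * t)"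
  and cst_apply: "t \<in> {0..1} \<Longrightarrow> cst x t = x"
  and joinp_apply: "t \<in> {0..1} \<Longrightarrow> joinp \<beta> \<alpha> t = (if t \<le> 1/2 then \<alpha> (2 * t) else \<beta> (2 * t - 1))"
  by (simp_all add: pull_def sub_def cst_def joinp_def)

lemma path_ext [simp]:
  "pull \<alpha> \<phi> \<in> extensional {0..1}" "sub \<alpha> a b \<in> extensional {0..1}" "cst x \<in> extensional {0..1}"
  "joinp \<beta> \<alpha> \<in> extensional {0..1}"
  by (simp_all add: pull_def sub_def cst_def joinp_def)

lemma path_eqI:
  assumes "\<alpha> \<in> extensional {0..1 :: real}" "\<beta> \<in> extensional {0..1}"
    and "\<And>t. t \<in> {0..1} \<Longrightarrow> \<alpha> t = \<beta> t"
  shows "\<alpha> = \<beta>"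
  using extensionalityI[OF assms] .

lemma path_ends [simp]:
  "sub \<alpha> a b 0 = \<alpha> a" "sub \<alpha> a b 1 = \<alpha> b" "cst x 0 = x" "cst x 1 = x"
  "joinp \<beta> \<alpha> 0 = \<alpha> 0" "joinp \<beta> \<alpha> 1 = \<beta> 1"
  by (simp_all add: sub_apply cst_apply joinp_apply)

lemma sub_self: "sub \<alpha> a a = cst (\<alpha> a)"
  by (simp add: sub_def pull_def cst_def)

lemma sub_01: "\<alpha> \<in> extensional {0..1} \<Longrightarrow> sub \<alpha> 0 1 = \<alpha>"
  by (rule path_eqI) (auto simp: sub_apply)

lemma affine_in:
  fixes a b t :: real
  assumes "0 \<le> t" "t \<le> 1" "a \<le> b"
  shows "a \<le> a + (b - a) * t" "a + (b - a) * t \<le> b"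
proof -
  have "(b - a) * t \<le> (b - a) * 1" using assms by (intro mult_left_mono) auto
  then show "a + (b - a) * t \<le> b" by simp
qed (use assms in simp)

lemma sub_in:
  assumes "\<And>t. a \<le> t \<Longrightarrow> t \<le> b \<Longrightarrow> \<alpha> t \<in> U" "a \<le> b" "t \<in> {0..1}"
  shows "sub \<alpha> a b t \<in> U"
  using assms affine_in[of t a b] by (simp add: sub_apply)

lemma sub_sub: "0 \<le> c \<Longrightarrow> c \<le> d \<Longrightarrow> d \<le> 1 \<Longrightarrow>
    sub (sub \<alpha> a b) c d = sub \<alpha> (a + (b - a) * c) (a + (b - a) * d)"
proof (rule path_eqI)
  fix t :: real assume *: "0 \<le> c" "c \<le> d" "d \<le> 1" "t \<in> {0..1}"
  then have "c + (d - c) * t \<in> {0..1}" using affine_in[of t c d] by auto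
  then show "sub (sub \<alpha> a b) c d t = sub \<alpha> (a + (b - a) * c) (a + (b - a) * d) t"
    using * by (simp add: sub_apply algebra_simps)
qed auto

definition sim :: "(real \<Rightarrow> 'a) \<Rightarrow> (real \<Rightarrow> 'a) \<Rightarrow> bool" where
  "sim \<alpha> \<beta> \<longleftrightarrow> (\<exists>\<phi>. incr \<phi> \<and> \<beta> = pull \<alpha> \<phi>)"

lemma sim_refl: "\<alpha> \<in> extensional {0..1} \<Longrightarrow> sim \<alpha> \<alpha>"
  unfolding sim_def by (intro exI[of _ "\<lambda>t. t"] conjI incr_id path_eqI) (auto simp: pull_apply)

lemma sim_sym:
  assumes "\<alpha> \<in> extensional {0..1}" "sim \<alpha> \<beta>"
  shows "sim \<beta> \<alpha>"
proof -
  obtain \<phi> where \<phi>: "incr \<phi>" "\<beta> = pull \<alpha> \<phi>" using assms by (auto simp: sim_def)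
  obtain \<psi> where \<psi>: "incr \<psi>" "\<And>t. t \<in> {0..1} \<Longrightarrow> \<phi> (\<psi> t) = t" using incr_inv[OF \<phi>(1)] by metis
  have "\<alpha> = pull \<beta> \<psi>"
    using \<phi> \<psi> assms incr_in[OF \<psi>(1)] by (intro path_eqI) (auto simp: pull_def)
  with \<psi> show ?thesis by (auto simp: sim_def)
qed

lemma sim_trans:
  assumes "sim \<alpha> \<beta>" "sim \<beta> \<gamma>"
  shows "sim \<alpha> \<gamma>"
proof -
  obtain \<phi> \<psi> where *: "incr \<phi>" "\<beta> = pull \<alpha> \<phi>" "incr \<psi>" "\<gamma> = pull \<beta> \<psi>" using assms by (auto simp: sim_def)
  then have "\<gamma> = pull \<alpha> (\<lambda>t. \<phi> (\<psi> t))"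
    using incr_in[OF *(3)] by (intro path_eqI) (auto simp: pull_def)
  then show ?thesis using incr_comp[OF *(1,3)] by (auto simp: sim_def)
qed

lemma sim_ends: "sim \<alpha> \<beta> \<Longrightarrow> \<beta> 0 = \<alpha> 0" "sim \<alpha> \<beta> \<Longrightarrow> \<beta> 1 = \<alpha> 1"
  by (auto simp: sim_def pull_apply incr_01)

lemma sim_joinp:
  assumes "sim \<alpha> \<alpha>'" "sim \<beta> \<beta>'"
  shows "sim (joinp \<beta> \<alpha>) (joinp \<beta>' \<alpha>')"
proof -
  obtain \<phi> \<xi> where *: "incr \<phi>" "\<alpha>' = pull \<alpha> \<phi>" "incr \<xi>" "\<beta>' = pull \<beta> \<xi>" using assms by (auto simp: sim_def)
  have "joinp \<beta>' \<alpha>' = pull (joinp \<beta> \<alpha>) (glue (1/2) \<phi> \<xi>)"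
  proof (rule path_eqI)
    fix t :: real assume t: "t \<in> {0..1}"
    have g: "glue (1/2) \<phi> \<xi> t \<in> {0..1}" using incr_in[OF incr_glue[OF _ _ *(1,3), of "1/2"] t] by simp
    show "joinp \<beta>' \<alpha>' t = pull (joinp \<beta> \<alpha>) (glue (1/2) \<phi> \<xi>) t"
    proof (cases "t \<le> 1/2")
      case True
      then have "\<phi> (2 * t) \<le> 1" using t incr_in[OF *(1), of "2 * t"] by simp
      then show ?thesis using True t g * by (simp add: joinp_apply pull_apply glue_def)
    next
      case False
      then have "0 < \<xi> (2 * t - 1)"
        using incr_less_iff[OF *(3), of 0 "2 * t - 1"] incr_01[OF *(3)] t by simp
      then show ?thesis using False t g * by (simp add: joinp_apply pull_apply glue_def)
    qed
  qed auto
  then show ?thesis using incr_glue[OF _ _ *(1,3), of "1/2"] by (auto simp: sim_def)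
qed

lemma sim_assoc: "sim (joinp \<gamma> (joinp \<beta> \<alpha>)) (joinp (joinp \<gamma> \<beta>) \<alpha>)"
proof -
  \<comment> \<open>Piecewise affine with slopes 1/2, 1 and 2 and breaks at 1/2 and 3/4. As the
    slopes increase, the function is the maximum of its three affine pieces, which makes continuity
    immediate.\<close>
  define \<phi> :: "real \<Rightarrow> real" where "\<phi> = (\<lambda>t. max (t / 2) (max (t - 1/4) (2 * t - 1)))"
  have "incr \<phi>"
    unfolding incr_def
  proof (intro conjI)
    show "continuous_on {0..1} \<phi>" unfolding \<phi>_def by (intro continuous_intros) auto
    show "strict_mono_on {0..1} \<phi>" unfolding \<phi>_def strict_mono_on_def by (auto simp: max_def)
  qed (auto simp: \<phi>_def)
  moreover have "joinp (joinp \<gamma> \<beta>) \<alpha> = pull (joinp \<gamma> (joinp \<beta> \<alpha>)) \<phi>"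
  proof (rule path_eqI)
    fix t :: real assume t: "t \<in> {0..1}"
    then have g: "\<phi> t \<in> {0..1}" using incr_in[OF \<open>incr \<phi>\<close>] by blast
    consider "t \<le> 1/2" | "1/2 < t" "t \<le> 3/4" | "3/4 < t" by linarith
    then show "joinp (joinp \<gamma> \<beta>) \<alpha> t = pull (joinp \<gamma> (joinp \<beta> \<alpha>)) \<phi> t"
    proof cases
      case 1
      then have eq: "\<phi> t = t / 2" by (simp add: \<phi>_def)
      show ?thesis using 1 t g by (simp add: joinp_apply pull_apply eq)
    next
      case 2
      then have eq: "\<phi> t = t - 1/4" by (simp add: \<phi>_def)
      show ?thesis using 2 t g by (simp add: joinp_apply pull_apply eq)
    next
      case 3
      then have eq: "\<phi> t = 2 * t - 1" by (simp add: \<phi>_def)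
      show ?thesis using 3 t g by (simp add: joinp_apply pull_apply eq)
    qed
  qed auto
  ultimately show ?thesis by (auto simp: sim_def)
qed

lemma pull_glue_id: "pull \<alpha> (glue m (\<lambda>t. t) (\<lambda>t. t)) = joinp (sub \<alpha> m 1) (sub \<alpha> 0 m)"
  by (rule path_eqI) (auto simp: pull_apply joinp_apply sub_apply glue_def)

lemma sim_cut:
  assumes "a < b" "b < c"
  shows "sim (sub \<alpha> a c) (joinp (sub \<alpha> b c) (sub \<alpha> a b))"
proof -
  \<comment> \<open>The relative position of \<open>b\<close> between \<open>a\<close> and
    \<open>c\<close>.\<close>
  define m where "m = (b - a) / (c - a)"
  have m: "0 < m" "m < 1" "a + (c - a) * m = b" using assms by (auto simp: m_def field_simps)
  have "sub (sub \<alpha> a c) m 1 = sub \<alpha> b c" "sub (sub \<alpha> a c) 0 m = sub \<alpha> a b"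
    using m by (simp_all add: sub_sub)
  then have "joinp (sub \<alpha> b c) (sub \<alpha> a b) = pull (sub \<alpha> a c) (glue m (\<lambda>t. t) (\<lambda>t. t))"
    using pull_glue_id[of "sub \<alpha> a c" m] by simp
  then show ?thesis using incr_glue[OF m(1,2) incr_id incr_id] by (auto simp: sim_def)
qed

lemma incr_strata:
  assumes \<phi>: "incr \<phi>" and P: "interval_stratification P"
  shows "interval_stratification (\<phi> -` P \<inter> {0..1})"
    "stratum_preserving unit_interval (interval_strata (\<phi> -` P \<inter> {0..1}))
      unit_interval (interval_strata P) \<phi>"
proof -
  have "inj_on \<phi> {0..1}" by (rule inj_onI) (simp only: incr_eq_iff[OF \<phi>])
  then have "finite (\<phi> -` P \<inter> {0..1})"
    using P finite_vimage_IntI[of P \<phi> "{0..1}"] by (simp add: interval_stratification_def)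
  then show "interval_stratification (\<phi> -` P \<inter> {0..1})"
    using P incr_01[OF \<phi>] by (auto simp: interval_stratification_def)
  have "continuous_map unit_interval unit_interval \<phi>"
    using \<phi> incr_in[OF \<phi>] by (auto simp: continuous_map_in_subtopology incr_def)
  moreover have "\<exists>S \<in> interval_strata P. \<phi> ` T \<subseteq> S" if "T \<in> interval_strata (\<phi> -` P \<inter> {0..1})" for T
  proof -
    from that consider p where "T = {p}" "p \<in> \<phi> -` P \<inter> {0..1}"
      | a b where "T = {a<..<b}" "a \<in> \<phi> -` P \<inter> {0..1}" "b \<in> \<phi> -` P \<inter> {0..1}" "a < b" "\<phi> -` P \<inter> {0..1} \<inter> {a<..<b} = {}"
      unfolding interval_strata_def by blast
    then show ?thesis
    proof cases
      case 1
      then show ?thesis by (intro bexI[of _ "{\<phi> p}"]) (auto simp: interval_strata_def)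
    next
      case 2
      have "P \<inter> {\<phi> a<..<\<phi> b} = {}"
      proof (rule ccontr)
        assume "P \<inter> {\<phi> a<..<\<phi> b} \<noteq> {}"
        then obtain q where q: "q \<in> P" "\<phi> a < q" "q < \<phi> b" by auto
        then have "q \<in> {0..1}" using P by (auto simp: interval_stratification_def)
        then obtain c where c: "c \<in> {0..1}" "\<phi> c = q" using incr_surj[OF \<phi>] by blast
        then have "a < c" "c < b" using q 2 incr_less_iff[OF \<phi>] by (auto simp: vimage_def)
        then show False using c q 2(5) by auto
      qed
      moreover have "\<phi> a < \<phi> b" using 2 incr_less_iff[OF \<phi>] by auto
      moreover have "\<phi> ` T \<subseteq> {\<phi> a<..<\<phi> b}"
        using 2 by (auto simp: incr_less_iff[OF \<phi>])
      ultimately show ?thesis using 2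
        by (intro bexI[of _ "{\<phi> a<..<\<phi> b}"]) (auto simp: interval_strata_def)
    qed
  qed
  ultimately show "stratum_preserving unit_interval (interval_strata (\<phi> -` P \<inter> {0..1}))
      unit_interval (interval_strata P) \<phi>"
    by (auto simp: stratum_preserving_def)
qed

lemma incr_reparametrization:
  assumes \<phi>: "incr \<phi>" and P: "interval_stratification P"
  shows "reparametrization (P, \<alpha>) (\<phi> -` P \<inter> {0..1}, pull \<alpha> \<phi>)"
proof -
  obtain \<psi> where \<psi>: "incr \<psi>" "\<And>t. t \<in> {0..1} \<Longrightarrow> \<phi> (\<psi> t) = t" "\<And>t. t \<in> {0..1} \<Longrightarrow> \<psi> (\<phi> t) = t"
    using incr_inv[OF \<phi>] by metis
  let ?P = "\<phi> -` P \<inter> {0..1}"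
  have "\<psi> -` ?P \<inter> {0..1} = P"
    using \<psi>(2) incr_in[OF \<psi>(1)] P by (auto simp: interval_stratification_def)
  then have 2: "stratum_preserving unit_interval (interval_strata P) unit_interval (interval_strata ?P) \<psi>"
    using incr_strata(2)[OF \<psi>(1) incr_strata(1)[OF \<phi> P]] by simp
  note 1 = incr_strata[OF \<phi> P]
  have "homeomorphic_maps unit_interval unit_interval \<phi> \<psi>"
    using 1 2 \<psi> by (auto simp: homeomorphic_maps_def stratum_preserving_def)
  then show ?thesis
    unfolding reparametrization_def using 1 2 incr_01[OF \<phi>] by (auto simp: pull_def)
qed

text \<open>A continuous injection of an interval is strictly monotone, and the fixed end points
  exclude the decreasing case.\<close>

lemma reparametrization_sim:
  assumes "reparametrization p q"
  shows "sim (snd p) (snd q)"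
proof -
  obtain P \<alpha> Q \<beta> where pq: "p = (P, \<alpha>)" "q = (Q, \<beta>)" by (cases p, cases q)
  obtain \<phi> \<psi> where *: "homeomorphic_maps unit_interval unit_interval \<phi> \<psi>" "\<phi> 0 = 0" "\<phi> 1 = 1"
      "\<beta> = (\<lambda>t \<in> {0..1}. \<alpha> (\<phi> t))"
    using assms by (auto simp: reparametrization_def pq)
  have c: "continuous_on {0..1} \<phi>" and inj: "inj_on \<phi> {0..1}"
    using *(1) by (auto simp: homeomorphic_maps_def continuous_map_in_subtopology intro: inj_on_inverseI)
  have "strict_mono_on {0..1} \<phi> \<or> strict_antimono_on {0..1} \<phi>"
    using injective_eq_monotone_map[OF is_interval_cc c] inj by blast
  moreover have "\<not> strict_antimono_on {0..1} \<phi>"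
    using monotone_onD[of "{0..1}" "(<)" "(>)" \<phi> 0 1] * by auto
  ultimately have "incr \<phi>" using c * by (simp add: incr_def)
  then show ?thesis using * by (auto simp: sim_def pull_def pq)
qed

section \<open>Entrance paths\<close>

locale strat =
  fixes n :: nat and K :: "'a fspace"
  assumes cs: "conically_stratified n K"
begin

abbreviation "X \<equiv> Top K"
abbreviation basic :: "'a \<Rightarrow> 'a set \<Rightarrow> bool" where "basic \<equiv> basic_open n K"

text \<open>On points of the space this is the dimension of the stratum through the point. It turns
  conditions on strata into equations between numbers, with connectedness supplying the
  rest.\<close>

definition level :: "'a \<Rightarrow> nat" where "level x = (LEAST k. x \<in> Fil K k)"

section \<open>Strata in terms of levels\<close>

lemma step: "step_filtration n K"
  using cs by (simp add: conically_stratified_def)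

lemma Fil_iff: "x \<in> topspace X \<Longrightarrow> x \<in> Fil K k \<longleftrightarrow> level x \<le> k"
proof
  assume "x \<in> topspace X"
  then have "x \<in> Fil K n" using step_filtrationD(3)[OF step] by simp
  then have "x \<in> Fil K (level x)" unfolding level_def by (rule LeastI)
  then show "level x \<le> k \<Longrightarrow> x \<in> Fil K k" using step_filtrationD(2)[OF step] by blast
qed (auto simp: level_def intro: Least_le)

lemma Fil_sub: "x \<in> Fil K k \<Longrightarrow> x \<in> topspace X"
  using step_filtrationD(4)[OF step] by blast

lemma layer_level: "x \<in> layer K d \<longleftrightarrow> x \<in> topspace X \<and> level x = d"
  using Fil_iff[of x d] Fil_iff[of x "d - 1"] Fil_sub[of x d] by (auto simp: layer_iff)

lemma basic_exists: "x \<in> topspace X \<Longrightarrow> \<exists>U. basic x U"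
  using cs layer_level[of x "level x"] by (auto simp: conically_stratified_def)

lemma basicD:
  assumes "basic x U"
  shows "x \<in> U" "openin X U" "U \<subseteq> topspace X" "x \<in> topspace X"
  using assms openin_subset[of X U] by (auto simp: basic_open_def)

lemma basic_within:
  assumes "openin X S" "x \<in> S"
  obtains W where "basic x W" "W \<subseteq> S"
proof -
  have "x \<in> topspace X" using assms openin_subset by blast
  then obtain U where "basic x U" using basic_exists by blast
  from basic_open_base[OF step this assms] show thesis using that by blast
qed

lemma basic_level: "basic x U \<Longrightarrow> y \<in> U \<Longrightarrow> level x \<le> level y"
  using basic_open_Fil[OF step, of x U "level x" y "level y"] layer_level[of x "level x"] Fil_iff[of y "level y"]
    basicD[of x U] by auto

text \<open>The inequality of levels is what later points of an entrance path satisfy. Levels in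
  \<open>U\<close> are at least that of the centre, so it is in fact an equality, and the centre can
  be moved.\<close>

lemma basic_move:
  assumes "basic x U" "y \<in> U" "level y \<le> level x"
  shows "basic y U" "level y = level x"
proof -
  have "x \<in> layer K (level x)" "y \<in> Fil K (level x)"
    using assms basicD[OF assms(1)] by (auto simp: layer_level Fil_iff)
  from basic_open_move[OF step assms(1,2) this] show "basic y U" "level y = level x"
    by (auto simp: layer_level)
qed

lemma strataD:
  assumes "S \<in> strata K" "x \<in> S"
  shows "x \<in> topspace X" "y \<in> S \<Longrightarrow> level y = level x"
proof -
  obtain d where "S \<in> connected_components_of (subtopology X (layer K d))"
    using assms by (auto simp: strata_def strata_of_dim_def)
  from connected_components_of_subset[OF this] have "S \<subseteq> topspace X \<inter> layer K d" by simp
  then show "x \<in> topspace X" "y \<in> S \<Longrightarrow> level y = level x"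
    using assms(2) layer_level[of _ d] by (blast, metis IntD2 subsetD)
qed

text \<open>Strata are the components of the layers. Proofs that a map preserves strata thereby
  reduce to exhibiting connected sets of constant level.\<close>

lemma connected_in_stratum:
  assumes C: "connectedin X C" "C \<noteq> {}" and d: "\<And>x. x \<in> C \<Longrightarrow> level x = d"
  shows "\<exists>S \<in> strata K. C \<subseteq> S"
proof -
  have CX: "C \<subseteq> topspace X" using C connectedin_subset_topspace by blast
  then have *: "C \<subseteq> layer K d" using d by (auto simp: layer_level)
  then have "connectedin (subtopology X (layer K d)) C" using C by (simp add: connectedin_subtopology)
  moreover have "subtopology X (layer K d) \<noteq> trivial_topology"
    using C(2) * CX by (auto simp: null_topspace_iff_trivial[symmetric])
  ultimately show ?thesis
    using exists_connected_component_of_superset[of "subtopology X (layer K d)" C]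
    by (auto simp: strata_def strata_of_dim_def)
qed

lemma point_in_stratum: "x \<in> topspace X \<Longrightarrow> \<exists>S \<in> strata K. x \<in> S"
  using connected_in_stratum[of "{x}" "level x"] by auto

lemma stratum_dim_at: "x \<in> topspace X \<Longrightarrow> stratum_dim_at K x = level x"
proof -
  assume x: "x \<in> topspace X"
  have "(\<exists>S \<in> strata_of_dim K d. x \<in> S) \<longleftrightarrow> level x = d" for d
    unfolding strata_of_dim_def Bex_def
    using Union_connected_components_of[of "subtopology X (layer K d)"] x by (auto simp: layer_level)
  then show ?thesis unfolding stratum_dim_at_def by simp
qed

text \<open>An entrance path that has forgotten its stratification; \<open>ep_exists_P\<close>
  recovers one.\<close>

definition ep :: "(real \<Rightarrow> 'a) \<Rightarrow> bool" where
  "ep \<alpha> \<longleftrightarrow> \<alpha> \<in> extensional {0..1} \<and> continuous_map unit_interval X \<alpha> \<and>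
     (\<forall>s t. 0 \<le> s \<longrightarrow> s \<le> t \<longrightarrow> t \<le> 1 \<longrightarrow> level (\<alpha> t) \<le> level (\<alpha> s))"

text \<open>The ends are left out because the level may drop at \<open>b\<close>. At
  \<open>a\<close> the level of an entrance path does not jump, by
  \<open>flat_closed_left\<close>.\<close>

definition flat :: "(real \<Rightarrow> 'a) \<Rightarrow> real \<Rightarrow> real \<Rightarrow> bool" where
  "flat \<alpha> a b \<longleftrightarrow> (\<forall>s t. a < s \<longrightarrow> s < b \<longrightarrow> a < t \<longrightarrow> t < b \<longrightarrow> level (\<alpha> s) = level (\<alpha> t))"

text \<open>All intervals that avoid \<open>P\<close> are considered, and not only those between
  neighbours, so that the property visibly survives a refinement of \<open>P\<close>.\<close>

definition gaps :: "real set \<Rightarrow> (real \<Rightarrow> 'a) \<Rightarrow> bool" where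
  "gaps P \<alpha> \<longleftrightarrow> (\<forall>a b. 0 \<le> a \<longrightarrow> a < b \<longrightarrow> b \<le> 1 \<longrightarrow> P \<inter> {a<..<b} = {} \<longrightarrow> flat \<alpha> a b)"

lemma ep_ext: "ep \<alpha> \<Longrightarrow> \<alpha> \<in> extensional {0..1}"
  and ep_continuous: "ep \<alpha> \<Longrightarrow> continuous_map unit_interval X \<alpha>"
  and ep_level: "ep \<alpha> \<Longrightarrow> 0 \<le> s \<Longrightarrow> s \<le> t \<Longrightarrow> t \<le> 1 \<Longrightarrow> level (\<alpha> t) \<le> level (\<alpha> s)"
  by (auto simp: ep_def)

lemma ep_in: "ep \<alpha> \<Longrightarrow> t \<in> {0..1} \<Longrightarrow> \<alpha> t \<in> topspace X"
  by (auto simp: ep_def continuous_map_def Pi_iff)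

lemma gaps_mono: "gaps P \<alpha> \<Longrightarrow> P \<subseteq> Q \<Longrightarrow> gaps Q \<alpha>"
  unfolding gaps_def by blast

text \<open>An open interval has a connected image, so staying in one stratum over it is the same as
  having constant level there. After this lemma entrance paths are handled through levels
  alone.\<close>

lemma entrance_iff:
  "entrance_path K (P, \<alpha>) \<longleftrightarrow> interval_stratification P \<and> ep \<alpha> \<and> gaps P \<alpha>" (is "?L \<longleftrightarrow> ?R")
proof
  assume L: ?L
  then have P: "interval_stratification P" and ext: "\<alpha> \<in> extensional {0..1}"
    and sp: "stratum_preserving unit_interval (interval_strata P) X (strata K) \<alpha>"
    and dim: "\<And>s t. s \<in> {0..1} \<Longrightarrow> t \<in> {0..1} \<Longrightarrow> s \<le> t \<Longrightarrow> stratum_dim_at K (\<alpha> t) \<le> stratum_dim_at K (\<alpha> s)"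
    by (auto simp: entrance_path_def)
  have c: "continuous_map unit_interval X \<alpha>" using sp by (simp add: stratum_preserving_def)
  then have X: "\<alpha> t \<in> topspace X" if "t \<in> {0..1}" for t using that by (auto simp: continuous_map_def Pi_iff)
  have "ep \<alpha>" unfolding ep_def using ext c dim stratum_dim_at X by (auto 0 3)
  moreover have "gaps P \<alpha>"
    unfolding gaps_def
  proof (intro allI impI)
    fix a b :: real assume ab: "0 \<le> a" "a < b" "b \<le> 1" "P \<inter> {a<..<b} = {}"
    \<comment> \<open>The points of \<open>P\<close> nearest to the given interval on either side
      bound a 1-stratum that contains it.\<close>
    define a' where "a' = Max {p \<in> P. p \<le> a}"
    define b' where "b' = Min {p \<in> P. b \<le> p}"
    have fin: "finite {p \<in> P. p \<le> a}" "finite {p \<in> P. b \<le> p}" using P by (auto simp: interval_stratification_def)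
    have ne: "{p \<in> P. p \<le> a} \<noteq> {}" "{p \<in> P. b \<le> p} \<noteq> {}" using P ab by (auto simp: interval_stratification_def)
    have a': "a' \<in> P" "a' \<le> a" using Max_in[OF fin(1) ne(1)] by (auto simp: a'_def)
    have b': "b' \<in> P" "b \<le> b'" using Min_in[OF fin(2) ne(2)] by (auto simp: b'_def)
    have "P \<inter> {a'<..<b'} = {}"
    proof (rule ccontr)
      assume "P \<inter> {a'<..<b'} \<noteq> {}"
      then obtain p where p: "p \<in> P" "a' < p" "p < b'" by auto
      have "\<not> p \<le> a" using p Max_ge[OF fin(1), of p] by (auto simp: a'_def)
      moreover have "\<not> b \<le> p" using p Min_le[OF fin(2), of p] by (auto simp: b'_def)
      ultimately show False using ab(4) p by auto
    qed
    then have "{a'<..<b'} \<in> interval_strata P"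
      using a' b' ab unfolding interval_strata_def
      by (intro UnI2 CollectI exI[of _ a'] exI[of _ b'] conjI refl) auto
    then obtain S where S: "S \<in> strata K" "\<alpha> ` {a'<..<b'} \<subseteq> S" using sp by (auto simp: stratum_preserving_def)
    show "flat \<alpha> a b"
      unfolding flat_def
    proof (intro allI impI)
      fix s t assume "a < s" "s < b" "a < t" "t < b"
      then have "\<alpha> s \<in> S" "\<alpha> t \<in> S" using S a' b' by auto
      then show "level (\<alpha> s) = level (\<alpha> t)" using strataD(2)[OF S(1)] by metis
    qed
  qed
  ultimately show ?R using P by blast
next
  assume R: ?R
  then have P: "interval_stratification P" and e: "ep \<alpha>" and g: "gaps P \<alpha>" by auto
  have "\<exists>S \<in> strata K. \<alpha> ` T \<subseteq> S" if T: "T \<in> interval_strata P" for T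
  proof -
    from T consider p where "T = {p}" "p \<in> P"
      | a b where "T = {a<..<b}" "a \<in> P" "b \<in> P" "a < b" "P \<inter> {a<..<b} = {}"
      unfolding interval_strata_def by blast
    then show ?thesis
    proof cases
      case 1
      then have "\<alpha> p \<in> topspace X" using P ep_in[OF e] by (auto simp: interval_stratification_def)
      then show ?thesis using point_in_stratum 1 by auto
    next
      case 2
      then have ab: "0 \<le> a" "b \<le> 1" using P by (auto simp: interval_stratification_def)
      then have f: "flat \<alpha> a b" using g 2 by (auto simp: gaps_def)
      have "connectedin unit_interval {a<..<b}" using ab by (auto simp: connectedin_subtopology)
      then have "connectedin X (\<alpha> ` T)" using connectedin_continuous_map_image[OF ep_continuous[OF e]] 2 by blast
      moreover have "level x = level (\<alpha> ((a + b) / 2))" if "x \<in> \<alpha> ` T" for x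
        using that f 2 by (auto simp: flat_def)
      moreover have "\<alpha> ` T \<noteq> {}" using 2 by auto
      ultimately show ?thesis using connected_in_stratum by blast
    qed
  qed
  then show ?L
    unfolding entrance_path_def using P e ep_in[OF e]
    by (auto simp: stratum_preserving_def ep_def stratum_dim_at)
qed

section \<open>The level along an entrance path\<close>

lemma ep_local:
  assumes e: "ep \<alpha>" and x: "x \<in> {0..1}" and V: "openin X V" "\<alpha> x \<in> V"
  shows "\<exists>\<delta>>0. \<forall>t \<in> {0..1}. \<bar>t - x\<bar> < \<delta> \<longrightarrow> \<alpha> t \<in> V"
proof -
  have "openin unit_interval {t \<in> topspace unit_interval. \<alpha> t \<in> V}"
    using openin_continuous_map_preimage[OF ep_continuous[OF e] V(1)] .
  then have o: "openin unit_interval {t \<in> {0..1}. \<alpha> t \<in> V}" by simp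
  then obtain d where "d > 0" "\<And>t. t \<in> {0..1} \<Longrightarrow> dist t x < d \<Longrightarrow> t \<in> {t \<in> {0..1}. \<alpha> t \<in> V}"
    using x V(2) unfolding openin_euclidean_subtopology_iff by blast
  then show ?thesis by (intro exI[of _ d]) (auto simp: dist_real_def)
qed

text \<open>After \<open>x\<close> the level is at most that at \<open>x\<close>, and inside
  \<open>V\<close> it is at least that. The two agree, and \<open>V\<close> is basic about the later
  points as well.\<close>

lemma ep_local_basic:
  assumes e: "ep \<alpha>" and x: "x \<in> {0..1}" and V: "basic (\<alpha> x) V"
  shows "\<exists>\<delta>>0. \<forall>t \<in> {0..1}. \<bar>t - x\<bar> < \<delta> \<longrightarrow> \<alpha> t \<in> V \<and> (x \<le> t \<longrightarrow> basic (\<alpha> t) V \<and> level (\<alpha> t) = level (\<alpha> x))"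
proof -
  obtain \<delta> where \<delta>: "\<delta> > 0" "\<And>t. t \<in> {0..1} \<Longrightarrow> \<bar>t - x\<bar> < \<delta> \<Longrightarrow> \<alpha> t \<in> V"
    using ep_local[OF e x basicD(2)[OF V] basicD(1)[OF V]] by blast
  then show ?thesis
    using basic_move[OF V] ep_level[OF e, of x] x by (intro exI[of _ \<delta>]) auto
qed

lemma ep_right_level:
  assumes e: "ep \<alpha>" and x: "x \<in> {0..1}"
  shows "\<exists>\<delta>>0. \<forall>t. x \<le> t \<longrightarrow> t < x + \<delta> \<longrightarrow> t \<le> 1 \<longrightarrow> level (\<alpha> t) = level (\<alpha> x)"
proof -
  obtain V where "basic (\<alpha> x) V" using basic_exists ep_in[OF e x] by blast
  from ep_local_basic[OF e x this] obtain \<delta> where \<delta>: "\<delta> > 0"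
    "\<forall>t \<in> {0..1}. \<bar>t - x\<bar> < \<delta> \<longrightarrow> \<alpha> t \<in> V \<and> (x \<le> t \<longrightarrow> basic (\<alpha> t) V \<and> level (\<alpha> t) = level (\<alpha> x))"
    by blast
  have "level (\<alpha> t) = level (\<alpha> x)" if "x \<le> t" "t < x + \<delta>" "t \<le> 1" for t
    using \<delta>(2)[rule_format, of t] that x by simp
  then show ?thesis using \<delta>(1) by blast
qed

text \<open>A non-increasing function with natural values is constant from the moment when it takes
  its least value among the times before \<open>x\<close>. At \<open>x\<close> itself it may still
  drop.\<close>

lemma ep_left_level:
  assumes e: "ep \<alpha>" and x: "x \<in> {0..1}"
  shows "\<exists>\<delta>>0. \<forall>s t. 0 \<le> s \<longrightarrow> 0 \<le> t \<longrightarrow> x - \<delta> < s \<longrightarrow> s < x \<longrightarrow> x - \<delta> < t \<longrightarrow> t < x \<longrightarrow>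
      level (\<alpha> s) = level (\<alpha> t)"
proof (cases "x = 0")
  case True
  then show ?thesis by (intro exI[of _ 1]) auto
next
  case False
  define m where "m = (LEAST k. \<exists>s. 0 \<le> s \<and> s < x \<and> level (\<alpha> s) = k)"
  have "\<exists>s. 0 \<le> s \<and> s < x \<and> level (\<alpha> s) = m"
    unfolding m_def by (rule LeastI_ex) (use False x in \<open>auto intro!: exI[of _ 0]\<close>)
  then obtain s where s: "0 \<le> s" "s < x" "level (\<alpha> s) = m" by blast
  have "level (\<alpha> t) = m" if "s \<le> t" "t < x" for t
  proof (rule antisym)
    show "level (\<alpha> t) \<le> m" using ep_level[OF e, of s t] s that x by simp
    show "m \<le> level (\<alpha> t)" unfolding m_def by (rule Least_le, rule exI[of _ t]) (use s that in auto)
  qed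
  then show ?thesis using s by (intro exI[of _ "x - s"]) auto
qed

lemma flat_closed_left:
  assumes e: "ep \<alpha>" and ab: "0 \<le> a" "b \<le> 1" and f: "flat \<alpha> a b" and s: "a \<le> s" "s < b"
  shows "level (\<alpha> s) = level (\<alpha> a)"
proof -
  have a: "a \<in> {0..1}" using ab s by auto
  obtain \<delta> where \<delta>: "\<delta> > 0" "\<And>t. a \<le> t \<Longrightarrow> t < a + \<delta> \<Longrightarrow> t \<le> 1 \<Longrightarrow> level (\<alpha> t) = level (\<alpha> a)"
    using ep_right_level[OF e a] by blast
  \<comment> \<open>A time inside the flat interval and so close to \<open>a\<close> that the level
    there is still the one at \<open>a\<close>.\<close>
  define t where "t = min (a + \<delta> / 2) ((a + b) / 2)"
  have t: "a < t" "t < a + \<delta>" "t < b" "t \<le> 1" using \<delta>(1) ab s by (auto simp: t_def min_def)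
  show ?thesis
  proof (cases "s = a")
    case False
    then have "level (\<alpha> s) = level (\<alpha> t)" using f[unfolded flat_def, rule_format, of s t] s t by simp
    then show ?thesis using \<delta>(2)[of t] t by simp
  qed simp
qed

lemma flat_subset: "flat \<alpha> a b \<Longrightarrow> a \<le> c \<Longrightarrow> d \<le> b \<Longrightarrow> flat \<alpha> c d"
  unfolding flat_def by force

text \<open>Stratifications of adjacent intervals unite, and near \<open>x\<close> the level is
  constant on either side of \<open>x\<close>, so that \<open>a\<close>, \<open>x\<close> and
  \<open>b\<close> suffice as 0-strata. Bisection reduces the whole interval to such short
  ones.\<close>

lemma ep_exists_P:
  assumes e: "ep \<alpha>"
  shows "\<exists>P. interval_stratification P \<and> gaps P \<alpha>"
proof -
  define Q where "Q = (\<lambda>a b. 0 \<le> a \<longrightarrow> b \<le> 1 \<longrightarrow> (\<exists>F. finite F \<and> F \<subseteq> {a..b} \<and> a \<in> F \<and> b \<in> F \<and>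
      (\<forall>c d. a \<le> c \<longrightarrow> c < d \<longrightarrow> d \<le> b \<longrightarrow> F \<inter> {c<..<d} = {} \<longrightarrow> flat \<alpha> c d)))"
  have "Q 0 1"
  proof (rule Bolzano[of 0 1 Q])
    fix a b c :: real assume ab: "Q a b" and bc: "Q b c" and le: "a \<le> b" "b \<le> c"
    show "Q a c"
      unfolding Q_def
    proof (intro impI)
      assume ac: "0 \<le> a" "c \<le> 1"
      obtain F where F: "finite F" "F \<subseteq> {a..b}" "a \<in> F" "b \<in> F"
          "\<And>c d. a \<le> c \<Longrightarrow> c < d \<Longrightarrow> d \<le> b \<Longrightarrow> F \<inter> {c<..<d} = {} \<Longrightarrow> flat \<alpha> c d"
        using ab ac le unfolding Q_def by force
      obtain G where G: "finite G" "G \<subseteq> {b..c}" "b \<in> G" "c \<in> G"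
          "\<And>e d. b \<le> e \<Longrightarrow> e < d \<Longrightarrow> d \<le> c \<Longrightarrow> G \<inter> {e<..<d} = {} \<Longrightarrow> flat \<alpha> e d"
        using bc ac le unfolding Q_def by force
      have "flat \<alpha> e d" if ed: "a \<le> e" "e < d" "d \<le> c" "(F \<union> G) \<inter> {e<..<d} = {}" for e d
      proof -
        have "b \<notin> {e<..<d}" using ed(4) F(4) by blast
        then consider "d \<le> b" | "b \<le> e" by fastforce
        then show ?thesis using F(5)[of e d] G(5)[of e d] ed by cases auto
      qed
      then show "\<exists>F. finite F \<and> F \<subseteq> {a..c} \<and> a \<in> F \<and> c \<in> F \<and>
          (\<forall>e d. a \<le> e \<longrightarrow> e < d \<longrightarrow> d \<le> c \<longrightarrow> F \<inter> {e<..<d} = {} \<longrightarrow> flat \<alpha> e d)"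
        using F G le by (intro exI[of _ "F \<union> G"]) force
    qed
  next
    fix x :: real assume "0 \<le> x" "x \<le> 1"
    then have x: "x \<in> {0..1}" by simp
    obtain d1 where d1: "d1 > 0" "\<And>s t. 0 \<le> s \<Longrightarrow> 0 \<le> t \<Longrightarrow> x - d1 < s \<Longrightarrow> s < x \<Longrightarrow> x - d1 < t \<Longrightarrow> t < x \<Longrightarrow>
      level (\<alpha> s) = level (\<alpha> t)" using ep_left_level[OF e x] by blast
    obtain d2 where d2: "d2 > 0" "\<And>t. x \<le> t \<Longrightarrow> t < x + d2 \<Longrightarrow> t \<le> 1 \<Longrightarrow> level (\<alpha> t) = level (\<alpha> x)"
      using ep_right_level[OF e x] by blast
    have "Q a b" if ab: "a \<le> x" "x \<le> b" "b - a < min d1 d2" for a b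
      unfolding Q_def
    proof (intro impI)
      assume 01: "0 \<le> a" "b \<le> 1"
      have "flat \<alpha> c d" if cd: "a \<le> c" "c < d" "d \<le> b" "{a, x, b} \<inter> {c<..<d} = {}" for c d
      proof -
        have "x \<notin> {c<..<d}" using cd(4) by blast
        then consider "d \<le> x" | "x \<le> c" by fastforce
        then show ?thesis
        proof cases
          case 1
          show ?thesis
            unfolding flat_def
          proof (intro allI impI)
            fix s t assume "c < s" "s < d" "c < t" "t < d"
            then show "level (\<alpha> s) = level (\<alpha> t)" using d1(2)[of s t] 1 cd ab 01 by simp
          qed
        next
          case 2
          have "level (\<alpha> t) = level (\<alpha> x)" if "c < t" "t < d" for t using d2(2)[of t] that 2 cd ab 01 by auto
          then show ?thesis unfolding flat_def by metis
        qed
      qed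
      then show "\<exists>F. finite F \<and> F \<subseteq> {a..b} \<and> a \<in> F \<and> b \<in> F \<and>
          (\<forall>e d. a \<le> e \<longrightarrow> e < d \<longrightarrow> d \<le> b \<longrightarrow> F \<inter> {e<..<d} = {} \<longrightarrow> flat \<alpha> e d)"
        using ab by (intro exI[of _ "{a, x, b}"]) auto
    qed
    then show "\<exists>d>0. \<forall>a b. a \<le> x \<and> x \<le> b \<and> b - a < d \<longrightarrow> Q a b"
      using d1 d2 by (intro exI[of _ "min d1 d2"]) auto
  qed simp
  then show ?thesis unfolding Q_def gaps_def interval_stratification_def by auto
qed

lemma ep_entrance: "ep \<alpha> \<Longrightarrow> \<exists>P. entrance_path K (P, \<alpha>)"
  using ep_exists_P entrance_iff by blast

section \<open>Pulling back, cutting and concatenating entrance paths\<close>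

lemma ep_pull:
  assumes e: "ep \<alpha>" and c: "continuous_on {0..1} \<phi>" and i: "\<And>t. t \<in> {0..1} \<Longrightarrow> \<phi> t \<in> {0..1}"
    and m: "\<And>s t. 0 \<le> s \<Longrightarrow> s \<le> t \<Longrightarrow> t \<le> 1 \<Longrightarrow> \<phi> s \<le> \<phi> t"
  shows "ep (pull \<alpha> \<phi>)"
proof -
  have "continuous_map unit_interval unit_interval \<phi>"
    using c i by (auto simp: continuous_map_in_subtopology)
  from continuous_map_compose[OF this ep_continuous[OF e]]
  have "continuous_map unit_interval X (pull \<alpha> \<phi>)"
    by (rule continuous_map_eq) (auto simp: pull_apply)
  moreover have "level (pull \<alpha> \<phi> t) \<le> level (pull \<alpha> \<phi> s)" if "0 \<le> s" "s \<le> t" "t \<le> 1" for s t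
    using ep_level[OF e, of "\<phi> s" "\<phi> t"] m[OF that] i[of s] i[of t] that by (simp add: pull_apply)
  ultimately show ?thesis by (simp add: ep_def)
qed

lemma ep_sim: "ep \<alpha> \<Longrightarrow> sim \<alpha> \<beta> \<Longrightarrow> ep \<beta>"
  using incr_in incr_le_iff by (auto simp: sim_def incr_def intro!: ep_pull)

lemma ep_sub:
  assumes "ep \<alpha>" "0 \<le> a" "a \<le> b" "b \<le> 1"
  shows "ep (sub \<alpha> a b)"
  unfolding sub_def
proof (rule ep_pull[OF assms(1)])
  fix t :: real assume "t \<in> {0..1}"
  then show "a + (b - a) * t \<in> {0..1}" using affine_in[of t a b] assms by auto
qed (use assms in \<open>auto intro!: continuous_intros mult_left_mono\<close>)

lemma ep_cst: "x \<in> topspace X \<Longrightarrow> ep (cst x)"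
  unfolding ep_def by (auto simp: cst_apply cst_def intro!: continuous_map_eq[of _ _ "\<lambda>_. x"])

lemma ep_joinp:
  assumes a: "ep \<alpha>" and b: "ep \<beta>" and ab: "\<beta> 0 = \<alpha> 1"
  shows "ep (joinp \<beta> \<alpha>)"
proof -
  have 1: "continuous_map (subtopology unit_interval {t. t \<in> topspace unit_interval \<and> t \<le> 1/2}) X (\<lambda>t. \<alpha> (2 * t))"
    by (rule continuous_map_compose[OF _ ep_continuous[OF a], unfolded o_def])
      (auto simp: continuous_map_in_subtopology subtopology_subtopology intro!: continuous_intros)
  have 2: "continuous_map (subtopology unit_interval {t. t \<in> topspace unit_interval \<and> 1/2 \<le> t}) X (\<lambda>t. \<beta> (2 * t - 1))"
    by (rule continuous_map_compose[OF _ ep_continuous[OF b], unfolded o_def])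
      (auto simp: continuous_map_in_subtopology subtopology_subtopology intro!: continuous_intros)
  have "continuous_map unit_interval X (\<lambda>t. if t \<le> 1/2 then \<alpha> (2 * t) else \<beta> (2 * t - 1))"
    by (rule continuous_map_cases_le[OF _ _ 1 2]) (auto simp: ab dest!: half_eq)
  then have "continuous_map unit_interval X (joinp \<beta> \<alpha>)"
    by (rule continuous_map_eq) (auto simp: joinp_apply)
  moreover have "level (joinp \<beta> \<alpha> t) \<le> level (joinp \<beta> \<alpha> s)" if st: "0 \<le> s" "s \<le> t" "t \<le> 1" for s t
  proof -
    consider "t \<le> 1/2" | "s > 1/2" | "s \<le> 1/2" "t > 1/2" using st by linarith
    then show ?thesis
    proof cases
      case 1
      then show ?thesis using st ep_level[OF a, of "2 * s" "2 * t"] by (simp add: joinp_apply)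
    next
      case 2
      then show ?thesis using st ep_level[OF b, of "2 * s - 1" "2 * t - 1"] by (simp add: joinp_apply)
    next
      case 3
      have "level (\<beta> (2 * t - 1)) \<le> level (\<beta> 0)" using 3 st ep_level[OF b, of 0 "2 * t - 1"] by simp
      also have "\<dots> \<le> level (\<alpha> (2 * s))" using 3 st ep_level[OF a, of "2 * s" 1] ab by simp
      finally show ?thesis using 3 st by (simp add: joinp_apply)
    qed
  qed
  ultimately show ?thesis by (simp add: ep_def)
qed

end

section \<open>Elementary homotopies\<close>

lemma triangle_eq: "triangle = {(x, y). 0 \<le> x \<and> 0 \<le> y \<and> x + y \<le> 1}"
proof (intro equalityI subsetI)
  fix p assume "p \<in> triangle"
  then show "p \<in> {(x, y). 0 \<le> x \<and> 0 \<le> y \<and> x + y \<le> 1}"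
    unfolding triangle_def convex_hull_3 by auto
next
  fix p :: "real \<times> real" assume "p \<in> {(x, y). 0 \<le> x \<and> 0 \<le> y \<and> x + y \<le> 1}"
  then show "p \<in> triangle"
    unfolding triangle_def convex_hull_3 mem_Collect_eq
    by - (rule exI[where x = "1 - fst p - snd p"], rule exI[where x = "fst p"], rule exI[where x = "snd p"], auto)
qed

lemma interior_triangle: "(x, y) \<in> interior triangle \<Longrightarrow> 0 \<le> x \<and> 0 \<le> y \<and> x + y < 1"
proof -
  assume p: "(x, y) \<in> interior triangle"
  then obtain e where e: "e > 0" "ball (x, y) e \<subseteq> triangle" by (auto simp: mem_interior)
  have "(x + e / 2, y) \<in> ball (x, y) e" using e(1) by (simp add: dist_Pair_Pair dist_real_def)
  then have "(x + e / 2, y) \<in> triangle" using e by blast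
  moreover have "(x, y) \<in> triangle" using p interior_subset by blast
  ultimately show ?thesis using e(1) by (auto simp: triangle_eq)
qed

lemma triangle_segments:
  "open_segment v0 v1 = (\<lambda>u. (u, 0)) ` {0<..<1 :: real}"
  "open_segment v1 v2 = (\<lambda>u. (1 - u, u)) ` {0<..<1 :: real}"
  "open_segment v0 v2 = (\<lambda>u. (0, u)) ` {0<..<1 :: real}"
  "closed_segment v0 v1 = (\<lambda>u. (u, 0)) ` {0..1 :: real}"
  "closed_segment v1 v2 = (\<lambda>u. (1 - u, u)) ` {0..1 :: real}"
  "closed_segment v0 v2 = (\<lambda>u. (0, u)) ` {0..1 :: real}"
  unfolding open_segment_image_interval closed_segment_image_interval by auto

text \<open>Pinches the top edge of the square to \<open>v2\<close>. The bottom edge becomes the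
  edge from \<open>v0\<close> to \<open>v1\<close>, the right edge the one from \<open>v1\<close> to
  \<open>v2\<close>, the left edge the one from \<open>v0\<close> to \<open>v2\<close>. Homotopies
  are easier to write down on the square.\<close>

definition collapse :: "real \<times> real \<Rightarrow> real \<times> real" where
  "collapse = (\<lambda>(u, s). ((1 - s) * u, s))"

text \<open>A continuous surjection from a compact space onto a Hausdorff space is a quotient map. A
  map of the square that is constant on the top edge therefore descends to the triangle.\<close>

lemma quotient_map_collapse:
  "quotient_map (top_of_set ({0..1} \<times> {0..1})) (top_of_set triangle) collapse"
proof (rule T1_Spaces.continuous_imp_quotient_map)
  have sub: "collapse ` ({0..1} \<times> {0..1}) \<subseteq> triangle"
  proof (clarsimp simp: collapse_def triangle_eq)
    fix u s :: real assume "0 \<le> u" "u \<le> 1" "0 \<le> s" "s \<le> 1"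
    then show "(1 - s) * u + s \<le> 1" using affine_in(2)[of u s 1] by (simp add: algebra_simps)
  qed
  have sup: "triangle \<subseteq> collapse ` ({0..1} \<times> {0..1})"
  proof
    fix p assume "p \<in> triangle"
    then obtain x y where p: "p = (x, y)" "0 \<le> x" "0 \<le> y" "x + y \<le> 1" by (auto simp: triangle_eq)
    show "p \<in> collapse ` ({0..1} \<times> {0..1})"
    proof (cases "y < 1")
      case True
      then show ?thesis using p
        by (intro image_eqI[of _ _ "(x / (1 - y), y)"]) (auto simp: collapse_def)
    next
      case False
      then show ?thesis using p by (intro image_eqI[of _ _ "(0, 1)"]) (auto simp: collapse_def)
    qed
  qed
  show "continuous_map (top_of_set ({0..1} \<times> {0..1})) (top_of_set triangle) collapse"
    using sub unfolding collapse_def case_prod_unfold continuous_map_in_subtopology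
    by (auto intro!: continuous_intros)
  show "compact_space (top_of_set ({0..1 :: real} \<times> {0..1 :: real}))"
    by (simp add: compact_space_subtopology compact_Times)
  show "Hausdorff_space (top_of_set triangle)"
    by (simp add: Hausdorff_space_subtopology)
  show "collapse ` topspace (top_of_set ({0..1} \<times> {0..1})) = topspace (top_of_set triangle)"
    using sub sup by simp
qed

definition edge_path :: "real \<Rightarrow> real \<times> real" where
  "edge_path t = (if t \<le> 1/2 then (2 * t, 0) else (2 - 2 * t, 2 * t - 1))"

lemma continuous_edge_path: "continuous_on {0..1} edge_path"
  unfolding edge_path_def
  by (rule continuous_on_cases_le) (auto intro!: continuous_intros dest!: half_eq)

lemma edge_path_image: "edge_path ` {0..1} = closed_segment v0 v1 \<union> closed_segment v1 v2"
proof (intro equalityI subsetI)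
  fix p assume "p \<in> edge_path ` {0..1}"
  then obtain t where t: "0 \<le> t" "t \<le> 1" "p = edge_path t" by auto
  show "p \<in> closed_segment v0 v1 \<union> closed_segment v1 v2"
  proof (cases "t \<le> 1/2")
    case True
    then show ?thesis using t unfolding triangle_segments by (intro UnI1 image_eqI[of _ _ "2 * t"]) (auto simp: edge_path_def)
  next
    case False
    then show ?thesis using t unfolding triangle_segments by (intro UnI2 image_eqI[of _ _ "2 * t - 1"]) (auto simp: edge_path_def)
  qed
next
  fix p assume "p \<in> closed_segment v0 v1 \<union> closed_segment v1 v2"
  then consider u where "0 \<le> u" "u \<le> 1" "p = (u, 0)" | u where "0 \<le> u" "u \<le> 1" "p = (1 - u, u)"
    unfolding triangle_segments by auto
  then show "p \<in> edge_path ` {0..1}"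
  proof cases
    case 1
    then show ?thesis by (intro image_eqI[of _ _ "u / 2"]) (auto simp: edge_path_def)
  next
    case 2
    then show ?thesis by (intro image_eqI[of _ _ "(u + 1) / 2"]) (auto simp: edge_path_def field_simps)
  qed
qed

lemma homeomorphic_map_edge_path:
  "homeomorphic_map unit_interval (top_of_set (closed_segment v0 v1 \<union> closed_segment v1 v2)) edge_path"
proof (rule continuous_imp_homeomorphic_map)
  show "continuous_map unit_interval (top_of_set (closed_segment v0 v1 \<union> closed_segment v1 v2)) edge_path"
    using continuous_edge_path edge_path_image by (auto simp: continuous_map_in_subtopology)
  show "inj_on edge_path (topspace unit_interval)"
    by (auto simp: inj_on_def edge_path_def split: if_splits)
qed (simp_all add: compact_space_subtopology Hausdorff_space_subtopology edge_path_image)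

lemma homeomorphic_map_vertical:
  "homeomorphic_map unit_interval (top_of_set (closed_segment v0 v2)) (\<lambda>t. (0, t))"
  by (rule continuous_imp_homeomorphic_map)
    (auto simp: compact_space_subtopology Hausdorff_space_subtopology triangle_segments inj_on_def
      continuous_map_in_subtopology intro!: continuous_intros)

lemma interval_strata_01: "T \<in> interval_strata {0, 1} \<Longrightarrow> T = {0} \<or> T = {1} \<or> T = {0<..<1}"
  unfolding interval_strata_def by auto

lemma interval_strata_half:
  assumes "T \<in> interval_strata {0, 1/2, 1}"
  shows "T = {0} \<or> T = {1/2} \<or> T = {1} \<or> T = {0<..<1/2} \<or> T = {1/2<..<1}"
proof -
  from assms consider p where "T = {p}" "p \<in> {0, 1/2, 1}"
    | a b where "T = {a<..<b}" "a \<in> {0, 1/2, 1}" "b \<in> {0, 1/2, 1}" "a < b" "1/2 \<notin> {a<..<b}"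
    unfolding interval_strata_def by blast
  then show ?thesis
  proof cases
    case 2
    from 2(2-5) have "a = 0 \<and> b = 1/2 \<or> a = 1/2 \<and> b = 1"
      unfolding insert_iff empty_iff greaterThanLessThan_iff by (elim disjE) auto
    then show ?thesis using 2(1) by blast
  qed blast
qed

lemma stratum_preserving_edge_path:
  "stratum_preserving unit_interval (interval_strata {0, 1/2, 1}) (top_of_set triangle) triangle_strata edge_path"
  unfolding stratum_preserving_def
proof (intro conjI ballI)
  have "edge_path ` {0..1} \<subseteq> triangle"
    unfolding edge_path_image triangle_segments triangle_eq by auto
  then show "continuous_map unit_interval (top_of_set triangle) edge_path"
    using continuous_edge_path by (auto simp: continuous_map_in_subtopology)
  fix T :: "real set" assume "T \<in> interval_strata {0, 1/2, 1}"
  from interval_strata_half[OF this]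
  consider "T = {0}" | "T = {1/2}" | "T = {1}" | "T = {0<..<1/2}" | "T = {1/2<..<1}" by blast
  then show "\<exists>S \<in> triangle_strata. edge_path ` T \<subseteq> S"
  proof cases
    case 1 then show ?thesis by (intro bexI[of _ "{v0}"]) (auto simp: edge_path_def triangle_strata_def)
  next
    case 2 then show ?thesis by (intro bexI[of _ "{v1}"]) (auto simp: edge_path_def triangle_strata_def)
  next
    case 3 then show ?thesis by (intro bexI[of _ "{v2}"]) (auto simp: edge_path_def triangle_strata_def)
  next
    case 4
    have "edge_path ` T \<subseteq> open_segment v0 v1"
      unfolding triangle_segments 4 by (auto simp: edge_path_def)
    then show ?thesis by (intro bexI[of _ "open_segment v0 v1"]) (auto simp: triangle_strata_def)
  next
    case 5
    have "edge_path t \<in> (\<lambda>u. (1 - u, u)) ` {0<..<1}" if "t \<in> T" for t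
      using that by (intro image_eqI[of _ _ "2 * t - 1"]) (auto simp: 5 edge_path_def)
    then have "edge_path ` T \<subseteq> open_segment v1 v2"
      unfolding triangle_segments by blast
    then show ?thesis by (intro bexI[of _ "open_segment v1 v2"]) (auto simp: triangle_strata_def)
  qed
qed

lemma stratum_preserving_vertical:
  "stratum_preserving unit_interval (interval_strata {0, 1}) (top_of_set triangle) triangle_strata (\<lambda>t. (0, t))"
  unfolding stratum_preserving_def
proof (intro conjI ballI)
  show "continuous_map unit_interval (top_of_set triangle) (\<lambda>t. (0, t))"
    by (auto simp: continuous_map_in_subtopology triangle_eq intro!: continuous_intros)
  fix T :: "real set" assume "T \<in> interval_strata {0, 1}"
  from interval_strata_01[OF this]
  consider "T = {0}" | "T = {1}" | "T = {0<..<1}" by blast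
  then show "\<exists>S \<in> triangle_strata. (\<lambda>t. (0, t)) ` T \<subseteq> S"
  proof cases
    case 1 then show ?thesis by (intro bexI[of _ "{v0}"]) (auto simp: triangle_strata_def)
  next
    case 2 then show ?thesis by (intro bexI[of _ "{v2}"]) (auto simp: triangle_strata_def)
  next
    case 3
    then have "(\<lambda>t. (0, t)) ` T = open_segment v0 v2" unfolding triangle_segments by simp
    then show ?thesis by (intro bexI[of _ "open_segment v0 v2"]) (auto simp: triangle_strata_def)
  qed
qed

lemma concat_path_eq: "concat_path (Q, \<beta>) (P, \<alpha>) = ((\<lambda>t. t / 2) ` P \<union> (\<lambda>t. (t + 1) / 2) ` Q, joinp \<beta> \<alpha>)"
  by (simp add: concat_path_def joinp_def)

lemma concat_path_01: "concat_path ({0, 1}, \<beta>) ({0, 1}, \<alpha>) = ({0, 1/2, 1}, joinp \<beta> \<alpha>)"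
  by (auto simp: concat_path_eq)

lemma snd_concat_path [simp]: "snd (concat_path q p) = joinp (snd q) (snd p)"
  by (cases q; cases p) (simp add: concat_path_eq)

context strat begin

lemma gaps_joinp:
  assumes a: "gaps P \<alpha>" and b: "gaps Q \<beta>" and P: "1 \<in> P"
  shows "gaps ((\<lambda>t. t / 2) ` P \<union> (\<lambda>t. (t + 1) / 2) ` Q) (joinp \<beta> \<alpha>)" (is "gaps ?R _")
  unfolding gaps_def
proof (intro allI impI)
  fix c d :: real assume cd: "0 \<le> c" "c < d" "d \<le> 1" "?R \<inter> {c<..<d} = {}"
  \<comment> \<open>The end 1 of \<open>P\<close> becomes 1/2, so no gap straddles the
    junction.\<close>
  have "1/2 \<in> ?R" using P by (auto intro: image_eqI[of _ _ 1])
  then have "1/2 \<notin> {c<..<d}" using cd by blast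
  then consider "d \<le> 1/2" | "1/2 \<le> c" by fastforce
  then show "flat (joinp \<beta> \<alpha>) c d"
  proof cases
    case 1
    have "P \<inter> {2 * c<..<2 * d} = {}"
    proof (rule ccontr)
      assume "P \<inter> {2 * c<..<2 * d} \<noteq> {}"
      then obtain p where "p \<in> P" "2 * c < p" "p < 2 * d" by auto
      then have "p / 2 \<in> ?R \<inter> {c<..<d}" by auto
      then show False using cd by blast
    qed
    then have "flat \<alpha> (2 * c) (2 * d)" using a cd 1 by (auto simp: gaps_def)
    then show ?thesis using cd 1 by (auto simp: flat_def joinp_apply)
  next
    case 2
    have "Q \<inter> {2 * c - 1<..<2 * d - 1} = {}"
    proof (rule ccontr)
      assume "Q \<inter> {2 * c - 1<..<2 * d - 1} \<noteq> {}"
      then obtain p where "p \<in> Q" "2 * c - 1 < p" "p < 2 * d - 1" by auto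
      then have "(p + 1) / 2 \<in> ?R \<inter> {c<..<d}" by auto
      then show False using cd by blast
    qed
    then have "flat \<beta> (2 * c - 1) (2 * d - 1)" using b cd 2 by (auto simp: gaps_def)
    then show ?thesis using cd 2 by (auto simp: flat_def joinp_apply)
  qed
qed

lemma entrance_concat:
  assumes p: "entrance_path K p" and q: "entrance_path K q" and pq: "path_start q = path_end p"
  shows "entrance_path K (concat_path q p)"
proof -
  obtain P \<alpha> Q \<beta> where [simp]: "p = (P, \<alpha>)" "q = (Q, \<beta>)" by (cases p, cases q)
  have P: "interval_stratification P" "ep \<alpha>" "gaps P \<alpha>" and Q: "interval_stratification Q" "ep \<beta>" "gaps Q \<beta>"
    using p q by (simp_all add: entrance_iff)
  have "interval_stratification ((\<lambda>t. t / 2) ` P \<union> (\<lambda>t. (t + 1) / 2) ` Q)"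
    using P(1) Q(1) by (force simp: interval_stratification_def image_iff)
  moreover have "1 \<in> P" using P(1) by (simp add: interval_stratification_def)
  ultimately show ?thesis
    using P Q pq gaps_joinp ep_joinp by (simp add: concat_path_eq entrance_iff path_start_def path_end_def)
qed

section \<open>Elementary homotopies from maps of the square\<close>

lemma entrance_01: "entrance_path K ({0, 1}, \<alpha>) \<longleftrightarrow> ep \<alpha> \<and> flat \<alpha> 0 1"
proof -
  have "gaps {0, 1} \<alpha> \<longleftrightarrow> flat \<alpha> 0 1"
    unfolding gaps_def by (auto intro: flat_subset)
  then show ?thesis by (auto simp: entrance_iff interval_stratification_def)
qed

text \<open>All elementary homotopies that the proof constructs come from here. The bottom edge
  \<open>\<alpha>\<close> followed by the right edge \<open>\<rho>\<close> is deformed to the left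
  edge \<open>\<beta>\<close>. The level is \<open>d\<close> off the right and top edges and
  \<open>e\<close> on the right edge, and the top edge is the single end point
  \<open>z\<close>.\<close>

lemma elementary_homotopyI:
  assumes H: "continuous_map (top_of_set ({0..1} \<times> {0..1})) X H"
    and z: "\<And>u. u \<in> {0..1} \<Longrightarrow> H (u, 1) = z"
    and d: "\<And>u s. 0 \<le> u \<Longrightarrow> u < 1 \<Longrightarrow> 0 \<le> s \<Longrightarrow> s < 1 \<Longrightarrow> level (H (u, s)) = d"
    and e: "\<And>s. 0 \<le> s \<Longrightarrow> s < 1 \<Longrightarrow> level (H (1, s)) = e" and ed: "e \<le> d"
    and U: "basic z U" and HU: "\<And>u s. u \<in> {0..1} \<Longrightarrow> s \<in> {0..1} \<Longrightarrow> H (u, s) \<in> U"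
    and \<alpha>: "\<alpha> = (\<lambda>u \<in> {0..1}. H (u, 0))" and \<rho>: "\<rho> = (\<lambda>s \<in> {0..1}. H (1, s))"
    and \<beta>: "\<beta> = (\<lambda>s \<in> {0..1}. H (0, s))"
  shows "elementary_homotopy n K ({0, 1/2, 1}, joinp \<rho> \<alpha>) ({0, 1}, \<beta>)"
proof -
  \<comment> \<open>Composition of \<open>H\<close> with the inverse of \<open>collapse\<close> away
    from the top edge.\<close>
  define h where "h = (\<lambda>p. if snd p < 1 then H (fst p / (1 - snd p), snd p) else z)"
  have hc: "h (collapse p) = H p" if "p \<in> {0..1} \<times> {0..1}" for p
    using that z by (cases p) (auto simp: h_def collapse_def)
  have "continuous_map (top_of_set ({0..1} \<times> {0..1})) X (h \<circ> collapse)"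
    by (rule continuous_map_eq[OF H]) (simp add: hc)
  then have h: "continuous_map (top_of_set triangle) X h"
    using continuous_compose_quotient_map[OF quotient_map_collapse] by blast
  have zX: "z \<in> topspace X" using basicD[OF U] by blast
  \<comment> \<open>\<open>U\<close> is basic about \<open>z\<close> and contains the right edge, so
    the level \<open>e\<close> there is at least that of \<open>z\<close>.\<close>
  have lz: "level z \<le> e" using e[of 0] basic_level[OF U HU[of 1 0]] by simp
  have pathH: "continuous_map unit_interval X (\<lambda>t\<in>{0..1}. H (f t))"
    if f: "continuous_on {0..1} f" "f ` {0..1} \<subseteq> {0..1} \<times> {0..1}" for f
  proof -
    have "continuous_map unit_interval (top_of_set ({0..1} \<times> {0..1})) f"
      using f by (auto simp: continuous_map_in_subtopology)
    from continuous_map_compose[OF this H] show ?thesis by (rule continuous_map_eq) auto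
  qed
  have e\<alpha>: "ep \<alpha>"
    unfolding ep_def
  proof (intro conjI allI impI)
    show "continuous_map unit_interval X \<alpha>" unfolding \<alpha> by (rule pathH) (auto intro!: continuous_intros)
    fix s t :: real assume st: "0 \<le> s" "s \<le> t" "t \<le> 1"
    show "level (\<alpha> t) \<le> level (\<alpha> s)"
    proof (cases "t < 1")
      case True then show ?thesis using st d[of s 0] d[of t 0] by (simp add: \<alpha>)
    next
      case False
      then consider "s = 1" "t = 1" | "s < 1" "t = 1" using st by linarith
      then show ?thesis using st ed d[of s 0] e[of 0] by cases (simp_all add: \<alpha>)
    qed
  qed (simp add: \<alpha>)
  have e\<rho>: "ep \<rho>"
    unfolding ep_def
  proof (intro conjI allI impI)
    show "continuous_map unit_interval X \<rho>" unfolding \<rho> by (rule pathH) (auto intro!: continuous_intros)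
    fix s t :: real assume st: "0 \<le> s" "s \<le> t" "t \<le> 1"
    show "level (\<rho> t) \<le> level (\<rho> s)"
    proof (cases "t < 1")
      case True then show ?thesis using st e[of s] e[of t] by (simp add: \<rho>)
    next
      case False
      then consider "s = 1" "t = 1" | "s < 1" "t = 1" using st by linarith
      then show ?thesis using st lz z[of 1] e[of s] by cases (simp_all add: \<rho>)
    qed
  qed (simp add: \<rho>)
  have e\<beta>: "ep \<beta>"
    unfolding ep_def
  proof (intro conjI allI impI)
    show "continuous_map unit_interval X \<beta>" unfolding \<beta> by (rule pathH) (auto intro!: continuous_intros)
    fix s t :: real assume st: "0 \<le> s" "s \<le> t" "t \<le> 1"
    show "level (\<beta> t) \<le> level (\<beta> s)"
    proof (cases "t < 1")
      case True then show ?thesis using st d[of 0 s] d[of 0 t] by (simp add: \<beta>)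
    next
      case False
      then consider "s = 1" "t = 1" | "s < 1" "t = 1" using st by linarith
      then show ?thesis using st lz ed z[of 0] d[of 0 s] by cases (simp_all add: \<beta>)
    qed
  qed (simp add: \<beta>)
  have en: "entrance_path K ({0, 1}, \<alpha>)" "entrance_path K ({0, 1}, \<rho>)" "entrance_path K ({0, 1}, \<beta>)"
    using e\<alpha> e\<rho> e\<beta> d e unfolding entrance_01 by (auto simp: flat_def \<alpha> \<rho> \<beta>)
  have en\<alpha>: "entrance_path K ({0, 1/2, 1}, joinp \<rho> \<alpha>)"
    using entrance_concat[OF en(1,2)] unfolding concat_path_01 by (simp add: path_start_def path_end_def \<alpha> \<rho>)
  \<comment> \<open>Each stratum of the triangle is connected and has constant level, which is all
    that needs to be checked below.\<close>
  have str: "\<exists>S \<in> strata K. h ` T \<subseteq> S" if T: "connected T" "T \<subseteq> triangle" "\<And>p. p \<in> T \<Longrightarrow> level (h p) = c" for T c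
  proof (cases "T = {}")
    case True
    then show ?thesis using point_in_stratum[OF zX] by blast
  next
    case False
    have "connectedin (top_of_set triangle) T" using T by (simp add: connectedin_subtopology)
    from connectedin_continuous_map_image[OF h this] show ?thesis
      using connected_in_stratum[of "h ` T" c] False T(3) by blast
  qed
  have lev: "level (h (x, y)) = d" if "0 \<le> x" "0 \<le> y" "x + y < 1" for x y
    using that d[of "x / (1 - y)" y] by (simp add: h_def)
  have vin: "{v0} \<subseteq> triangle" "{v1} \<subseteq> triangle" "{v2} \<subseteq> triangle" by (auto simp: triangle_eq)
  have sp: "stratum_preserving (top_of_set triangle) triangle_strata X (strata K) h"
    unfolding stratum_preserving_def
  proof (intro conjI ballI h)
    fix T assume "T \<in> triangle_strata"
    then consider v where "T = {v}" "v \<in> {v0, v1, v2}" | "T = open_segment v0 v1" | "T = open_segment v1 v2"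
      | "T = open_segment v0 v2" | "T = interior triangle" unfolding triangle_strata_def by blast
    then show "\<exists>S \<in> strata K. h ` T \<subseteq> S"
    proof cases
      case 1
      then show ?thesis using vin by (intro str[of T "level (h v)"]) auto
    next
      case 2
      show ?thesis
        by (rule str[of T d]) (unfold 2, auto simp: triangle_segments triangle_eq intro!: lev connected_continuous_image continuous_intros)
    next
      case 3
      show ?thesis
        by (rule str[of T e]) (unfold 3, auto simp: triangle_segments triangle_eq h_def e intro!: connected_continuous_image continuous_intros)
    next
      case 4
      show ?thesis
        by (rule str[of T d]) (unfold 4, auto simp: triangle_segments triangle_eq intro!: lev connected_continuous_image continuous_intros)
    next
      case 5
      have "convex triangle" by (simp add: triangle_def convex_convex_hull)
      then have "connected T" using 5 convex_interior convex_connected by blast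
      moreover have "level (h p) = d" if "p \<in> T" for p
        using that interior_triangle[of "fst p" "snd p"] lev[of "fst p" "snd p"] 5 by simp
      ultimately show ?thesis using str[of T d] 5 interior_subset by blast
    qed
  qed
  have open_part: "\<exists>S \<in> strata K. h ` (triangle - closed_segment v1 v2) \<subseteq> S"
  proof -
    \<comment> \<open>Half-planes cut out the triangle without the edge opposite \<open>v0\<close>;
      this set is therefore convex, hence connected.\<close>
    let ?A = "{p. 0 \<le> fst p} \<inter> {p. 0 \<le> snd p} \<inter> {p :: real \<times> real. fst p + snd p < 1}"
    have "?A = {p. inner (1, 0) p \<ge> 0} \<inter> {p. inner (0, 1) p \<ge> 0} \<inter> {p. inner (1, 1) p < 1}"
      by (auto simp: inner_prod_def)
    moreover have "convex \<dots>"
      by (intro convex_Int convex_halfspace_ge convex_halfspace_lt)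
    ultimately have "connected ?A" using convex_connected by simp
    then obtain S where S: "S \<in> strata K" "h ` ?A \<subseteq> S"
    proof -
      assume *: "\<And>S. S \<in> strata K \<Longrightarrow> h ` ?A \<subseteq> S \<Longrightarrow> thesis"
      have "?A \<subseteq> triangle" by (auto simp: triangle_eq)
      moreover have "level (h p) = d" if "p \<in> ?A" for p using lev[of "fst p" "snd p"] that by simp
      ultimately show thesis using str[OF \<open>connected ?A\<close>] * by blast
    qed
    have "triangle - closed_segment v1 v2 \<subseteq> ?A"
    proof
      fix p assume p: "p \<in> triangle - closed_segment v1 v2"
      then obtain x y where xy: "p = (x, y)" "0 \<le> x" "0 \<le> y" "x + y \<le> 1" by (auto simp: triangle_eq)
      have "x + y \<noteq> 1"
      proof
        assume "x + y = 1"
        then have "p \<in> closed_segment v1 v2"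
          unfolding triangle_segments using xy by (intro image_eqI[of _ _ y]) auto
        then show False using p by blast
      qed
      then show "p \<in> ?A" using xy by simp
    qed
    then show ?thesis using S by blast
  qed
  have hU: "h ` triangle \<subseteq> U"
  proof
    fix w assume "w \<in> h ` triangle"
    moreover have "triangle = collapse ` ({0..1} \<times> {0..1})"
      using quotient_imp_surjective_map[OF quotient_map_collapse] by simp
    ultimately have "w \<in> h ` collapse ` ({0..1} \<times> {0..1})" by simp
    then obtain u s where us: "u \<in> {0..1}" "s \<in> {0..1}" "w = h (collapse (u, s))" by blast
    then show "w \<in> U" using hc[of "(u, s)"] HU by simp
  qed
  have ha: "h (edge_path t) = joinp \<rho> \<alpha> t" if t: "t \<in> {0..1}" for t
  proof -
    have "t \<le> 1/2 \<or> 1/2 < t \<and> t < 1 \<or> t = 1" using t by auto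
    then consider "t \<le> 1/2" | "1/2 < t" "t < 1" | "t = 1" by blast
    then show ?thesis
    proof cases
      case 1 then show ?thesis using t by (simp add: h_def edge_path_def joinp_apply \<alpha>)
    next
      case 2
      then have "(2 - 2 * t) / (1 - (2 * t - 1)) = 1" by simp
      then show ?thesis using t 2 by (simp add: h_def edge_path_def joinp_apply \<rho>)
    next
      case 3 then show ?thesis using z[of 1] by (simp add: h_def edge_path_def joinp_apply \<rho>)
    qed
  qed
  have hb: "h (0, t) = \<beta> t" if "t \<in> {0..1}" for t
    using that z[of 0] by (auto simp: h_def \<beta>)
  have hv2: "h v2 = z" by (simp add: h_def)
  show ?thesis
    unfolding elementary_homotopy_def prod.case
  proof (intro conjI refl en(3) en\<alpha>, rule exI[of _ h], rule exI[of _ edge_path], rule exI[of _ "\<lambda>t. (0, t)"], intro conjI ballI)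
    show "\<exists>U. basic (h v2) U \<and> h ` triangle \<subseteq> U" using U hU hv2 by auto
  qed (use sp homeomorphic_map_edge_path stratum_preserving_edge_path homeomorphic_map_vertical
      stratum_preserving_vertical ha hb open_part in \<open>auto simp: edge_path_def\<close>)
qed

text \<open>The map is \<open>H (u, s) = p (s + (1 - s) * u)\<close>, the part of \<open>p\<close>
  that remains after time \<open>s\<close>. Its left edge is \<open>p\<close> itself, and its right
  edge rests at \<open>p 1\<close>.\<close>

lemma homotopy_const_left:
  assumes p: "ep p" and f: "flat p 0 1" and U: "basic (p 1) U" and pU: "\<And>t. t \<in> {0..1} \<Longrightarrow> p t \<in> U"
  shows "elementary_homotopy n K ({0, 1/2, 1}, joinp (cst (p 1)) p) ({0, 1}, p)"
proof -
  have i: "s + (1 - s) * u \<in> {0..1}" if "u \<in> {0..1}" "s \<in> {0..1}" for u s :: real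
    using that affine_in[of u s 1] by auto
  have lt: "s + (1 - s) * u < 1" if "u < 1" "s < 1" for u s :: real
  proof -
    have "(1 - s) * u < (1 - s) * 1" using that by (intro mult_strict_left_mono) auto
    then show ?thesis by simp
  qed
  show ?thesis
  proof (rule elementary_homotopyI[where H = "\<lambda>q. p (snd q + (1 - snd q) * fst q)" and z = "p 1"
        and d = "level (p 0)" and e = "level (p 1)"])
    have "continuous_map (top_of_set ({0..1} \<times> {0..1})) unit_interval (\<lambda>q. snd q + (1 - snd q) * fst q)"
      using i by (auto simp: continuous_map_in_subtopology intro!: continuous_intros)
    from continuous_map_compose[OF this ep_continuous[OF p]]
    show "continuous_map (top_of_set ({0..1} \<times> {0..1})) X (\<lambda>q. p (snd q + (1 - snd q) * fst q))"
      by (simp add: o_def)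
    show "level (p (snd (u, s) + (1 - snd (u, s)) * fst (u, s))) = level (p 0)"
      if "0 \<le> u" "u < 1" "0 \<le> s" "s < 1" for u s
      using flat_closed_left[OF p _ _ f, of "s + (1 - s) * u"] lt[of u s] i[of u s] that by simp
    show "level (p 1) \<le> level (p 0)" using ep_level[OF p, of 0 1] by simp
    show "p (snd (u, s) + (1 - snd (u, s)) * fst (u, s)) \<in> U" if "u \<in> {0..1}" "s \<in> {0..1}" for u s
      using pU[OF i[OF that]] by simp
    show "p = (\<lambda>u\<in>{0..1}. p (snd (u, 0) + (1 - snd (u, 0)) * fst (u, 0)))"
      "p = (\<lambda>s\<in>{0..1}. p (snd (0, s) + (1 - snd (0, s)) * fst (0, s)))"
      using ep_ext[OF p] by (auto intro: path_eqI)
    show "cst (p 1) = (\<lambda>s\<in>{0..1}. p (snd (1, s) + (1 - snd (1, s)) * fst (1, s)))"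
      by (rule path_eqI) (auto simp: cst_apply)
  qed (use U in auto)
qed

text \<open>Here \<open>H (u, s) = p s\<close> is independent of \<open>u\<close>: the bottom edge
  rests at \<open>p 0\<close>, and both sides are \<open>p\<close>.\<close>

lemma homotopy_const_right:
  assumes p: "ep p" and f: "flat p 0 1" and U: "basic (p 1) U" and pU: "\<And>t. t \<in> {0..1} \<Longrightarrow> p t \<in> U"
  shows "elementary_homotopy n K ({0, 1/2, 1}, joinp p (cst (p 0))) ({0, 1}, p)"
proof (rule elementary_homotopyI[where H = "\<lambda>q. p (snd q)" and z = "p 1" and d = "level (p 0)" and e = "level (p 0)"])
  have "continuous_map (top_of_set ({0..1} \<times> {0..1 :: real})) unit_interval snd"
    by (auto simp: continuous_map_in_subtopology intro!: continuous_intros)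
  from continuous_map_compose[OF this ep_continuous[OF p]]
  show "continuous_map (top_of_set ({0..1} \<times> {0..1})) X (\<lambda>q. p (snd q))"
    by (simp add: o_def)
  show "level (p (snd (u, s))) = level (p 0)" if "0 \<le> s" "s < 1" for u s :: real
    using flat_closed_left[OF p _ _ f, of s] that by simp
  show "level (p (snd (1, s))) = level (p 0)" if "0 \<le> s" "s < 1" for s :: real
    using flat_closed_left[OF p _ _ f, of s] that by simp
  show "p = (\<lambda>s\<in>{0..1}. p (snd (1, s)))" "p = (\<lambda>s\<in>{0..1}. p (snd (0, s)))"
    using ep_ext[OF p] by (auto intro: path_eqI)
  show "cst (p 0) = (\<lambda>u\<in>{0..1}. p (snd (u, 0)))"
    by (rule path_eqI) (auto simp: cst_apply)
qed (use U pU in auto)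

definition is_contraction :: "'a \<Rightarrow> 'a set \<Rightarrow> (real \<times> 'a \<Rightarrow> 'a) \<Rightarrow> bool" where
  "is_contraction x U c \<longleftrightarrow>
     continuous_map (prod_topology unit_interval (subtopology X U)) (subtopology X U) c \<and>
     (\<forall>y \<in> U. c (0, y) = y \<and> c (1, y) = x) \<and> (\<forall>s \<in> {0..1}. c (s, x) = x) \<and>
     (\<forall>y \<in> U. \<forall>s. 0 \<le> s \<longrightarrow> s < 1 \<longrightarrow> level (c (s, y)) = level y)"

lemma contraction_exists:
  assumes U: "basic x U"
  obtains c where "is_contraction x U c"
proof -
  obtain c where c: "continuous_map (prod_topology unit_interval (subtopology X U)) (subtopology X U) c"
    "\<And>y. y \<in> U \<Longrightarrow> c (0, y) = y" "\<And>y. y \<in> U \<Longrightarrow> c (1, y) = x"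
    "\<And>s. s \<in> {0..1} \<Longrightarrow> c (s, x) = x"
    "\<And>s y k. y \<in> U \<Longrightarrow> 0 \<le> s \<Longrightarrow> s < 1 \<Longrightarrow> c (s, y) \<in> Fil K k \<longleftrightarrow> y \<in> Fil K k"
    by (rule basic_open_contraction[OF step U]) (rule that)
  have "level (c (s, y)) = level y" if "y \<in> U" "0 \<le> s" "s < 1" for s y
    unfolding level_def using c(5)[OF that] by simp
  then have "is_contraction x U c" using c(1-4) by (simp add: is_contraction_def)
  then show thesis using that by blast
qed

lemma contraction_in:
  assumes "is_contraction x U c" "basic x U" "y \<in> U" "s \<in> {0..1}"
  shows "c (s, y) \<in> U"
proof -
  have "topspace (subtopology X U) = U" using basicD[OF assms(2)] by auto
  then show ?thesis
    using assms unfolding is_contraction_def continuous_map_def by (auto simp: Pi_iff)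
qed

definition ray :: "(real \<times> 'a \<Rightarrow> 'a) \<Rightarrow> 'a \<Rightarrow> real \<Rightarrow> 'a" where
  "ray c y = (\<lambda>s \<in> {0..1}. c (s, y))"

text \<open>The level is constant before time 1, and at time 1 the ray reaches the centre, whose
  level is the least in \<open>U\<close>.\<close>

lemma ray:
  assumes c: "is_contraction x U c" and U: "basic x U" and y: "y \<in> U"
  shows "ep (ray c y)" "ray c y 0 = y" "ray c y 1 = x" "\<And>t. t \<in> {0..1} \<Longrightarrow> ray c y t \<in> U"
proof -
  show *: "ray c y 0 = y" "ray c y 1 = x" and in_U: "\<And>t. t \<in> {0..1} \<Longrightarrow> ray c y t \<in> U"
    using c y contraction_in[OF c U y] by (auto simp: ray_def is_contraction_def)
  have "continuous_map unit_interval (prod_topology unit_interval (subtopology X U)) (\<lambda>s. (s, y))"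
    using y basicD[OF U] by (intro continuous_map_pairedI) auto
  then have "continuous_map unit_interval (subtopology X U) (c \<circ> (\<lambda>s. (s, y)))"
    using c continuous_map_compose unfolding is_contraction_def by blast
  then have "continuous_map unit_interval X (c \<circ> (\<lambda>s. (s, y)))" using continuous_map_into_fulltopology by blast
  then have "continuous_map unit_interval X (ray c y)"
    by (rule continuous_map_eq) (auto simp: ray_def)
  moreover have "level (ray c y t) \<le> level (ray c y s)" if "0 \<le> s" "s \<le> t" "t \<le> 1" for s t
  proof (cases "t < 1")
    case True
    then show ?thesis using that c y by (simp add: ray_def is_contraction_def)
  next
    case False
    then show ?thesis using that * basic_level[OF U in_U[of s]] by simp
  qed
  ultimately show "ep (ray c y)" by (simp add: ep_def ray_def)
qed

text \<open>The contraction is applied to all of \<open>p\<close> at once: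
  \<open>H (u, s) = c (s, p u)\<close>. The sides are the rays from \<open>p 0\<close> and from
  \<open>p 1\<close>, and the top edge is the centre because every ray ends there. Flatness of
  \<open>p\<close> makes the level constant off the right and top edges.\<close>

lemma homotopy_ray:
  assumes c: "is_contraction x U c" and U: "basic x U" and p: "ep p" and f: "flat p 0 1"
    and pU: "\<And>t. t \<in> {0..1} \<Longrightarrow> p t \<in> U"
  shows "elementary_homotopy n K ({0, 1/2, 1}, joinp (ray c (p 1)) p) ({0, 1}, ray c (p 0))"
proof (rule elementary_homotopyI[where H = "\<lambda>q. c (snd q, p (fst q))" and z = x and d = "level (p 0)" and e = "level (p 1)"])
  have pc: "continuous_map unit_interval (subtopology X U) p"
    using ep_continuous[OF p] pU by (auto simp: continuous_map_in_subtopology)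
  have 1: "continuous_map (top_of_set ({0..1} \<times> {0..1 :: real})) unit_interval snd"
    "continuous_map (top_of_set ({0..1 :: real} \<times> {0..1 :: real})) unit_interval fst"
    by (auto simp: continuous_map_in_subtopology intro!: continuous_intros)
  have "continuous_map (top_of_set ({0..1} \<times> {0..1})) (prod_topology unit_interval (subtopology X U))
      (\<lambda>q. (snd q, p (fst q)))"
    using continuous_map_compose[OF 1(2) pc] by (intro continuous_map_pairedI 1) (simp add: o_def)
  then have "continuous_map (top_of_set ({0..1} \<times> {0..1})) (subtopology X U) (c \<circ> (\<lambda>q. (snd q, p (fst q))))"
    using c continuous_map_compose unfolding is_contraction_def by blast
  then show "continuous_map (top_of_set ({0..1} \<times> {0..1})) X (\<lambda>q. c (snd q, p (fst q)))"
    using continuous_map_into_fulltopology by (fastforce simp: o_def)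
  show "c (snd (u, 1), p (fst (u, 1))) = x" if "u \<in> {0..1}" for u
    using c pU[OF that] by (simp add: is_contraction_def)
  show "level (c (snd (u, s), p (fst (u, s)))) = level (p 0)" if "0 \<le> u" "u < 1" "0 \<le> s" "s < 1" for u s
    using c pU[of u] that flat_closed_left[OF p _ _ f, of u] by (simp add: is_contraction_def)
  show "level (c (snd (1, s), p (fst (1, s)))) = level (p 1)" if "0 \<le> s" "s < 1" for s
    using c pU[of 1] that by (simp add: is_contraction_def)
  show "level (p 1) \<le> level (p 0)" using ep_level[OF p, of 0 1] by simp
  show "c (snd (u, s), p (fst (u, s))) \<in> U" if "u \<in> {0..1}" "s \<in> {0..1}" for u s
    using contraction_in[OF c U pU[OF that(1)] that(2)] by simp
  show "p = (\<lambda>u\<in>{0..1}. c (snd (u, 0), p (fst (u, 0))))"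
  proof (rule path_eqI)
    fix t :: real assume "t \<in> {0..1}"
    then show "p t = (\<lambda>u\<in>{0..1}. c (snd (u, 0), p (fst (u, 0)))) t"
      using c pU[of t] by (simp add: is_contraction_def)
  qed (use ep_ext[OF p] in auto)
qed (use U in \<open>auto simp: ray_def\<close>)

end

section \<open>The entrance path category\<close>

lemma affine_lt:
  fixes a b t :: real
  assumes "a < b" "0 < t" "t < 1"
  shows "a < a + (b - a) * t" "a + (b - a) * t < b"
proof -
  have "(b - a) * t < (b - a) * 1" using assms by (intro mult_strict_left_mono) auto
  then show "a + (b - a) * t < b" by simp
qed (use assms in simp)

context strat begin

section \<open>Equivalence of paths and its compatibility with reparametrization and
  concatenation\<close>

abbreviation "ER \<equiv> elementarily_related n K"
abbreviation "eqv \<equiv> ER\<^sup>*\<^sup>*"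

text \<open>The part of \<open>decomposes\<close> that concerns the pieces alone, separated from how
  they fit a given path.\<close>

definition pieces :: "'a strat_path option \<Rightarrow> 'a strat_path \<Rightarrow> 'a strat_path option \<Rightarrow> bool" where
  "pieces r3 p2 r1 \<longleftrightarrow>
     (\<forall>q \<in> set_option r3. entrance_path K q \<and> path_start q = path_end p2) \<and> entrance_path K p2 \<and>
     (\<forall>q \<in> set_option r1. entrance_path K q \<and> path_end q = path_start p2)"

lemma decomposes_iff:
  "decomposes K p r3 p2 r1 \<longleftrightarrow> pieces r3 p2 r1 \<and> snd p = snd (concat3 r3 p2 r1) \<and> fst p \<subseteq> fst (concat3 r3 p2 r1)"
  by (auto simp: decomposes_def pieces_def)

lemma path_ends_concat [simp]:
  "path_start (concat_path q p) = path_start p" "path_end (concat_path q p) = path_end q"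
  by (simp_all add: path_start_def path_end_def)

lemma pieces_entrance: "pieces r3 p2 r1 \<Longrightarrow> entrance_path K (concat3 r3 p2 r1)"
  by (cases r3; cases r1) (auto simp: pieces_def concat3_def intro!: entrance_concat)

lemma pieces_ends:
  "path_start (concat3 r3 p2 r1) = (case r1 of None \<Rightarrow> path_start p2 | Some r \<Rightarrow> path_start r)"
  "path_end (concat3 r3 p2 r1) = (case r3 of None \<Rightarrow> path_end p2 | Some r \<Rightarrow> path_end r)"
  by (auto simp: concat3_def split: option.split)

lemma entrance_ep: "entrance_path K p \<Longrightarrow> ep (snd p)"
  by (cases p) (simp add: entrance_iff)

lemma ER_I:
  assumes p: "entrance_path K p" and q: "entrance_path K q" and \<phi>: "incr \<phi>" and \<psi>: "incr \<psi>"
    and "pieces r3 p2 r1" "pieces r3 q2 r1"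
    and "pull (snd p) \<phi> = snd (concat3 r3 p2 r1)" "\<phi> -` fst p \<inter> {0..1} \<subseteq> fst (concat3 r3 p2 r1)"
    and "pull (snd q) \<psi> = snd (concat3 r3 q2 r1)" "\<psi> -` fst q \<inter> {0..1} \<subseteq> fst (concat3 r3 q2 r1)"
    and el: "elementary_homotopy n K p2 q2 \<or> elementary_homotopy n K q2 p2"
  shows "ER p q"
proof -
  have "interval_stratification (fst p)" "interval_stratification (fst q)"
    using p q by (cases p, cases q, simp add: entrance_iff)+
  then have rp: "reparametrization p (\<phi> -` fst p \<inter> {0..1}, pull (snd p) \<phi>)"
    "reparametrization q (\<psi> -` fst q \<inter> {0..1}, pull (snd q) \<psi>)"
    using incr_reparametrization[OF \<phi>, of "fst p" "snd p"] incr_reparametrization[OF \<psi>, of "fst q" "snd q"] by simp_all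
  show ?thesis
    unfolding elementarily_related_def
  proof (intro conjI p q, rule exI, rule exI, rule exI[of _ r3], rule exI[of _ p2], rule exI[of _ q2],
      rule exI[of _ r1], intro conjI)
    show "decomposes K (\<phi> -` fst p \<inter> {0..1}, pull (snd p) \<phi>) r3 p2 r1"
      "decomposes K (\<psi> -` fst q \<inter> {0..1}, pull (snd q) \<psi>) r3 q2 r1"
      unfolding decomposes_iff using assms by simp_all
  qed (rule rp el)+
qed

lemma ER_sym: "ER p q \<Longrightarrow> ER q p"
  unfolding elementarily_related_def by blast

lemma eqv_sym: "eqv p q \<Longrightarrow> eqv q p"
  by (induction rule: rtranclp_induct) (auto intro: converse_rtranclp_into_rtranclp ER_sym)

lemma path_class_eqI: "eqv p q \<Longrightarrow> path_class n K p = path_class n K q"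
  unfolding path_class_def using eqv_sym rtranclp_trans[of ER] by (intro Collect_cong) blast

lemma path_class_eqD: "path_class n K p = path_class n K q \<Longrightarrow> eqv p q"
proof -
  assume "path_class n K p = path_class n K q"
  moreover have "q \<in> path_class n K q" by (simp add: path_class_def)
  ultimately have "q \<in> path_class n K p" by simp
  then show "eqv p q" by (simp add: path_class_def)
qed

text \<open>Both paths are related to one and the same third path, in which a short final part of \<open>\<alpha>\<close> is followed
  by a constant path.\<close>

lemma eqv_sim:
  assumes p: "entrance_path K (P, \<alpha>)" and q: "entrance_path K (Q, \<beta>)" and sim: "sim \<alpha> \<beta>"
  shows "eqv (P, \<alpha>) (Q, \<beta>)"
proof -
  obtain \<xi> where \<xi>: "incr \<xi>" "\<beta> = pull \<alpha> \<xi>" using sim by (auto simp: sim_def)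
  have e: "ep \<alpha>" and P: "interval_stratification P" using p by (auto simp: entrance_iff)
  have Q: "interval_stratification Q" using q by (auto simp: entrance_iff)
  have 1: "(1::real) \<in> {0..1}" by simp
  obtain U where U: "basic (\<alpha> 1) U" using basic_exists ep_in[OF e 1] by blast
  obtain d1 where d1: "d1 > 0" "\<And>t. t \<in> {0..1} \<Longrightarrow> \<bar>t - 1\<bar> < d1 \<Longrightarrow> \<alpha> t \<in> U"
    using ep_local[OF e 1 basicD(2)[OF U] basicD(1)[OF U]] by blast
  obtain d2 where d2: "d2 > 0" "\<And>s t. 0 \<le> s \<Longrightarrow> 0 \<le> t \<Longrightarrow> 1 - d2 < s \<Longrightarrow> s < 1 \<Longrightarrow> 1 - d2 < t \<Longrightarrow> t < 1 \<Longrightarrow>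
      level (\<alpha> s) = level (\<alpha> t)" using ep_left_level[OF e 1] by blast
  \<comment> \<open>The 0-strata of both paths, expressed in the time of \<open>\<alpha>\<close>,
    since \<open>\<beta>\<close> at \<open>q\<close> is \<open>\<alpha>\<close> at
    \<open>\<xi> q\<close>.\<close>
  define Z where "Z = P \<union> \<xi> ` Q"
  have "finite Z" using P Q by (simp add: Z_def interval_stratification_def)
  then obtain d3 where d3: "d3 > 0" "\<And>z. z \<in> Z \<Longrightarrow> z \<noteq> 1 \<Longrightarrow> d3 \<le> \<bar>1 - z\<bar>"
    using finite_set_avoid[of Z 1] by (auto simp: dist_real_def)
  have Z01: "Z \<subseteq> {0..1}"
    using P Q incr_in[OF \<xi>(1)] by (auto simp: Z_def interval_stratification_def)
  \<comment> \<open>So small that after \<open>1 - \<delta>\<close> the path stays in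
    \<open>U\<close>, keeps its level until just before the end, and meets no point of
    \<open>Z\<close> other than 1.\<close>
  define \<delta> where "\<delta> = min (1/2) (min d1 (min d2 d3)) / 2"
  have \<delta>: "0 < \<delta>" "\<delta> < 1/2" "\<delta> < d1" "\<delta> < d2" "\<delta> < d3" using d1 d2 d3 by (auto simp: \<delta>_def min_def)
  define s where "s = 1 - \<delta>"
  have s: "0 < s" "s < 1" using \<delta> by (auto simp: s_def)
  have \<alpha>U: "\<alpha> t \<in> U" if "s \<le> t" "t \<le> 1" for t using d1(2)[of t] that \<delta> s by (simp add: s_def)
  have Zs: "z \<le> s \<or> z = 1" if "z \<in> Z" for z using d3(2)[OF that] that Z01 \<delta> by (force simp: s_def)
  define \<phi> where "\<phi> = glue s (\<lambda>t. t) (\<lambda>t. t)"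
  have \<phi>: "incr \<phi>" unfolding \<phi>_def by (rule incr_glue[OF s incr_id incr_id])
  define p2 where "p2 = sub \<alpha> s 1"
  define r where "r = sub \<alpha> 0 s"
  have ep2: "ep p2" and er: "ep r" using ep_sub[OF e] s by (auto simp: p2_def r_def)
  have p2U: "p2 t \<in> U" if "t \<in> {0..1}" for t
    unfolding p2_def by (rule sub_in) (use \<alpha>U s that in auto)
  have f2: "flat p2 0 1"
    unfolding flat_def
  proof (intro allI impI)
    fix t u :: real assume t: "0 < t" "t < 1" and u: "0 < u" "u < 1"
    note 1 = affine_lt[OF s(2) t] and 2 = affine_lt[OF s(2) u]
    have 3: "1 - d2 < s" using \<delta> by (simp add: s_def)
    have "level (\<alpha> (s + (1 - s) * t)) = level (\<alpha> (s + (1 - s) * u))"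
      by (rule d2(2)) (use 1 2 3 s(1) in linarith)+
    then show "level (p2 t) = level (p2 u)" using t u by (simp add: p2_def sub_apply)
  qed
  obtain R0 where R0: "interval_stratification R0" "gaps R0 r" using ep_exists_P[OF er] by blast
  \<comment> \<open>\<open>decomposes\<close> wants the 0-strata of the path among those of the
    composite, so the first piece also receives the points of \<open>Z\<close> before the cut,
    rescaled.\<close>
  define R where "R = R0 \<union> (\<lambda>z. z / s) ` (Z \<inter> {0..s})"
  have "(\<lambda>z. z / s) ` (Z \<inter> {0..s}) \<subseteq> {0..1}" using s by auto
  then have "interval_stratification R"
    using R0(1) \<open>finite Z\<close> by (auto simp: R_def interval_stratification_def)
  then have enr: "entrance_path K (R, r)"
    using er gaps_mono[OF R0(2), of R] by (auto simp: entrance_iff R_def)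
  have enp2: "entrance_path K ({0, 1}, p2)" using ep2 f2 by (simp add: entrance_01)
  have p21: "p2 1 = \<alpha> 1" and p20: "p2 0 = r 1" by (simp_all add: p2_def r_def)
  have el: "elementary_homotopy n K ({0, 1/2, 1}, joinp (cst (p2 1)) p2) ({0, 1}, p2)"
    using homotopy_const_left[OF ep2 f2 _ p2U] U p21 by simp
  then have en2: "entrance_path K ({0, 1/2, 1}, joinp (cst (p2 1)) p2)" by (simp add: elementary_homotopy_def)
  define w where "w = concat3 None ({0, 1/2, 1}, joinp (cst (p2 1)) p2) (Some (R, r))"
  have pc: "pieces None ({0, 1/2, 1}, joinp (cst (p2 1)) p2) (Some (R, r))" "pieces None ({0, 1}, p2) (Some (R, r))"
    using enr en2 enp2 p20 by (auto simp: pieces_def path_start_def path_end_def)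
  have enw: "entrance_path K w" unfolding w_def by (rule pieces_entrance[OF pc(1)])
  have joined: "pull \<alpha> \<phi> = snd (concat3 None ({0, 1}, p2) (Some (R, r)))"
    unfolding \<phi>_def pull_glue_id by (simp add: concat3_def p2_def r_def)
  have strata: "\<phi> -` Z \<inter> {0..1} \<subseteq> fst (concat3 None ({0, 1}, p2) (Some (R, r)))"
  proof
    fix t assume t: "t \<in> \<phi> -` Z \<inter> {0..1}"
    show "t \<in> fst (concat3 None ({0, 1}, p2) (Some (R, r)))"
    proof (cases "t \<le> 1/2")
      case True
      have "s * (2 * t) \<le> s * 1" using True s by (intro mult_left_mono) auto
      then have "s * (2 * t) \<in> Z \<inter> {0..s}" using t True s by (auto simp: \<phi>_def glue_def)
      then have "2 * t \<in> R" unfolding R_def using s by (intro UnI2 image_eqI[of _ _ "s * (2 * t)"]) auto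
      then have "t \<in> (\<lambda>t. t / 2) ` R" by (intro image_eqI[of _ _ "2 * t"]) auto
      then show ?thesis by (simp add: concat3_def concat_path_eq)
    next
      case False
      have "(1 - s) * (2 * t - 1) > 0" using False s by simp
      then have "\<phi> t > s" using False by (simp add: \<phi>_def glue_def)
      then have "\<phi> t = 1" using Zs[of "\<phi> t"] t by auto
      then have "t = 1" using incr_eq_iff[OF \<phi>, of t 1] incr_01[OF \<phi>] t by simp
      then show ?thesis by (simp add: concat3_def concat_path_eq)
    qed
  qed
  have idw: "pull (snd w) (\<lambda>t. t) = snd w" using ep_ext[OF entrance_ep[OF enw]] by (intro path_eqI) (auto simp: pull_apply)
  obtain \<psi> where \<psi>: "incr \<psi>" "\<And>t. t \<in> {0..1} \<Longrightarrow> \<xi> (\<psi> t) = t" "\<And>t. t \<in> {0..1} \<Longrightarrow> \<psi> (\<xi> t) = t"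
    using incr_inv[OF \<xi>(1)] by metis
  have "ER (P, \<alpha>) w"
  proof (rule ER_I[OF p enw \<phi> incr_id pc(2,1)])
    show "\<phi> -` fst (P, \<alpha>) \<inter> {0..1} \<subseteq> fst (concat3 None ({0, 1}, p2) (Some (R, r)))"
      using strata by (auto simp: Z_def)
  qed (use joined idw el in \<open>auto simp: w_def\<close>)
  \<comment> \<open>Undoing \<open>\<xi>\<close> turns \<open>\<beta>\<close> into the very function
    that was cut before, so the same pieces serve.\<close>
  moreover have "ER (Q, \<beta>) w"
  proof (rule ER_I[OF q enw incr_comp[OF \<psi>(1) \<phi>] incr_id pc(2,1)])
    have "(\<lambda>t. \<psi> (\<phi> t)) -` Q \<inter> {0..1} \<subseteq> \<phi> -` Z \<inter> {0..1}"
    proof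
      fix t assume t: "t \<in> (\<lambda>t. \<psi> (\<phi> t)) -` Q \<inter> {0..1}"
      then have "\<phi> t = \<xi> (\<psi> (\<phi> t))" using \<psi>(2)[OF incr_in[OF \<phi>]] by simp
      then show "t \<in> \<phi> -` Z \<inter> {0..1}" using t by (auto simp: Z_def)
    qed
    then show "(\<lambda>t. \<psi> (\<phi> t)) -` fst (Q, \<beta>) \<inter> {0..1} \<subseteq> fst (concat3 None ({0, 1}, p2) (Some (R, r)))"
      unfolding fst_conv using strata by (rule subset_trans)
    have "pull \<beta> (\<lambda>t. \<psi> (\<phi> t)) = pull \<alpha> \<phi>"
      using \<xi>(2) \<psi>(2) incr_in[OF \<phi>] incr_in[OF \<psi>(1)] by (intro path_eqI) (auto simp: pull_def)
    then show "pull (snd (Q, \<beta>)) (\<lambda>t. \<psi> (\<phi> t)) = snd (concat3 None ({0, 1}, p2) (Some (R, r)))"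
      using joined by simp
  qed (use idw el in \<open>auto simp: w_def\<close>)
  ultimately show ?thesis
    using ER_sym by (meson converse_rtranclp_into_rtranclp r_into_rtranclp)
qed

text \<open>The choice of the stratification is immaterial by \<open>eqv_sim\<close>.\<close>

definition cls :: "(real \<Rightarrow> 'a) \<Rightarrow> 'a strat_path set" where
  "cls \<alpha> = path_class n K (SOME P. entrance_path K (P, \<alpha>), \<alpha>)"

lemma cls_eq: "entrance_path K (P, \<alpha>) \<Longrightarrow> path_class n K (P, \<alpha>) = cls \<alpha>"
  unfolding cls_def
proof (intro path_class_eqI eqv_sim sim_refl)
  assume e: "entrance_path K (P, \<alpha>)"
  then show "entrance_path K (SOME P. entrance_path K (P, \<alpha>), \<alpha>)" by (rule someI)
  show "\<alpha> \<in> extensional {0..1}" using entrance_ep[OF e] ep_ext by simp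
qed

lemma cls_eq': "entrance_path K p \<Longrightarrow> path_class n K p = cls (snd p)"
  using cls_eq[of "fst p" "snd p"] by simp

lemma cls_sim:
  assumes "ep \<alpha>" "sim \<alpha> \<beta>"
  shows "cls \<alpha> = cls \<beta>"
proof -
  obtain P Q where "entrance_path K (P, \<alpha>)" "entrance_path K (Q, \<beta>)"
    using ep_entrance[OF assms(1)] ep_entrance[OF ep_sim[OF assms]] by blast
  then show ?thesis using path_class_eqI[OF eqv_sim[OF _ _ assms(2)]] cls_eq by metis
qed

text \<open>An elementary relation between bare functions, oriented and with reparametrization split
  off; \<open>ER_elem_step\<close> attaches the latter through \<open>sim\<close>.\<close>

definition elem_step :: "(real \<Rightarrow> 'a) \<Rightarrow> (real \<Rightarrow> 'a) \<Rightarrow> bool" where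
  "elem_step \<alpha> \<beta> \<longleftrightarrow> (\<exists>r3 p2 q2 r1. pieces r3 p2 r1 \<and> pieces r3 q2 r1 \<and> elementary_homotopy n K p2 q2 \<and>
     \<alpha> = snd (concat3 r3 p2 r1) \<and> \<beta> = snd (concat3 r3 q2 r1))"

lemma elementary_homotopy_ends:
  assumes "elementary_homotopy n K p q"
  shows "path_start q = path_start p" "path_end q = path_end p" "entrance_path K p" "entrance_path K q"
proof -
  obtain P \<alpha> Q \<beta> where pq: "p = (P, \<alpha>)" "q = (Q, \<beta>)" by (cases p, cases q)
  from assms obtain h a b where *: "a 0 = v0" "a 1 = v2" "b 0 = v0" "b 1 = v2"
      "\<forall>t \<in> {0..1}. h (a t) = \<alpha> t" "\<forall>t \<in> {0..1}. h (b t) = \<beta> t"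
    unfolding elementary_homotopy_def pq by auto
  have "\<alpha> 0 = \<beta> 0" "\<alpha> 1 = \<beta> 1" using *(5,6)[rule_format, of 0] *(5,6)[rule_format, of 1] *(1-4) by simp_all
  then show "path_start q = path_start p" "path_end q = path_end p" by (simp_all add: pq path_start_def path_end_def)
  show "entrance_path K p" "entrance_path K q" using assms by (auto simp: elementary_homotopy_def pq)
qed

lemma elem_stepI:
  assumes "elementary_homotopy n K p q"
    "\<And>r. r3 = Some r \<Longrightarrow> entrance_path K r \<and> path_start r = path_end p"
    "\<And>r. r1 = Some r \<Longrightarrow> entrance_path K r \<and> path_end r = path_start p"
  shows "elem_step (snd (concat3 r3 p r1)) (snd (concat3 r3 q r1))"
  unfolding elem_step_def using assms elementary_homotopy_ends[OF assms(1)]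
  by (intro exI[of _ r3] exI[of _ p] exI[of _ q] exI[of _ r1]) (auto simp: pieces_def)

lemma elem_step_cls:
  assumes "elem_step \<alpha> \<beta>"
  shows "cls \<alpha> = cls \<beta>" "ep \<alpha>" "ep \<beta>" "\<beta> 0 = \<alpha> 0" "\<beta> 1 = \<alpha> 1"
proof -
  obtain r3 p2 q2 r1 where *: "pieces r3 p2 r1" "pieces r3 q2 r1" "elementary_homotopy n K p2 q2"
     "\<alpha> = snd (concat3 r3 p2 r1)" "\<beta> = snd (concat3 r3 q2 r1)" using assms by (auto simp: elem_step_def)
  note en = pieces_entrance[OF *(1)] pieces_entrance[OF *(2)]
  show e: "ep \<alpha>" "ep \<beta>" using en entrance_ep * by auto
  have "ER (concat3 r3 p2 r1) (concat3 r3 q2 r1)"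
    by (rule ER_I[OF en incr_id incr_id *(1,2)])
      (use * ep_ext[OF e(1)] ep_ext[OF e(2)] in \<open>auto intro!: path_eqI simp: pull_apply\<close>)
  then have "path_class n K (concat3 r3 p2 r1) = path_class n K (concat3 r3 q2 r1)"
    by (intro path_class_eqI) auto
  then show "cls \<alpha> = cls \<beta>" using cls_eq'[OF en(1)] cls_eq'[OF en(2)] * by simp
  have "path_start (concat3 r3 q2 r1) = path_start (concat3 r3 p2 r1)" "path_end (concat3 r3 q2 r1) = path_end (concat3 r3 p2 r1)"
    unfolding pieces_ends using elementary_homotopy_ends[OF *(3)] by (auto split: option.split)
  then show "\<beta> 0 = \<alpha> 0" "\<beta> 1 = \<alpha> 1" using * by (auto simp: path_start_def path_end_def)
qed

lemma ER_elem_step: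
  assumes "ER p q"
  obtains \<alpha> \<beta> where "sim (snd p) \<alpha>" "sim (snd q) \<beta>" "elem_step \<alpha> \<beta> \<or> elem_step \<beta> \<alpha>" "ep (snd p)" "ep (snd q)"
proof -
  obtain p' q' r3 p2 q2 r1 where *: "entrance_path K p" "entrance_path K q" "reparametrization p p'" "reparametrization q q'"
      "decomposes K p' r3 p2 r1" "decomposes K q' r3 q2 r1" "elementary_homotopy n K p2 q2 \<or> elementary_homotopy n K q2 p2"
    using assms unfolding elementarily_related_def by blast
  have "elem_step (snd p') (snd q') \<or> elem_step (snd q') (snd p')"
    using * unfolding elem_step_def decomposes_iff by blast
  then show thesis using that[OF reparametrization_sim[OF *(3)] reparametrization_sim[OF *(4)]] *(1,2) entrance_ep by blast
qed

text \<open>\<open>\<gamma>\<close> is absorbed into the last outer piece, which leaves the middle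
  homotopy alone. The change of brackets is a reparametrization.\<close>

lemma elem_step_joinp_left:
  assumes elem_step: "elem_step \<alpha> \<beta>" and \<gamma>: "ep \<gamma>" "\<gamma> 0 = \<alpha> 1"
  obtains \<alpha>' \<beta>' where "sim (joinp \<gamma> \<alpha>) \<alpha>'" "sim (joinp \<gamma> \<beta>) \<beta>'" "elem_step \<alpha>' \<beta>'"
proof -
  obtain r3 p2 q2 r1 where *: "pieces r3 p2 r1" "pieces r3 q2 r1" "elementary_homotopy n K p2 q2"
     "\<alpha> = snd (concat3 r3 p2 r1)" "\<beta> = snd (concat3 r3 q2 r1)" using elem_step by (auto simp: elem_step_def)
  obtain R where R: "entrance_path K (R, \<gamma>)" using ep_entrance[OF \<gamma>(1)] by blast
  have \<gamma>0: "\<gamma> 0 = path_end (concat3 r3 p2 r1)" using \<gamma>(2) *(4) by (simp add: path_end_def)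
  define r3' where "r3' = Some (case r3 of None \<Rightarrow> (R, \<gamma>) | Some r \<Rightarrow> concat_path (R, \<gamma>) r)"
  have "elem_step (snd (concat3 r3' p2 r1)) (snd (concat3 r3' q2 r1))"
    by (rule elem_stepI[OF *(3)])
      (use * R \<gamma>0 in \<open>auto simp: r3'_def pieces_def pieces_ends path_start_def[of "(R, \<gamma>)"] intro!: entrance_concat split: option.splits\<close>)
  moreover have sim: "sim (joinp \<gamma> (snd (concat3 r3 x r1))) (snd (concat3 r3' x r1))" for x
    by (cases r3; cases r1) (auto simp: r3'_def concat3_def intro: sim_assoc sim_refl)
  ultimately show thesis using that[OF sim[of p2, folded *(4)] sim[of q2, folded *(5)]] by blast
qed

text \<open>The mirror image, with \<open>\<gamma>\<close> absorbed into the first outer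
  piece.\<close>

lemma elem_step_joinp_right:
  assumes elem_step: "elem_step \<alpha> \<beta>" and \<gamma>: "ep \<gamma>" "\<gamma> 1 = \<alpha> 0"
  obtains \<alpha>' \<beta>' where "sim (joinp \<alpha> \<gamma>) \<alpha>'" "sim (joinp \<beta> \<gamma>) \<beta>'" "elem_step \<alpha>' \<beta>'"
proof -
  obtain r3 p2 q2 r1 where *: "pieces r3 p2 r1" "pieces r3 q2 r1" "elementary_homotopy n K p2 q2"
     "\<alpha> = snd (concat3 r3 p2 r1)" "\<beta> = snd (concat3 r3 q2 r1)" using elem_step by (auto simp: elem_step_def)
  obtain R where R: "entrance_path K (R, \<gamma>)" using ep_entrance[OF \<gamma>(1)] by blast
  have \<gamma>1: "\<gamma> 1 = path_start (concat3 r3 p2 r1)" using \<gamma>(2) *(4) by (simp add: path_start_def)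
  define r1' where "r1' = Some (case r1 of None \<Rightarrow> (R, \<gamma>) | Some r \<Rightarrow> concat_path r (R, \<gamma>))"
  have "elem_step (snd (concat3 r3 p2 r1')) (snd (concat3 r3 q2 r1'))"
    by (rule elem_stepI[OF *(3)])
      (use * R \<gamma>1 in \<open>auto simp: r1'_def pieces_def pieces_ends path_end_def[of "(R, \<gamma>)"] intro!: entrance_concat split: option.splits\<close>)
  moreover have sim: "sim (joinp (snd (concat3 r3 x r1)) \<gamma>) (snd (concat3 r3 x r1'))" for x
  proof -
    have assoc: "sim (joinp (joinp a b) c) (joinp a (joinp b c))" for a b c :: "real \<Rightarrow> 'a"
      by (rule sim_sym[OF _ sim_assoc]) simp
    \<comment> \<open>In \<open>concat3\<close> the first piece sits inside the composite with
      \<open>r3\<close>, so brackets have to be moved under that composite.\<close>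
    have congr: "sim (joinp (snd r) a) (joinp (snd r) b)" if "sim a b" "r3 = Some r" for a b r
    proof -
      have "snd r \<in> extensional {0..1}" using * that by (auto simp: pieces_def intro: ep_ext entrance_ep)
      then show ?thesis using sim_joinp[OF that(1) sim_refl] by blast
    qed
    show ?thesis
    proof (cases r3)
      case None
      then show ?thesis by (cases r1) (auto simp: r1'_def concat3_def intro: assoc sim_refl)
    next
      case (Some r)
      have "sim (joinp (joinp (snd r) a) \<gamma>) (joinp (snd r) b)" if "sim (joinp a \<gamma>) b" for a b
        using sim_trans[OF assoc congr[OF that Some]] .
      then show ?thesis using Some by (cases r1) (auto simp: r1'_def concat3_def intro: assoc sim_refl)
    qed
  qed
  ultimately show thesis using that[OF sim[of p2, folded *(4)] sim[of q2, folded *(5)]] by blast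
qed

lemma ER_joinp:
  assumes "ER p q"
  shows "snd q 0 = snd p 0" "snd q 1 = snd p 1" "ep (snd p)" "ep (snd q)"
    "\<And>\<gamma>. ep \<gamma> \<Longrightarrow> \<gamma> 0 = snd p 1 \<Longrightarrow> cls (joinp \<gamma> (snd p)) = cls (joinp \<gamma> (snd q))"
    "\<And>\<gamma>. ep \<gamma> \<Longrightarrow> \<gamma> 1 = snd p 0 \<Longrightarrow> cls (joinp (snd p) \<gamma>) = cls (joinp (snd q) \<gamma>)"
proof -
  obtain \<alpha> \<beta> where *: "sim (snd p) \<alpha>" "sim (snd q) \<beta>" "elem_step \<alpha> \<beta> \<or> elem_step \<beta> \<alpha>" "ep (snd p)" "ep (snd q)"
    using ER_elem_step[OF assms] by metis
  then show "ep (snd p)" "ep (snd q)" by auto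
  show ends: "snd q 0 = snd p 0" "snd q 1 = snd p 1"
    using * elem_step_cls[of \<alpha> \<beta>] elem_step_cls[of \<beta> \<alpha>] by (metis sim_ends)+
  have ends': "\<alpha> 0 = snd p 0" "\<alpha> 1 = snd p 1" "\<beta> 0 = snd p 0" "\<beta> 1 = snd p 1"
    using sim_ends[OF *(1)] sim_ends[OF *(2)] ends by auto
  fix \<gamma> assume \<gamma>: "ep \<gamma>"
  have sg: "sim \<gamma> \<gamma>" using sim_refl ep_ext[OF \<gamma>] by blast
  have ep\<alpha>\<beta>: "ep \<alpha>" "ep \<beta>" using elem_step_cls * by blast+
  {
    assume g: "\<gamma> 0 = snd p 1"
    have 1: "cls (joinp \<gamma> (snd p)) = cls (joinp \<gamma> \<alpha>)" "cls (joinp \<gamma> (snd q)) = cls (joinp \<gamma> \<beta>)"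
      using * \<gamma> g ends by (auto intro!: cls_sim ep_joinp sim_joinp sg)
    have "cls (joinp \<gamma> a) = cls (joinp \<gamma> b)" if ab: "elem_step a b" "\<gamma> 0 = a 1" for a b
    proof -
      obtain a' b' where s: "sim (joinp \<gamma> a) a'" "sim (joinp \<gamma> b) b'" "elem_step a' b'" using elem_step_joinp_left[OF ab(1) \<gamma> ab(2)] by metis
      have "ep (joinp \<gamma> a)" "ep (joinp \<gamma> b)" using elem_step_cls[OF ab(1)] ab(2) \<gamma> by (auto intro!: ep_joinp)
      then show ?thesis using cls_sim s elem_step_cls[OF s(3)] by metis
    qed
    then show "cls (joinp \<gamma> (snd p)) = cls (joinp \<gamma> (snd q))" using 1 *(3) g ends' by metis
  }
  {
    assume g: "\<gamma> 1 = snd p 0"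
    have 1: "cls (joinp (snd p) \<gamma>) = cls (joinp \<alpha> \<gamma>)" "cls (joinp (snd q) \<gamma>) = cls (joinp \<beta> \<gamma>)"
      using * \<gamma> g ends by (auto intro!: cls_sim ep_joinp sim_joinp sg)
    have "cls (joinp a \<gamma>) = cls (joinp b \<gamma>)" if ab: "elem_step a b" "\<gamma> 1 = a 0" for a b
    proof -
      obtain a' b' where s: "sim (joinp a \<gamma>) a'" "sim (joinp b \<gamma>) b'" "elem_step a' b'" using elem_step_joinp_right[OF ab(1) \<gamma> ab(2)] by metis
      have "ep (joinp a \<gamma>)" "ep (joinp b \<gamma>)" using elem_step_cls[OF ab(1)] ab(2) \<gamma> by (auto intro!: ep_joinp)
      then show ?thesis using cls_sim s elem_step_cls[OF s(3)] by metis
    qed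
    then show "cls (joinp (snd p) \<gamma>) = cls (joinp (snd q) \<gamma>)" using 1 *(3) g ends' by metis
  }
qed

text \<open>This makes composition well defined on classes. The end points are carried through the
  induction so that \<open>\<gamma>\<close> stays composable along the chain.\<close>

lemma eqv_joinp:
  assumes "eqv p q" and e: "ep (snd p)"
  shows "snd q 0 = snd p 0 \<and> snd q 1 = snd p 1 \<and> ep (snd q) \<and>
    (\<forall>\<gamma>. ep \<gamma> \<longrightarrow> \<gamma> 0 = snd p 1 \<longrightarrow> cls (joinp \<gamma> (snd p)) = cls (joinp \<gamma> (snd q))) \<and>
    (\<forall>\<gamma>. ep \<gamma> \<longrightarrow> \<gamma> 1 = snd p 0 \<longrightarrow> cls (joinp (snd p) \<gamma>) = cls (joinp (snd q) \<gamma>))"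
  using assms(1)
proof (induction rule: rtranclp_induct)
  case (step q r)
  then show ?case using ER_joinp[OF step(2)] by simp
qed (simp add: e)

section \<open>The calculus of path classes: composition, units and cutting\<close>

lemma eqv_entrance:
  assumes "eqv p q" "entrance_path K p" shows "entrance_path K q"
  using assms by (induction rule: rtranclp_induct) (auto simp: elementarily_related_def)

lemma cls_eqv:
  assumes "cls \<alpha> = cls \<beta>" "ep \<alpha>" "ep \<beta>"
  obtains P Q where "eqv (P, \<alpha>) (Q, \<beta>)"
proof -
  obtain P Q where "entrance_path K (P, \<alpha>)" "entrance_path K (Q, \<beta>)" using ep_entrance assms by blast
  then have "path_class n K (P, \<alpha>) = path_class n K (Q, \<beta>)" using assms(1) cls_eq by simp
  then show thesis using that path_class_eqD by blast
qed

lemma cls_joinp_left: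
  assumes "cls \<alpha> = cls \<beta>" "ep \<alpha>" "ep \<beta>" "ep \<gamma>" "\<gamma> 0 = \<alpha> 1"
  shows "cls (joinp \<gamma> \<alpha>) = cls (joinp \<gamma> \<beta>)"
proof -
  obtain P Q where "eqv (P, \<alpha>) (Q, \<beta>)" using cls_eqv[OF assms(1-3)] by blast
  from eqv_joinp[OF this] show ?thesis using assms by simp
qed

lemma cls_joinp_right:
  assumes "cls \<alpha> = cls \<beta>" "ep \<alpha>" "ep \<beta>" "ep \<gamma>" "\<gamma> 1 = \<alpha> 0"
  shows "cls (joinp \<alpha> \<gamma>) = cls (joinp \<beta> \<gamma>)"
proof -
  obtain P Q where "eqv (P, \<alpha>) (Q, \<beta>)" using cls_eqv[OF assms(1-3)] by blast
  from eqv_joinp[OF this] show ?thesis using assms by simp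
qed

lemma cls_assoc:
  assumes "ep \<alpha>" "ep \<beta>" "ep \<gamma>" "\<beta> 0 = \<alpha> 1" "\<gamma> 0 = \<beta> 1"
  shows "cls (joinp \<gamma> (joinp \<beta> \<alpha>)) = cls (joinp (joinp \<gamma> \<beta>) \<alpha>)"
  by (rule cls_sim[OF _ sim_assoc]) (use assms in \<open>auto intro!: ep_joinp\<close>)

lemma cls_cut:
  assumes \<alpha>: "ep \<alpha>" and "0 \<le> a" "a < b" "b < c" "c \<le> 1"
  shows "cls (joinp (sub \<alpha> b c) (sub \<alpha> a b)) = cls (sub \<alpha> a c)"
  using cls_sim[OF ep_sub[OF \<alpha>] sim_cut] assms by simp

lemma cls_elementary:
  assumes "elementary_homotopy n K (P, \<alpha>) (Q, \<beta>)"
  shows "cls \<alpha> = cls \<beta>"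
  using elem_step_cls(1)[OF elem_stepI[OF assms, of None None]] by (simp add: concat3_def)

text \<open>\<open>homotopy_const_right\<close> asks for a flat path inside a basic open about its
  end, which \<open>\<beta>\<close> as a whole need not be. A short initial piece is, since a basic
  open about \<open>\<beta> 0\<close> is basic about the next points too; associativity then moves
  the constant path there.\<close>

lemma cls_unit_right:
  assumes \<beta>: "ep \<beta>"
  shows "cls (joinp \<beta> (cst (\<beta> 0))) = cls \<beta>"
proof -
  have 0: "(0::real) \<in> {0..1}" by simp
  obtain U where U: "basic (\<beta> 0) U" using basic_exists ep_in[OF \<beta> 0] by blast
  obtain d where d: "d > 0" "\<forall>t \<in> {0..1}. \<bar>t - 0\<bar> < d \<longrightarrow> \<beta> t \<in> U \<and> (0 \<le> t \<longrightarrow> basic (\<beta> t) U \<and> level (\<beta> t) = level (\<beta> 0))"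
    using ep_local_basic[OF \<beta> 0 U] by blast
  define s where "s = min (1/2) (d/2)"
  have s: "0 < s" "s < 1" "s < d" using d by (auto simp: s_def min_def)
  have \<beta>U: "\<beta> t \<in> U \<and> basic (\<beta> t) U \<and> level (\<beta> t) = level (\<beta> 0)" if "0 \<le> t" "t \<le> s" for t
    using d(2)[rule_format, of t] that s by simp
  define p where "p = sub \<beta> 0 s"
  have p: "ep p" unfolding p_def using \<beta> s by (intro ep_sub) auto
  have pU: "p t \<in> U \<and> level (p t) = level (\<beta> 0)" if "t \<in> {0..1}" for t
    using \<beta>U[of "s * t"] affine_in[of t 0 s] s that by (simp add: p_def sub_apply)
  have X0: "\<beta> 0 \<in> topspace X" using ep_in[OF \<beta> 0] .
  have "elementary_homotopy n K ({0, 1/2, 1}, joinp p (cst (p 0))) ({0, 1}, p)"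
    by (rule homotopy_const_right[OF p, of U]) (use pU \<beta>U[of s] s in \<open>auto simp: flat_def p_def\<close>)
  from cls_elementary[OF this] have el: "cls (joinp p (cst (\<beta> 0))) = cls p" by (simp add: p_def)
  define r where "r = sub \<beta> s 1"
  have r: "ep r" unfolding r_def using \<beta> s by (intro ep_sub) auto
  have rp: "r 0 = p 1" "p 0 = \<beta> 0" by (simp_all add: r_def p_def)
  have sim: "sim \<beta> (joinp r p)" using sim_cut[OF s(1,2), of \<beta>] sub_01[OF ep_ext[OF \<beta>]] by (simp add: r_def p_def)
  have "cls (joinp \<beta> (cst (\<beta> 0))) = cls (joinp (joinp r p) (cst (\<beta> 0)))"
    by (rule cls_sim) (auto intro!: ep_joinp \<beta> ep_cst X0 sim_joinp sim sim_refl)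
  also have "\<dots> = cls (joinp r (joinp p (cst (\<beta> 0))))"
    using cls_assoc[OF ep_cst[OF X0] p r] rp by simp
  also have "\<dots> = cls (joinp r p)"
    by (rule cls_joinp_left[OF el]) (use p r rp X0 in \<open>auto intro!: ep_joinp ep_cst\<close>)
  also have "\<dots> = cls \<beta>" using cls_sim[OF \<beta> sim] by simp
  finally show ?thesis .
qed

text \<open>The constant path is absorbed by a short final piece: close to its end the path lies in
  a basic open about \<open>\<beta> 1\<close>, and its level is constant just before the
  end.\<close>

lemma cls_unit_left:
  assumes \<beta>: "ep \<beta>"
  shows "cls (joinp (cst (\<beta> 1)) \<beta>) = cls \<beta>"
proof -
  have 1: "(1::real) \<in> {0..1}" by simp
  obtain U where U: "basic (\<beta> 1) U" using basic_exists ep_in[OF \<beta> 1] by blast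
  obtain d1 where d1: "d1 > 0" "\<And>t. t \<in> {0..1} \<Longrightarrow> \<bar>t - 1\<bar> < d1 \<Longrightarrow> \<beta> t \<in> U"
    using ep_local[OF \<beta> 1 basicD(2)[OF U] basicD(1)[OF U]] by blast
  obtain d2 where d2: "d2 > 0" "\<And>s t. 0 \<le> s \<Longrightarrow> 0 \<le> t \<Longrightarrow> 1 - d2 < s \<Longrightarrow> s < 1 \<Longrightarrow> 1 - d2 < t \<Longrightarrow> t < 1 \<Longrightarrow>
      level (\<beta> s) = level (\<beta> t)" using ep_left_level[OF \<beta> 1] by blast
  define s where "s = 1 - min (1/2) (min d1 d2) / 2"
  have s: "0 < s" "s < 1" "1 - s < d1" "1 - s < d2" using d1 d2 by (auto simp: s_def min_def)
  define p where "p = sub \<beta> s 1"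
  have p: "ep p" unfolding p_def using \<beta> s by (intro ep_sub) auto
  have pU: "p t \<in> U" if "t \<in> {0..1}" for t
    unfolding p_def by (rule sub_in) (use d1(2) s that in auto)
  have f: "flat p 0 1"
    unfolding flat_def
  proof (intro allI impI)
    fix t u :: real assume t: "0 < t" "t < 1" and u: "0 < u" "u < 1"
    note 1 = affine_lt[OF s(2) t] and 2 = affine_lt[OF s(2) u]
    have 3: "1 - d2 < s" using s by simp
    have "level (\<beta> (s + (1 - s) * t)) = level (\<beta> (s + (1 - s) * u))"
      by (rule d2(2)) (use 1 2 3 s(1) in linarith)+
    then show "level (p t) = level (p u)" using t u by (simp add: p_def sub_apply)
  qed
  have X1: "\<beta> 1 \<in> topspace X" using ep_in[OF \<beta> 1] .
  have "elementary_homotopy n K ({0, 1/2, 1}, joinp (cst (p 1)) p) ({0, 1}, p)"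
    by (rule homotopy_const_left[OF p f, of U]) (use pU U in \<open>auto simp: p_def\<close>)
  from cls_elementary[OF this] have el: "cls (joinp (cst (\<beta> 1)) p) = cls p" by (simp add: p_def)
  define r where "r = sub \<beta> 0 s"
  have r: "ep r" unfolding r_def using \<beta> s by (intro ep_sub) auto
  have rp: "p 0 = r 1" "p 1 = \<beta> 1" by (simp_all add: r_def p_def)
  have sim: "sim \<beta> (joinp p r)" using sim_cut[OF s(1,2), of \<beta>] sub_01[OF ep_ext[OF \<beta>]] by (simp add: r_def p_def)
  have "cls (joinp (cst (\<beta> 1)) \<beta>) = cls (joinp (cst (\<beta> 1)) (joinp p r))"
    by (rule cls_sim) (auto intro!: ep_joinp \<beta> ep_cst X1 sim_joinp sim sim_refl)
  also have "\<dots> = cls (joinp (joinp (cst (\<beta> 1)) p) r)"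
    using cls_assoc[OF r p ep_cst[OF X1]] rp by simp
  also have "\<dots> = cls (joinp p r)"
    by (rule cls_joinp_right[OF el]) (use p r rp X1 in \<open>auto intro!: ep_joinp ep_cst\<close>)
  also have "\<dots> = cls \<beta>" using cls_sim[OF \<beta> sim] by simp
  finally show ?thesis .
qed

text \<open>An interval of length 0 gives a constant path, which the unit laws absorb. Bisection
  produces such intervals.\<close>

lemma cls_cut':
  assumes \<alpha>: "ep \<alpha>" and abc: "0 \<le> a" "a \<le> b" "b \<le> c" "c \<le> 1"
  shows "cls (joinp (sub \<alpha> b c) (sub \<alpha> a b)) = cls (sub \<alpha> a c)"
proof -
  consider "a < b" "b < c" | "a = b" | "b = c" using abc by linarith
  then show ?thesis
  proof cases
    case 1 then show ?thesis using cls_cut[OF \<alpha>] abc by blast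
  next
    case 2 then show ?thesis using cls_unit_right[OF ep_sub[OF \<alpha>, of b c]] abc by (simp add: sub_self)
  next
    case 3 then show ?thesis using cls_unit_left[OF ep_sub[OF \<alpha>, of a b]] abc by (simp add: sub_self)
  qed
qed

text \<open>\<open>homotopy_ray\<close> covers flat paths only, so \<open>\<alpha>\<close> is
  bisected. To follow a piece and then the ray from its end is to follow the ray from its start, and
  these relations telescope.\<close>

lemma cls_ray:
  assumes c: "is_contraction x U c" and U: "basic x U" and \<alpha>: "ep \<alpha>" and \<alpha>U: "\<And>t. t \<in> {0..1} \<Longrightarrow> \<alpha> t \<in> U"
  shows "cls (joinp (ray c (\<alpha> 1)) \<alpha>) = cls (ray c (\<alpha> 0))"
proof -
  define Q where "Q = (\<lambda>a b. 0 \<le> a \<longrightarrow> b \<le> 1 \<longrightarrow> cls (joinp (ray c (\<alpha> b)) (sub \<alpha> a b)) = cls (ray c (\<alpha> a)))"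
  have trans: "Q a d" if Q: "Q a b" "Q b d" "a \<le> b" "b \<le> d" for a b d
    unfolding Q_def
  proof (intro impI)
    assume 01: "0 \<le> a" "d \<le> 1"
    note r = ray[OF c U \<alpha>U]
    have s: "ep (sub \<alpha> a b)" "ep (sub \<alpha> b d)" using ep_sub[OF \<alpha>] 01 Q by auto
    have in01: "a \<in> {0..1}" "b \<in> {0..1}" "d \<in> {0..1}" using 01 Q by auto
    have "cls (joinp (ray c (\<alpha> d)) (sub \<alpha> a d)) = cls (joinp (ray c (\<alpha> d)) (joinp (sub \<alpha> b d) (sub \<alpha> a b)))"
      by (rule cls_joinp_left[OF cls_cut'[symmetric]])
        (use \<alpha> Q 01 s r in01 in \<open>auto intro!: ep_sub ep_joinp\<close>)
    also have "\<dots> = cls (joinp (joinp (ray c (\<alpha> d)) (sub \<alpha> b d)) (sub \<alpha> a b))"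
      using s r in01 by (intro cls_assoc) auto
    also have "\<dots> = cls (joinp (ray c (\<alpha> b)) (sub \<alpha> a b))"
    proof (rule cls_joinp_right)
      show "cls (joinp (ray c (\<alpha> d)) (sub \<alpha> b d)) = cls (ray c (\<alpha> b))"
        using Q(2) 01 Q(3) by (simp add: Q_def)
    qed (use s r in01 in \<open>auto intro!: ep_joinp\<close>)
    also have "\<dots> = cls (ray c (\<alpha> a))" using Q(1,4) 01 by (simp add: Q_def)
    finally show "cls (joinp (ray c (\<alpha> d)) (sub \<alpha> a d)) = cls (ray c (\<alpha> a))" .
  qed
  have piece: "Q a b" if ab: "a < b" "0 \<le> a \<Longrightarrow> b \<le> 1 \<Longrightarrow> flat \<alpha> a b" for a b
    unfolding Q_def
  proof (intro impI)
    assume 01: "0 \<le> a" "b \<le> 1"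
    have f: "flat (sub \<alpha> a b) 0 1"
      unfolding flat_def
    proof (intro allI impI)
      fix t u :: real assume t: "0 < t" "t < 1" and u: "0 < u" "u < 1"
      note affine_lt[OF ab(1) t] affine_lt[OF ab(1) u]
      then show "level (sub \<alpha> a b t) = level (sub \<alpha> a b u)"
        using ab(2)[OF 01] t u by (auto simp: flat_def sub_apply)
    qed
    have "elementary_homotopy n K ({0, 1/2, 1}, joinp (ray c (sub \<alpha> a b 1)) (sub \<alpha> a b)) ({0, 1}, ray c (sub \<alpha> a b 0))"
    proof (rule homotopy_ray[OF c U _ f])
      show "ep (sub \<alpha> a b)" using ep_sub[OF \<alpha>] 01 ab by simp
      show "sub \<alpha> a b t \<in> U" if "t \<in> {0..1}" for t
        by (rule sub_in) (use \<alpha>U that ab 01 in auto)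
    qed
    from cls_elementary[OF this]
    show "cls (joinp (ray c (\<alpha> b)) (sub \<alpha> a b)) = cls (ray c (\<alpha> a))" by simp
  qed
  \<comment> \<open>In the bisection \<open>x\<close> may be an end of the interval, and then one of
    the two pieces is a single point.\<close>
  have const: "Q a a" for a
    unfolding Q_def
  proof (intro impI)
    assume "0 \<le> a" "a \<le> 1"
    then show "cls (joinp (ray c (\<alpha> a)) (sub \<alpha> a a)) = cls (ray c (\<alpha> a))"
      using cls_unit_right[of "ray c (\<alpha> a)"] ray[OF c U \<alpha>U[of a]] by (simp add: sub_self)
  qed
  have "Q 0 1"
  proof (rule Bolzano[of 0 1 Q])
    fix x :: real assume "0 \<le> x" "x \<le> 1"
    then have x: "x \<in> {0..1}" by simp
    obtain d1 where d1: "d1 > 0" "\<And>s t. 0 \<le> s \<Longrightarrow> 0 \<le> t \<Longrightarrow> x - d1 < s \<Longrightarrow> s < x \<Longrightarrow> x - d1 < t \<Longrightarrow> t < x \<Longrightarrow>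
      level (\<alpha> s) = level (\<alpha> t)" using ep_left_level[OF \<alpha> x] by blast
    obtain d2 where d2: "d2 > 0" "\<And>t. x \<le> t \<Longrightarrow> t < x + d2 \<Longrightarrow> t \<le> 1 \<Longrightarrow> level (\<alpha> t) = level (\<alpha> x)"
      using ep_right_level[OF \<alpha> x] by blast
    have "Q a b" if ab: "a \<le> x" "x \<le> b" "b - a < min d1 d2" for a b
    proof -
      have "Q a x"
      proof (cases "a = x")
        case False
        have "flat \<alpha> a x" if "0 \<le> a"
          unfolding flat_def
        proof (intro allI impI)
          fix s t assume "a < s" "s < x" "a < t" "t < x"
          then show "level (\<alpha> s) = level (\<alpha> t)" using d1(2)[of s t] ab that by simp
        qed
        then show ?thesis using piece[of a x] False ab by simp
      qed (simp add: const)
      moreover have "Q x b"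
      proof (cases "b = x")
        case False
        have "flat \<alpha> x b" if "b \<le> 1"
          unfolding flat_def
        proof (intro allI impI)
          fix s t assume "x < s" "s < b" "x < t" "t < b"
          then show "level (\<alpha> s) = level (\<alpha> t)" using d2(2)[of s] d2(2)[of t] ab that by simp
        qed
        then show ?thesis using piece[of x b] False ab by simp
      qed (simp add: const)
      ultimately show ?thesis using trans ab by blast
    qed
    then show "\<exists>d>0. \<forall>a b. a \<le> x \<and> x \<le> b \<and> b - a < d \<longrightarrow> Q a b"
      using d1 d2 by (intro exI[of _ "min d1 d2"]) auto
  qed (use trans in auto)
  then show ?thesis using sub_01[OF ep_ext[OF \<alpha>]] by (simp add: Q_def)
qed

text \<open>A point is terminal in the entrance path category of a basic open about it.\<close>

lemma cls_unique:
  assumes U: "basic x U" and \<alpha>: "ep \<alpha>" "\<And>t. t \<in> {0..1} \<Longrightarrow> \<alpha> t \<in> U" "\<alpha> 1 = x"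
    and \<beta>: "ep \<beta>" "\<And>t. t \<in> {0..1} \<Longrightarrow> \<beta> t \<in> U" "\<beta> 1 = x" and "\<alpha> 0 = \<beta> 0"
  shows "cls \<alpha> = cls \<beta>"
proof -
  obtain c where c: "is_contraction x U c" using contraction_exists[OF U] by blast
  \<comment> \<open>The contraction fixes the centre, so for a path that ends there
    \<open>cls_ray\<close> says that the path is equivalent to the ray from its start.\<close>
  have "ray c x = cst x"
    using c by (intro path_eqI) (auto simp: ray_def cst_def is_contraction_def)
  then have "cls \<gamma> = cls (ray c (\<gamma> 0))" if "ep \<gamma>" "\<And>t. t \<in> {0..1} \<Longrightarrow> \<gamma> t \<in> U" "\<gamma> 1 = x" for \<gamma>
    using cls_ray[OF c U that(1,2)] cls_unit_left[OF that(1)] that(3) by simp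
  then show ?thesis using assms by metis
qed

lemma path_to_center:
  assumes U: "basic x U" and y: "y \<in> U"
  obtains \<alpha> where "ep \<alpha>" "\<And>t. t \<in> {0..1} \<Longrightarrow> \<alpha> t \<in> U" "\<alpha> 0 = y" "\<alpha> 1 = x"
proof -
  obtain c where c: "is_contraction x U c" using contraction_exists[OF U] by blast
  show thesis using that ray[OF c U y] by blast
qed

subsection \<open>Objects and arrows of the entrance path category\<close>

lemma entrance_const: "x \<in> topspace X \<Longrightarrow> entrance_path K (const_path x)"
  using ep_cst[of x] by (auto simp: const_path_def cst_def entrance_01[unfolded] flat_def)

lemma Arr_Ent: "A \<in> Arr (Ent n K) \<longleftrightarrow> (\<exists>\<alpha>. ep \<alpha> \<and> A = cls \<alpha>)"
proof
  assume "A \<in> Arr (Ent n K)"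
  then obtain p where "entrance_path K p" "A = path_class n K p" by (auto simp: Ent_def)
  then show "\<exists>\<alpha>. ep \<alpha> \<and> A = cls \<alpha>" using entrance_ep cls_eq' by blast
next
  assume "\<exists>\<alpha>. ep \<alpha> \<and> A = cls \<alpha>"
  then obtain \<alpha> P where "A = cls \<alpha>" "entrance_path K (P, \<alpha>)" using ep_entrance by blast
  then show "A \<in> Arr (Ent n K)" using cls_eq[of P \<alpha>] by (auto simp: Ent_def)
qed

lemma in_cls:
  assumes "ep \<alpha>" "p \<in> cls \<alpha>"
  shows "entrance_path K p" "snd p 0 = \<alpha> 0" "snd p 1 = \<alpha> 1" "cls (snd p) = cls \<alpha>" "ep (snd p)"
proof -
  obtain P where P: "entrance_path K (P, \<alpha>)" using ep_entrance assms by blast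
  have *: "eqv (P, \<alpha>) p" using assms(2) cls_eq[OF P] by (auto simp: path_class_def)
  show en: "entrance_path K p" using eqv_entrance[OF * P] .
  then show "cls (snd p) = cls \<alpha>" using path_class_eqI[OF *] cls_eq[OF P] cls_eq' by metis
  show "snd p 0 = \<alpha> 0" "snd p 1 = \<alpha> 1" "ep (snd p)" using eqv_joinp[OF *] assms(1) by auto
qed

lemma cls_nonempty: "ep \<alpha> \<Longrightarrow> \<exists>P. (P, \<alpha>) \<in> cls \<alpha>"
proof -
  assume "ep \<alpha>"
  then obtain P where "entrance_path K (P, \<alpha>)" using ep_entrance by blast
  from cls_eq[OF this] show ?thesis by (auto simp: path_class_def)
qed

lemma Dom_Ent: "ep \<alpha> \<Longrightarrow> Dom (Ent n K) (cls \<alpha>) = \<alpha> 0"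
proof -
  assume \<alpha>: "ep \<alpha>"
  have "path_start p = \<alpha> 0" if "p \<in> cls \<alpha>" for p
    using in_cls(2)[OF \<alpha> that] by (simp add: path_start_def)
  then have "path_start ` cls \<alpha> \<subseteq> {\<alpha> 0}" by auto
  moreover have "path_start ` cls \<alpha> \<noteq> {}" using cls_nonempty[OF \<alpha>] by auto
  ultimately have "path_start ` cls \<alpha> = {\<alpha> 0}" by (simp add: subset_singleton_iff)
  then show ?thesis by (simp add: Ent_def)
qed

lemma Cod_Ent: "ep \<alpha> \<Longrightarrow> Cod (Ent n K) (cls \<alpha>) = \<alpha> 1"
proof -
  assume \<alpha>: "ep \<alpha>"
  have "path_end p = \<alpha> 1" if "p \<in> cls \<alpha>" for p
    using in_cls(3)[OF \<alpha> that] by (simp add: path_end_def)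
  then have "path_end ` cls \<alpha> \<subseteq> {\<alpha> 1}" by auto
  moreover have "path_end ` cls \<alpha> \<noteq> {}" using cls_nonempty[OF \<alpha>] by auto
  ultimately have "path_end ` cls \<alpha> = {\<alpha> 1}" by (simp add: subset_singleton_iff)
  then show ?thesis by (simp add: Ent_def)
qed

lemma hom_Ent: "A \<in> hom (Ent n K) x y \<longleftrightarrow> (\<exists>\<alpha>. ep \<alpha> \<and> A = cls \<alpha> \<and> \<alpha> 0 = x \<and> \<alpha> 1 = y)"
  unfolding hom_iff Arr_Ent using Dom_Ent Cod_Ent by auto

lemma Obj_Ent [simp]: "Obj (Ent n K) = topspace X"
  by (simp add: Ent_def)

lemma Ident_Ent: "x \<in> topspace X \<Longrightarrow> Ident (Ent n K) x = cls (cst x)"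
  using cls_eq'[OF entrance_const] by (simp add: Ent_def const_path_def cst_def)

text \<open>All concatenations of representatives are equivalent, so the union in the definition of
  \<open>Comp\<close> is a single class.\<close>

lemma Comp_Ent:
  assumes "ep \<alpha>" "ep \<beta>" "\<beta> 0 = \<alpha> 1"
  shows "Comp (Ent n K) (cls \<beta>) (cls \<alpha>) = cls (joinp \<beta> \<alpha>)"
proof -
  have "path_class n K (concat_path q p) = cls (joinp \<beta> \<alpha>)" if "p \<in> cls \<alpha>" "q \<in> cls \<beta>" for p q
  proof -
    note p = in_cls[OF assms(1) that(1)] and q = in_cls[OF assms(2) that(2)]
    have "entrance_path K (concat_path q p)"
      by (rule entrance_concat) (use p q assms in \<open>auto simp: path_start_def path_end_def\<close>)
    then have "path_class n K (concat_path q p) = cls (joinp (snd q) (snd p))" using cls_eq' by simp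
    also have "\<dots> = cls (joinp (snd q) \<alpha>)" using p q assms by (intro cls_joinp_left) auto
    also have "\<dots> = cls (joinp \<beta> \<alpha>)" using q assms by (intro cls_joinp_right) auto
    finally show ?thesis .
  qed
  then have "{path_class n K (concat_path q p) | p q. p \<in> cls \<alpha> \<and> q \<in> cls \<beta>} = {cls (joinp \<beta> \<alpha>)}"
    using cls_nonempty[OF assms(1)] cls_nonempty[OF assms(2)] by blast
  then show ?thesis by (simp add: Ent_def)
qed

lemma is_category_Ent: "is_category (Ent n K)"
  unfolding is_category_def
proof (intro conjI ballI impI)
  fix f assume "f \<in> Arr (Ent n K)"
  then obtain \<alpha> where \<alpha>: "ep \<alpha>" "f = cls \<alpha>" by (auto simp: Arr_Ent)
  have X: "\<alpha> 0 \<in> topspace X" "\<alpha> 1 \<in> topspace X" using ep_in[OF \<alpha>(1)] by auto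
  then show "Dom (Ent n K) f \<in> Obj (Ent n K)" "Cod (Ent n K) f \<in> Obj (Ent n K)"
    using \<alpha> by (simp_all add: Dom_Ent Cod_Ent)
  show "Comp (Ent n K) f (Ident (Ent n K) (Dom (Ent n K) f)) = f"
    "Comp (Ent n K) (Ident (Ent n K) (Cod (Ent n K) f)) f = f"
    using \<alpha> X by (simp_all add: Dom_Ent Cod_Ent Ident_Ent Comp_Ent ep_cst cls_unit_left cls_unit_right)
next
  fix x assume "x \<in> Obj (Ent n K)"
  then show "Ident (Ent n K) x \<in> hom (Ent n K) x x"
    using ep_cst by (auto simp: hom_Ent Ident_Ent intro!: exI[of _ "cst x"])
next
  fix f g assume "f \<in> Arr (Ent n K)" "g \<in> Arr (Ent n K)" "Dom (Ent n K) g = Cod (Ent n K) f"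
  then obtain \<alpha> \<beta> where ab: "ep \<alpha>" "f = cls \<alpha>" "ep \<beta>" "g = cls \<beta>" "\<beta> 0 = \<alpha> 1"
    by (auto simp: Arr_Ent Dom_Ent Cod_Ent)
  have j: "ep (joinp \<beta> \<alpha>)" using ep_joinp ab by blast
  then show "Comp (Ent n K) g f \<in> hom (Ent n K) (Dom (Ent n K) f) (Cod (Ent n K) g)"
    using ab by (auto simp: hom_Ent Comp_Ent Dom_Ent Cod_Ent intro!: exI[of _ "joinp \<beta> \<alpha>"])
  fix h assume "h \<in> Arr (Ent n K)" "Dom (Ent n K) h = Cod (Ent n K) g"
  then obtain \<gamma> where c: "ep \<gamma>" "h = cls \<gamma>" "\<gamma> 0 = \<beta> 1"
    using ab by (auto simp: Arr_Ent Dom_Ent Cod_Ent)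
  have j': "ep (joinp \<gamma> \<beta>)" using ep_joinp ab c by blast
  show "Comp (Ent n K) h (Comp (Ent n K) g f) = Comp (Ent n K) (Comp (Ent n K) h g) f"
    using ab c j j' by (simp add: Comp_Ent cls_assoc)
qed

end

section \<open>Germs of constructible cosheaves\<close>

lemma inclusion_poset_simps [simp]:
  "Obj (inclusion_poset \<U>) = \<U>" "(U, V) \<in> Arr (inclusion_poset \<U>) \<longleftrightarrow> U \<in> \<U> \<and> V \<in> \<U> \<and> U \<subseteq> V"
  "Dom (inclusion_poset \<U>) = fst" "Cod (inclusion_poset \<U>) = snd" "Ident (inclusion_poset \<U>) U = (U, U)"
  "Comp (inclusion_poset \<U>) g f = (fst f, snd g)"
  by (simp_all add: inclusion_poset_def)

lemma is_category_inclusion_poset: "is_category (inclusion_poset \<U>)"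
  unfolding is_category_def by (auto simp: hom_iff; blast)

lemma hom_Open: "f \<in> hom (Open Y) U V \<longleftrightarrow> f = (U, V) \<and> openin Y U \<and> openin Y V \<and> U \<subseteq> V"
  by (cases f) (auto simp: Open_def hom_iff)

lemma Obj_Open [simp]: "Obj (Open Y) = {U. openin Y U}"
  by (simp add: Open_def)

lemma is_category_Open: "is_category (Open Y)"
  by (simp add: Open_def is_category_inclusion_poset)

lemma Open_functor:
  assumes F: "is_functor (Open Y) D F"
  shows "openin Y U \<Longrightarrow> Omap F U \<in> Obj D"
    "openin Y U \<Longrightarrow> openin Y V \<Longrightarrow> U \<subseteq> V \<Longrightarrow> Amap F (U, V) \<in> hom D (Omap F U) (Omap F V)"
    "openin Y U \<Longrightarrow> Amap F (U, U) = Ident D (Omap F U)"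
    "openin Y U \<Longrightarrow> openin Y V \<Longrightarrow> openin Y W \<Longrightarrow> U \<subseteq> V \<Longrightarrow> V \<subseteq> W \<Longrightarrow>
      Comp D (Amap F (V, W)) (Amap F (U, V)) = Amap F (U, W)"
proof -
  show "openin Y U \<Longrightarrow> Omap F U \<in> Obj D" using functorD(5)[OF F, of U] by simp
  show "openin Y U \<Longrightarrow> openin Y V \<Longrightarrow> U \<subseteq> V \<Longrightarrow> Amap F (U, V) \<in> hom D (Omap F U) (Omap F V)"
    using functorD(6)[OF F, of "(U, V)" U V] by (simp add: hom_Open)
  show "openin Y U \<Longrightarrow> Amap F (U, U) = Ident D (Omap F U)"
    using functorD(7)[OF F, of U] by (simp add: Open_def)
  show "openin Y U \<Longrightarrow> openin Y V \<Longrightarrow> openin Y W \<Longrightarrow> U \<subseteq> V \<Longrightarrow> V \<subseteq> W \<Longrightarrow>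
      Comp D (Amap F (V, W)) (Amap F (U, V)) = Amap F (U, W)"
    using functorD(8)[OF F, of "(U, V)" U V "(V, W)" W] by (simp add: hom_Open) (simp add: Open_def)
qed

locale strat_cat = strat n K + Om: category \<Omega>
  for n :: nat and K :: "'a fspace" and \<Omega> :: "('o, 'm) cat"
begin

abbreviation comp (infixl "\<odot>" 70) where "g \<odot> f \<equiv> Comp \<Omega> g f"

text \<open>Germs and transport are built from functoriality and constructibility; the cosheaf
  condition enters with gluing.\<close>

definition constr :: "('a set, 'a set \<times> 'a set, 'o, 'm) func \<Rightarrow> bool" where
  "constr F \<longleftrightarrow> is_functor (Open X) \<Omega> F \<and> is_constructible n K \<Omega> F"

definition csh :: "('a set, 'a set \<times> 'a set, 'o, 'm) func \<Rightarrow> bool" where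
  "csh F \<longleftrightarrow> is_cosheaf X \<Omega> F \<and> is_constructible n K \<Omega> F"

lemma csh_constr: "csh F \<Longrightarrow> constr F"
  by (simp add: csh_def constr_def is_cosheaf_def)

lemma constr_functor: "constr F \<Longrightarrow> is_functor (Open X) \<Omega> F"
  by (simp add: constr_def)

lemma constr_iso:
  assumes F: "constr F" and "basic x W" "basic x V" "W \<subseteq> V"
  shows "is_iso \<Omega> (Amap F (W, V))"
proof -
  obtain S where "S \<in> strata K" "x \<in> S" using point_in_stratum basicD(4)[OF assms(2)] by blast
  then show ?thesis
    using assms unfolding constr_def is_constructible_def stratum_basic_open_def by blast
qed

section \<open>Costalks and germs\<close>

definition nbh :: "'a \<Rightarrow> 'a set" where "nbh x = (SOME U. basic x U)"

lemma nbh: "x \<in> topspace X \<Longrightarrow> basic x (nbh x)"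
  unfolding nbh_def using basic_exists by (rule someI_ex)

text \<open>A costalk is a limit over neighbourhoods in general. The basic opens about
  \<open>x\<close> form a neighbourhood base with invertible inclusions, so one value represents
  it.\<close>

definition costalk :: "('a set, 'a set \<times> 'a set, 'o, 'm) func \<Rightarrow> 'a \<Rightarrow> 'o" where
  "costalk F x = Omap F (nbh x)"

text \<open>Back from the costalk to a smaller \<open>W\<close> by inversion, then on to the value
  at \<open>U\<close>. The intermediate \<open>W\<close> is there because \<open>U\<close> and
  \<open>nbh x\<close> need not be nested.\<close>

definition germ :: "('a set, 'a set \<times> 'a set, 'o, 'm) func \<Rightarrow> 'a set \<Rightarrow> 'a \<Rightarrow> 'm" where
  "germ F U x = (let W = (SOME W. basic x W \<and> W \<subseteq> U \<inter> nbh x) in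
     Amap F (W, U) \<odot> Om.inv_arr (Amap F (W, nbh x)))"

text \<open>Independence of the choice: two candidates for \<open>W\<close> are both compared with a
  basic open inside their intersection.\<close>

lemma germ_eq:
  assumes F: "constr F" and U: "openin X U" and W: "basic x W" "W \<subseteq> U" "W \<subseteq> nbh x"
  shows "germ F U x = Amap F (W, U) \<odot> Om.inv_arr (Amap F (W, nbh x))"
proof -
  note fF = constr_functor[OF F]
  define W0 where "W0 = (SOME W. basic x W \<and> W \<subseteq> U \<inter> nbh x)"
  have "basic x W0 \<and> W0 \<subseteq> U \<inter> nbh x" unfolding W0_def by (rule someI[of _ W]) (use W in auto)
  then have W0: "basic x W0" "W0 \<subseteq> U" "W0 \<subseteq> nbh x" by auto
  have N: "basic x (nbh x)" using nbh basicD(4)[OF W(1)] .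
  note oN = basicD(2)[OF N]
  \<comment> \<open>Both sides agree after precomposition with the map from the value at
    \<open>V'\<close> to the costalk, which is invertible.\<close>
  have shrink: "Amap F (V', U) \<odot> Om.inv_arr (Amap F (V', nbh x)) = Amap F (V, U) \<odot> Om.inv_arr (Amap F (V, nbh x))"
    if V: "basic x V" "V \<subseteq> U" "V \<subseteq> nbh x" and V': "basic x V'" "V' \<subseteq> V" for V V'
  proof -
    note o = basicD(2)[OF V(1)] basicD(2)[OF V'(1)]
    note h = Open_functor(2)[OF fF o(2) oN] Open_functor(2)[OF fF o(1) oN] Open_functor(2)[OF fF o(2,1) V'(2)]
      Open_functor(2)[OF fF o(1) U V(2)] Open_functor(2)[OF fF o(2) U]
    have h1: "Amap F (V', nbh x) \<in> hom \<Omega> (Omap F V') (costalk F x)" and h2: "Amap F (V, nbh x) \<in> hom \<Omega> (Omap F V) (costalk F x)"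
      and h5: "Amap F (V', U) \<in> hom \<Omega> (Omap F V') (Omap F U)"
      using h V V' by (auto simp: costalk_def)
    have i1: "is_iso \<Omega> (Amap F (V', nbh x))" using constr_iso[OF F V'(1) N] V V' by blast
    have i2: "is_iso \<Omega> (Amap F (V, nbh x))" using constr_iso[OF F V(1) N] V by blast
    note j1 = Om.inv_arr[OF i1 h1] and j2 = Om.inv_arr[OF i2 h2]
    have "(Amap F (V, U) \<odot> Om.inv_arr (Amap F (V, nbh x))) \<odot> Amap F (V', nbh x) =
        Amap F (V, U) \<odot> (Om.inv_arr (Amap F (V, nbh x)) \<odot> Amap F (V', nbh x))"
      by (rule Om.comp_assoc[OF h1 j2(1) h(4)])
    also have "Amap F (V', nbh x) = Amap F (V, nbh x) \<odot> Amap F (V', V)"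
      using Open_functor(4)[OF fF o(2,1) oN V'(2) V(3)] by simp
    also have "Om.inv_arr (Amap F (V, nbh x)) \<odot> (Amap F (V, nbh x) \<odot> Amap F (V', V)) = Amap F (V', V)"
      using Om.comp_assoc[OF h(3) h2 j2(1)] j2 Om.comp_ident_left[OF h(3)] by simp
    also have "Amap F (V, U) \<odot> Amap F (V', V) = Amap F (V', U)"
      using Open_functor(4)[OF fF o(2,1) U V'(2) V(2)] .
    also have "\<dots> = (Amap F (V', U) \<odot> Om.inv_arr (Amap F (V', nbh x))) \<odot> Amap F (V', nbh x)"
      using Om.comp_assoc[OF h1 j1(1) h5] j1 Om.comp_ident_right[OF h5] by simp
    finally have "(Amap F (V, U) \<odot> Om.inv_arr (Amap F (V, nbh x))) \<odot> Amap F (V', nbh x) =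
        (Amap F (V', U) \<odot> Om.inv_arr (Amap F (V', nbh x))) \<odot> Amap F (V', nbh x)"
      using Open_functor(4)[OF fF o(2,1) oN V'(2) V(3)] by simp
    from Om.iso_cancel_right[OF i1 h1 Om.comp_hom[OF j2(1) h(4)] Om.comp_hom[OF j1(1) h5] this]
    show ?thesis by simp
  qed
  obtain W' where W': "basic x W'" "W' \<subseteq> W \<inter> W0"
    using basic_within[OF openin_Int[OF basicD(2)[OF W(1)] basicD(2)[OF W0(1)]], of x] basicD(1)[OF W(1)] basicD(1)[OF W0(1)] by blast
  have "germ F U x = Amap F (W0, U) \<odot> Om.inv_arr (Amap F (W0, nbh x))"
    by (simp add: germ_def Let_def W0_def)
  then show ?thesis using shrink[OF W W'(1)] shrink[OF W0 W'(1)] W'(2) by simp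
qed

lemma germ_nbhd:
  assumes U: "openin X U" "x \<in> U"
  obtains W where "basic x W" "W \<subseteq> U" "W \<subseteq> nbh x"
proof -
  have "x \<in> topspace X" using U openin_subset by blast
  note N = nbh[OF this]
  obtain W where "basic x W" "W \<subseteq> U \<inter> nbh x"
    using basic_within[OF openin_Int[OF U(1) basicD(2)[OF N]]] U basicD(1)[OF N] by blast
  then show thesis using that by blast
qed

lemma germ_hom:
  assumes F: "constr F" and U: "openin X U" "x \<in> U"
  shows "germ F U x \<in> hom \<Omega> (costalk F x) (Omap F U)"
proof -
  note fF = constr_functor[OF F]
  obtain W where W: "basic x W" "W \<subseteq> U" "W \<subseteq> nbh x" using germ_nbhd[OF U] by blast
  have N: "basic x (nbh x)" using nbh basicD(4)[OF W(1)] .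
  note h = Open_functor(2)[OF fF basicD(2)[OF W(1)] U(1) W(2)] Open_functor(2)[OF fF basicD(2)[OF W(1)] basicD(2)[OF N] W(3)]
  show ?thesis
    unfolding germ_eq[OF F U(1) W] costalk_def
    using Om.comp_hom[OF Om.inv_arr(1)[OF constr_iso[OF F W(1) N W(3)] h(2)] h(1)] .
qed

lemma germ_extend:
  assumes F: "constr F" and U: "openin X U" "x \<in> U" and V: "openin X V" "U \<subseteq> V"
  shows "Amap F (U, V) \<odot> germ F U x = germ F V x"
proof -
  note fF = constr_functor[OF F]
  obtain W where W: "basic x W" "W \<subseteq> U" "W \<subseteq> nbh x" using germ_nbhd[OF U] by blast
  have N: "basic x (nbh x)" using nbh basicD(4)[OF W(1)] .
  note oW = basicD(2)[OF W(1)]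
  note h = Open_functor(2)[OF fF oW U(1) W(2)] Open_functor(2)[OF fF oW basicD(2)[OF N] W(3)]
    Open_functor(2)[OF fF U(1) V]
  note j = Om.inv_arr(1)[OF constr_iso[OF F W(1) N W(3)] h(2)]
  have "W \<subseteq> V" using W V by blast
  then show ?thesis
    unfolding germ_eq[OF F U(1) W] germ_eq[OF F V(1) W(1) \<open>W \<subseteq> V\<close> W(3)]
    using Om.comp_assoc[OF j h(1) h(3)] Open_functor(4)[OF fF oW U(1) V(1) W(2) V(2)] by simp
qed

lemma germ_iso:
  assumes F: "constr F" and U: "basic x U"
  shows "is_iso \<Omega> (germ F U x)"
proof -
  note fF = constr_functor[OF F]
  obtain W where W: "basic x W" "W \<subseteq> U" "W \<subseteq> nbh x" using germ_nbhd[OF basicD(2,1)[OF U]] by blast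
  have N: "basic x (nbh x)" using nbh basicD(4)[OF W(1)] .
  note h = Open_functor(2)[OF fF basicD(2)[OF W(1)] basicD(2)[OF U] W(2)] Open_functor(2)[OF fF basicD(2)[OF W(1)] basicD(2)[OF N] W(3)]
  note i = constr_iso[OF F W(1) N W(3)]
  show ?thesis
    unfolding germ_eq[OF F basicD(2)[OF U] W]
    by (rule Om.comp_iso[OF Om.inv_arr_iso[OF i h(2)] Om.inv_arr(1)[OF i h(2)] constr_iso[OF F W(1) U W(2)] h(1)])
qed

lemma germ_self:
  assumes F: "constr F" and x: "x \<in> topspace X"
  shows "germ F (nbh x) x = Ident \<Omega> (costalk F x)"
proof -
  note fF = constr_functor[OF F] and N = nbh[OF x]
  note h = Open_functor(2)[OF fF basicD(2)[OF N] basicD(2)[OF N] order_refl]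
  show ?thesis
    unfolding germ_eq[OF F basicD(2)[OF N] N order_refl order_refl] costalk_def
    by (rule Om.inv_arr(3)[OF constr_iso[OF F N N order_refl] h])
qed

lemma costalk_obj: "constr F \<Longrightarrow> x \<in> topspace X \<Longrightarrow> costalk F x \<in> Obj \<Omega>"
  unfolding costalk_def using Open_functor(1)[OF constr_functor] basicD(2)[OF nbh] by blast

lemma nat_trans_Open:
  assumes \<tau>: "is_nat_trans (Open X) \<Omega> F G \<tau>"
  shows "openin X U \<Longrightarrow> \<tau> U \<in> hom \<Omega> (Omap F U) (Omap G U)"
    "openin X U \<Longrightarrow> openin X V \<Longrightarrow> U \<subseteq> V \<Longrightarrow> \<tau> V \<odot> Amap F (U, V) = Amap G (U, V) \<odot> \<tau> U"
  using nat_transD(4)[OF \<tau>, of U] nat_transD(5)[OF \<tau>, of "(U, V)" U V] by (simp_all add: hom_Open)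

text \<open>It suffices to compare after precomposition with the invertible map from the value at
  \<open>W\<close> to the costalk; there naturality of \<open>\<tau>\<close> for \<open>W\<close> in
  \<open>U\<close> and for \<open>W\<close> in \<open>nbh x\<close> applies.\<close>

lemma germ_natural:
  assumes F: "constr F" and G: "constr G" and \<tau>: "is_nat_trans (Open X) \<Omega> F G \<tau>"
    and U: "openin X U" "x \<in> U"
  shows "\<tau> U \<odot> germ F U x = germ G U x \<odot> \<tau> (nbh x)"
proof -
  note fF = constr_functor[OF F] and fG = constr_functor[OF G]
  obtain W where W: "basic x W" "W \<subseteq> U" "W \<subseteq> nbh x" using germ_nbhd[OF U] by blast
  have N: "basic x (nbh x)" using nbh basicD(4)[OF W(1)] .
  note oW = basicD(2)[OF W(1)] and oN = basicD(2)[OF N]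
  note t = nat_trans_Open(1)[OF \<tau>]
  note h = Open_functor(2)[OF fF oW U(1) W(2)] Open_functor(2)[OF fF oW oN W(3)]
  note h' = Open_functor(2)[OF fG oW U(1) W(2)] Open_functor(2)[OF fG oW oN W(3)]
  note iF = constr_iso[OF F W(1) N W(3)] and iG = constr_iso[OF G W(1) N W(3)]
  note j = Om.inv_arr[OF iF h(2)] and j' = Om.inv_arr[OF iG h'(2)]
  have gF: "germ F U x \<odot> Amap F (W, nbh x) = Amap F (W, U)"
    unfolding germ_eq[OF F U(1) W] using Om.comp_assoc[OF h(2) j(1) h(1)] j Om.comp_ident_right[OF h(1)] by simp
  have gG: "germ G U x \<odot> Amap G (W, nbh x) = Amap G (W, U)"
    unfolding germ_eq[OF G U(1) W] using Om.comp_assoc[OF h'(2) j'(1) h'(1)] j' Om.comp_ident_right[OF h'(1)] by simp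
  note g = germ_hom[OF F U, unfolded costalk_def] and g' = germ_hom[OF G U, unfolded costalk_def]
  have "(\<tau> U \<odot> germ F U x) \<odot> Amap F (W, nbh x) = \<tau> U \<odot> Amap F (W, U)"
    using Om.comp_assoc[OF h(2) g t[OF U(1)]] gF by simp
  also have "\<dots> = Amap G (W, U) \<odot> \<tau> W" using nat_trans_Open(2)[OF \<tau> oW U(1) W(2)] .
  also have "\<dots> = germ G U x \<odot> (Amap G (W, nbh x) \<odot> \<tau> W)"
    using Om.comp_assoc[OF t[OF oW] h'(2) g'] gG by simp
  also have "\<dots> = germ G U x \<odot> (\<tau> (nbh x) \<odot> Amap F (W, nbh x))"
    using nat_trans_Open(2)[OF \<tau> oW oN W(3)] by simp
  also have "\<dots> = (germ G U x \<odot> \<tau> (nbh x)) \<odot> Amap F (W, nbh x)"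
    using Om.comp_assoc[OF h(2) t[OF oN] g'] by simp
  finally show ?thesis
    by (rule Om.iso_cancel_right[OF iF h(2) Om.comp_hom[OF g t[OF U(1)]] Om.comp_hom[OF t[OF oN] g']])
qed

text \<open>The sheaf property of the maps from \<open>F\<close> to a fixed \<open>z\<close>. A
  family that is closed under smaller opens is a complete cover by itself, as it contains the
  intersections of its members.\<close>

lemma cosheaf_glue:
  assumes F: "csh F" and op: "\<And>V. V \<in> \<U> \<Longrightarrow> openin X V"
    and down: "\<And>V W. V \<in> \<U> \<Longrightarrow> openin X W \<Longrightarrow> W \<subseteq> V \<Longrightarrow> W \<in> \<U>" and U: "\<Union>\<U> = U"
    and z: "z \<in> Obj \<Omega>"
    and g: "\<And>V. V \<in> \<U> \<Longrightarrow> g V \<in> hom \<Omega> (Omap F V) z"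
    and gc: "\<And>V W. V \<in> \<U> \<Longrightarrow> W \<in> \<U> \<Longrightarrow> V \<subseteq> W \<Longrightarrow> g W \<odot> Amap F (V, W) = g V"
  shows "\<exists>!m. m \<in> hom \<Omega> (Omap F U) z \<and> (\<forall>V \<in> \<U>. m \<odot> Amap F (V, U) = g V)"
proof -
  have oU: "openin X U" using op U openin_Union by blast
  have "complete_cover X U \<U>"
    unfolding complete_cover_def
  proof (intro conjI ballI op U)
    fix V W assume VW: "V \<in> \<U>" "W \<in> \<U>"
    then have "V \<inter> W \<in> \<U>" using down[of V "V \<inter> W"] op openin_Int by blast
    then show "\<exists>\<V>\<subseteq>\<U>. \<Union>\<V> = V \<inter> W" by (intro exI[of _ "{V \<inter> W}"]) simp
  qed
  then obtain c \<kappa> i where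
    col: "is_colimit (inclusion_poset \<U>) \<Omega> (restrict_functor F (inclusion_poset \<U>)) c \<kappa>"
    and i: "i \<in> hom \<Omega> c (Omap F U)" "\<And>V. V \<in> \<U> \<Longrightarrow> i \<odot> \<kappa> V = Amap F (V, U)" "is_iso \<Omega> i"
    using F oU unfolding csh_def is_cosheaf_def by meson
  have k: "\<kappa> V \<in> hom \<Omega> (Omap F V) c" if "V \<in> \<U>" for V
    using col that unfolding is_colimit_def is_cocone_def by (simp add: restrict_functor_def)
  have "is_cocone (inclusion_poset \<U>) \<Omega> (restrict_functor F (inclusion_poset \<U>)) z g"
    unfolding is_cocone_def using z g gc by (auto simp: restrict_functor_def)
  then have ex: "\<exists>!m. m \<in> hom \<Omega> c z \<and> (\<forall>V \<in> \<U>. m \<odot> \<kappa> V = g V)"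
    using col unfolding is_colimit_def by simp
  then obtain m where m: "m \<in> hom \<Omega> c z" "\<And>V. V \<in> \<U> \<Longrightarrow> m \<odot> \<kappa> V = g V" by blast
  note j = Om.inv_arr[OF i(3,1)]
  show ?thesis
  proof (rule ex1I[of _ "m \<odot> Om.inv_arr i"])
    have "(m \<odot> Om.inv_arr i) \<odot> Amap F (V, U) = g V" if V: "V \<in> \<U>" for V
    proof -
      have ih: "i \<odot> \<kappa> V \<in> hom \<Omega> (Omap F V) (Omap F U)" using i(1) k[OF V] by blast
      have "(m \<odot> Om.inv_arr i) \<odot> Amap F (V, U) = m \<odot> (Om.inv_arr i \<odot> (i \<odot> \<kappa> V))"
        using Om.comp_assoc[OF ih j(1) m(1)] i(2)[OF V] by simp
      also have "\<dots> = g V"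
        using Om.comp_assoc[OF k[OF V] i(1) j(1)] j Om.comp_ident_left[OF k[OF V]] m(2)[OF V] by simp
      finally show ?thesis .
    qed
    then show "m \<odot> Om.inv_arr i \<in> hom \<Omega> (Omap F U) z \<and> (\<forall>V \<in> \<U>. (m \<odot> Om.inv_arr i) \<odot> Amap F (V, U) = g V)"
      using m j by blast
    fix m' assume m': "m' \<in> hom \<Omega> (Omap F U) z \<and> (\<forall>V \<in> \<U>. m' \<odot> Amap F (V, U) = g V)"
    have "m' \<odot> i \<in> hom \<Omega> c z \<and> (\<forall>V \<in> \<U>. (m' \<odot> i) \<odot> \<kappa> V = g V)"
      using m' i Om.comp_assoc[OF k i(1)] by auto
    then have "m' \<odot> i = m" using ex m by blast
    then have "m \<odot> Om.inv_arr i = m' \<odot> (i \<odot> Om.inv_arr i)" using Om.comp_assoc[OF j(1) i(1)] m' by auto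
    then show "m' = m \<odot> Om.inv_arr i" using j m' Om.comp_ident_right[of m' "Omap F U" z] by simp
  qed
qed

text \<open>The opens on which \<open>g\<close> and \<open>g'\<close> agree form a family closed
  under smaller opens. It covers \<open>U\<close>, because over a basic open the germ at the centre
  is invertible.\<close>

lemma germ_joint_epi:
  assumes F: "csh F" and U: "openin X U" and g: "g \<in> hom \<Omega> (Omap F U) z" "g' \<in> hom \<Omega> (Omap F U) z"
    and eq: "\<And>x. x \<in> U \<Longrightarrow> g \<odot> germ F U x = g' \<odot> germ F U x"
  shows "g = g'"
proof -
  note cF = csh_constr[OF F] note fF = constr_functor[OF cF]
  define \<U> where "\<U> = {V. openin X V \<and> V \<subseteq> U \<and> g \<odot> Amap F (V, U) = g' \<odot> Amap F (V, U)}"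
  have down: "W \<in> \<U>" if "V \<in> \<U>" "openin X W" "W \<subseteq> V" for V W
  proof -
    have V: "openin X V" "V \<subseteq> U" "g \<odot> Amap F (V, U) = g' \<odot> Amap F (V, U)" using that by (auto simp: \<U>_def)
    note h = Open_functor(2)[OF fF that(2) V(1) that(3)] Open_functor(2)[OF fF V(1) U V(2)]
    have "g \<odot> Amap F (W, U) = g' \<odot> Amap F (W, U)"
      using Om.comp_assoc[OF h g(1)] Om.comp_assoc[OF h g(2)] V(3)
        Open_functor(4)[OF fF that(2) V(1) U that(3) V(2)] by simp
    then show ?thesis using that V by (auto simp: \<U>_def)
  qed
  have "U \<subseteq> \<Union>\<U>"
  proof
    fix x assume x: "x \<in> U"
    obtain W where W: "basic x W" "W \<subseteq> U" using basic_within[OF U x] by blast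
    note oW = basicD(2)[OF W(1)] and xW = basicD(1)[OF W(1)]
    note h = germ_hom[OF cF oW xW] Open_functor(2)[OF fF oW U W(2)]
    have "(g \<odot> Amap F (W, U)) \<odot> germ F W x = (g' \<odot> Amap F (W, U)) \<odot> germ F W x"
      using Om.comp_assoc[OF h g(1)] Om.comp_assoc[OF h g(2)] germ_extend[OF cF oW xW U W(2)] eq[OF x] by simp
    then have "g \<odot> Amap F (W, U) = g' \<odot> Amap F (W, U)"
      by (rule Om.iso_cancel_right[OF germ_iso[OF cF W(1)] h(1) Om.comp_hom[OF h(2) g(1)] Om.comp_hom[OF h(2) g(2)]])
    then show "x \<in> \<Union>\<U>" using W oW xW by (auto simp: \<U>_def)
  qed
  then have UU: "\<Union>\<U> = U" by (auto simp: \<U>_def)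
  have "\<exists>!m. m \<in> hom \<Omega> (Omap F U) z \<and> (\<forall>V \<in> \<U>. m \<odot> Amap F (V, U) = g \<odot> Amap F (V, U))"
  proof (rule cosheaf_glue[OF F _ down UU])
    show "z \<in> Obj \<Omega>" using Om.hom_obj[OF g(1)] by blast
    show "openin X V" if "V \<in> \<U>" for V using that by (simp add: \<U>_def)
    show "g \<odot> Amap F (V, U) \<in> hom \<Omega> (Omap F V) z" if "V \<in> \<U>" for V
      using that g Open_functor(2)[OF fF _ U, of V] by (auto simp: \<U>_def)
    fix V W assume VW: "V \<in> \<U>" "W \<in> \<U>" "V \<subseteq> W"
    then have o: "openin X V" "openin X W" "W \<subseteq> U" by (auto simp: \<U>_def)
    show "(g \<odot> Amap F (W, U)) \<odot> Amap F (V, W) = g \<odot> Amap F (V, U)"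
      using Om.comp_assoc[OF Open_functor(2)[OF fF o(1,2) VW(3)] Open_functor(2)[OF fF o(2) U o(3)] g(1)]
        Open_functor(4)[OF fF o(1,2) U VW(3) o(3)] by simp
  qed
  moreover have "\<forall>V \<in> \<U>. g' \<odot> Amap F (V, U) = g \<odot> Amap F (V, U)" by (simp add: \<U>_def)
  ultimately show ?thesis using g by (elim ex1E) metis
qed

text \<open>A family of maps on costalks that comes locally from maps out of \<open>F\<close> comes
  from one map out of the value at \<open>U\<close>. The domains of local maps form a family closed
  under smaller opens.\<close>

lemma germ_glue:
  assumes F: "csh F" and U: "openin X U" and z: "z \<in> Obj \<Omega>"
    and loc: "\<And>x. x \<in> U \<Longrightarrow> \<exists>W g. openin X W \<and> x \<in> W \<and> W \<subseteq> U \<and> g \<in> hom \<Omega> (Omap F W) z \<and>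
      (\<forall>y \<in> W. g \<odot> germ F W y = s y)"
  shows "\<exists>g. g \<in> hom \<Omega> (Omap F U) z \<and> (\<forall>x \<in> U. g \<odot> germ F U x = s x)"
proof -
  note cF = csh_constr[OF F] note fF = constr_functor[OF cF]
  define G where "G = (\<lambda>W g. g \<in> hom \<Omega> (Omap F W) z \<and> (\<forall>y \<in> W. g \<odot> germ F W y = s y))"
  define \<U> where "\<U> = {W. openin X W \<and> W \<subseteq> U \<and> (\<exists>g. G W g)}"
  have Gr: "G V (g \<odot> Amap F (V, W))" if "G W g" "openin X V" "openin X W" "V \<subseteq> W" for V W g
  proof -
    have g: "g \<in> hom \<Omega> (Omap F W) z" using that by (simp add: G_def)
    note h = Open_functor(2)[OF fF that(2-4)]
    have "(g \<odot> Amap F (V, W)) \<odot> germ F V y = s y" if y: "y \<in> V" for y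
    proof -
      have "(g \<odot> Amap F (V, W)) \<odot> germ F V y = g \<odot> (Amap F (V, W) \<odot> germ F V y)"
        by (rule Om.comp_assoc[OF germ_hom[OF cF \<open>openin X V\<close> y] h g])
      also have "\<dots> = s y"
        using germ_extend[OF cF \<open>openin X V\<close> y \<open>openin X W\<close> \<open>V \<subseteq> W\<close>] \<open>G W g\<close> y \<open>V \<subseteq> W\<close> by (auto simp: G_def)
      finally show ?thesis .
    qed
    then show ?thesis using h g by (auto simp: G_def)
  qed
  \<comment> \<open>Local maps are determined by \<open>s\<close>, so arbitrary choices of them are
    compatible under restriction.\<close>
  have uniq: "g = g'" if "G W g" "G W g'" "openin X W" for W g g'
    by (rule germ_joint_epi[OF F that(3), of _ z]) (use that in \<open>auto simp: G_def\<close>)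
  define g where "g = (\<lambda>W. SOME g. G W g)"
  have gG: "G W (g W)" if "W \<in> \<U>" for W
    using that someI_ex[of "G W"] by (auto simp: \<U>_def g_def)
  have UU: "\<Union>\<U> = U"
  proof
    show "U \<subseteq> \<Union>\<U>"
    proof
      fix x assume "x \<in> U"
      from loc[OF this] obtain W g where "openin X W" "x \<in> W" "W \<subseteq> U" "G W g" unfolding G_def by blast
      then show "x \<in> \<Union>\<U>" unfolding \<U>_def by blast
    qed
  qed (auto simp: \<U>_def)
  have "\<exists>!m. m \<in> hom \<Omega> (Omap F U) z \<and> (\<forall>V \<in> \<U>. m \<odot> Amap F (V, U) = g V)"
  proof (rule cosheaf_glue[OF F _ _ UU z])
    fix V W assume "V \<in> \<U>" "openin X W" "W \<subseteq> V"
    then show "W \<in> \<U>" using Gr unfolding \<U>_def by blast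
  next
    fix V W assume "V \<in> \<U>" "W \<in> \<U>" "V \<subseteq> W"
    then show "g W \<odot> Amap F (V, W) = g V"
      using uniq[OF Gr[OF gG] gG] by (simp add: \<U>_def)
  qed (use gG in \<open>auto simp: \<U>_def G_def\<close>)
  then obtain m where m: "m \<in> hom \<Omega> (Omap F U) z" "\<And>V. V \<in> \<U> \<Longrightarrow> m \<odot> Amap F (V, U) = g V" by blast
  have "m \<odot> germ F U x = s x" if x: "x \<in> U" for x
  proof -
    obtain V where V: "V \<in> \<U>" "x \<in> V" using x UU by blast
    then have o: "openin X V" "V \<subseteq> U" by (auto simp: \<U>_def)
    have "m \<odot> germ F U x = m \<odot> (Amap F (V, U) \<odot> germ F V x)"
      using germ_extend[OF cF o(1) V(2) U o(2)] by simp
    also have "\<dots> = g V \<odot> germ F V x"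
      using Om.comp_assoc[OF germ_hom[OF cF o(1) V(2)] Open_functor(2)[OF fF o(1) U o(2)] m(1)] m(2)[OF V(1)] by simp
    also have "\<dots> = s x" using gG[OF V(1)] V(2) by (simp add: G_def)
    finally show ?thesis .
  qed
  then show ?thesis using m by blast
qed

section \<open>Parallel transport along entrance paths\<close>

text \<open>A cosheaf valued in \<open>\<Omega>\<close> amounts to the sheaves of sets of maps from its values to the objects
  \<open>z\<close>. The following are the sections of the pullback of such a sheaf to an interval: they are determined by their value
  at the end of the interval, which may be prescribed.\<close>

definition sect :: "('a set, 'a set \<times> 'a set, 'o, 'm) func \<Rightarrow> 'o \<Rightarrow> (real \<Rightarrow> 'a) \<Rightarrow> real \<Rightarrow> real \<Rightarrow> (real \<Rightarrow> 'm) \<Rightarrow> bool" where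
  "sect F z \<alpha> a b s \<longleftrightarrow> (\<forall>t \<in> {a..b}. \<exists>V g \<delta>. openin X V \<and> g \<in> hom \<Omega> (Omap F V) z \<and> \<delta> > 0 \<and>
     (\<forall>u \<in> {a..b}. \<bar>u - t\<bar> < \<delta> \<longrightarrow> \<alpha> u \<in> V \<and> s u = g \<odot> germ F V (\<alpha> u)))"

lemma sectE:
  assumes "sect F z \<alpha> a b s" "t \<in> {a..b}"
  obtains V g \<delta> where "openin X V" "g \<in> hom \<Omega> (Omap F V) z" "\<delta> > 0"
    "\<And>u. u \<in> {a..b} \<Longrightarrow> \<bar>u - t\<bar> < \<delta> \<Longrightarrow> \<alpha> u \<in> V" "\<And>u. u \<in> {a..b} \<Longrightarrow> \<bar>u - t\<bar> < \<delta> \<Longrightarrow> s u = g \<odot> germ F V (\<alpha> u)"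
  using assms unfolding sect_def by meson

lemma sect_hom:
  assumes F: "constr F" and s: "sect F z \<alpha> a b s" and t: "t \<in> {a..b}"
  shows "s t \<in> hom \<Omega> (costalk F (\<alpha> t)) z"
proof -
  obtain V g \<delta> where V: "openin X V" "g \<in> hom \<Omega> (Omap F V) z" "\<delta> > 0"
    "\<And>u. u \<in> {a..b} \<Longrightarrow> \<bar>u - t\<bar> < \<delta> \<Longrightarrow> \<alpha> u \<in> V" "\<And>u. u \<in> {a..b} \<Longrightarrow> \<bar>u - t\<bar> < \<delta> \<Longrightarrow> s u = g \<odot> germ F V (\<alpha> u)"
    using sectE[OF s t] by metis
  have "\<alpha> t \<in> V" "s t = g \<odot> germ F V (\<alpha> t)" using V(3) V(4)[of t] V(5)[of t] t by auto
  then show ?thesis using Om.comp_hom[OF germ_hom[OF F V(1)] V(2)] by simp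
qed

lemma sect_cong:
  assumes "sect F z \<alpha> a b s" "\<And>t. t \<in> {a..b} \<Longrightarrow> \<beta> t = \<alpha> t" "\<And>t. t \<in> {a..b} \<Longrightarrow> r t = s t"
  shows "sect F z \<beta> a b r"
  unfolding sect_def
proof
  fix t assume "t \<in> {a..b}"
  then obtain V g \<delta> where "openin X V" "g \<in> hom \<Omega> (Omap F V) z" "\<delta> > 0"
    "\<And>u. u \<in> {a..b} \<Longrightarrow> \<bar>u - t\<bar> < \<delta> \<Longrightarrow> \<alpha> u \<in> V" "\<And>u. u \<in> {a..b} \<Longrightarrow> \<bar>u - t\<bar> < \<delta> \<Longrightarrow> s u = g \<odot> germ F V (\<alpha> u)"
    using sectE[OF assms(1)] by metis
  then show "\<exists>V g \<delta>. openin X V \<and> g \<in> hom \<Omega> (Omap F V) z \<and> \<delta> > 0 \<and>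
     (\<forall>u \<in> {a..b}. \<bar>u - t\<bar> < \<delta> \<longrightarrow> \<beta> u \<in> V \<and> r u = g \<odot> germ F V (\<beta> u))"
    using assms(2,3) by - (rule exI[of _ V], rule exI[of _ g], rule exI[of _ \<delta>], simp)
qed

lemma sect_restrict:
  assumes F: "constr F" and g: "g \<in> hom \<Omega> (Omap F V) z" and V: "openin X V" "openin X W" "W \<subseteq> V" "x \<in> W"
  shows "g \<odot> germ F V x = (g \<odot> Amap F (W, V)) \<odot> germ F W x"
  using Om.comp_assoc[OF germ_hom[OF F V(2,4)] Open_functor(2)[OF constr_functor[OF F] V(2,1,3)] g]
    germ_extend[OF F V(2,4,1,3)] by simp

lemma sect_pull:
  assumes s: "sect F z \<alpha> a b s" and c: "continuous_on {c..d} \<phi>" and i: "\<phi> ` {c..d} \<subseteq> {a..b}"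
  shows "sect F z (\<lambda>t. \<alpha> (\<phi> t)) c d (\<lambda>t. s (\<phi> t))"
  unfolding sect_def
proof
  fix t assume t: "t \<in> {c..d}"
  then have "\<phi> t \<in> {a..b}" using i by blast
  then obtain V g \<delta> where V: "openin X V" "g \<in> hom \<Omega> (Omap F V) z" "\<delta> > 0"
    "\<And>u. u \<in> {a..b} \<Longrightarrow> \<bar>u - \<phi> t\<bar> < \<delta> \<Longrightarrow> \<alpha> u \<in> V" "\<And>u. u \<in> {a..b} \<Longrightarrow> \<bar>u - \<phi> t\<bar> < \<delta> \<Longrightarrow> s u = g \<odot> germ F V (\<alpha> u)"
    using sectE[OF s] by metis
  obtain e where e: "e > 0" "\<And>u. u \<in> {c..d} \<Longrightarrow> dist u t < e \<Longrightarrow> dist (\<phi> u) (\<phi> t) < \<delta>"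
    using c t V(3) unfolding continuous_on_iff by metis
  have "\<alpha> (\<phi> u) \<in> V \<and> s (\<phi> u) = g \<odot> germ F V (\<alpha> (\<phi> u))" if "u \<in> {c..d}" "\<bar>u - t\<bar> < e" for u
  proof -
    have "\<phi> u \<in> {a..b}" using that i by blast
    then show ?thesis using V(4,5)[of "\<phi> u"] e(2)[of u] that by (simp add: dist_real_def)
  qed
  then show "\<exists>V g \<delta>. openin X V \<and> g \<in> hom \<Omega> (Omap F V) z \<and> \<delta> > 0 \<and>
     (\<forall>u \<in> {c..d}. \<bar>u - t\<bar> < \<delta> \<longrightarrow> \<alpha> (\<phi> u) \<in> V \<and> s (\<phi> u) = g \<odot> germ F V (\<alpha> (\<phi> u)))"
    using V e by blast
qed

lemma sect_post:
  assumes F: "constr F" and s: "sect F z \<alpha> a b s" and h: "h \<in> hom \<Omega> z z'"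
  shows "sect F z' \<alpha> a b (\<lambda>t. h \<odot> s t)"
  unfolding sect_def
proof
  fix t assume t: "t \<in> {a..b}"
  obtain V g \<delta> where V: "openin X V" "g \<in> hom \<Omega> (Omap F V) z" "\<delta> > 0"
    "\<And>u. u \<in> {a..b} \<Longrightarrow> \<bar>u - t\<bar> < \<delta> \<Longrightarrow> \<alpha> u \<in> V" "\<And>u. u \<in> {a..b} \<Longrightarrow> \<bar>u - t\<bar> < \<delta> \<Longrightarrow> s u = g \<odot> germ F V (\<alpha> u)"
    using sectE[OF s t] by metis
  have "\<alpha> u \<in> V \<and> h \<odot> s u = (h \<odot> g) \<odot> germ F V (\<alpha> u)" if "u \<in> {a..b}" "\<bar>u - t\<bar> < \<delta>" for u
    using V(4,5)[OF that] Om.comp_assoc[OF germ_hom[OF F V(1)] V(2) h] by simp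
  then show "\<exists>V g \<delta>. openin X V \<and> g \<in> hom \<Omega> (Omap F V) z' \<and> \<delta> > 0 \<and>
     (\<forall>u \<in> {a..b}. \<bar>u - t\<bar> < \<delta> \<longrightarrow> \<alpha> u \<in> V \<and> h \<odot> s u = g \<odot> germ F V (\<alpha> u))"
    using V(1,3) Om.comp_hom[OF V(2) h] by blast
qed

lemma sect_open:
  assumes "openin X V" "g \<in> hom \<Omega> (Omap F V) z" "\<And>t. t \<in> {a..b} \<Longrightarrow> \<alpha> t \<in> V"
    and "\<And>t. t \<in> {a..b} \<Longrightarrow> s t = g \<odot> germ F V (\<alpha> t)"
  shows "sect F z \<alpha> a b s"
  unfolding sect_def
proof
  fix t assume "t \<in> {a..b}"
  show "\<exists>V g \<delta>. openin X V \<and> g \<in> hom \<Omega> (Omap F V) z \<and> \<delta> > 0 \<and>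
     (\<forall>u \<in> {a..b}. \<bar>u - t\<bar> < \<delta> \<longrightarrow> \<alpha> u \<in> V \<and> s u = g \<odot> germ F V (\<alpha> u))"
    by (rule exI[of _ V], rule exI[of _ g], rule exI[of _ 1]) (use assms in auto)
qed

text \<open>Agreement travels from the end of a short interval to its start. In a basic open about
  \<open>\<alpha> x\<close> the sections come from maps \<open>k\<close> and \<open>k'\<close>; this
  open is also basic about the end \<open>\<alpha> b\<close>, where the invertible germ turns
  agreement into \<open>k = k'\<close>.\<close>

lemma sect_unique:
  assumes F: "constr F" and \<alpha>: "ep \<alpha>" and s: "sect F z \<alpha> 0 1 s" "sect F z \<alpha> 0 1 s'" and e: "s 1 = s' 1"
  shows "s 0 = s' 0"
proof -
  note fF = constr_functor[OF F]
  define Q where "Q = (\<lambda>a b. 0 \<le> a \<longrightarrow> b \<le> 1 \<longrightarrow> s b = s' b \<longrightarrow> s a = s' a)"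
  have "Q 0 1"
  proof (rule Bolzano[of 0 1 Q])
    fix x :: real assume "0 \<le> x" "x \<le> 1"
    then have x: "x \<in> {0..1}" by simp
    obtain V g d1 where V: "openin X V" "g \<in> hom \<Omega> (Omap F V) z" "d1 > 0"
      "\<And>u. u \<in> {0..1} \<Longrightarrow> \<bar>u - x\<bar> < d1 \<Longrightarrow> \<alpha> u \<in> V" "\<And>u. u \<in> {0..1} \<Longrightarrow> \<bar>u - x\<bar> < d1 \<Longrightarrow> s u = g \<odot> germ F V (\<alpha> u)"
      using sectE[OF s(1) x] by metis
    obtain V' g' d2 where V': "openin X V'" "g' \<in> hom \<Omega> (Omap F V') z" "d2 > 0"
      "\<And>u. u \<in> {0..1} \<Longrightarrow> \<bar>u - x\<bar> < d2 \<Longrightarrow> \<alpha> u \<in> V'" "\<And>u. u \<in> {0..1} \<Longrightarrow> \<bar>u - x\<bar> < d2 \<Longrightarrow> s' u = g' \<odot> germ F V' (\<alpha> u)"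
      using sectE[OF s(2) x] by metis
    have "\<alpha> x \<in> V \<inter> V'" using V(3,4) V'(3,4) x by simp
    then obtain W where W: "basic (\<alpha> x) W" "W \<subseteq> V \<inter> V'" using basic_within[OF openin_Int[OF V(1) V'(1)]] by blast
    then have WV: "W \<subseteq> V" "W \<subseteq> V'" by auto
    note oW = basicD(2)[OF W(1)]
    obtain d3 where d3: "d3 > 0" "\<forall>t \<in> {0..1}. \<bar>t - x\<bar> < d3 \<longrightarrow> \<alpha> t \<in> W \<and> (x \<le> t \<longrightarrow> basic (\<alpha> t) W \<and> level (\<alpha> t) = level (\<alpha> x))"
      using ep_local_basic[OF \<alpha> x W(1)] by blast
    define k where "k = g \<odot> Amap F (W, V)"
    define k' where "k' = g' \<odot> Amap F (W, V')"
    have k: "k \<in> hom \<Omega> (Omap F W) z" "k' \<in> hom \<Omega> (Omap F W) z"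
      using Om.comp_hom[OF Open_functor(2)[OF fF oW V(1) WV(1)] V(2)] Om.comp_hom[OF Open_functor(2)[OF fF oW V'(1) WV(2)] V'(2)]
      by (simp_all add: k_def k'_def)
    have sk: "s u = k \<odot> germ F W (\<alpha> u)" "s' u = k' \<odot> germ F W (\<alpha> u)" if "u \<in> {0..1}" "\<bar>u - x\<bar> < min d1 (min d2 d3)" for u
    proof -
      have "\<alpha> u \<in> W" using d3(2) that by auto
      then show "s u = k \<odot> germ F W (\<alpha> u)" "s' u = k' \<odot> germ F W (\<alpha> u)"
        using V(5)[of u] V'(5)[of u] that sect_restrict[OF F V(2,1) oW WV(1)] sect_restrict[OF F V'(2,1) oW WV(2)]
        by (simp_all add: k_def k'_def)
    qed
    have "Q a b" if ab: "a \<le> x" "x \<le> b" "b - a < min d1 (min d2 d3)" for a b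
      unfolding Q_def
    proof (intro impI)
      assume 01: "0 \<le> a" "b \<le> 1" and eq: "s b = s' b"
      have b: "b \<in> {0..1}" "\<bar>b - x\<bar> < min d1 (min d2 d3)" and a: "a \<in> {0..1}" "\<bar>a - x\<bar> < min d1 (min d2 d3)"
        using ab 01 by auto
      have B: "basic (\<alpha> b) W" using d3(2)[rule_format, OF b(1)] b ab by simp
      have "k \<odot> germ F W (\<alpha> b) = k' \<odot> germ F W (\<alpha> b)" using sk[OF b] eq by simp
      then have "k = k'"
        by (rule Om.iso_cancel_right[OF germ_iso[OF F B] germ_hom[OF F oW basicD(1)[OF B]] k])
      then show "s a = s' a" using sk[OF a] by simp
    qed
    then show "\<exists>d>0. \<forall>a b. a \<le> x \<and> x \<le> b \<and> b - a < d \<longrightarrow> Q a b"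
      using V(3) V'(3) d3(1) by (intro exI[of _ "min d1 (min d2 d3)"]) auto
  qed (auto simp: Q_def)
  then show ?thesis using e by (simp add: Q_def)
qed

text \<open>Only the junction is at issue. The maps that describe the section on its two sides have
  the same composite with the germ at \<open>\<alpha> b\<close>, which is invertible over a basic
  open about that point, so they coincide.\<close>

lemma sect_glue:
  assumes F: "constr F" and \<alpha>: "ep \<alpha>" and 01: "0 \<le> a" "a \<le> b" "b \<le> c" "c \<le> 1"
    and s: "sect F z \<alpha> a b s" "sect F z \<alpha> b c s"
  shows "sect F z \<alpha> a c s"
  unfolding sect_def
proof
  note fF = constr_functor[OF F]
  let ?G = "\<lambda>t. \<exists>V g \<delta>. openin X V \<and> g \<in> hom \<Omega> (Omap F V) z \<and> \<delta> > 0 \<and>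
     (\<forall>u \<in> {a..c}. \<bar>u - t\<bar> < \<delta> \<longrightarrow> \<alpha> u \<in> V \<and> s u = g \<odot> germ F V (\<alpha> u))"
  fix t assume t: "t \<in> {a..c}"
  have "t < b \<or> t = b \<or> b < t" by auto
  then consider "t < b" | "t = b" | "b < t" by blast
  then show "?G t"
  proof cases
    case 1
    then have "t \<in> {a..b}" using t by simp
    then obtain V g \<delta> where V: "openin X V" "g \<in> hom \<Omega> (Omap F V) z" "\<delta> > 0"
      "\<And>u. u \<in> {a..b} \<Longrightarrow> \<bar>u - t\<bar> < \<delta> \<Longrightarrow> \<alpha> u \<in> V" "\<And>u. u \<in> {a..b} \<Longrightarrow> \<bar>u - t\<bar> < \<delta> \<Longrightarrow> s u = g \<odot> germ F V (\<alpha> u)"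
      using sectE[OF s(1)] by metis
    have "\<alpha> u \<in> V \<and> s u = g \<odot> germ F V (\<alpha> u)" if "u \<in> {a..c}" "\<bar>u - t\<bar> < min \<delta> (b - t)" for u
      using V(4,5)[of u] that by auto
    then show ?thesis using V(1-3) 1
      by - (rule exI[of _ V], rule exI[of _ g], rule exI[of _ "min \<delta> (b - t)"], simp)
  next
    case 3
    then have "t \<in> {b..c}" using t by simp
    then obtain V g \<delta> where V: "openin X V" "g \<in> hom \<Omega> (Omap F V) z" "\<delta> > 0"
      "\<And>u. u \<in> {b..c} \<Longrightarrow> \<bar>u - t\<bar> < \<delta> \<Longrightarrow> \<alpha> u \<in> V" "\<And>u. u \<in> {b..c} \<Longrightarrow> \<bar>u - t\<bar> < \<delta> \<Longrightarrow> s u = g \<odot> germ F V (\<alpha> u)"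
      using sectE[OF s(2)] by metis
    have "\<alpha> u \<in> V \<and> s u = g \<odot> germ F V (\<alpha> u)" if "u \<in> {a..c}" "\<bar>u - t\<bar> < min \<delta> (t - b)" for u
      using V(4,5)[of u] that by auto
    then show ?thesis using V(1-3) 3
      by - (rule exI[of _ V], rule exI[of _ g], rule exI[of _ "min \<delta> (t - b)"], simp)
  next
    case 2
    have b: "b \<in> {a..b}" "b \<in> {b..c}" and b01: "b \<in> {0..1}" using 01 by auto
    obtain V g d1 where V: "openin X V" "g \<in> hom \<Omega> (Omap F V) z" "d1 > 0"
      "\<And>u. u \<in> {a..b} \<Longrightarrow> \<bar>u - b\<bar> < d1 \<Longrightarrow> \<alpha> u \<in> V" "\<And>u. u \<in> {a..b} \<Longrightarrow> \<bar>u - b\<bar> < d1 \<Longrightarrow> s u = g \<odot> germ F V (\<alpha> u)"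
      using sectE[OF s(1) b(1)] by metis
    obtain V' g' d2 where V': "openin X V'" "g' \<in> hom \<Omega> (Omap F V') z" "d2 > 0"
      "\<And>u. u \<in> {b..c} \<Longrightarrow> \<bar>u - b\<bar> < d2 \<Longrightarrow> \<alpha> u \<in> V'" "\<And>u. u \<in> {b..c} \<Longrightarrow> \<bar>u - b\<bar> < d2 \<Longrightarrow> s u = g' \<odot> germ F V' (\<alpha> u)"
      using sectE[OF s(2) b(2)] by metis
    have "\<alpha> b \<in> V \<inter> V'" using V(3,4) V'(3,4) b by simp
    then obtain W where W: "basic (\<alpha> b) W" "W \<subseteq> V \<inter> V'" using basic_within[OF openin_Int[OF V(1) V'(1)]] by blast
    then have WV: "W \<subseteq> V" "W \<subseteq> V'" by auto
    note oW = basicD(2)[OF W(1)] and bW = basicD(1)[OF W(1)]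
    obtain d3 where d3: "d3 > 0" "\<And>t. t \<in> {0..1} \<Longrightarrow> \<bar>t - b\<bar> < d3 \<Longrightarrow> \<alpha> t \<in> W"
      using ep_local[OF \<alpha> b01 oW bW] by blast
    define k where "k = g \<odot> Amap F (W, V)"
    define k' where "k' = g' \<odot> Amap F (W, V')"
    have k: "k \<in> hom \<Omega> (Omap F W) z" "k' \<in> hom \<Omega> (Omap F W) z"
      using Om.comp_hom[OF Open_functor(2)[OF fF oW V(1) WV(1)] V(2)] Om.comp_hom[OF Open_functor(2)[OF fF oW V'(1) WV(2)] V'(2)]
      by (simp_all add: k_def k'_def)
    have kl: "s u = k \<odot> germ F W (\<alpha> u)" if "u \<in> {a..b}" "\<bar>u - b\<bar> < min d1 (min d2 d3)" for u
      using V(5)[of u] that 01 sect_restrict[OF F V(2,1) oW WV(1) d3(2)[of u]] by (simp add: k_def)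
    have kr: "s u = k' \<odot> germ F W (\<alpha> u)" if "u \<in> {b..c}" "\<bar>u - b\<bar> < min d1 (min d2 d3)" for u
      using V'(5)[of u] that 01 sect_restrict[OF F V'(2,1) oW WV(2) d3(2)[of u]] by (simp add: k'_def)
    have "k \<odot> germ F W (\<alpha> b) = k' \<odot> germ F W (\<alpha> b)"
      using kl[OF b(1)] kr[OF b(2)] V(3) V'(3) d3(1) by simp
    then have "k = k'"
      by (rule Om.iso_cancel_right[OF germ_iso[OF F W(1)] germ_hom[OF F oW bW] k])
    then have "\<alpha> u \<in> W \<and> s u = k \<odot> germ F W (\<alpha> u)" if "u \<in> {a..c}" "\<bar>u - b\<bar> < min d1 (min d2 d3)" for u
      using kl[of u] kr[of u] d3(2)[of u] that 01 by (cases "u \<le> b") auto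
    then show ?thesis using oW k(1) V(3) V'(3) d3(1) 2
      by - (rule exI[of _ W], rule exI[of _ k], rule exI[of _ "min d1 (min d2 d3)"], simp)
  qed
qed

text \<open>A short interval lies in a basic open that is basic about its end, and inverting the
  germ there extends \<open>f\<close> over the interval. Of two adjacent intervals the later is
  treated first, and its value at the junction is prescribed for the earlier.\<close>

lemma sect_exists:
  assumes F: "constr F" and \<alpha>: "ep \<alpha>" and f: "f \<in> hom \<Omega> (costalk F (\<alpha> 1)) z"
  shows "\<exists>s. sect F z \<alpha> 0 1 s \<and> s 1 = f"
proof -
  define Q where "Q = (\<lambda>a b. 0 \<le> a \<longrightarrow> b \<le> 1 \<longrightarrow> (\<forall>f \<in> hom \<Omega> (costalk F (\<alpha> b)) z. \<exists>s. sect F z \<alpha> a b s \<and> s b = f))"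
  have "Q 0 1"
  proof (rule Bolzano[of 0 1 Q])
    fix a b c :: real assume Q: "Q a b" "Q b c" and le: "a \<le> b" "b \<le> c"
    show "Q a c"
      unfolding Q_def
    proof (intro impI ballI)
      fix f assume 01: "0 \<le> a" "c \<le> 1" and f: "f \<in> hom \<Omega> (costalk F (\<alpha> c)) z"
      obtain s2 where s2: "sect F z \<alpha> b c s2" "s2 c = f" using Q(2) f 01 le unfolding Q_def by force
      have "s2 b \<in> hom \<Omega> (costalk F (\<alpha> b)) z" by (rule sect_hom[OF F s2(1)]) (use le in simp)
      then obtain s1 where s1: "sect F z \<alpha> a b s1" "s1 b = s2 b" using Q(1) 01 le unfolding Q_def by force
      define s where "s = (\<lambda>t. if t \<le> b then s1 t else s2 t)"
      have "sect F z \<alpha> a b s" by (rule sect_cong[OF s1(1)]) (auto simp: s_def)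
      moreover have "sect F z \<alpha> b c s" by (rule sect_cong[OF s2(1)]) (use s1(2) in \<open>auto simp: s_def\<close>)
      ultimately have "sect F z \<alpha> a c s" using sect_glue[OF F \<alpha> 01(1) le 01(2)] by blast
      moreover have "s c = f" using s1 s2 le by (cases "c = b") (auto simp: s_def)
      ultimately show "\<exists>s. sect F z \<alpha> a c s \<and> s c = f" by blast
    qed
  next
    fix x :: real assume "0 \<le> x" "x \<le> 1"
    then have x: "x \<in> {0..1}" by simp
    obtain V where V: "basic (\<alpha> x) V" using basic_exists ep_in[OF \<alpha> x] by blast
    obtain d where d: "d > 0" "\<forall>t \<in> {0..1}. \<bar>t - x\<bar> < d \<longrightarrow> \<alpha> t \<in> V \<and> (x \<le> t \<longrightarrow> basic (\<alpha> t) V \<and> level (\<alpha> t) = level (\<alpha> x))"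
      using ep_local_basic[OF \<alpha> x V] by blast
    have "Q a b" if ab: "a \<le> x" "x \<le> b" "b - a < d" for a b
      unfolding Q_def
    proof (intro impI ballI)
      fix f assume 01: "0 \<le> a" "b \<le> 1" and f: "f \<in> hom \<Omega> (costalk F (\<alpha> b)) z"
      have B: "basic (\<alpha> b) V" using d(2)[rule_format, of b] ab 01 by simp
      note h = germ_hom[OF F basicD(2,1)[OF B]] and i = germ_iso[OF F B]
      note j = Om.inv_arr[OF i h]
      define s where "s = (\<lambda>t. (f \<odot> Om.inv_arr (germ F V (\<alpha> b))) \<odot> germ F V (\<alpha> t))"
      have "sect F z \<alpha> a b s"
      proof (rule sect_open[OF basicD(2)[OF V] Om.comp_hom[OF j(1) f]])
        fix t assume t: "t \<in> {a..b}"
        then show "\<alpha> t \<in> V" using d(2)[rule_format, of t] ab 01 by auto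
      qed (simp add: s_def)
      moreover have "s b = f"
        using Om.comp_assoc[OF h j(1) f] j Om.comp_ident_right[OF f] by (simp add: s_def)
      ultimately show "\<exists>s. sect F z \<alpha> a b s \<and> s b = f" by blast
    qed
    then show "\<exists>d>0. \<forall>a b. a \<le> x \<and> x \<le> b \<and> b - a < d \<longrightarrow> Q a b" using d(1) by blast
  qed simp
  then show ?thesis using f by (simp add: Q_def)
qed

text \<open>Sections are extended from the end to the start, but they consist of maps out of the
  costalks. With the costalk at the end as \<open>z\<close> and the identity as end value, the value
  at the start is a map in the direction of the path.\<close>

definition tr :: "('a set, 'a set \<times> 'a set, 'o, 'm) func \<Rightarrow> (real \<Rightarrow> 'a) \<Rightarrow> 'm" where
  "tr F \<alpha> = (THE m. \<exists>s. sect F (costalk F (\<alpha> 1)) \<alpha> 0 1 s \<and> s 1 = Ident \<Omega> (costalk F (\<alpha> 1)) \<and> s 0 = m)"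

section \<open>Transport and its behaviour under concatenation\<close>

lemma tr_eqI:
  assumes F: "constr F" and \<alpha>: "ep \<alpha>"
    and "sect F (costalk F (\<alpha> 1)) \<alpha> 0 1 s" "s 1 = Ident \<Omega> (costalk F (\<alpha> 1))"
  shows "tr F \<alpha> = s 0"
  unfolding tr_def
proof (rule the_equality)
  show "\<exists>s'. sect F (costalk F (\<alpha> 1)) \<alpha> 0 1 s' \<and> s' 1 = Ident \<Omega> (costalk F (\<alpha> 1)) \<and> s' 0 = s 0"
    using assms by blast
  fix m assume "\<exists>s. sect F (costalk F (\<alpha> 1)) \<alpha> 0 1 s \<and> s 1 = Ident \<Omega> (costalk F (\<alpha> 1)) \<and> s 0 = m"
  then obtain s' where "sect F (costalk F (\<alpha> 1)) \<alpha> 0 1 s'" "s' 1 = Ident \<Omega> (costalk F (\<alpha> 1))" "s' 0 = m" by blast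
  then show "m = s 0" using sect_unique[OF F \<alpha> _ assms(3), of s'] assms(4) by simp
qed

lemma tr_sect:
  assumes F: "constr F" and \<alpha>: "ep \<alpha>"
  obtains s where "sect F (costalk F (\<alpha> 1)) \<alpha> 0 1 s" "s 1 = Ident \<Omega> (costalk F (\<alpha> 1))" "s 0 = tr F \<alpha>"
proof -
  have "Ident \<Omega> (costalk F (\<alpha> 1)) \<in> hom \<Omega> (costalk F (\<alpha> 1)) (costalk F (\<alpha> 1))"
    using costalk_obj[OF F] ep_in[OF \<alpha>, of 1] by simp
  from sect_exists[OF F \<alpha> this] show thesis using that tr_eqI[OF F \<alpha>] by metis
qed

lemma tr_hom:
  assumes F: "constr F" and \<alpha>: "ep \<alpha>"
  shows "tr F \<alpha> \<in> hom \<Omega> (costalk F (\<alpha> 0)) (costalk F (\<alpha> 1))"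
proof -
  obtain s where s: "sect F (costalk F (\<alpha> 1)) \<alpha> 0 1 s" "s 0 = tr F \<alpha>" using tr_sect[OF F \<alpha>] by metis
  show ?thesis using sect_hom[OF F s(1), of 0] s(2) by simp
qed

text \<open>Composing the section that defines \<open>tr F \<alpha>\<close> with \<open>s 1\<close>
  gives a section with the same end value as \<open>s\<close>, hence with the same value at the
  start.\<close>

lemma tr_compat:
  assumes F: "constr F" and \<alpha>: "ep \<alpha>" and s: "sect F z \<alpha> 0 1 s"
  shows "s 0 = s 1 \<odot> tr F \<alpha>"
proof -
  obtain r where r: "sect F (costalk F (\<alpha> 1)) \<alpha> 0 1 r" "r 1 = Ident \<Omega> (costalk F (\<alpha> 1))" "r 0 = tr F \<alpha>"
    using tr_sect[OF F \<alpha>] by metis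
  have h: "s 1 \<in> hom \<Omega> (costalk F (\<alpha> 1)) z" using sect_hom[OF F s, of 1] by simp
  have "s 0 = s 1 \<odot> r 0"
    by (rule sect_unique[OF F \<alpha> s sect_post[OF F r(1) h]]) (use r(2) Om.comp_ident_right[OF h] in simp)
  then show ?thesis using r(3) by simp
qed

text \<open>The germs into the value at \<open>U\<close> along the path form the section that the
  identity of this value describes.\<close>

lemma tr_germ:
  assumes F: "constr F" and \<alpha>: "ep \<alpha>" and U: "openin X U" and \<alpha>U: "\<And>t. t \<in> {0..1} \<Longrightarrow> \<alpha> t \<in> U"
  shows "germ F U (\<alpha> 1) \<odot> tr F \<alpha> = germ F U (\<alpha> 0)"
proof -
  have i: "Ident \<Omega> (Omap F U) \<in> hom \<Omega> (Omap F U) (Omap F U)"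
    using Open_functor(1)[OF constr_functor[OF F] U] by blast
  have "sect F (Omap F U) \<alpha> 0 1 (\<lambda>t. germ F U (\<alpha> t))"
    by (rule sect_open[OF U i \<alpha>U]) (use Om.comp_ident_left[OF germ_hom[OF F U \<alpha>U]] in auto)
  from tr_compat[OF F \<alpha> this] show ?thesis by simp
qed

lemma tr_sim:
  assumes F: "constr F" and \<alpha>: "ep \<alpha>" and sim: "sim \<alpha> \<beta>"
  shows "tr F \<beta> = tr F \<alpha>"
proof -
  obtain \<phi> where \<phi>: "incr \<phi>" "\<beta> = pull \<alpha> \<phi>" using sim by (auto simp: sim_def)
  obtain s where s: "sect F (costalk F (\<alpha> 1)) \<alpha> 0 1 s" "s 1 = Ident \<Omega> (costalk F (\<alpha> 1))" "s 0 = tr F \<alpha>"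
    using tr_sect[OF F \<alpha>] by metis
  have "sect F (costalk F (\<alpha> 1)) (\<lambda>t. \<alpha> (\<phi> t)) 0 1 (\<lambda>t. s (\<phi> t))"
  proof (rule sect_pull[OF s(1)])
    show "continuous_on {0..1} \<phi>" using \<phi>(1) by (simp add: incr_def)
    show "\<phi> ` {0..1} \<subseteq> {0..1}" using incr_in[OF \<phi>(1)] by blast
  qed
  then have "sect F (costalk F (\<beta> 1)) \<beta> 0 1 (\<lambda>t. s (\<phi> t))"
    unfolding sim_ends(2)[OF sim] by (rule sect_cong) (simp_all add: \<phi>(2) pull_apply)
  from tr_eqI[OF F ep_sim[OF \<alpha> sim] this] show ?thesis using s sim_ends[OF sim] incr_01[OF \<phi>(1)] by simp
qed

lemma tr_joinp:
  assumes F: "constr F" and \<alpha>: "ep \<alpha>" and \<beta>: "ep \<beta>" and ab: "\<beta> 0 = \<alpha> 1"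
  shows "tr F (joinp \<beta> \<alpha>) = tr F \<beta> \<odot> tr F \<alpha>"
proof -
  let ?z = "costalk F (\<beta> 1)"
  obtain s where s: "sect F (costalk F (\<alpha> 1)) \<alpha> 0 1 s" "s 1 = Ident \<Omega> (costalk F (\<alpha> 1))" "s 0 = tr F \<alpha>"
    using tr_sect[OF F \<alpha>] by metis
  obtain r where r: "sect F ?z \<beta> 0 1 r" "r 1 = Ident \<Omega> ?z" "r 0 = tr F \<beta>" using tr_sect[OF F \<beta>] by metis
  have h: "tr F \<beta> \<in> hom \<Omega> (costalk F (\<alpha> 1)) ?z" using tr_hom[OF F \<beta>] ab by simp
  \<comment> \<open>The section of the first half is composed with the transport along
    \<open>\<beta>\<close>, so that the two halves meet at the junction.\<close>
  define q where "q = (\<lambda>t. if t \<le> 1/2 then tr F \<beta> \<odot> s (2 * t) else r (2 * t - 1))"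
  have "sect F ?z (\<lambda>t. \<alpha> (2 * t)) 0 (1/2) (\<lambda>t. tr F \<beta> \<odot> s (2 * t))"
    by (rule sect_pull[OF sect_post[OF F s(1) h]]) (auto intro!: continuous_intros)
  then have 1: "sect F ?z (joinp \<beta> \<alpha>) 0 (1/2) q"
    by (rule sect_cong) (auto simp: q_def joinp_apply)
  have "sect F ?z (\<lambda>t. \<beta> (2 * t - 1)) (1/2) 1 (\<lambda>t. r (2 * t - 1))"
    by (rule sect_pull[OF r(1)]) (auto intro!: continuous_intros)
  then have 2: "sect F ?z (joinp \<beta> \<alpha>) (1/2) 1 q"
  proof (rule sect_cong)
    fix t :: real assume t: "t \<in> {1/2..1}"
    have "joinp \<beta> \<alpha> t = \<beta> (2 * t - 1) \<and> q t = r (2 * t - 1)"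
    proof (cases "t = 1/2")
      case True
      have "q (1/2) = r 0" using r(3) s(2) Om.comp_ident_right[OF h] by (simp add: q_def)
      moreover have "joinp \<beta> \<alpha> (1/2) = \<beta> 0" using ab by (simp add: joinp_apply)
      ultimately show ?thesis unfolding True by simp
    next
      case False
      then show ?thesis using t by (simp add: joinp_apply q_def)
    qed
    then show "joinp \<beta> \<alpha> t = \<beta> (2 * t - 1)" "q t = r (2 * t - 1)" by auto
  qed
  have "sect F ?z (joinp \<beta> \<alpha>) 0 1 q"
    by (rule sect_glue[OF F ep_joinp[OF \<alpha> \<beta> ab] _ _ _ _ 1 2]) auto
  from tr_eqI[OF F ep_joinp[OF \<alpha> \<beta> ab], of q] this show ?thesis
    using r s by (simp add: q_def)
qed

lemma tr_cst:
  assumes F: "constr F" and x: "x \<in> topspace X"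
  shows "tr F (cst x) = Ident \<Omega> (costalk F x)"
proof -
  have i: "Ident \<Omega> (costalk F x) \<in> hom \<Omega> (costalk F x) (costalk F x)" using costalk_obj[OF F x] by blast
  have "sect F (Omap F (nbh x)) (cst x) 0 1 (\<lambda>t. Ident \<Omega> (costalk F x))"
  proof (rule sect_open[OF basicD(2)[OF nbh[OF x]] i[unfolded costalk_def]])
    fix t :: real assume t: "t \<in> {0..1}"
    show "cst x t \<in> nbh x" using basicD(1)[OF nbh[OF x]] t by (simp add: cst_apply)
    show "Ident \<Omega> (costalk F x) = Ident \<Omega> (Omap F (nbh x)) \<odot> germ F (nbh x) (cst x t)"
      using germ_self[OF F x] Om.comp_ident_left[OF i] t by (simp add: cst_apply costalk_def)
  qed
  from tr_eqI[OF F ep_cst[OF x], of "\<lambda>t. Ident \<Omega> (costalk F x)"] this show ?thesis by (simp add: costalk_def)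
qed

section \<open>Homotopy invariance of transport and the universal property of the values\<close>

lemma elementary_homotopy_basic:
  assumes "elementary_homotopy n K p q"
  obtains U where "basic (snd p 1) U" "\<And>t. t \<in> {0..1} \<Longrightarrow> snd p t \<in> U" "\<And>t. t \<in> {0..1} \<Longrightarrow> snd q t \<in> U"
proof -
  obtain P \<alpha> Q \<beta> where pq: "p = (P, \<alpha>)" "q = (Q, \<beta>)" by (cases p, cases q)
  show thesis
    using assms unfolding elementary_homotopy_def pq prod.case
  proof (elim conjE exE)
    fix h a b U assume a1: "a 1 = v2"
      and sa: "stratum_preserving unit_interval (interval_strata P) (top_of_set triangle) triangle_strata a"
      and sb: "stratum_preserving unit_interval (interval_strata Q) (top_of_set triangle) triangle_strata b"
      and ha: "\<forall>t \<in> {0..1}. h (a t) = \<alpha> t" and hb: "\<forall>t \<in> {0..1}. h (b t) = \<beta> t"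
      and U: "basic (h v2) U" and hU: "h ` triangle \<subseteq> U"
    have abt: "a t \<in> triangle" "b t \<in> triangle" if "t \<in> {0..1}" for t
      using sa sb that by (auto simp: stratum_preserving_def continuous_map_in_subtopology)
    show thesis
    proof (rule that[of U])
      show "basic (snd p 1) U" using U ha[rule_format, of 1] a1 by (simp add: pq)
      fix t :: real assume t: "t \<in> {0..1}"
      show "snd p t \<in> U" "snd q t \<in> U"
        using ha[rule_format, OF t] hb[rule_format, OF t] abt[OF t] hU by (auto simp: pq)
    qed
  qed
qed

lemma tr_elem_step:
  assumes F: "constr F" and elem_step: "elem_step \<alpha> \<beta>"
  shows "tr F \<alpha> = tr F \<beta>"
proof -
  obtain r3 p2 q2 r1 where *: "pieces r3 p2 r1" "pieces r3 q2 r1" "elementary_homotopy n K p2 q2"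
     "\<alpha> = snd (concat3 r3 p2 r1)" "\<beta> = snd (concat3 r3 q2 r1)" using elem_step by (auto simp: elem_step_def)
  note ends = elementary_homotopy_ends[OF *(3)]
  have ep2: "ep (snd p2)" "ep (snd q2)" using ends entrance_ep by auto
  have e: "snd q2 0 = snd p2 0" "snd q2 1 = snd p2 1" using ends by (auto simp: path_start_def path_end_def)
  obtain U where U: "basic (snd p2 1) U" "\<And>t. t \<in> {0..1} \<Longrightarrow> snd p2 t \<in> U" "\<And>t. t \<in> {0..1} \<Longrightarrow> snd q2 t \<in> U"
    using elementary_homotopy_basic[OF *(3)] by metis
  note oU = basicD(2)[OF U(1)]
  \<comment> \<open>Followed by the germ at the common end, either transport becomes the germ at the
    common start. The germ at the end can be cancelled, because \<open>U\<close> is basic about that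
    point.\<close>
  have "germ F U (snd p2 1) \<odot> tr F (snd p2) = germ F U (snd p2 1) \<odot> tr F (snd q2)"
    using tr_germ[OF F ep2(1) oU U(2)] tr_germ[OF F ep2(2) oU U(3)] e by simp
  then have eq: "tr F (snd p2) = tr F (snd q2)"
    using Om.iso_cancel_left[OF germ_iso[OF F U(1)] germ_hom[OF F oU basicD(1)[OF U(1)]] tr_hom[OF F ep2(1)]]
      tr_hom[OF F ep2(2)] e by simp
  have tr1: "tr F (snd (case r1 of None \<Rightarrow> x | Some p \<Rightarrow> concat_path x p)) =
        (case r1 of None \<Rightarrow> tr F (snd x) | Some p \<Rightarrow> tr F (snd x) \<odot> tr F (snd p))"
    and en1: "entrance_path K (case r1 of None \<Rightarrow> x | Some p \<Rightarrow> concat_path x p)"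
      "path_end (case r1 of None \<Rightarrow> x | Some p \<Rightarrow> concat_path x p) = path_end x" if x: "pieces r3 x r1" for x
    using x tr_joinp[OF F] by (auto simp: pieces_def entrance_ep path_start_def path_end_def split: option.split intro!: entrance_concat)
  have tr3: "tr F (snd (concat3 r3 x r1)) = (case r3 of None \<Rightarrow> id | Some p \<Rightarrow> (\<lambda>m. tr F (snd p) \<odot> m))
      (case r1 of None \<Rightarrow> tr F (snd x) | Some p \<Rightarrow> tr F (snd x) \<odot> tr F (snd p))" if x: "pieces r3 x r1" for x
  proof (cases r3)
    case None
    then show ?thesis using tr1[OF x] by (simp add: concat3_def Let_def)
  next
    case (Some r)
    have "ep (snd r)" "path_start r = path_end x" using x Some by (auto simp: pieces_def entrance_ep)
    then show ?thesis
      using tr_joinp[OF F entrance_ep[OF en1(1)[OF x]], of "snd r"] en1(2)[OF x] tr1[OF x] Some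
      by (simp add: concat3_def Let_def path_start_def path_end_def)
  qed
  show ?thesis unfolding *(4,5) tr3[OF *(1)] tr3[OF *(2)] eq ..
qed

lemma tr_cls:
  assumes F: "constr F" and "cls \<alpha> = cls \<beta>" "ep \<alpha>" "ep \<beta>"
  shows "tr F \<alpha> = tr F \<beta>"
proof -
  have step: "tr F (snd p) = tr F (snd q)" if er: "ER p q" for p q
  proof -
    obtain a b where ab: "sim (snd p) a" "sim (snd q) b" "elem_step a b \<or> elem_step b a" "ep (snd p)" "ep (snd q)" using ER_elem_step[OF er] by metis
    have "tr F a = tr F b" using ab(3) tr_elem_step[OF F, of a b] tr_elem_step[OF F, of b a] by auto
    then show ?thesis using tr_sim[OF F ab(4,1)] tr_sim[OF F ab(5,2)] by simp
  qed
  obtain P Q where "eqv (P, \<alpha>) (Q, \<beta>)" using cls_eqv[OF assms(2-4)] by blast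
  then have "tr F (snd (P, \<alpha>)) = tr F (snd (Q, \<beta>))"
    by (induction rule: rtranclp_induct) (use step in auto)
  then show ?thesis by simp
qed

text \<open>By \<open>germ_glue\<close> it suffices to work in a basic \<open>W\<close> about
  \<open>x\<close>. There the only candidate is \<open>s x\<close> composed with the inverse germ,
  and compatibility along a path in \<open>W\<close> from \<open>y\<close> to the centre shows that
  it has the required value at \<open>y\<close>.\<close>

lemma csh_universal:
  assumes F: "csh F" and U: "openin X U" and z: "z \<in> Obj \<Omega>"
    and s: "\<And>x. x \<in> U \<Longrightarrow> s x \<in> hom \<Omega> (costalk F x) z"
    and st: "\<And>\<alpha>. ep \<alpha> \<Longrightarrow> (\<And>t. t \<in> {0..1} \<Longrightarrow> \<alpha> t \<in> U) \<Longrightarrow> s (\<alpha> 1) \<odot> tr F \<alpha> = s (\<alpha> 0)"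
  shows "\<exists>g. g \<in> hom \<Omega> (Omap F U) z \<and> (\<forall>x \<in> U. g \<odot> germ F U x = s x)"
proof (rule germ_glue[OF F U z])
  note cF = csh_constr[OF F]
  fix x assume x: "x \<in> U"
  obtain W where W: "basic x W" "W \<subseteq> U" using basic_within[OF U x] by blast
  note oW = basicD(2)[OF W(1)] and xW = basicD(1)[OF W(1)]
  note h = germ_hom[OF cF oW xW] and j = Om.inv_arr[OF germ_iso[OF cF W(1)] germ_hom[OF cF oW xW]]
  define g where "g = s x \<odot> Om.inv_arr (germ F W x)"
  have g: "g \<in> hom \<Omega> (Omap F W) z" unfolding g_def using j(1) s[OF x] by blast
  have "g \<odot> germ F W y = s y" if y: "y \<in> W" for y
  proof -
    obtain \<alpha> where \<alpha>: "ep \<alpha>" "\<And>t. t \<in> {0..1} \<Longrightarrow> \<alpha> t \<in> W" "\<alpha> 0 = y" "\<alpha> 1 = x" using path_to_center[OF W(1) y] by metis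
    have t: "tr F \<alpha> \<in> hom \<Omega> (costalk F y) (costalk F x)" using tr_hom[OF cF \<alpha>(1)] \<alpha> by simp
    have "germ F W x \<odot> tr F \<alpha> = germ F W y" using tr_germ[OF cF \<alpha>(1) oW \<alpha>(2)] \<alpha>(3,4) by simp
    then have "g \<odot> germ F W y = (g \<odot> germ F W x) \<odot> tr F \<alpha>" using Om.comp_assoc[OF t h g] by simp
    also have "g \<odot> germ F W x = s x"
      unfolding g_def using Om.comp_assoc[OF h j(1) s[OF x]] j Om.comp_ident_right[OF s[OF x]] by simp
    also have "s x \<odot> tr F \<alpha> = s y" using st[OF \<alpha>(1)] \<alpha> W(2) by auto
    finally show ?thesis .
  qed
  then show "\<exists>W g. openin X W \<and> x \<in> W \<and> W \<subseteq> U \<and> g \<in> hom \<Omega> (Omap F W) z \<and> (\<forall>y \<in> W. g \<odot> germ F W y = s y)"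
    using oW xW W(2) g by blast
qed

section \<open>The functor of costalks\<close>

text \<open>The representative of a class is chosen arbitrarily; \<open>tr_cls\<close> makes the
  choice immaterial.\<close>

definition costalks :: "('a set, 'a set \<times> 'a set, 'o, 'm) func \<Rightarrow> ('a, 'a strat_path set, 'o, 'm) func" where
  "costalks F = \<lparr>Omap = (\<lambda>x \<in> topspace X. costalk F x),
     Amap = (\<lambda>A \<in> Arr (Ent n K). tr F (SOME \<alpha>. ep \<alpha> \<and> A = cls \<alpha>))\<rparr>"

lemma costalks_simps:
  "x \<in> topspace X \<Longrightarrow> Omap (costalks F) x = costalk F x"
  "constr F \<Longrightarrow> ep \<alpha> \<Longrightarrow> Amap (costalks F) (cls \<alpha>) = tr F \<alpha>"
proof -
  show "x \<in> topspace X \<Longrightarrow> Omap (costalks F) x = costalk F x" by (simp add: costalks_def)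
  assume F: "constr F" and \<alpha>: "ep \<alpha>"
  have "ep (SOME \<beta>. ep \<beta> \<and> cls \<alpha> = cls \<beta>) \<and> cls \<alpha> = cls (SOME \<beta>. ep \<beta> \<and> cls \<alpha> = cls \<beta>)"
    by (rule someI[of _ \<alpha>]) (use \<alpha> in simp)
  then show "Amap (costalks F) (cls \<alpha>) = tr F \<alpha>"
    using tr_cls[OF F, of "SOME \<beta>. ep \<beta> \<and> cls \<alpha> = cls \<beta>" \<alpha>] \<alpha> by (auto simp: costalks_def Arr_Ent)
qed

lemma is_functor_costalks:
  assumes F: "constr F"
  shows "is_functor (Ent n K) \<Omega> (costalks F)"
proof (rule functorI[OF is_category_Ent Om.is_cat])
  show "Omap (costalks F) \<in> extensional (Obj (Ent n K))" "Amap (costalks F) \<in> extensional (Arr (Ent n K))"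
    by (simp_all add: costalks_def)
  show "Omap (costalks F) x \<in> Obj \<Omega>" if "x \<in> Obj (Ent n K)" for x
    using that costalk_obj[OF F] by (simp add: costalks_simps)
  show "Amap (costalks F) (Ident (Ent n K) x) = Ident \<Omega> (Omap (costalks F) x)" if "x \<in> Obj (Ent n K)" for x
    using that by (simp add: Ident_Ent costalks_simps[OF _] costalks_simps(2)[OF F] ep_cst tr_cst[OF F])
next
  fix f a b assume "f \<in> hom (Ent n K) a b"
  then obtain \<alpha> where \<alpha>: "ep \<alpha>" "f = cls \<alpha>" "\<alpha> 0 = a" "\<alpha> 1 = b" by (auto simp: hom_Ent)
  have "a \<in> topspace X" "b \<in> topspace X" using ep_in[OF \<alpha>(1), of 0] ep_in[OF \<alpha>(1), of 1] \<alpha> by auto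
  then show "Amap (costalks F) f \<in> hom \<Omega> (Omap (costalks F) a) (Omap (costalks F) b)"
    using tr_hom[OF F \<alpha>(1)] \<alpha> by (simp add: costalks_simps(1) costalks_simps(2)[OF F])
next
  fix f g a b c assume "f \<in> hom (Ent n K) a b" "g \<in> hom (Ent n K) b c"
  then obtain \<alpha> \<beta> where "ep \<alpha>" "f = cls \<alpha>" "\<alpha> 1 = b" "ep \<beta>" "g = cls \<beta>" "\<beta> 0 = b" by (auto simp: hom_Ent)
  then show "Amap (costalks F) (Comp (Ent n K) g f) = Amap (costalks F) g \<odot> Amap (costalks F) f"
    using ep_joinp by (simp add: Comp_Ent costalks_simps(2)[OF F] tr_joinp[OF F])
qed

text \<open>Composing a section for \<open>G\<close> with \<open>\<tau>\<close> gives one for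
  \<open>F\<close>, by naturality of germs. For the section that defines
  \<open>tr G \<alpha>\<close> the new end value is \<open>\<tau>\<close> at the end, and
  \<open>tr_compat\<close> compares it with the value at the start.\<close>

lemma tr_natural:
  assumes F: "constr F" and G: "constr G" and \<tau>: "is_nat_trans (Open X) \<Omega> F G \<tau>" and \<alpha>: "ep \<alpha>"
  shows "\<tau> (nbh (\<alpha> 1)) \<odot> tr F \<alpha> = tr G \<alpha> \<odot> \<tau> (nbh (\<alpha> 0))"
proof -
  obtain s where s: "sect G (costalk G (\<alpha> 1)) \<alpha> 0 1 s" "s 1 = Ident \<Omega> (costalk G (\<alpha> 1))" "s 0 = tr G \<alpha>"
    using tr_sect[OF G \<alpha>] by metis
  have X: "\<alpha> t \<in> topspace X" if "t \<in> {0..1}" for t using ep_in[OF \<alpha> that] .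
  have t: "\<tau> (nbh x) \<in> hom \<Omega> (costalk F x) (costalk G x)" if "x \<in> topspace X" for x
    unfolding costalk_def using nat_trans_Open(1)[OF \<tau> basicD(2)[OF nbh[OF that]]] .
  have "sect F (costalk G (\<alpha> 1)) \<alpha> 0 1 (\<lambda>t. s t \<odot> \<tau> (nbh (\<alpha> t)))"
    unfolding sect_def
  proof
    fix t :: real assume "t \<in> {0..1}"
    then obtain V g \<delta> where V: "openin X V" "g \<in> hom \<Omega> (Omap G V) (costalk G (\<alpha> 1))" "\<delta> > 0"
      "\<And>u. u \<in> {0..1} \<Longrightarrow> \<bar>u - t\<bar> < \<delta> \<Longrightarrow> \<alpha> u \<in> V" "\<And>u. u \<in> {0..1} \<Longrightarrow> \<bar>u - t\<bar> < \<delta> \<Longrightarrow> s u = g \<odot> germ G V (\<alpha> u)"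
      using sectE[OF s(1)] by metis
    note tV = nat_trans_Open(1)[OF \<tau> V(1)]
    have "\<alpha> u \<in> V \<and> s u \<odot> \<tau> (nbh (\<alpha> u)) = (g \<odot> \<tau> V) \<odot> germ F V (\<alpha> u)" if u: "u \<in> {0..1}" "\<bar>u - t\<bar> < \<delta>" for u
    proof -
      note uV = V(4)[OF u]
      have "s u \<odot> \<tau> (nbh (\<alpha> u)) = g \<odot> (germ G V (\<alpha> u) \<odot> \<tau> (nbh (\<alpha> u)))"
        using V(5)[OF u] Om.comp_assoc[OF t[OF X[OF u(1)]] germ_hom[OF G V(1) uV] V(2)] by simp
      also have "\<dots> = g \<odot> (\<tau> V \<odot> germ F V (\<alpha> u))" using germ_natural[OF F G \<tau> V(1) uV] by simp
      also have "\<dots> = (g \<odot> \<tau> V) \<odot> germ F V (\<alpha> u)" using Om.comp_assoc[OF germ_hom[OF F V(1) uV] tV V(2)] by simp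
      finally show ?thesis using uV by simp
    qed
    then show "\<exists>V g \<delta>. openin X V \<and> g \<in> hom \<Omega> (Omap F V) (costalk G (\<alpha> 1)) \<and> \<delta> > 0 \<and>
       (\<forall>u \<in> {0..1}. \<bar>u - t\<bar> < \<delta> \<longrightarrow> \<alpha> u \<in> V \<and> s u \<odot> \<tau> (nbh (\<alpha> u)) = g \<odot> germ F V (\<alpha> u))"
      using V(1,3) Om.comp_hom[OF tV V(2)] by blast
  qed
  from tr_compat[OF F \<alpha> this] show ?thesis
    using s Om.comp_ident_left[OF t[OF X[of 1]]] by simp
qed

definition costalk_functor where
  "costalk_functor = \<lparr>Omap = (\<lambda>F \<in> Obj (Csh \<Omega> n K). costalks F),
     Amap = (\<lambda>f \<in> Arr (Csh \<Omega> n K). case f of (F, \<tau>, G) \<Rightarrow> (costalks F, \<lambda>x \<in> topspace X. \<tau> (nbh x), costalks G))\<rparr>"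

lemma Obj_Csh: "F \<in> Obj (Csh \<Omega> n K) \<longleftrightarrow> csh F"
  by (auto simp: Csh_def csh_def is_cosheaf_def)

lemma hom_Csh: "f \<in> hom (Csh \<Omega> n K) F G \<longleftrightarrow> csh F \<and> csh G \<and> (\<exists>\<tau>. f = (F, \<tau>, G) \<and> is_nat_trans (Open X) \<Omega> F G \<tau>)"
  by (auto simp: Csh_def csh_def hom_full_subcat hom_functor_cat)

lemma is_category_Csh: "is_category (Csh \<Omega> n K)"
  unfolding Csh_def by (intro is_category_full_subcat is_category_functor_cat is_category_Open Om.is_cat)

lemma Comp_Csh: "Comp (Csh \<Omega> n K) (G, \<sigma>, H) (F, \<tau>, G) = (F, \<lambda>U \<in> {U. openin X U}. \<sigma> U \<odot> \<tau> U, H)"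
  by (simp add: Csh_def)

lemma Ident_Csh: "Ident (Csh \<Omega> n K) F = (F, \<lambda>U \<in> {U. openin X U}. Ident \<Omega> (Omap F U), F)"
  by (simp add: Csh_def)

lemma costalk_functor_simps:
  "csh F \<Longrightarrow> Omap costalk_functor F = costalks F"
  "(F, \<tau>, G) \<in> hom (Csh \<Omega> n K) F G \<Longrightarrow>
     Amap costalk_functor (F, \<tau>, G) = (costalks F, \<lambda>x \<in> topspace X. \<tau> (nbh x), costalks G)"
  using homD(1)[of "(F, \<tau>, G)" "Csh \<Omega> n K" F G] by (simp_all add: costalk_functor_def Obj_Csh)

lemma costalks_nat_trans:
  assumes F: "constr F" and G: "constr G" and \<tau>: "is_nat_trans (Open X) \<Omega> F G \<tau>"
  shows "is_nat_trans (Ent n K) \<Omega> (costalks F) (costalks G) (\<lambda>x \<in> topspace X. \<tau> (nbh x))"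
proof (rule nat_transI[OF is_functor_costalks[OF F] is_functor_costalks[OF G]])
  fix x assume "x \<in> Obj (Ent n K)"
  then show "(\<lambda>x \<in> topspace X. \<tau> (nbh x)) x \<in> hom \<Omega> (Omap (costalks F) x) (Omap (costalks G) x)"
    using nat_trans_Open(1)[OF \<tau> basicD(2)[OF nbh]] by (simp add: costalks_simps costalk_def)
next
  fix f a b assume "f \<in> hom (Ent n K) a b"
  then obtain \<alpha> where \<alpha>: "ep \<alpha>" "f = cls \<alpha>" "\<alpha> 0 = a" "\<alpha> 1 = b" by (auto simp: hom_Ent)
  have "a \<in> topspace X" "b \<in> topspace X" using ep_in[OF \<alpha>(1), of 0] ep_in[OF \<alpha>(1), of 1] \<alpha> by auto
  then show "(\<lambda>x \<in> topspace X. \<tau> (nbh x)) b \<odot> Amap (costalks F) f = Amap (costalks G) f \<odot> (\<lambda>x \<in> topspace X. \<tau> (nbh x)) a"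
    using tr_natural[OF F G \<tau> \<alpha>(1)] \<alpha> by (simp add: costalks_simps(2)[OF F] costalks_simps(2)[OF G])
qed simp

lemma is_functor_costalk_functor:
  "is_functor (Csh \<Omega> n K) (functor_cat (Ent n K) \<Omega>) costalk_functor"
proof (rule functorI[OF is_category_Csh is_category_functor_cat[OF is_category_Ent Om.is_cat]])
  show "Omap costalk_functor \<in> extensional (Obj (Csh \<Omega> n K))" "Amap costalk_functor \<in> extensional (Arr (Csh \<Omega> n K))"
    by (simp_all add: costalk_functor_def)
  show "Omap costalk_functor F \<in> Obj (functor_cat (Ent n K) \<Omega>)" if "F \<in> Obj (Csh \<Omega> n K)" for F
    using that is_functor_costalks[OF csh_constr] by (simp add: costalk_functor_simps Obj_Csh)
next
  fix f F G assume f: "f \<in> hom (Csh \<Omega> n K) F G"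
  then obtain \<tau> where *: "csh F" "csh G" "f = (F, \<tau>, G)" "is_nat_trans (Open X) \<Omega> F G \<tau>" by (auto simp: hom_Csh)
  then show "Amap costalk_functor f \<in> hom (functor_cat (Ent n K) \<Omega>) (Omap costalk_functor F) (Omap costalk_functor G)"
    using f costalks_nat_trans[OF csh_constr csh_constr]
    by (simp add: costalk_functor_simps(1) costalk_functor_simps(2)[of F \<tau> G] hom_functor_cat)
next
  fix F assume "F \<in> Obj (Csh \<Omega> n K)"
  then have F: "csh F" by (simp add: Obj_Csh)
  then have "Ident (Csh \<Omega> n K) F \<in> hom (Csh \<Omega> n K) F F"
    using category.ident_hom[of "Csh \<Omega> n K" F] is_category_Csh by (simp add: category_def Obj_Csh)
  then show "Amap costalk_functor (Ident (Csh \<Omega> n K) F) = Ident (functor_cat (Ent n K) \<Omega>) (Omap costalk_functor F)"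
    using F basicD(2)[OF nbh]
    by (auto simp: Ident_Csh costalk_functor_simps costalks_simps costalk_def intro!: restrict_ext)
next
  fix f g F G H assume f: "f \<in> hom (Csh \<Omega> n K) F G" and g: "g \<in> hom (Csh \<Omega> n K) G H"
  obtain \<tau> \<sigma> where *: "f = (F, \<tau>, G)" "g = (G, \<sigma>, H)" using f g by (auto simp: hom_Csh)
  have "Comp (Csh \<Omega> n K) g f \<in> hom (Csh \<Omega> n K) F H"
    using category.comp_hom[OF _ f g] is_category_Csh by (simp add: category_def)
  then show "Amap costalk_functor (Comp (Csh \<Omega> n K) g f) =
      Comp (functor_cat (Ent n K) \<Omega>) (Amap costalk_functor g) (Amap costalk_functor f)"
    using f g * basicD(2)[OF nbh]
    by (auto simp: Comp_Csh costalk_functor_simps intro!: restrict_ext)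
qed

text \<open>Given \<open>\<sigma>\<close> on costalks, the germs of \<open>G\<close> composed with
  \<open>\<sigma>\<close> are compatible with the transport of \<open>F\<close>, so
  \<open>csh_universal\<close> yields a map of values over every open set. Naturality and uniqueness
  are checked on germs, and \<open>germ_self\<close> recovers \<open>\<sigma>\<close> over the
  chosen neighbourhoods.\<close>

lemma costalk_functor_fully_faithful:
  assumes F: "csh F" and G: "csh G" and g: "g \<in> hom (functor_cat (Ent n K) \<Omega>) (costalks F) (costalks G)"
  shows "\<exists>!f. f \<in> hom (Csh \<Omega> n K) F G \<and> Amap costalk_functor f = g"
proof -
  note cF = csh_constr[OF F] and cG = csh_constr[OF G]
  note fF = constr_functor[OF cF] and fG = constr_functor[OF cG]
  obtain \<sigma> where g_eq: "g = (costalks F, \<sigma>, costalks G)" and \<sigma>: "is_nat_trans (Ent n K) \<Omega> (costalks F) (costalks G) \<sigma>"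
    using g by (auto simp: hom_functor_cat)
  have sh: "\<sigma> x \<in> hom \<Omega> (costalk F x) (costalk G x)" if "x \<in> topspace X" for x
    using nat_transD(4)[OF \<sigma>, of x] that by (simp add: costalks_simps)
  have sn: "\<sigma> (\<alpha> 1) \<odot> tr F \<alpha> = tr G \<alpha> \<odot> \<sigma> (\<alpha> 0)" if "ep \<alpha>" for \<alpha>
    using nat_transD(5)[OF \<sigma>, of "cls \<alpha>" "\<alpha> 0" "\<alpha> 1"] that by (auto simp: hom_Ent costalks_simps(2)[OF cF] costalks_simps(2)[OF cG])
  have inX: "x \<in> topspace X" if "openin X U" "x \<in> U" for x U using that openin_subset by blast
  have ex: "\<exists>m. m \<in> hom \<Omega> (Omap F U) (Omap G U) \<and> (\<forall>x \<in> U. m \<odot> germ F U x = germ G U x \<odot> \<sigma> x)" if U: "openin X U" for U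
  proof (rule csh_universal[OF F U])
    show "Omap G U \<in> Obj \<Omega>" using Open_functor(1)[OF fG U] .
    show "germ G U x \<odot> \<sigma> x \<in> hom \<Omega> (costalk F x) (Omap G U)" if "x \<in> U" for x
      using germ_hom[OF cG U that] sh[OF inX[OF U that]] by blast
    fix \<alpha> assume \<alpha>: "ep \<alpha>" and \<alpha>U: "\<And>t. t \<in> {0..1} \<Longrightarrow> \<alpha> t \<in> U"
    have U01: "\<alpha> 0 \<in> U" "\<alpha> 1 \<in> U" using \<alpha>U by auto
    note h = tr_hom[OF cF \<alpha>] tr_hom[OF cG \<alpha>] sh[OF inX[OF U U01(1)]] sh[OF inX[OF U U01(2)]] germ_hom[OF cG U U01(2)]
    show "(germ G U (\<alpha> 1) \<odot> \<sigma> (\<alpha> 1)) \<odot> tr F \<alpha> = germ G U (\<alpha> 0) \<odot> \<sigma> (\<alpha> 0)"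
      using Om.comp_assoc[OF h(1,4,5)] sn[OF \<alpha>] Om.comp_assoc[OF h(3,2,5)] tr_germ[OF cG \<alpha> U \<alpha>U] by simp
  qed
  define \<tau> where "\<tau> = (\<lambda>U \<in> {U. openin X U}. SOME m. m \<in> hom \<Omega> (Omap F U) (Omap G U) \<and> (\<forall>x \<in> U. m \<odot> germ F U x = germ G U x \<odot> \<sigma> x))"
  have t: "\<tau> U \<in> hom \<Omega> (Omap F U) (Omap G U)" "\<And>x. x \<in> U \<Longrightarrow> \<tau> U \<odot> germ F U x = germ G U x \<odot> \<sigma> x" if "openin X U" for U
    using someI_ex[OF ex[OF that]] that by (auto simp: \<tau>_def)
  have \<tau>: "is_nat_trans (Open X) \<Omega> F G \<tau>"
  proof (rule nat_transI[OF fF fG])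
    fix f U V assume "f \<in> hom (Open X) U V"
    then have f: "f = (U, V)" and U: "openin X U" and V: "openin X V" and UV: "U \<subseteq> V" by (auto simp: hom_Open)
    note h = Open_functor(2)[OF fF U V UV] Open_functor(2)[OF fG U V UV]
    have "\<tau> V \<odot> Amap F (U, V) = Amap G (U, V) \<odot> \<tau> U"
    proof (rule germ_joint_epi[OF F U Om.comp_hom[OF h(1) t(1)[OF V]] Om.comp_hom[OF t(1)[OF U] h(2)]])
      fix x assume x: "x \<in> U"
      then have xV: "x \<in> V" using UV by blast
      note k = germ_hom[OF cF U x] germ_hom[OF cG U x] sh[OF inX[OF U x]]
      have "(\<tau> V \<odot> Amap F (U, V)) \<odot> germ F U x = germ G V x \<odot> \<sigma> x"
        using Om.comp_assoc[OF k(1) h(1) t(1)[OF V]] germ_extend[OF cF U x V UV] t(2)[OF V xV] by simp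
      also have "\<dots> = (Amap G (U, V) \<odot> \<tau> U) \<odot> germ F U x"
        using Om.comp_assoc[OF k(1) t(1)[OF U] h(2)] t(2)[OF U x] Om.comp_assoc[OF k(3,2) h(2)] germ_extend[OF cG U x V UV] by simp
      finally show "(\<tau> V \<odot> Amap F (U, V)) \<odot> germ F U x = (Amap G (U, V) \<odot> \<tau> U) \<odot> germ F U x" .
    qed
    then show "\<tau> V \<odot> Amap F f = Amap G f \<odot> \<tau> U" by (simp add: f)
  next
    show "\<tau> \<in> extensional (Obj (Open X))" by (simp add: \<tau>_def)
  qed (simp add: t(1))
  have t_nbh: "\<tau> (nbh x) = \<sigma> x" if x: "x \<in> topspace X" for x
  proof -
    note N = nbh[OF x]
    have a: "\<tau> (nbh x) \<in> hom \<Omega> (costalk F x) (costalk G x)" using t(1)[OF basicD(2)[OF N]] by (simp add: costalk_def)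
    show ?thesis
      using t(2)[OF basicD(2,1)[OF N]] germ_self[OF cF x] germ_self[OF cG x] Om.comp_ident_right[OF a] Om.comp_ident_left[OF sh[OF x]] by simp
  qed
  show ?thesis
  proof (rule ex1I[of _ "(F, \<tau>, G)"])
    have fh: "(F, \<tau>, G) \<in> hom (Csh \<Omega> n K) F G" using F G \<tau> by (simp add: hom_Csh)
    have "(\<lambda>x \<in> topspace X. \<tau> (nbh x)) = \<sigma>"
      by (rule extensionalityI[of _ "topspace X"]) (use nat_transD(3)[OF \<sigma>] t_nbh in auto)
    then show "(F, \<tau>, G) \<in> hom (Csh \<Omega> n K) F G \<and> Amap costalk_functor (F, \<tau>, G) = g"
      using fh g_eq by (simp add: costalk_functor_simps(2))
    fix f assume f: "f \<in> hom (Csh \<Omega> n K) F G \<and> Amap costalk_functor f = g"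
    then obtain \<rho> where r: "f = (F, \<rho>, G)" "is_nat_trans (Open X) \<Omega> F G \<rho>" by (auto simp: hom_Csh)
    then have "(F, \<rho>, G) \<in> hom (Csh \<Omega> n K) F G" using f by blast
    from costalk_functor_simps(2)[OF this] have "(\<lambda>x \<in> topspace X. \<rho> (nbh x)) = \<sigma>" using f g_eq r(1) by simp
    then have rx: "\<rho> (nbh x) = \<sigma> x" if "x \<in> topspace X" for x using that by (metis restrict_apply')
    have "\<rho> U = \<tau> U" if U: "openin X U" for U
    proof (rule germ_joint_epi[OF F U nat_trans_Open(1)[OF r(2) U] t(1)[OF U]])
      fix x assume x: "x \<in> U"
      show "\<rho> U \<odot> germ F U x = \<tau> U \<odot> germ F U x"
        using germ_natural[OF cF cG r(2) U x] rx[OF inX[OF U x]] t(2)[OF U x] by simp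
    qed
    then have "\<rho> = \<tau>"
      by (intro extensionalityI[of _ "{U. openin X U}"]) (use nat_transD(3)[OF r(2)] in \<open>auto simp: \<tau>_def\<close>)
    then show "f = (F, \<tau>, G)" using r by simp
  qed
qed

end

section \<open>The cosheaf of a functor on the entrance path category\<close>

locale ent_functor = strat_cat n K \<Omega>
  for n :: nat and K :: "'a fspace" and \<Omega> :: "('o, 'm) cat" +
  fixes G :: "('a, 'a strat_path set, 'o, 'm) func"
  assumes G: "is_functor (Ent n K) \<Omega> G"
    and bicomplete: "bicomplete TYPE('a strat_path set) \<Omega>"
begin

section \<open>Colimits over the paths in an open set\<close>

definition gp :: "(real \<Rightarrow> 'a) \<Rightarrow> 'm" where "gp \<alpha> = Amap G (cls \<alpha>)"

lemma gp_hom: "ep \<alpha> \<Longrightarrow> gp \<alpha> \<in> hom \<Omega> (Omap G (\<alpha> 0)) (Omap G (\<alpha> 1))"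
  unfolding gp_def by (rule functorD(6)[OF G]) (auto simp: hom_Ent)

lemma gp_joinp: "ep \<alpha> \<Longrightarrow> ep \<beta> \<Longrightarrow> \<beta> 0 = \<alpha> 1 \<Longrightarrow> gp (joinp \<beta> \<alpha>) = gp \<beta> \<odot> gp \<alpha>"
  unfolding gp_def
  using functorD(8)[OF G, of "cls \<alpha>" "\<alpha> 0" "\<alpha> 1" "cls \<beta>" "\<beta> 1"] Comp_Ent[of \<alpha> \<beta>] hom_Ent by metis

lemma gp_cst: "x \<in> topspace X \<Longrightarrow> gp (cst x) = Ident \<Omega> (Omap G x)"
  unfolding gp_def using functorD(7)[OF G, of x] by (simp add: Ident_Ent)

lemma gp_cut:
  assumes "ep \<alpha>" "0 \<le> a" "a \<le> b" "b \<le> c" "c \<le> 1"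
  shows "gp (sub \<alpha> b c) \<odot> gp (sub \<alpha> a b) = gp (sub \<alpha> a c)"
  using gp_joinp[of "sub \<alpha> a b" "sub \<alpha> b c"] ep_sub[OF assms(1)] cls_cut'[OF assms] assms by (simp add: gp_def)

lemma G_obj: "x \<in> topspace X \<Longrightarrow> Omap G x \<in> Obj \<Omega>"
  using functorD(5)[OF G] by simp

text \<open>Cocones on \<open>G\<close> over the paths in \<open>U\<close>, indexed by the points
  and paths themselves so that the encoding in \<open>path_cat\<close> stays out of sight.\<close>

definition compat :: "'a set \<Rightarrow> 'o \<Rightarrow> ('a \<Rightarrow> 'm) \<Rightarrow> bool" where
  "compat U z s \<longleftrightarrow> z \<in> Obj \<Omega> \<and> (\<forall>x \<in> U. s x \<in> hom \<Omega> (Omap G x) z) \<and>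
     (\<forall>\<alpha>. ep \<alpha> \<longrightarrow> (\<forall>t \<in> {0..1}. \<alpha> t \<in> U) \<longrightarrow> s (\<alpha> 1) \<odot> gp \<alpha> = s (\<alpha> 0))"

definition universal :: "'a set \<Rightarrow> 'o \<Rightarrow> ('a \<Rightarrow> 'm) \<Rightarrow> bool" where
  "universal U c k \<longleftrightarrow> compat U c k \<and>
     (\<forall>z s. compat U z s \<longrightarrow> (\<exists>!m. m \<in> hom \<Omega> c z \<and> (\<forall>x \<in> U. m \<odot> k x = s x)))"

lemma compatD:
  assumes "compat U z s"
  shows "z \<in> Obj \<Omega>" "x \<in> U \<Longrightarrow> s x \<in> hom \<Omega> (Omap G x) z"
    "ep \<alpha> \<Longrightarrow> (\<And>t. t \<in> {0..1} \<Longrightarrow> \<alpha> t \<in> U) \<Longrightarrow> s (\<alpha> 1) \<odot> gp \<alpha> = s (\<alpha> 0)"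
  using assms unfolding compat_def by blast+

lemma compatI:
  assumes "z \<in> Obj \<Omega>" "\<And>x. x \<in> U \<Longrightarrow> s x \<in> hom \<Omega> (Omap G x) z"
    "\<And>\<alpha>. ep \<alpha> \<Longrightarrow> (\<And>t. t \<in> {0..1} \<Longrightarrow> \<alpha> t \<in> U) \<Longrightarrow> s (\<alpha> 1) \<odot> gp \<alpha> = s (\<alpha> 0)"
  shows "compat U z s"
  using assms unfolding compat_def by blast

text \<open>The category of entrance paths in \<open>U\<close>, up to homotopy in the whole space, with a point
  encoded as the singleton of the constant path at it.\<close>

definition path_cat :: "'a set \<Rightarrow> ('a strat_path set, 'a strat_path set) cat" where
  "path_cat U =
     \<lparr>Obj = (\<lambda>x. {const_path x}) ` U,
      Arr = {cls \<alpha> | \<alpha>. ep \<alpha> \<and> (\<forall>t \<in> {0..1}. \<alpha> t \<in> U)},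
      Dom = (\<lambda>A. {const_path (Dom (Ent n K) A)}),
      Cod = (\<lambda>A. {const_path (Cod (Ent n K) A)}),
      Ident = (\<lambda>c. Ident (Ent n K) (path_start (the_elem c))),
      Comp = Comp (Ent n K)\<rparr>"

lemma path_start_const [simp]: "path_start (const_path x) = x"
  by (simp add: path_start_def const_path_def)

lemma const_path_inject [simp]: "const_path x = const_path y \<longleftrightarrow> x = y"
  using path_start_const by metis

lemma hom_path_cat:
  "A \<in> hom (path_cat U) a b \<longleftrightarrow>
     (\<exists>\<alpha>. ep \<alpha> \<and> (\<forall>t \<in> {0..1}. \<alpha> t \<in> U) \<and> A = cls \<alpha> \<and> a = {const_path (\<alpha> 0)} \<and> b = {const_path (\<alpha> 1)})"
  unfolding hom_iff by (auto simp: path_cat_def Dom_Ent Cod_Ent)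

lemma joinp_in: "\<forall>t \<in> {0..1}. \<alpha> t \<in> U \<Longrightarrow> \<forall>t \<in> {0..1}. \<beta> t \<in> U \<Longrightarrow> t \<in> {0..1} \<Longrightarrow> joinp \<beta> \<alpha> t \<in> U"
  by (simp add: joinp_apply)

lemma path_cat_simps:
  "x \<in> U \<Longrightarrow> U \<subseteq> topspace X \<Longrightarrow> Ident (path_cat U) {const_path x} = cls (cst x)"
  "Comp (path_cat U) = Comp (Ent n K)" "Obj (path_cat U) = (\<lambda>x. {const_path x}) ` U"
  using Ident_Ent[of x] by (auto simp: path_cat_def)

lemma is_category_path_cat:
  assumes U: "U \<subseteq> topspace X"
  shows "is_category (path_cat U)"
proof -
  let ?J = "path_cat U"
  have arr: "\<exists>\<alpha>. ep \<alpha> \<and> (\<forall>t \<in> {0..1}. \<alpha> t \<in> U) \<and> A = cls \<alpha> \<and> Dom ?J A = {const_path (\<alpha> 0)} \<and> Cod ?J A = {const_path (\<alpha> 1)}"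
    if "A \<in> Arr ?J" for A
    using arr_hom[OF that] unfolding hom_path_cat by blast
  show ?thesis
    unfolding is_category_def
  proof (intro conjI ballI impI)
    fix f assume "f \<in> Arr ?J"
    then obtain \<alpha> where a: "ep \<alpha>" "\<forall>t \<in> {0..1}. \<alpha> t \<in> U" "f = cls \<alpha>" "Dom ?J f = {const_path (\<alpha> 0)}" "Cod ?J f = {const_path (\<alpha> 1)}"
      using arr by blast
    then have U01: "\<alpha> 0 \<in> U" "\<alpha> 1 \<in> U" by auto
    then show "Dom ?J f \<in> Obj ?J" "Cod ?J f \<in> Obj ?J" using a by (auto simp: path_cat_simps)
    have X: "\<alpha> 0 \<in> topspace X" "\<alpha> 1 \<in> topspace X" using U01 U by auto
    show "Comp ?J f (Ident ?J (Dom ?J f)) = f" "Comp ?J (Ident ?J (Cod ?J f)) f = f"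
      unfolding a(4,5)
      unfolding a(3) path_cat_simps(1)[OF U01(1) U] path_cat_simps(1)[OF U01(2) U] path_cat_simps(2)
      using a(1) X by (simp_all add: Comp_Ent ep_cst cls_unit_left cls_unit_right)
  next
    fix c assume "c \<in> Obj ?J"
    then obtain x where x: "x \<in> U" "c = {const_path x}" by (auto simp: path_cat_simps)
    have "x \<in> topspace X" using x U by blast
    then show "Ident ?J c \<in> hom ?J c c"
      unfolding x(2) path_cat_simps(1)[OF x(1) U] hom_path_cat
      using x(1) by (intro exI[of _ "cst x"]) (auto simp: ep_cst cst_apply)
  next
    fix f g assume fg: "f \<in> Arr ?J" "g \<in> Arr ?J" "Dom ?J g = Cod ?J f"
    obtain \<alpha> where a: "ep \<alpha>" "\<forall>t \<in> {0..1}. \<alpha> t \<in> U" "f = cls \<alpha>" "Dom ?J f = {const_path (\<alpha> 0)}" "Cod ?J f = {const_path (\<alpha> 1)}"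
      using arr[OF fg(1)] by blast
    obtain \<beta> where b: "ep \<beta>" "\<forall>t \<in> {0..1}. \<beta> t \<in> U" "g = cls \<beta>" "Dom ?J g = {const_path (\<beta> 0)}" "Cod ?J g = {const_path (\<beta> 1)}"
      using arr[OF fg(2)] by blast
    have ab: "\<beta> 0 = \<alpha> 1" using fg(3) a(5) b(4) by simp
    have j: "ep (joinp \<beta> \<alpha>)" using ep_joinp a b ab by blast
    have eq: "Comp ?J g f = cls (joinp \<beta> \<alpha>)" using a b ab by (simp add: path_cat_simps Comp_Ent)
    show "Comp ?J g f \<in> hom ?J (Dom ?J f) (Cod ?J g)"
      unfolding hom_path_cat eq using a b j joinp_in[OF a(2) b(2)] by (intro exI[of _ "joinp \<beta> \<alpha>"]) simp
    fix h assume h: "h \<in> Arr ?J" "Dom ?J h = Cod ?J g"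
    obtain \<gamma> where c: "ep \<gamma>" "h = cls \<gamma>" "Dom ?J h = {const_path (\<gamma> 0)}"
      using arr[OF h(1)] by blast
    have bc: "\<gamma> 0 = \<beta> 1" using h(2) b(5) c(3) by simp
    have j': "ep (joinp \<gamma> \<beta>)" using ep_joinp b c bc by blast
    show "Comp ?J h (Comp ?J g f) = Comp ?J (Comp ?J h g) f"
      unfolding path_cat_simps(2) a(3) b(3) c(2)
      using a(1) b(1) c(1) ab bc j j' by (simp add: Comp_Ent cls_assoc)
  qed
qed

definition path_diagram :: "'a set \<Rightarrow> ('a strat_path set, 'a strat_path set, 'o, 'm) func" where
  "path_diagram U = \<lparr>Omap = (\<lambda>c \<in> Obj (path_cat U). Omap G (path_start (the_elem c))),
     Amap = (\<lambda>A \<in> Arr (path_cat U). Amap G A)\<rparr>"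

lemma path_diagram_simps:
  "x \<in> U \<Longrightarrow> Omap (path_diagram U) {const_path x} = Omap G x"
  "ep \<alpha> \<Longrightarrow> \<forall>t \<in> {0..1}. \<alpha> t \<in> U \<Longrightarrow> Amap (path_diagram U) (cls \<alpha>) = gp \<alpha>"
  by (auto simp: path_diagram_def path_cat_def gp_def)

lemma is_functor_path_diagram:
  assumes U: "U \<subseteq> topspace X"
  shows "is_functor (path_cat U) \<Omega> (path_diagram U)"
proof (rule functorI[OF is_category_path_cat[OF U] Om.is_cat])
  show "Omap (path_diagram U) \<in> extensional (Obj (path_cat U))" "Amap (path_diagram U) \<in> extensional (Arr (path_cat U))"
    by (simp_all add: path_diagram_def)
next
  fix c assume "c \<in> Obj (path_cat U)"
  then obtain x where x: "x \<in> U" "c = {const_path x}" by (auto simp: path_cat_simps)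
  then have xX: "x \<in> topspace X" using U by blast
  show "Omap (path_diagram U) c \<in> Obj \<Omega>" using x xX G_obj by (simp add: path_diagram_simps)
  show "Amap (path_diagram U) (Ident (path_cat U) c) = Ident \<Omega> (Omap (path_diagram U) c)"
    using x xX U path_diagram_simps(2)[OF ep_cst[OF xX], of U]
    by (simp add: path_cat_simps path_diagram_simps(1) cst_apply gp_cst)
next
  fix f a b assume "f \<in> hom (path_cat U) a b"
  then obtain \<alpha> where a: "ep \<alpha>" "\<forall>t \<in> {0..1}. \<alpha> t \<in> U" "f = cls \<alpha>" "a = {const_path (\<alpha> 0)}" "b = {const_path (\<alpha> 1)}"
    unfolding hom_path_cat by blast
  have U01: "\<alpha> 0 \<in> U" "\<alpha> 1 \<in> U" using a(2) by auto
  show "Amap (path_diagram U) f \<in> hom \<Omega> (Omap (path_diagram U) a) (Omap (path_diagram U) b)"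
    using gp_hom[OF a(1)] path_diagram_simps(2)[OF a(1,2)] U01 a(3-5) by (simp add: path_diagram_simps(1))
next
  fix f g a b c assume "f \<in> hom (path_cat U) a b" "g \<in> hom (path_cat U) b c"
  then obtain \<alpha> \<beta> where a: "ep \<alpha>" "\<forall>t \<in> {0..1}. \<alpha> t \<in> U" "f = cls \<alpha>" "b = {const_path (\<alpha> 1)}"
    and b: "ep \<beta>" "\<forall>t \<in> {0..1}. \<beta> t \<in> U" "g = cls \<beta>" "b = {const_path (\<beta> 0)}"
    unfolding hom_path_cat by blast
  have ab: "\<beta> 0 = \<alpha> 1" using a(4) b(4) by simp
  have j: "ep (joinp \<beta> \<alpha>)" "\<forall>t \<in> {0..1}. joinp \<beta> \<alpha> t \<in> U" using ep_joinp[OF a(1) b(1) ab] joinp_in[OF a(2) b(2)] by auto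
  show "Amap (path_diagram U) (Comp (path_cat U) g f) = Amap (path_diagram U) g \<odot> Amap (path_diagram U) f"
    unfolding path_cat_simps(2) a(3) b(3) Comp_Ent[OF a(1) b(1) ab] path_diagram_simps(2)[OF j]
      path_diagram_simps(2)[OF a(1,2)] path_diagram_simps(2)[OF b(1,2)]
    by (rule gp_joinp[OF a(1) b(1) ab])
qed

text \<open>\<open>bicomplete\<close> supplies colimits over categories on a fixed type of indices,
  hence the detour through \<open>path_cat\<close>; its cocones are the compatible families.\<close>

lemma universal_exists:
  assumes U: "U \<subseteq> topspace X"
  shows "\<exists>c k. universal U c k"
proof -
  let ?J = "path_cat U" and ?D = "path_diagram U"
  have cocone: "is_cocone ?J \<Omega> ?D z \<kappa> \<longleftrightarrow> compat U z (\<lambda>x. \<kappa> {const_path x})" for z \<kappa>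
  proof
    assume c: "is_cocone ?J \<Omega> ?D z \<kappa>"
    show "compat U z (\<lambda>x. \<kappa> {const_path x})"
    proof (rule compatI)
      show "z \<in> Obj \<Omega>" using c by (simp add: is_cocone_def)
      show "\<kappa> {const_path x} \<in> hom \<Omega> (Omap G x) z" if "x \<in> U" for x
        using c that path_diagram_simps(1)[OF that] by (force simp: is_cocone_def path_cat_simps)
      fix \<alpha> assume \<alpha>: "ep \<alpha>" "\<And>t. t \<in> {0..1} \<Longrightarrow> \<alpha> t \<in> U"
      then have h: "cls \<alpha> \<in> hom ?J {const_path (\<alpha> 0)} {const_path (\<alpha> 1)}" unfolding hom_path_cat by blast
      then have "\<kappa> {const_path (\<alpha> 1)} \<odot> Amap ?D (cls \<alpha>) = \<kappa> {const_path (\<alpha> 0)}"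
        using c homD[OF h] unfolding is_cocone_def by metis
      then show "\<kappa> {const_path (\<alpha> 1)} \<odot> gp \<alpha> = \<kappa> {const_path (\<alpha> 0)}"
        using path_diagram_simps(2)[OF \<alpha>(1), of U] \<alpha>(2) by simp
    qed
  next
    assume c: "compat U z (\<lambda>x. \<kappa> {const_path x})"
    show "is_cocone ?J \<Omega> ?D z \<kappa>"
      unfolding is_cocone_def
    proof (intro conjI ballI)
      show "z \<in> Obj \<Omega>" by (rule compatD(1)[OF c])
      fix j assume "j \<in> Obj ?J"
      then obtain x where x: "x \<in> U" "j = {const_path x}" by (auto simp: path_cat_simps)
      then show "\<kappa> j \<in> hom \<Omega> (Omap ?D j) z" using compatD(2)[OF c x(1)] by (simp add: path_diagram_simps)
    next
      fix f assume "f \<in> Arr ?J"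
      then obtain \<alpha> where a: "ep \<alpha>" "\<forall>t \<in> {0..1}. \<alpha> t \<in> U" "f = cls \<alpha>" "Dom ?J f = {const_path (\<alpha> 0)}" "Cod ?J f = {const_path (\<alpha> 1)}"
        using arr_hom[of f ?J] unfolding hom_path_cat by blast
      show "\<kappa> (Cod ?J f) \<odot> Amap ?D f = \<kappa> (Dom ?J f)"
        unfolding a(4,5) unfolding a(3) path_diagram_simps(2)[OF a(1,2)]
        using compatD(3)[OF c a(1)] a(2) by blast
    qed
  qed
  obtain c \<kappa> where col: "is_colimit ?J \<Omega> ?D c \<kappa>"
    using bicomplete is_functor_path_diagram[OF U] unfolding bicomplete_def by blast
  have "universal U c (\<lambda>x. \<kappa> {const_path x})"
    unfolding universal_def
  proof (intro conjI allI impI)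
    show "compat U c (\<lambda>x. \<kappa> {const_path x})" using col cocone by (simp add: is_colimit_def)
    fix z s assume s: "compat U z s"
    define \<mu> where "\<mu> = (\<lambda>j. s (path_start (the_elem j)))"
    have "is_cocone ?J \<Omega> ?D z \<mu>" using s by (simp add: cocone \<mu>_def)
    then have "\<exists>!m. m \<in> hom \<Omega> c z \<and> (\<forall>j \<in> Obj ?J. m \<odot> \<kappa> j = \<mu> j)" using col unfolding is_colimit_def by blast
    then show "\<exists>!m. m \<in> hom \<Omega> c z \<and> (\<forall>x \<in> U. m \<odot> \<kappa> {const_path x} = s x)"
      by (simp add: path_cat_simps \<mu>_def)
  qed
  then show ?thesis by blast
qed

text \<open>Object and cocone are the components of a single choice, so that they belong
  together.\<close>

definition col :: "'a set \<Rightarrow> 'o" where "col U = fst (SOME p. universal U (fst p) (snd p))"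
definition leg :: "'a set \<Rightarrow> 'a \<Rightarrow> 'm" where "leg U = snd (SOME p. universal U (fst p) (snd p))"

lemma universal: "openin X U \<Longrightarrow> universal U (col U) (leg U)"
  unfolding col_def leg_def
  by (rule someI_ex) (use universal_exists[OF openin_subset] in auto)

lemma leg_compat: "openin X U \<Longrightarrow> compat U (col U) (leg U)"
  using universal unfolding universal_def by blast

lemma col_lift:
  assumes "openin X U" "compat U z s"
  shows "\<exists>!m. m \<in> hom \<Omega> (col U) z \<and> (\<forall>x \<in> U. m \<odot> leg U x = s x)"
  using universal[OF assms(1)] assms(2) unfolding universal_def by blast

text \<open>Both maps factor the same compatible family, and the factorization is unique.\<close>

lemma col_joint_epi:
  assumes U: "openin X U" and m: "m \<in> hom \<Omega> (col U) z" "m' \<in> hom \<Omega> (col U) z"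
    and eq: "\<And>x. x \<in> U \<Longrightarrow> m \<odot> leg U x = m' \<odot> leg U x"
  shows "m = m'"
proof -
  note c = leg_compat[OF U]
  have "compat U z (\<lambda>x. m \<odot> leg U x)"
  proof (rule compatI)
    show "z \<in> Obj \<Omega>" using Om.hom_obj[OF m(1)] by blast
    show "m \<odot> leg U x \<in> hom \<Omega> (Omap G x) z" if "x \<in> U" for x
      using Om.comp_hom[OF compatD(2)[OF c that] m(1)] .
    fix \<alpha> assume \<alpha>: "ep \<alpha>" "\<And>t. t \<in> {0..1} \<Longrightarrow> \<alpha> t \<in> U"
    then have "\<alpha> 1 \<in> U" by simp
    then show "(m \<odot> leg U (\<alpha> 1)) \<odot> gp \<alpha> = m \<odot> leg U (\<alpha> 0)"
      using Om.comp_assoc[OF gp_hom[OF \<alpha>(1)] compatD(2)[OF c] m(1)] compatD(3)[OF c \<alpha>] by simp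
  qed
  from col_lift[OF U this] show ?thesis using m eq by (elim ex1E) metis
qed

lemma compat_subset: "compat V z s \<Longrightarrow> U \<subseteq> V \<Longrightarrow> compat U z s"
  unfolding compat_def by blast

definition ext :: "'a set \<Rightarrow> 'a set \<Rightarrow> 'm" where
  "ext U V = (THE m. m \<in> hom \<Omega> (col U) (col V) \<and> (\<forall>x \<in> U. m \<odot> leg U x = leg V x))"

lemma ext:
  assumes "openin X U" "openin X V" "U \<subseteq> V"
  shows "ext U V \<in> hom \<Omega> (col U) (col V)" "x \<in> U \<Longrightarrow> ext U V \<odot> leg U x = leg V x"
  using theI'[OF col_lift[OF assms(1) compat_subset[OF leg_compat[OF assms(2)] assms(3)]]]
  unfolding ext_def by blast+

lemma ext_unique:
  assumes "openin X U" "openin X V" "U \<subseteq> V" "m \<in> hom \<Omega> (col U) (col V)" "\<And>x. x \<in> U \<Longrightarrow> m \<odot> leg U x = leg V x"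
  shows "m = ext U V"
  by (rule col_joint_epi[OF assms(1,4) ext(1)[OF assms(1-3)]]) (use assms ext(2)[OF assms(1-3)] in simp)

section \<open>The path cosheaf: cosheaf condition, constructibility and costalks\<close>

definition path_cosheaf :: "('a set, 'a set \<times> 'a set, 'o, 'm) func" where
  "path_cosheaf = \<lparr>Omap = (\<lambda>U \<in> Obj (Open X). col U), Amap = (\<lambda>f \<in> Arr (Open X). ext (fst f) (snd f))\<rparr>"

lemma path_cosheaf_simps:
  "openin X U \<Longrightarrow> Omap path_cosheaf U = col U"
  "openin X U \<Longrightarrow> openin X V \<Longrightarrow> U \<subseteq> V \<Longrightarrow> Amap path_cosheaf (U, V) = ext U V"
  by (simp_all add: path_cosheaf_def Open_def)

lemma is_functor_path_cosheaf: "is_functor (Open X) \<Omega> path_cosheaf"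
proof (rule functorI[OF is_category_Open Om.is_cat])
  show "Omap path_cosheaf \<in> extensional (Obj (Open X))" "Amap path_cosheaf \<in> extensional (Arr (Open X))"
    by (simp_all add: path_cosheaf_def)
next
  fix U assume "U \<in> Obj (Open X)"
  then have U: "openin X U" by simp
  note c = leg_compat[OF U]
  show "Omap path_cosheaf U \<in> Obj \<Omega>" using compatD(1)[OF c] U by (simp add: path_cosheaf_simps)
  have "Ident \<Omega> (col U) = ext U U"
    by (rule ext_unique[OF U U order_refl])
      (use compatD(1)[OF c] Om.comp_ident_left[OF compatD(2)[OF c]] in auto)
  then show "Amap path_cosheaf (Ident (Open X) U) = Ident \<Omega> (Omap path_cosheaf U)"
    using path_cosheaf_simps(2)[OF U U] U by (simp add: path_cosheaf_simps(1)) (simp add: Open_def)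
next
  fix f U V assume "f \<in> hom (Open X) U V"
  then show "Amap path_cosheaf f \<in> hom \<Omega> (Omap path_cosheaf U) (Omap path_cosheaf V)"
    using ext(1)[of U V] by (auto simp: hom_Open path_cosheaf_simps)
next
  fix f g U V W assume "f \<in> hom (Open X) U V" "g \<in> hom (Open X) V W"
  then have *: "f = (U, V)" "g = (V, W)" "openin X U" "openin X V" "openin X W" "U \<subseteq> V" "V \<subseteq> W" "U \<subseteq> W"
    by (auto simp: hom_Open)
  note e = ext[OF *(3,4,6)] ext[OF *(4,5,7)]
  have "ext V W \<odot> ext U V = ext U W"
  proof (rule ext_unique[OF *(3,5,8) Om.comp_hom[OF e(1,3)]])
    fix x assume x: "x \<in> U"
    show "(ext V W \<odot> ext U V) \<odot> leg U x = leg W x"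
      using Om.comp_assoc[OF compatD(2)[OF leg_compat[OF *(3)] x] e(1,3)] e(2)[OF x] e(4)[of x] x *(6) by auto
  qed
  then show "Amap path_cosheaf (Comp (Open X) g f) = Amap path_cosheaf g \<odot> Amap path_cosheaf f"
    using * by (simp add: path_cosheaf_simps(2)[OF *(3,4,6)] path_cosheaf_simps(2)[OF *(4,5,7)])
      (simp add: Open_def path_cosheaf_simps(2)[OF *(3,5,8)])
qed

text \<open>Van Kampen: by the Lebesgue number argument, compatibility along all paths in \<open>U\<close> may be checked
  along paths in the members of a cover.\<close>

lemma compat_local:
  assumes U: "openin X U" and z: "z \<in> Obj \<Omega>"
    and s: "\<And>x. x \<in> U \<Longrightarrow> \<exists>V. openin X V \<and> x \<in> V \<and> compat V z s"
  shows "compat U z s"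
proof (rule compatI[OF z])
  show "s x \<in> hom \<Omega> (Omap G x) z" if "x \<in> U" for x using s[OF that] compatD(2) by blast
  fix \<alpha> assume \<alpha>: "ep \<alpha>" "\<And>t. t \<in> {0..1} \<Longrightarrow> \<alpha> t \<in> U"
  define Q where "Q = (\<lambda>a b. 0 \<le> a \<longrightarrow> b \<le> 1 \<longrightarrow> a \<le> b \<longrightarrow> s (\<alpha> b) \<odot> gp (sub \<alpha> a b) = s (\<alpha> a))"
  have "Q 0 1"
  proof (rule Bolzano[of 0 1 Q])
    fix a b c :: real assume Q: "Q a b" "Q b c" and le: "a \<le> b" "b \<le> c"
    show "Q a c"
      unfolding Q_def
    proof (intro impI)
      assume 01: "0 \<le> a" "c \<le> 1" "a \<le> c"
      have c: "c \<in> {0..1}" using 01 le by simp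
      obtain V where V: "\<alpha> c \<in> V" "compat V z s" using s[OF \<alpha>(2)[OF c]] by blast
      have sc: "s (\<alpha> c) \<in> hom \<Omega> (Omap G (\<alpha> c)) z" using compatD(2)[OF V(2,1)] .
      have e: "ep (sub \<alpha> a b)" "ep (sub \<alpha> b c)" using ep_sub[OF \<alpha>(1)] 01 le by auto
      have g: "gp (sub \<alpha> a b) \<in> hom \<Omega> (Omap G (\<alpha> a)) (Omap G (\<alpha> b))" "gp (sub \<alpha> b c) \<in> hom \<Omega> (Omap G (\<alpha> b)) (Omap G (\<alpha> c))"
        using gp_hom[OF e(1)] gp_hom[OF e(2)] by simp_all
      have "s (\<alpha> c) \<odot> gp (sub \<alpha> a c) = s (\<alpha> c) \<odot> (gp (sub \<alpha> b c) \<odot> gp (sub \<alpha> a b))"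
        using gp_cut[OF \<alpha>(1) 01(1) le 01(2)] by simp
      also have "\<dots> = (s (\<alpha> c) \<odot> gp (sub \<alpha> b c)) \<odot> gp (sub \<alpha> a b)" using Om.comp_assoc[OF g sc] by simp
      also have "\<dots> = s (\<alpha> a)" using Q 01 le by (simp add: Q_def)
      finally show "s (\<alpha> c) \<odot> gp (sub \<alpha> a c) = s (\<alpha> a)" .
    qed
  next
    fix x :: real assume "0 \<le> x" "x \<le> 1"
    then have x: "x \<in> {0..1}" by simp
    obtain V where V: "openin X V" "\<alpha> x \<in> V" "compat V z s" using s[OF \<alpha>(2)[OF x]] by blast
    obtain d where d: "d > 0" "\<And>t. t \<in> {0..1} \<Longrightarrow> \<bar>t - x\<bar> < d \<Longrightarrow> \<alpha> t \<in> V"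
      using ep_local[OF \<alpha>(1) x V(1,2)] by blast
    have "Q a b" if ab: "a \<le> x" "x \<le> b" "b - a < d" for a b
      unfolding Q_def
    proof (intro impI)
      assume 01: "0 \<le> a" "b \<le> 1" "a \<le> b"
      have "sub \<alpha> a b t \<in> V" if "t \<in> {0..1}" for t
        by (rule sub_in[OF d(2)]) (use that ab 01 in auto)
      from compatD(3)[OF V(3) ep_sub[OF \<alpha>(1)] this] show "s (\<alpha> b) \<odot> gp (sub \<alpha> a b) = s (\<alpha> a)" using 01 by simp
    qed
    then show "\<exists>d>0. \<forall>a b. a \<le> x \<and> x \<le> b \<and> b - a < d \<longrightarrow> Q a b" using d(1) by blast
  qed simp
  then show "s (\<alpha> 1) \<odot> gp \<alpha> = s (\<alpha> 0)" using sub_01[OF ep_ext[OF \<alpha>(1)]] by (simp add: Q_def)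
qed

text \<open>A cocone on the cover assigns a map to each point, through any member that contains the
  point. By completeness a point of \<open>V \<inter> W\<close> lies in a smaller member, so the
  member chosen does not matter; \<open>compat_local\<close> then passes from compatibility in the
  members to compatibility in \<open>U\<close>.\<close>

lemma is_cosheaf_path_cosheaf: "is_cosheaf X \<Omega> path_cosheaf"
  unfolding is_cosheaf_def
proof (intro conjI allI impI is_functor_path_cosheaf)
  fix U \<U> assume U: "openin X U" and cov: "complete_cover X U \<U>"
  have op: "\<And>V. V \<in> \<U> \<Longrightarrow> openin X V" and UU: "\<Union>\<U> = U"
    and int: "\<And>V W. V \<in> \<U> \<Longrightarrow> W \<in> \<U> \<Longrightarrow> \<exists>\<V>\<subseteq>\<U>. \<Union>\<V> = V \<inter> W"
    using cov by (auto simp: complete_cover_def)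
  have sub: "V \<subseteq> U" if "V \<in> \<U>" for V using that UU by blast
  let ?J = "inclusion_poset \<U>" and ?D = "restrict_functor path_cosheaf (inclusion_poset \<U>)"
  have D: "Omap ?D V = col V" if "V \<in> \<U>" for V using that op by (simp add: restrict_functor_def path_cosheaf_simps)
  have DA: "Amap ?D (V, W) = ext V W" if "V \<in> \<U>" "W \<in> \<U>" "V \<subseteq> W" for V W
    using that op by (simp add: restrict_functor_def path_cosheaf_simps)
  have cocone: "is_cocone ?J \<Omega> ?D z \<mu> \<longleftrightarrow> z \<in> Obj \<Omega> \<and> (\<forall>V \<in> \<U>. \<mu> V \<in> hom \<Omega> (col V) z) \<and>
      (\<forall>V \<in> \<U>. \<forall>W \<in> \<U>. V \<subseteq> W \<longrightarrow> \<mu> W \<odot> ext V W = \<mu> V)" for z \<mu>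
  proof -
    have "(\<forall>f \<in> Arr ?J. P f) \<longleftrightarrow> (\<forall>V \<in> \<U>. \<forall>W \<in> \<U>. V \<subseteq> W \<longrightarrow> P (V, W))" for P
      by (auto simp: inclusion_poset_def)
    then show ?thesis unfolding is_cocone_def by (simp add: D DA cong: ball_cong imp_cong)
  qed
  have "is_colimit ?J \<Omega> ?D (col U) (\<lambda>V. ext V U)"
    unfolding is_colimit_def
  proof (intro conjI allI impI)
    have "ext W U \<odot> ext V W = ext V U" if "V \<in> \<U>" "W \<in> \<U>" "V \<subseteq> W" for V W
      using Open_functor(4)[OF is_functor_path_cosheaf op op U that(3) sub] that op U sub
      by (simp add: path_cosheaf_simps)
    then show "is_cocone ?J \<Omega> ?D (col U) (\<lambda>V. ext V U)"
      unfolding cocone using compatD(1)[OF leg_compat[OF U]] ext(1)[OF op U sub] by blast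
    fix z \<mu> assume "is_cocone ?J \<Omega> ?D z \<mu>"
    then have z: "z \<in> Obj \<Omega>" and \<mu>: "\<And>V. V \<in> \<U> \<Longrightarrow> \<mu> V \<in> hom \<Omega> (col V) z"
      and \<mu>c: "\<And>V W. V \<in> \<U> \<Longrightarrow> W \<in> \<U> \<Longrightarrow> V \<subseteq> W \<Longrightarrow> \<mu> W \<odot> ext V W = \<mu> V"
      unfolding cocone by auto
    note leg_hom = compatD(2)[OF leg_compat[OF op]]
    have shrink: "\<mu> W \<odot> leg W x = \<mu> V \<odot> leg V x" if "V \<in> \<U>" "W \<in> \<U>" "V \<subseteq> W" "x \<in> V" for V W x
      using Om.comp_assoc[OF leg_hom[OF that(1,4)] ext(1)[OF op[OF that(1)] op[OF that(2)] that(3)] \<mu>[OF that(2)]]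
        \<mu>c[OF that(1-3)] ext(2)[OF op[OF that(1)] op[OF that(2)] that(3,4)] by simp
    have indep: "\<mu> V \<odot> leg V x = \<mu> W \<odot> leg W x" if VW: "V \<in> \<U>" "W \<in> \<U>" "x \<in> V" "x \<in> W" for V W x
    proof -
      from int[OF VW(1,2)] obtain \<V> where \<V>: "\<V> \<subseteq> \<U>" "\<Union>\<V> = V \<inter> W" by (elim exE conjE)
      have "x \<in> \<Union>\<V>" unfolding \<V>(2) using VW(3,4) by (rule IntI)
      then obtain V' where V': "V' \<in> \<V>" "x \<in> V'" by (elim UnionE)
      have "V' \<subseteq> V \<inter> W" using V'(1) \<V>(2) by (metis Union_upper)
      then have V': "V' \<in> \<U>" "x \<in> V'" "V' \<subseteq> V" "V' \<subseteq> W" using V' \<V>(1) by auto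
      show ?thesis using shrink[OF V'(1) VW(1) V'(3,2)] shrink[OF V'(1) VW(2) V'(4,2)] by simp
    qed
    define s where "s = (\<lambda>x. let V = (SOME V. V \<in> \<U> \<and> x \<in> V) in \<mu> V \<odot> leg V x)"
    have s: "s x = \<mu> V \<odot> leg V x" if "V \<in> \<U>" "x \<in> V" for V x
    proof -
      have *: "(SOME V. V \<in> \<U> \<and> x \<in> V) \<in> \<U> \<and> x \<in> (SOME V. V \<in> \<U> \<and> x \<in> V)"
        by (rule someI[of _ V]) (use that in simp)
      show ?thesis
        unfolding s_def Let_def by (rule indep[OF conjunct1[OF *] that(1) conjunct2[OF *] that(2)])
    qed
    have sV: "compat V z s" if V: "V \<in> \<U>" for V
    proof (rule compatI[OF z])
      fix x assume x: "x \<in> V"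
      show "s x \<in> hom \<Omega> (Omap G x) z" using s[OF V x] Om.comp_hom[OF leg_hom[OF V x] \<mu>[OF V]] by simp
    next
      fix \<alpha> assume \<alpha>: "ep \<alpha>" "\<And>t. t \<in> {0..1} \<Longrightarrow> \<alpha> t \<in> V"
      have V01: "\<alpha> 0 \<in> V" "\<alpha> 1 \<in> V" using \<alpha>(2) by auto
      show "s (\<alpha> 1) \<odot> gp \<alpha> = s (\<alpha> 0)"
        using s[OF V V01(1)] s[OF V V01(2)] Om.comp_assoc[OF gp_hom[OF \<alpha>(1)] leg_hom[OF V V01(2)] \<mu>[OF V]]
          compatD(3)[OF leg_compat[OF op[OF V]] \<alpha>] by simp
    qed
    have "compat U z s"
    proof (rule compat_local[OF U z])
      fix x assume "x \<in> U"
      then obtain V where "V \<in> \<U>" "x \<in> V" using UU by blast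
      then show "\<exists>V. openin X V \<and> x \<in> V \<and> compat V z s" using op sV by blast
    qed
    from col_lift[OF U this]
    have ex1: "\<exists>!m. m \<in> hom \<Omega> (col U) z \<and> (\<forall>x \<in> U. m \<odot> leg U x = s x)" .
    \<comment> \<open>Factorizations of the cocone are the same as factorizations of the family on
      points, so existence and uniqueness are inherited from \<open>col U\<close>.\<close>
    have iff: "(\<forall>j \<in> Obj ?J. m \<odot> ext j U = \<mu> j) \<longleftrightarrow> (\<forall>x \<in> U. m \<odot> leg U x = s x)" if m: "m \<in> hom \<Omega> (col U) z" for m
    proof
      assume L: "\<forall>j \<in> Obj ?J. m \<odot> ext j U = \<mu> j"
      show "\<forall>x \<in> U. m \<odot> leg U x = s x"
      proof
        fix x assume "x \<in> U"
        then obtain V where V: "V \<in> \<U>" "x \<in> V" using UU by blast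
        then show "m \<odot> leg U x = s x"
          using Om.comp_assoc[OF leg_hom[OF V] ext(1)[OF op[OF V(1)] U sub[OF V(1)]] m] ext(2)[OF op[OF V(1)] U sub[OF V(1)] V(2)]
            L s[OF V] by simp
      qed
    next
      assume R: "\<forall>x \<in> U. m \<odot> leg U x = s x"
      show "\<forall>j \<in> Obj ?J. m \<odot> ext j U = \<mu> j"
      proof
        fix V assume "V \<in> Obj ?J"
        then have V: "V \<in> \<U>" by simp
        note e = ext[OF op[OF V] U sub[OF V]]
        show "m \<odot> ext V U = \<mu> V"
        proof (rule col_joint_epi[OF op[OF V] Om.comp_hom[OF e(1) m] \<mu>[OF V]])
          fix x assume x: "x \<in> V"
          have "x \<in> U" using x sub[OF V] by blast
          then show "(m \<odot> ext V U) \<odot> leg V x = \<mu> V \<odot> leg V x"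
            using Om.comp_assoc[OF leg_hom[OF V x] e(1) m] e(2)[OF x] R s[OF V x] by simp
        qed
      qed
    qed
    show "\<exists>!m. m \<in> hom \<Omega> (col U) z \<and> (\<forall>j \<in> Obj ?J. m \<odot> ext j U = \<mu> j)"
      using ex1 iff by metis
  qed
  \<comment> \<open>\<open>col U\<close> is itself the colimit over the cover, so the comparison map
    is the identity.\<close>
  moreover have "Ident \<Omega> (col U) \<in> hom \<Omega> (col U) (Omap path_cosheaf U)" "is_iso \<Omega> (Ident \<Omega> (col U))"
    using compatD(1)[OF leg_compat[OF U]] Om.ident_iso U by (auto simp: path_cosheaf_simps)
  moreover have "Ident \<Omega> (col U) \<odot> ext V U = Amap path_cosheaf (V, U)" if "V \<in> \<U>" for V
    using Om.comp_ident_left[OF ext(1)[OF op[OF that] U sub[OF that]]] path_cosheaf_simps(2)[OF op[OF that] U sub[OF that]] by simp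
  ultimately show "\<exists>c \<kappa> m. is_colimit ?J \<Omega> ?D c \<kappa> \<and> m \<in> hom \<Omega> c (Omap path_cosheaf U) \<and>
      (\<forall>V \<in> \<U>. m \<odot> \<kappa> V = Amap path_cosheaf (V, U)) \<and> is_iso \<Omega> m"
    by blast
qed

text \<open>By \<open>cls_unique\<close> the paths in \<open>U\<close> from \<open>y\<close> to the
  centre form one class, so the values of \<open>G\<close> on these classes are a compatible family
  with target \<open>Omap G x\<close>. The map that this family induces is inverse to the leg at
  \<open>x\<close>.\<close>

lemma leg_iso:
  assumes U: "basic x U"
  shows "is_iso \<Omega> (leg U x)"
proof -
  note oU = basicD(2)[OF U] and xU = basicD(1)[OF U] and xX = basicD(4)[OF U]
  note c = leg_compat[OF basicD(2)[OF U]]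
  have "\<exists>\<alpha>. ep \<alpha> \<and> (\<forall>t \<in> {0..1}. \<alpha> t \<in> U) \<and> \<alpha> 0 = y \<and> \<alpha> 1 = x" if "y \<in> U" for y
    using path_to_center[OF U that] by metis
  then obtain p where p: "\<And>y. y \<in> U \<Longrightarrow> ep (p y)" "\<And>y t. y \<in> U \<Longrightarrow> t \<in> {0..1} \<Longrightarrow> p y t \<in> U"
      "\<And>y. y \<in> U \<Longrightarrow> p y 0 = y" "\<And>y. y \<in> U \<Longrightarrow> p y 1 = x" by metis
  have gh: "gp (p y) \<in> hom \<Omega> (Omap G y) (Omap G x)" if "y \<in> U" for y using gp_hom[OF p(1)[OF that]] p(3,4)[OF that] by simp
  have gu: "gp \<alpha> = gp (p (\<alpha> 0))" if "ep \<alpha>" "\<And>t. t \<in> {0..1} \<Longrightarrow> \<alpha> t \<in> U" "\<alpha> 1 = x" for \<alpha>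
  proof -
    have "\<alpha> 0 \<in> U" using that by simp
    then show ?thesis unfolding gp_def using cls_unique[OF U that p(1) p(2) p(4)] p(3) by simp
  qed
  have "compat U (Omap G x) (\<lambda>y. gp (p y))"
  proof (rule compatI[OF G_obj[OF xX] gh])
    fix \<alpha> assume \<alpha>: "ep \<alpha>" "\<And>t. t \<in> {0..1} \<Longrightarrow> \<alpha> t \<in> U"
    then have a1: "\<alpha> 1 \<in> U" by simp
    have "gp (p (\<alpha> 1)) \<odot> gp \<alpha> = gp (joinp (p (\<alpha> 1)) \<alpha>)"
      using gp_joinp[OF \<alpha>(1) p(1)[OF a1]] p(3)[OF a1] by simp
    also have "\<dots> = gp (p (\<alpha> 0))"
      using gu[of "joinp (p (\<alpha> 1)) \<alpha>"] ep_joinp[OF \<alpha>(1) p(1)[OF a1] p(3)[OF a1]] joinp_in[of \<alpha> U "p (\<alpha> 1)"] \<alpha>(2) p(2)[OF a1] p(4)[OF a1]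
      by simp
    finally show "gp (p (\<alpha> 1)) \<odot> gp \<alpha> = gp (p (\<alpha> 0))" .
  qed
  from col_lift[OF oU this] obtain m where m: "m \<in> hom \<Omega> (col U) (Omap G x)" "\<And>y. y \<in> U \<Longrightarrow> m \<odot> leg U y = gp (p y)" by blast
  have "gp (cst x) = gp (p x)" using gu[of "cst x"] ep_cst[OF xX] xU by (simp add: cst_apply)
  then have 1: "m \<odot> leg U x = Ident \<Omega> (Omap G x)" using m(2)[OF xU] gp_cst[OF xX] by simp
  note ix = compatD(2)[OF c xU]
  have 2: "leg U x \<odot> m = Ident \<Omega> (col U)"
  proof (rule col_joint_epi[OF oU Om.comp_hom[OF m(1) ix] Om.ident_hom[OF compatD(1)[OF c]]])
    fix y assume y: "y \<in> U"
    have "(leg U x \<odot> m) \<odot> leg U y = leg U x \<odot> gp (p y)"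
      using Om.comp_assoc[OF compatD(2)[OF c y] m(1) ix] m(2)[OF y] by simp
    also have "\<dots> = leg U y" using compatD(3)[OF c p(1)[OF y] p(2)[OF y]] p(3,4)[OF y] by simp
    finally show "(leg U x \<odot> m) \<odot> leg U y = Ident \<Omega> (col U) \<odot> leg U y"
      using Om.comp_ident_left[OF compatD(2)[OF c y]] by simp
  qed
  show ?thesis by (rule Om.isoI[OF ix m(1) 1 2])
qed

lemma csh_path_cosheaf: "csh path_cosheaf"
  unfolding csh_def is_constructible_def
proof (intro conjI is_cosheaf_path_cosheaf ballI allI impI)
  fix S U V assume S: "S \<in> strata K" and bU: "stratum_basic_open n K S U" and bV: "stratum_basic_open n K S V"
    and UV: "U \<subseteq> V"
  obtain x where x: "x \<in> S" "basic x U" using bU by (auto simp: stratum_basic_open_def)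
  obtain y where y: "y \<in> S" "basic y V" using bV by (auto simp: stratum_basic_open_def)
  have xU: "x \<in> U" "x \<in> V" using basicD(1)[OF x(2)] UV by auto
  \<comment> \<open>The two opens may have different centres. As \<open>x\<close> lies in
    \<open>V\<close> and on the stratum of \<open>y\<close>, the open \<open>V\<close> is basic
    about \<open>x\<close> too, and legs at the same point can be compared.\<close>
  have V: "basic x V" by (rule basic_move(1)[OF y(2) xU(2)]) (use strataD(2)[OF S x(1) y(1)] in simp)
  note oU = basicD(2)[OF x(2)] and oV = basicD(2)[OF V]
  note e = ext[OF oU oV UV]
  have "is_iso \<Omega> (ext U V)"
    by (rule Om.iso_of_comp_iso[OF leg_iso[OF x(2)] compatD(2)[OF leg_compat[OF oU] xU(1)] e(1)])
      (simp add: e(2)[OF xU(1)] leg_iso[OF V])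
  then show "is_iso \<Omega> (Amap path_cosheaf (U, V))" using path_cosheaf_simps(2)[OF oU oV UV] by simp
qed

text \<open>Germs start at the costalk, legs at \<open>Omap G x\<close>; the leg over the chosen
  neighbourhood connects the two.\<close>

lemma germ_leg:
  assumes V: "openin X V" "x \<in> V"
  shows "germ path_cosheaf V x \<odot> leg (nbh x) x = leg V x"
proof -
  note F = csh_constr[OF csh_path_cosheaf]
  obtain W where W: "basic x W" "W \<subseteq> V" "W \<subseteq> nbh x" using germ_nbhd[OF V] by blast
  have N: "basic x (nbh x)" using nbh basicD(4)[OF W(1)] .
  note oW = basicD(2)[OF W(1)] and oN = basicD(2)[OF N] and xW = basicD(1)[OF W(1)]
  note e = ext[OF oW oN W(3)] ext[OF oW V(1) W(2)]
  have i: "is_iso \<Omega> (ext W (nbh x))" using constr_iso[OF F W(1) N W(3)] path_cosheaf_simps(2)[OF oW oN W(3)] by simp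
  note j = Om.inv_arr[OF i e(1)]
  note k = compatD(2)[OF leg_compat[OF oW] xW]
  have N': "leg (nbh x) x = ext W (nbh x) \<odot> leg W x" using e(2)[OF xW] by simp
  have "germ path_cosheaf V x = ext W V \<odot> Om.inv_arr (ext W (nbh x))"
    using germ_eq[OF F V(1) W] path_cosheaf_simps(2)[OF oW oN W(3)] path_cosheaf_simps(2)[OF oW V(1) W(2)] by simp
  then have "germ path_cosheaf V x \<odot> leg (nbh x) x = ext W V \<odot> (Om.inv_arr (ext W (nbh x)) \<odot> (ext W (nbh x) \<odot> leg W x))"
    using Om.comp_assoc[OF Om.comp_hom[OF k e(1)] j(1) e(3)] N' by simp
  also have "Om.inv_arr (ext W (nbh x)) \<odot> (ext W (nbh x) \<odot> leg W x) = leg W x"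
    using Om.comp_assoc[OF k e(1) j(1)] j(2) Om.comp_ident_left[OF k] by simp
  also have "ext W V \<odot> leg W x = leg V x" using e(4)[OF xW] .
  finally show ?thesis .
qed

text \<open>On a short piece the germ at the end is invertible, and after composition with it both
  sides become the leg at the start of the piece. Longer paths follow by bisection.\<close>

lemma leg_natural:
  assumes \<alpha>: "ep \<alpha>"
  shows "leg (nbh (\<alpha> 1)) (\<alpha> 1) \<odot> gp \<alpha> = tr path_cosheaf \<alpha> \<odot> leg (nbh (\<alpha> 0)) (\<alpha> 0)"
proof -
  note F = csh_constr[OF csh_path_cosheaf]
  define \<iota> where "\<iota> = (\<lambda>x. leg (nbh x) x)"
  have \<iota>: "\<iota> x \<in> hom \<Omega> (Omap G x) (costalk path_cosheaf x)" if x: "x \<in> topspace X" for x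
    using compatD(2)[OF leg_compat[OF basicD(2)[OF nbh[OF x]]] basicD(1)[OF nbh[OF x]]] basicD(2)[OF nbh[OF x]]
    by (simp add: \<iota>_def costalk_def path_cosheaf_simps)
  define Q where "Q = (\<lambda>a b. 0 \<le> a \<longrightarrow> b \<le> 1 \<longrightarrow> a \<le> b \<longrightarrow>
    \<iota> (\<alpha> b) \<odot> gp (sub \<alpha> a b) = tr path_cosheaf (sub \<alpha> a b) \<odot> \<iota> (\<alpha> a))"
  have "Q 0 1"
  proof (rule Bolzano[of 0 1 Q])
    fix a b c :: real assume Q: "Q a b" "Q b c" and le: "a \<le> b" "b \<le> c"
    show "Q a c"
      unfolding Q_def
    proof (intro impI)
      assume 01: "0 \<le> a" "c \<le> 1" "a \<le> c"
      have X: "\<alpha> a \<in> topspace X" "\<alpha> b \<in> topspace X" "\<alpha> c \<in> topspace X" using ep_in[OF \<alpha>] 01 le by auto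
      have e: "ep (sub \<alpha> a b)" "ep (sub \<alpha> b c)" "ep (sub \<alpha> a c)" using ep_sub[OF \<alpha>] 01 le by auto
      have g: "gp (sub \<alpha> a b) \<in> hom \<Omega> (Omap G (\<alpha> a)) (Omap G (\<alpha> b))" "gp (sub \<alpha> b c) \<in> hom \<Omega> (Omap G (\<alpha> b)) (Omap G (\<alpha> c))"
        using gp_hom[OF e(1)] gp_hom[OF e(2)] by simp_all
      have t: "tr path_cosheaf (sub \<alpha> a b) \<in> hom \<Omega> (costalk path_cosheaf (\<alpha> a)) (costalk path_cosheaf (\<alpha> b))"
        "tr path_cosheaf (sub \<alpha> b c) \<in> hom \<Omega> (costalk path_cosheaf (\<alpha> b)) (costalk path_cosheaf (\<alpha> c))"
        using tr_hom[OF F e(1)] tr_hom[OF F e(2)] by simp_all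
      have tc: "tr path_cosheaf (sub \<alpha> a c) = tr path_cosheaf (sub \<alpha> b c) \<odot> tr path_cosheaf (sub \<alpha> a b)"
        using tr_cls[OF F cls_cut'[OF \<alpha> 01(1) le 01(2)] ep_joinp[OF e(1,2)] e(3)] tr_joinp[OF F e(1,2)] by simp
      have "\<iota> (\<alpha> c) \<odot> gp (sub \<alpha> a c) = (\<iota> (\<alpha> c) \<odot> gp (sub \<alpha> b c)) \<odot> gp (sub \<alpha> a b)"
        using gp_cut[OF \<alpha> 01(1) le 01(2)] Om.comp_assoc[OF g \<iota>[OF X(3)]] by simp
      also have "\<dots> = tr path_cosheaf (sub \<alpha> b c) \<odot> (\<iota> (\<alpha> b) \<odot> gp (sub \<alpha> a b))"
        using Q(2) 01 le Om.comp_assoc[OF g(1) \<iota>[OF X(2)] t(2)] by (simp add: Q_def)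
      also have "\<dots> = tr path_cosheaf (sub \<alpha> a c) \<odot> \<iota> (\<alpha> a)"
        using Q(1) 01 le Om.comp_assoc[OF \<iota>[OF X(1)] t] tc by (simp add: Q_def)
      finally show "\<iota> (\<alpha> c) \<odot> gp (sub \<alpha> a c) = tr path_cosheaf (sub \<alpha> a c) \<odot> \<iota> (\<alpha> a)" .
    qed
  next
    fix x :: real assume "0 \<le> x" "x \<le> 1"
    then have x: "x \<in> {0..1}" by simp
    obtain V where V: "basic (\<alpha> x) V" using basic_exists ep_in[OF \<alpha> x] by blast
    note oV = basicD(2)[OF V]
    obtain d where d: "d > 0" "\<forall>t \<in> {0..1}. \<bar>t - x\<bar> < d \<longrightarrow> \<alpha> t \<in> V \<and> (x \<le> t \<longrightarrow> basic (\<alpha> t) V \<and> level (\<alpha> t) = level (\<alpha> x))"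
      using ep_local_basic[OF \<alpha> x V] by blast
    have "Q a b" if ab: "a \<le> x" "x \<le> b" "b - a < d" for a b
      unfolding Q_def
    proof (intro impI)
      assume 01: "0 \<le> a" "b \<le> 1" "a \<le> b"
      have aV: "\<alpha> t \<in> V" if "a \<le> t" "t \<le> b" for t using d(2)[rule_format, of t] that ab 01 by auto
      have B: "basic (\<alpha> b) V" using d(2)[rule_format, of b] ab 01 by simp
      have e: "ep (sub \<alpha> a b)" using ep_sub[OF \<alpha>] 01 by auto
      have sV: "sub \<alpha> a b t \<in> V" if "t \<in> {0..1}" for t using sub_in[OF aV 01(3) that] .
      have X: "\<alpha> a \<in> topspace X" "\<alpha> b \<in> topspace X" using ep_in[OF \<alpha>] 01 by auto
      have abV: "\<alpha> a \<in> V" "\<alpha> b \<in> V" using aV 01 by auto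
      have g: "gp (sub \<alpha> a b) \<in> hom \<Omega> (Omap G (\<alpha> a)) (Omap G (\<alpha> b))" using gp_hom[OF e] by simp
      have t: "tr path_cosheaf (sub \<alpha> a b) \<in> hom \<Omega> (costalk path_cosheaf (\<alpha> a)) (costalk path_cosheaf (\<alpha> b))"
        using tr_hom[OF F e] by simp
      note gb = germ_hom[OF F oV abV(2)]
      have "germ path_cosheaf V (\<alpha> b) \<odot> (\<iota> (\<alpha> b) \<odot> gp (sub \<alpha> a b)) = leg V (\<alpha> a)"
        using Om.comp_assoc[OF g \<iota>[OF X(2)] gb] germ_leg[OF oV abV(2)] compatD(3)[OF leg_compat[OF oV] e sV]
        by (simp add: \<iota>_def)
      also have "\<dots> = germ path_cosheaf V (\<alpha> b) \<odot> (tr path_cosheaf (sub \<alpha> a b) \<odot> \<iota> (\<alpha> a))"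
        using Om.comp_assoc[OF \<iota>[OF X(1)] t gb] tr_germ[OF F e oV sV] germ_leg[OF oV abV(1)] by (simp add: \<iota>_def)
      finally show "\<iota> (\<alpha> b) \<odot> gp (sub \<alpha> a b) = tr path_cosheaf (sub \<alpha> a b) \<odot> \<iota> (\<alpha> a)"
        by (rule Om.iso_cancel_left[OF germ_iso[OF F B] gb Om.comp_hom[OF g \<iota>[OF X(2)]] Om.comp_hom[OF \<iota>[OF X(1)] t]])
    qed
    then show "\<exists>d>0. \<forall>a b. a \<le> x \<and> x \<le> b \<and> b - a < d \<longrightarrow> Q a b" using d(1) by blast
  qed simp
  then show ?thesis using sub_01[OF ep_ext[OF \<alpha>]] by (simp add: Q_def \<iota>_def)
qed

lemma costalks_path_cosheaf:
  "is_nat_iso (Ent n K) \<Omega> G (costalks path_cosheaf) (\<lambda>x \<in> topspace X. leg (nbh x) x)"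
  unfolding is_nat_iso_def
proof (intro conjI ballI)
  note F = csh_constr[OF csh_path_cosheaf]
  show "is_nat_trans (Ent n K) \<Omega> G (costalks path_cosheaf) (\<lambda>x \<in> topspace X. leg (nbh x) x)"
  proof (rule nat_transI[OF G is_functor_costalks[OF F]])
    fix x assume "x \<in> Obj (Ent n K)"
    then have x: "x \<in> topspace X" by simp
    show "(\<lambda>x \<in> topspace X. leg (nbh x) x) x \<in> hom \<Omega> (Omap G x) (Omap (costalks path_cosheaf) x)"
      using x compatD(2)[OF leg_compat[OF basicD(2)[OF nbh[OF x]]] basicD(1)[OF nbh[OF x]]] basicD(2)[OF nbh[OF x]]
      by (simp add: costalks_simps costalk_def path_cosheaf_simps)
  next
    fix f a b assume "f \<in> hom (Ent n K) a b"
    then obtain \<alpha> where \<alpha>: "ep \<alpha>" "f = cls \<alpha>" "\<alpha> 0 = a" "\<alpha> 1 = b" by (auto simp: hom_Ent)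
    have "a \<in> topspace X" "b \<in> topspace X" using ep_in[OF \<alpha>(1), of 0] ep_in[OF \<alpha>(1), of 1] \<alpha> by auto
    then show "(\<lambda>x \<in> topspace X. leg (nbh x) x) b \<odot> Amap G f =
        Amap (costalks path_cosheaf) f \<odot> (\<lambda>x \<in> topspace X. leg (nbh x) x) a"
      using leg_natural[OF \<alpha>(1)] \<alpha> by (simp add: costalks_simps(2)[OF F] gp_def)
  qed simp
  show "is_iso \<Omega> ((\<lambda>x \<in> topspace X. leg (nbh x) x) x)" if "x \<in> Obj (Ent n K)" for x
    using leg_iso[OF nbh] that by simp
qed

end

theorem theorem6p1:
  fixes K :: "'a fspace" and n :: nat and \<Omega> :: "('o, 'm) cat"
  assumes "conically_stratified n K"
    and "is_category \<Omega>"
    and "bicomplete TYPE('a strat_path set) \<Omega>"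
  shows "equivalent_categories (Csh \<Omega> n K) (functor_cat (Ent n K) \<Omega>)"
proof -
  interpret strat_cat n K \<Omega> using assms(1,2) by unfold_locales
  show ?thesis
  proof (rule equivalent_categoriesI[OF is_functor_costalk_functor])
    fix F F' g assume "F \<in> Obj (Csh \<Omega> n K)" "F' \<in> Obj (Csh \<Omega> n K)"
      and g: "g \<in> hom (functor_cat (Ent n K) \<Omega>) (Omap costalk_functor F) (Omap costalk_functor F')"
    then have F: "csh F" "csh F'" by (simp_all add: Obj_Csh)
    show "\<exists>!f. f \<in> hom (Csh \<Omega> n K) F F' \<and> Amap costalk_functor f = g"
      using costalk_functor_fully_faithful[OF F] g F by (simp add: costalk_functor_simps(1))
  next
    fix G assume "G \<in> Obj (functor_cat (Ent n K) \<Omega>)"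
    then interpret ent_functor n K \<Omega> G using assms(3) by unfold_locales auto
    interpret FC: category "functor_cat (Ent n K) \<Omega>"
      using is_category_functor_cat[OF is_category_Ent Om.is_cat] by unfold_locales
    let ?i = "(G, \<lambda>x \<in> topspace X. leg (nbh x) x, costalks path_cosheaf)"
    have i: "is_iso (functor_cat (Ent n K) \<Omega>) ?i" by (rule is_nat_iso_imp_is_iso[OF costalks_path_cosheaf])
    have h: "?i \<in> hom (functor_cat (Ent n K) \<Omega>) G (costalks path_cosheaf)"
      using costalks_path_cosheaf by (simp add: hom_functor_cat is_nat_iso_def)
    \<comment> \<open>The isomorphism found leads from \<open>G\<close> to the costalks, whereas
      essential surjectivity is stated in the other direction; hence the inverse.\<close>
    show "\<exists>c \<in> Obj (Csh \<Omega> n K). \<exists>i \<in> hom (functor_cat (Ent n K) \<Omega>) (Omap costalk_functor c) G.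
        is_iso (functor_cat (Ent n K) \<Omega>) i"
      using csh_path_cosheaf FC.inv_arr(1)[OF i h] FC.inv_arr_iso[OF i h]
      by (intro bexI[of _ path_cosheaf] bexI[of _ "FC.inv_arr ?i"]) (simp_all add: Obj_Csh costalk_functor_simps(1))
  qed
qed

end
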